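(* Let $\mathbb K$ be a field, let $I$ be a monomial ideal in $S=\mathbb K[X_1,\dots,X_n]$, let $R=S/I$ and let $M$ be its binoid (so $R=\mathbb K[M]$). Let $I_\triangle=\sqrt I$, let $R_{\mathrm{red}}=S/I_\triangle$ and let $\triangle$ be the simplicial complex associated to $I_\triangle$. If \begin{itemize} \item $\operatorname{Pic}^{\mathrm{loc}}(R_{\mathrm{red}})\neq0$, or \item $\operatorname{Pic}^{\mathrm{loc}}(M)\neq0$, or \item $\mathrm H^1(\triangle,\mathbb K^* )\neq0$, \end{itemize} then $\operatorname{Pic}^{\mathrm{loc}}(R)\neq0$.
   Context: A (commutative) binoid is a commutative monoid $(M,+,0)$ with an absorbing element $\infty$. The binoid of $S/I$ is $M=(\mathbb N^n)^\infty/J$, where $(\mathbb N^n)^\infty=\mathbb N^n\cup\{\infty\}$ and all exponent vectors of monomials in $I$ are identified with $\infty$; $R=\mathbb K[M]$ has as $\mathbb K$-basis the monomials not in $I$. The ideal $\sqrt I$ is the Stanley-Reisner ideal of the simplicial complex $\triangle$ whose faces are the sets $F\subseteq[n]$ with $\prod_{i\in F}X_i\notin\sqrt I$. $\mathrm H^1(\triangle,\mathbb K^* )$ is simplicial cohomology with coefficients in the multiplicative group $\mathbb K^*$. For $A=R$ or $A=R_{\mathrm{red}}$, the local Picard group $\operatorname{Pic}^{\mathrm{loc}}(A)$ is the Picard group of the punctured spectrum $\operatorname{Spec}^\bullet A$, i.e. of the open subscheme of $\operatorname{Spec}A$ obtained by removing the point given by the ideal generated by all the variables. For the binoid $M$: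 a prime ideal is a subset $\mathfrak p\ni\infty$ with $\mathfrak p+M\subseteq\mathfrak p$ and $M\smallsetminus\mathfrak p$ a submonoid; $\operatorname{Spec}M$ is the set of primes with basis of open sets $D(f)=\{\mathfrak p\mid f\notin\mathfrak p\}$; $\operatorname{Spec}^\bullet M$ is $\operatorname{Spec}M$ minus its unique maximal element $M_+$ (the ideal of non-units). $\mathcal O_M$ is the sheaf of binoids with $\mathcal O_M(D(f))=M_f$, and $\mathcal O_M^*$ its sheaf of units. The local Picard group $\operatorname{Pic}^{\mathrm{loc}}(M)$ is the group of isomorphism classes of sheaves of $\mathcal O_M$-sets on $\operatorname{Spec}^\bullet M$ locally isomorphic to $\mathcal O_M$, under the smash product; it is isomorphic to $\mathrm H^1(\operatorname{Spec}^\bullet M,\mathcal O^*_M)$. *)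

theory Defs
  imports
    "HOL-Analysis.Abstract_Topology"
    "HOL-Library.Poly_Mapping"
    "HOL-Algebra.Algebraic_Closure_Type"
    "HOL-Algebra.Algebra"
begin

section \<open>Sheaves\<close>

text \<open>
  \<open>sec F U\<close> is the algebraic structure (ring, module, binoid, ...) of sections over \<open>U\<close>, and
  \<open>res F U V\<close> is the restriction from \<open>U\<close> to \<open>V\<close>.  Only the values at open sets matter.
\<close>

record ('p, 'o, 's) sheaf_data =
  sec :: "'p set \<Rightarrow> 'o"
  res :: "'p set \<Rightarrow> 'p set \<Rightarrow> 's \<Rightarrow> 's"

type_synonym ('p, 'r) ring_sheaf = "('p, 'r ring, 'r) sheaf_data"
type_synonym ('p, 'r, 'm) module_sheaf = "('p, ('r, 'm) module, 'm) sheaf_data"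

text \<open>
  The family \<open>\<U>\<close> in the gluing axiom may be empty, so there is exactly one section over the
  empty set.
\<close>

locale sheaf =
  fixes T :: "'p topology" and F :: "('p, ('s, 'z) partial_object_scheme, 's) sheaf_data"
  assumes res_closed:
      "\<lbrakk>openin T U; openin T V; V \<subseteq> U; s \<in> carrier (sec F U)\<rbrakk> \<Longrightarrow> res F U V s \<in> carrier (sec F V)"
    and res_id: "\<lbrakk>openin T U; s \<in> carrier (sec F U)\<rbrakk> \<Longrightarrow> res F U U s = s"
    and res_res:
      "\<lbrakk>openin T U; openin T V; openin T W; W \<subseteq> V; V \<subseteq> U; s \<in> carrier (sec F U)\<rbrakk>
        \<Longrightarrow> res F V W (res F U V s) = res F U W s"
    and gluing:
      "\<lbrakk>\<And>V. V \<in> \<U> \<Longrightarrow> openin T V; \<And>V. V \<in> \<U> \<Longrightarrow> \<sigma> V \<in> carrier (sec F V);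
        \<And>V W. \<lbrakk>V \<in> \<U>; W \<in> \<U>\<rbrakk> \<Longrightarrow> res F V (V \<inter> W) (\<sigma> V) = res F W (V \<inter> W) (\<sigma> W)\<rbrakk>
        \<Longrightarrow> \<exists>!t. t \<in> carrier (sec F (\<Union>\<U>)) \<and> (\<forall>V\<in>\<U>. res F (\<Union>\<U>) V t = \<sigma> V)"

locale module_sheaf = sheaf T F
  for T :: "'p topology" and \<O> :: "('p, 'r) ring_sheaf" and F :: "('p, 'r, 'm) module_sheaf" +
  assumes module: "openin T U \<Longrightarrow> module (sec \<O> U) (sec F U)"
    and res_add:
      "\<lbrakk>openin T U; openin T V; V \<subseteq> U; s \<in> carrier (sec F U); t \<in> carrier (sec F U)\<rbrakk>
        \<Longrightarrow> res F U V (s \<oplus>\<^bsub>sec F U\<^esub> t) = res F U V s \<oplus>\<^bsub>sec F V\<^esub> res F U V t"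
    and res_smult:
      "\<lbrakk>openin T U; openin T V; V \<subseteq> U; a \<in> carrier (sec \<O> U); s \<in> carrier (sec F U)\<rbrakk>
        \<Longrightarrow> res F U V (a \<odot>\<^bsub>sec F U\<^esub> s) = res \<O> U V a \<odot>\<^bsub>sec F V\<^esub> res F U V s"

definition module_sheaf_hom ::
  "'p topology \<Rightarrow> ('p, 'r) ring_sheaf \<Rightarrow> ('p, 'r, 'm) module_sheaf \<Rightarrow> ('p, 'r, 'n) module_sheaf
    \<Rightarrow> ('p set \<Rightarrow> 'm \<Rightarrow> 'n) set" where
  "module_sheaf_hom T \<O> F G = {\<phi>.
     (\<forall>U. openin T U \<longrightarrow>
        \<phi> U \<in> carrier (sec F U) \<rightarrow> carrier (sec G U) \<and>
        (\<forall>s \<in> carrier (sec F U). \<forall>t \<in> carrier (sec F U).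
           \<phi> U (s \<oplus>\<^bsub>sec F U\<^esub> t) = \<phi> U s \<oplus>\<^bsub>sec G U\<^esub> \<phi> U t) \<and>
        (\<forall>a \<in> carrier (sec \<O> U). \<forall>s \<in> carrier (sec F U).
           \<phi> U (a \<odot>\<^bsub>sec F U\<^esub> s) = a \<odot>\<^bsub>sec G U\<^esub> \<phi> U s)) \<and>
     (\<forall>U V. openin T U \<and> openin T V \<and> V \<subseteq> U \<longrightarrow>
        (\<forall>s \<in> carrier (sec F U). \<phi> V (res F U V s) = res G U V (\<phi> U s)))}"

definition module_sheaf_iso ::
  "'p topology \<Rightarrow> ('p, 'r) ring_sheaf \<Rightarrow> ('p, 'r, 'm) module_sheaf \<Rightarrow> ('p, 'r, 'n) module_sheaf
    \<Rightarrow> bool" where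
  "module_sheaf_iso T \<O> F G \<longleftrightarrow> (\<exists>\<phi> \<in> module_sheaf_hom T \<O> F G.
     \<forall>U. openin T U \<longrightarrow> bij_betw (\<phi> U) (carrier (sec F U)) (carrier (sec G U)))"

definition ring_as_module :: "'r ring \<Rightarrow> ('r, 'r) module" where
  "ring_as_module R = \<lparr>carrier = carrier R, monoid.mult = monoid.mult R,
     monoid.one = monoid.one R, ring.zero = ring.zero R, ring.add = ring.add R,
     module.smult = monoid.mult R\<rparr>"

definition structure_module :: "('p, 'r) ring_sheaf \<Rightarrow> ('p, 'r, 'r) module_sheaf" where
  "structure_module \<O> = \<lparr>sec = (\<lambda>U. ring_as_module (sec \<O> U)), res = res \<O>\<rparr>"

definition invertible_sheaf ::
  "'p topology \<Rightarrow> ('p, 'r) ring_sheaf \<Rightarrow> ('p, 'r, 'm) module_sheaf \<Rightarrow> bool" where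
  "invertible_sheaf T \<O> F \<longleftrightarrow> module_sheaf T \<O> F \<and>
     (\<forall>x \<in> topspace T. \<exists>U. openin T U \<and> x \<in> U \<and>
        module_sheaf_iso (subtopology T U) \<O> F (structure_module \<O>))"

definition module_sheaf_bilinear ::
  "'p topology \<Rightarrow> ('p, 'r) ring_sheaf \<Rightarrow> ('p, 'r, 'm) module_sheaf \<Rightarrow> ('p, 'r, 'n) module_sheaf
    \<Rightarrow> ('p, 'r, 'l) module_sheaf \<Rightarrow> ('p set \<Rightarrow> 'm \<Rightarrow> 'n \<Rightarrow> 'l) set" where
  "module_sheaf_bilinear T \<O> F G H = {\<beta>.
     (\<forall>U. openin T U \<longrightarrow>
        (\<forall>s \<in> carrier (sec F U). \<forall>t \<in> carrier (sec G U). \<beta> U s t \<in> carrier (sec H U)) \<and>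
        (\<forall>s \<in> carrier (sec F U). \<forall>s' \<in> carrier (sec F U). \<forall>t \<in> carrier (sec G U).
           \<beta> U (s \<oplus>\<^bsub>sec F U\<^esub> s') t = \<beta> U s t \<oplus>\<^bsub>sec H U\<^esub> \<beta> U s' t) \<and>
        (\<forall>s \<in> carrier (sec F U). \<forall>t \<in> carrier (sec G U). \<forall>t' \<in> carrier (sec G U).
           \<beta> U s (t \<oplus>\<^bsub>sec G U\<^esub> t') = \<beta> U s t \<oplus>\<^bsub>sec H U\<^esub> \<beta> U s t') \<and>
        (\<forall>a \<in> carrier (sec \<O> U). \<forall>s \<in> carrier (sec F U). \<forall>t \<in> carrier (sec G U).
           \<beta> U (a \<odot>\<^bsub>sec F U\<^esub> s) t = a \<odot>\<^bsub>sec H U\<^esub> \<beta> U s t \<and>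
           \<beta> U s (a \<odot>\<^bsub>sec G U\<^esub> t) = a \<odot>\<^bsub>sec H U\<^esub> \<beta> U s t)) \<and>
     (\<forall>U V. openin T U \<and> openin T V \<and> V \<subseteq> U \<longrightarrow>
        (\<forall>s \<in> carrier (sec F U). \<forall>t \<in> carrier (sec G U).
           \<beta> V (res F U V s) (res G U V t) = res H U V (\<beta> U s t)))}"

text \<open>
  \<open>N\<close> is a tensor product of \<open>F\<close> and \<open>G\<close>, by the universal property (which is that of the
  sheafification of the presheaf tensor product).
\<close>

definition is_tensor_product ::
  "'p topology \<Rightarrow> ('p, 'r) ring_sheaf \<Rightarrow> ('p, 'r, 'm) module_sheaf \<Rightarrow> ('p, 'r, 'm) module_sheaf
    \<Rightarrow> ('p, 'r, 'm) module_sheaf \<Rightarrow> bool" where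
  "is_tensor_product T \<O> F G N \<longleftrightarrow> module_sheaf T \<O> N \<and>
     (\<exists>\<beta> \<in> module_sheaf_bilinear T \<O> F G N.
        \<forall>(P :: ('p, 'r, 'm) module_sheaf) \<gamma>.
          module_sheaf T \<O> P \<and> \<gamma> \<in> module_sheaf_bilinear T \<O> F G P \<longrightarrow>
          (\<exists>\<phi> \<in> module_sheaf_hom T \<O> N P.
             (\<forall>U. openin T U \<longrightarrow>
                (\<forall>s \<in> carrier (sec F U). \<forall>t \<in> carrier (sec G U). \<phi> U (\<beta> U s t) = \<gamma> U s t)) \<and>
             (\<forall>\<psi> \<in> module_sheaf_hom T \<O> N P.
                (\<forall>U. openin T U \<longrightarrow>
                   (\<forall>s \<in> carrier (sec F U). \<forall>t \<in> carrier (sec G U). \<psi> U (\<beta> U s t) = \<gamma> U s t)) \<longrightarrow>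
                (\<forall>U. openin T U \<longrightarrow> (\<forall>w \<in> carrier (sec N U). \<psi> U w = \<phi> U w)))))"

text \<open>
  Isomorphism classes of the objects in \<open>L\<close>; \<open>tens F G N\<close> says that \<open>N\<close> is a product of
  \<open>F\<close> and \<open>G\<close>.
\<close>

definition class_group ::
  "'l set \<Rightarrow> ('l \<Rightarrow> 'l \<Rightarrow> bool) \<Rightarrow> ('l \<Rightarrow> 'l \<Rightarrow> 'l \<Rightarrow> bool) \<Rightarrow> 'l \<Rightarrow> 'l set monoid" where
  "class_group L isom tens e =
     \<lparr>carrier = L // {(F, G). F \<in> L \<and> G \<in> L \<and> isom F G},
      monoid.mult = (\<lambda>C D. {N \<in> L. \<exists>F\<in>C. \<exists>G\<in>D. tens F G N}),
      monoid.one = {N \<in> L. isom e N}\<rparr>"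

text \<open>
  HOL has no quantification over types, so the invertible sheaves here have sections in the type
  of the sections of \<open>\<O>\<close>.  For the structure sheaves below, whose sections are functions on sets
  of points with values in stalks, this is no restriction: choosing an isomorphism of every stalk
  of an invertible sheaf with the stalk of \<open>\<O>\<close> and sending a section to the family of its germs
  embeds the sheaf into functions of that type.  The same applies to binoids.
\<close>

definition Pic :: "'p topology \<Rightarrow> ('p, 'r) ring_sheaf \<Rightarrow> ('p, 'r, 'r) module_sheaf set monoid" where
  "Pic T \<O> = class_group {F. invertible_sheaf T \<O> F} (module_sheaf_iso T \<O>)
     (is_tensor_product T \<O>) (structure_module \<O>)"


section \<open>Binoids and sheaves of binoid sets\<close>

text \<open>
  Binoids are written multiplicatively, following the library's convention for monoids: \<open>\<otimes>\<close> is
  the addition of the binoid, \<open>\<one>\<close> its neutral element \<open>0\<close> and \<open>absorb\<close> its absorbing element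
  \<open>\<infinity>\<close>.
\<close>

record 'a binoid = "'a monoid" +
  absorb :: 'a

locale binoid = comm_monoid M for M :: "'a binoid" (structure) +
  assumes absorb_closed: "absorb M \<in> carrier M"
    and absorb_mult: "a \<in> carrier M \<Longrightarrow> absorb M \<otimes> a = absorb M"

record ('a, 's) binoid_set = "'s partial_object" +
  base :: 's
  act :: "'a \<Rightarrow> 's \<Rightarrow> 's"

locale binoid_set = binoid M for M :: "'a binoid" (structure) and S :: "('a, 's) binoid_set" +
  assumes base_closed: "base S \<in> carrier S"
    and act_closed: "\<lbrakk>a \<in> carrier M; s \<in> carrier S\<rbrakk> \<Longrightarrow> act S a s \<in> carrier S"
    and act_one: "s \<in> carrier S \<Longrightarrow> act S \<one> s = s"
    and act_mult: "\<lbrakk>a \<in> carrier M; b \<in> carrier M; s \<in> carrier S\<rbrakk>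
      \<Longrightarrow> act S (a \<otimes> b) s = act S a (act S b s)"
    and act_absorb: "s \<in> carrier S \<Longrightarrow> act S (absorb M) s = base S"
    and act_base: "a \<in> carrier M \<Longrightarrow> act S a (base S) = base S"

type_synonym ('p, 'a) binoid_sheaf = "('p, 'a binoid, 'a) sheaf_data"
type_synonym ('p, 'a, 's) binoid_set_sheaf = "('p, ('a, 's) binoid_set, 's) sheaf_data"

locale binoid_set_sheaf = sheaf T F
  for T :: "'p topology" and \<O> :: "('p, 'a) binoid_sheaf" and F :: "('p, 'a, 's) binoid_set_sheaf" +
  assumes binoid_set: "openin T U \<Longrightarrow> binoid_set (sec \<O> U) (sec F U)"
    and res_base:
      "\<lbrakk>openin T U; openin T V; V \<subseteq> U\<rbrakk> \<Longrightarrow> res F U V (base (sec F U)) = base (sec F V)"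
    and res_act:
      "\<lbrakk>openin T U; openin T V; V \<subseteq> U; a \<in> carrier (sec \<O> U); s \<in> carrier (sec F U)\<rbrakk>
        \<Longrightarrow> res F U V (act (sec F U) a s) = act (sec F V) (res \<O> U V a) (res F U V s)"

definition binoid_set_sheaf_hom ::
  "'p topology \<Rightarrow> ('p, 'a) binoid_sheaf \<Rightarrow> ('p, 'a, 's) binoid_set_sheaf
    \<Rightarrow> ('p, 'a, 't) binoid_set_sheaf \<Rightarrow> ('p set \<Rightarrow> 's \<Rightarrow> 't) set" where
  "binoid_set_sheaf_hom T \<O> F G = {\<phi>.
     (\<forall>U. openin T U \<longrightarrow>
        \<phi> U \<in> carrier (sec F U) \<rightarrow> carrier (sec G U) \<and>
        \<phi> U (base (sec F U)) = base (sec G U) \<and>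
        (\<forall>a \<in> carrier (sec \<O> U). \<forall>s \<in> carrier (sec F U).
           \<phi> U (act (sec F U) a s) = act (sec G U) a (\<phi> U s))) \<and>
     (\<forall>U V. openin T U \<and> openin T V \<and> V \<subseteq> U \<longrightarrow>
        (\<forall>s \<in> carrier (sec F U). \<phi> V (res F U V s) = res G U V (\<phi> U s)))}"

definition binoid_set_sheaf_iso ::
  "'p topology \<Rightarrow> ('p, 'a) binoid_sheaf \<Rightarrow> ('p, 'a, 's) binoid_set_sheaf
    \<Rightarrow> ('p, 'a, 't) binoid_set_sheaf \<Rightarrow> bool" where
  "binoid_set_sheaf_iso T \<O> F G \<longleftrightarrow> (\<exists>\<phi> \<in> binoid_set_sheaf_hom T \<O> F G.
     \<forall>U. openin T U \<longrightarrow> bij_betw (\<phi> U) (carrier (sec F U)) (carrier (sec G U)))"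

definition binoid_as_set :: "'a binoid \<Rightarrow> ('a, 'a) binoid_set" where
  "binoid_as_set M = \<lparr>carrier = carrier M, base = absorb M, act = monoid.mult M\<rparr>"

definition structure_binoid_set :: "('p, 'a) binoid_sheaf \<Rightarrow> ('p, 'a, 'a) binoid_set_sheaf" where
  "structure_binoid_set \<O> = \<lparr>sec = (\<lambda>U. binoid_as_set (sec \<O> U)), res = res \<O>\<rparr>"

definition invertible_binoid_set_sheaf ::
  "'p topology \<Rightarrow> ('p, 'a) binoid_sheaf \<Rightarrow> ('p, 'a, 's) binoid_set_sheaf \<Rightarrow> bool" where
  "invertible_binoid_set_sheaf T \<O> F \<longleftrightarrow> binoid_set_sheaf T \<O> F \<and>
     (\<forall>x \<in> topspace T. \<exists>U. openin T U \<and> x \<in> U \<and>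
        binoid_set_sheaf_iso (subtopology T U) \<O> F (structure_binoid_set \<O>))"

definition binoid_set_sheaf_bilinear ::
  "'p topology \<Rightarrow> ('p, 'a) binoid_sheaf \<Rightarrow> ('p, 'a, 's) binoid_set_sheaf
    \<Rightarrow> ('p, 'a, 't) binoid_set_sheaf \<Rightarrow> ('p, 'a, 'u) binoid_set_sheaf
    \<Rightarrow> ('p set \<Rightarrow> 's \<Rightarrow> 't \<Rightarrow> 'u) set" where
  "binoid_set_sheaf_bilinear T \<O> F G H = {\<beta>.
     (\<forall>U. openin T U \<longrightarrow>
        (\<forall>s \<in> carrier (sec F U). \<forall>t \<in> carrier (sec G U).
           \<beta> U s t \<in> carrier (sec H U) \<and>
           \<beta> U (base (sec F U)) t = base (sec H U) \<and>
           \<beta> U s (base (sec G U)) = base (sec H U) \<and>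
           (\<forall>a \<in> carrier (sec \<O> U).
              \<beta> U (act (sec F U) a s) t = act (sec H U) a (\<beta> U s t) \<and>
              \<beta> U s (act (sec G U) a t) = act (sec H U) a (\<beta> U s t)))) \<and>
     (\<forall>U V. openin T U \<and> openin T V \<and> V \<subseteq> U \<longrightarrow>
        (\<forall>s \<in> carrier (sec F U). \<forall>t \<in> carrier (sec G U).
           \<beta> V (res F U V s) (res G U V t) = res H U V (\<beta> U s t)))}"

definition is_smash_product ::
  "'p topology \<Rightarrow> ('p, 'a) binoid_sheaf \<Rightarrow> ('p, 'a, 's) binoid_set_sheaf
    \<Rightarrow> ('p, 'a, 's) binoid_set_sheaf \<Rightarrow> ('p, 'a, 's) binoid_set_sheaf \<Rightarrow> bool" where
  "is_smash_product T \<O> F G N \<longleftrightarrow> binoid_set_sheaf T \<O> N \<and>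
     (\<exists>\<beta> \<in> binoid_set_sheaf_bilinear T \<O> F G N.
        \<forall>(P :: ('p, 'a, 's) binoid_set_sheaf) \<gamma>.
          binoid_set_sheaf T \<O> P \<and> \<gamma> \<in> binoid_set_sheaf_bilinear T \<O> F G P \<longrightarrow>
          (\<exists>\<phi> \<in> binoid_set_sheaf_hom T \<O> N P.
             (\<forall>U. openin T U \<longrightarrow>
                (\<forall>s \<in> carrier (sec F U). \<forall>t \<in> carrier (sec G U). \<phi> U (\<beta> U s t) = \<gamma> U s t)) \<and>
             (\<forall>\<psi> \<in> binoid_set_sheaf_hom T \<O> N P.
                (\<forall>U. openin T U \<longrightarrow>
                   (\<forall>s \<in> carrier (sec F U). \<forall>t \<in> carrier (sec G U). \<psi> U (\<beta> U s t) = \<gamma> U s t)) \<longrightarrow>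
                (\<forall>U. openin T U \<longrightarrow> (\<forall>w \<in> carrier (sec N U). \<psi> U w = \<phi> U w)))))"

definition binoid_Pic ::
  "'p topology \<Rightarrow> ('p, 'a) binoid_sheaf \<Rightarrow> ('p, 'a, 'a) binoid_set_sheaf set monoid" where
  "binoid_Pic T \<O> = class_group {F. invertible_binoid_set_sheaf T \<O> F} (binoid_set_sheaf_iso T \<O>)
     (is_smash_product T \<O>) (structure_binoid_set \<O>)"


section \<open>Localization and spectra\<close>

text \<open>
  The fraction \<open>a / s\<close> with denominators in \<open>S\<close>.  The relation between fractions only involves
  the multiplication, so this serves for rings and for binoids.
\<close>

definition fraction :: "('a, 'b) monoid_scheme \<Rightarrow> 'a set \<Rightarrow> 'a \<Rightarrow> 'a \<Rightarrow> ('a \<times> 'a) set" where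
  "fraction G S a s = {(b, t). b \<in> carrier G \<and> t \<in> S \<and>
     (\<exists>u\<in>S. u \<otimes>\<^bsub>G\<^esub> (a \<otimes>\<^bsub>G\<^esub> t) = u \<otimes>\<^bsub>G\<^esub> (b \<otimes>\<^bsub>G\<^esub> s))}"

text \<open>
  In the operations below all members of each union are equal, so that the union is the class
  defined by any choice of representatives.
\<close>

definition fraction_mult ::
  "('a, 'b) monoid_scheme \<Rightarrow> 'a set \<Rightarrow> ('a \<times> 'a) set \<Rightarrow> ('a \<times> 'a) set \<Rightarrow> ('a \<times> 'a) set" where
  "fraction_mult G S x y = (\<Union>(a, s)\<in>x. \<Union>(b, t)\<in>y. fraction G S (a \<otimes>\<^bsub>G\<^esub> b) (s \<otimes>\<^bsub>G\<^esub> t))"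

definition fraction_add ::
  "('a, 'b) ring_scheme \<Rightarrow> 'a set \<Rightarrow> ('a \<times> 'a) set \<Rightarrow> ('a \<times> 'a) set \<Rightarrow> ('a \<times> 'a) set" where
  "fraction_add R S x y = (\<Union>(a, s)\<in>x. \<Union>(b, t)\<in>y.
     fraction R S (a \<otimes>\<^bsub>R\<^esub> t \<oplus>\<^bsub>R\<^esub> b \<otimes>\<^bsub>R\<^esub> s) (s \<otimes>\<^bsub>R\<^esub> t))"

definition ring_localization :: "('a, 'b) ring_scheme \<Rightarrow> 'a set \<Rightarrow> ('a \<times> 'a) set ring" where
  "ring_localization R S =
     \<lparr>carrier = {fraction R S a s | a s. a \<in> carrier R \<and> s \<in> S},
      monoid.mult = fraction_mult R S, monoid.one = fraction R S \<one>\<^bsub>R\<^esub> \<one>\<^bsub>R\<^esub>,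
      ring.zero = fraction R S \<zero>\<^bsub>R\<^esub> \<one>\<^bsub>R\<^esub>, ring.add = fraction_add R S\<rparr>"

definition binoid_localization :: "'a binoid \<Rightarrow> 'a set \<Rightarrow> ('a \<times> 'a) set binoid" where
  "binoid_localization M S =
     \<lparr>carrier = {fraction M S a s | a s. a \<in> carrier M \<and> s \<in> S},
      monoid.mult = fraction_mult M S, monoid.one = fraction M S \<one>\<^bsub>M\<^esub> \<one>\<^bsub>M\<^esub>,
      absorb = fraction M S (absorb M) \<one>\<^bsub>M\<^esub>\<rparr>"

text \<open>Families of elements of the stalks over \<open>U\<close> that are locally given by one fraction.\<close>

definition fraction_sections ::
  "('a, 'b) monoid_scheme \<Rightarrow> 'a set topology \<Rightarrow> 'a set set \<Rightarrow> ('a set \<Rightarrow> ('a \<times> 'a) set) set" where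
  "fraction_sections G T U = {s \<in> extensional U. \<forall>P\<in>U. \<exists>V a f.
     openin T V \<and> P \<in> V \<and> V \<subseteq> U \<and> a \<in> carrier G \<and> f \<in> carrier G \<and>
     (\<forall>Q\<in>V. f \<notin> Q \<and> s Q = fraction G (carrier G - Q) a f)}"

definition Spec :: "('a, 'b) ring_scheme \<Rightarrow> 'a set topology" where
  "Spec R = topology_generated_by {{P. primeideal P R \<and> f \<notin> P} | f. f \<in> carrier R}"

definition structure_sheaf :: "('a, 'b) ring_scheme \<Rightarrow> ('a set, 'a set \<Rightarrow> ('a \<times> 'a) set) ring_sheaf" where
  "structure_sheaf R =
     \<lparr>sec = (\<lambda>U.
        \<lparr>carrier = fraction_sections R (Spec R) U,
         monoid.mult = (\<lambda>s t. \<lambda>P\<in>U. s P \<otimes>\<^bsub>ring_localization R (carrier R - P)\<^esub> t P),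
         monoid.one = (\<lambda>P\<in>U. \<one>\<^bsub>ring_localization R (carrier R - P)\<^esub>),
         ring.zero = (\<lambda>P\<in>U. \<zero>\<^bsub>ring_localization R (carrier R - P)\<^esub>),
         ring.add = (\<lambda>s t. \<lambda>P\<in>U. s P \<oplus>\<^bsub>ring_localization R (carrier R - P)\<^esub> t P)\<rparr>),
      res = (\<lambda>U V s. restrict s V)\<rparr>"

definition binoid_prime :: "'a set \<Rightarrow> 'a binoid \<Rightarrow> bool" where
  "binoid_prime P M \<longleftrightarrow> P \<subseteq> carrier M \<and> absorb M \<in> P \<and>
     (\<forall>a\<in>P. \<forall>b\<in>carrier M. a \<otimes>\<^bsub>M\<^esub> b \<in> P) \<and> submonoid (carrier M - P) M"

definition binoid_Spec :: "'a binoid \<Rightarrow> 'a set topology" where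
  "binoid_Spec M = topology_generated_by {{P. binoid_prime P M \<and> f \<notin> P} | f. f \<in> carrier M}"

text \<open>
  The sections over \<open>D(f)\<close> form the localization \<open>M\<^sub>f\<close>: if \<open>D(f)\<close> is nonempty, it is the smallest
  open neighbourhood of the complement of \<open>{g. g divides a power of f}\<close>.
\<close>

definition binoid_structure_sheaf ::
  "'a binoid \<Rightarrow> ('a set, 'a set \<Rightarrow> ('a \<times> 'a) set) binoid_sheaf" where
  "binoid_structure_sheaf M =
     \<lparr>sec = (\<lambda>U.
        \<lparr>carrier = fraction_sections M (binoid_Spec M) U,
         monoid.mult = (\<lambda>s t. \<lambda>P\<in>U. s P \<otimes>\<^bsub>binoid_localization M (carrier M - P)\<^esub> t P),
         monoid.one = (\<lambda>P\<in>U. \<one>\<^bsub>binoid_localization M (carrier M - P)\<^esub>),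
         absorb = (\<lambda>P\<in>U. absorb (binoid_localization M (carrier M - P)))\<rparr>),
      res = (\<lambda>U V s. restrict s V)\<rparr>"

definition puncture :: "'p topology \<Rightarrow> 'p \<Rightarrow> 'p topology" where
  "puncture T x = subtopology T (topspace T - {x})"

definition binoid_Pic_loc ::
  "'a binoid \<Rightarrow> ('a set, 'a set \<Rightarrow> ('a \<times> 'a) set, 'a set \<Rightarrow> ('a \<times> 'a) set) binoid_set_sheaf set monoid"
  where
  "binoid_Pic_loc M =
     binoid_Pic (puncture (binoid_Spec M) (carrier M - Units M)) (binoid_structure_sheaf M)"


section \<open>Simplicial cohomology\<close>

definition simplices :: "'v set set \<Rightarrow> nat \<Rightarrow> 'v set set" where
  "simplices \<Delta> k = {\<sigma>\<in>\<Delta>. finite \<sigma> \<and> card \<sigma> = k + 1}"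

definition cochains :: "'v set set \<Rightarrow> ('g, 'b) monoid_scheme \<Rightarrow> nat \<Rightarrow> ('v set \<Rightarrow> 'g) monoid" where
  "cochains \<Delta> G k = product_group (simplices \<Delta> k) (\<lambda>_. G)"

text \<open>The simplices are oriented by the order of their vertices; \<open>G\<close> is written multiplicatively.\<close>

definition coboundary ::
  "'v::linorder set set \<Rightarrow> ('g, 'b) monoid_scheme \<Rightarrow> nat \<Rightarrow> ('v set \<Rightarrow> 'g) \<Rightarrow> 'v set \<Rightarrow> 'g" where
  "coboundary \<Delta> G k c = (\<lambda>\<sigma>\<in>simplices \<Delta> (k + 1).
     (\<Otimes>\<^bsub>G\<^esub>j\<in>{..k + 1}. c (\<sigma> - {sorted_list_of_set \<sigma> ! j}) [^]\<^bsub>G\<^esub> ((-1 :: int) ^ j)))"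

definition coboundaries ::
  "'v::linorder set set \<Rightarrow> ('g, 'b) monoid_scheme \<Rightarrow> nat \<Rightarrow> ('v set \<Rightarrow> 'g) set" where
  "coboundaries \<Delta> G k = (case k of
       0 \<Rightarrow> {\<one>\<^bsub>cochains \<Delta> G 0\<^esub>}
     | Suc l \<Rightarrow> coboundary \<Delta> G l ` carrier (cochains \<Delta> G l))"

definition simplicial_cohomology ::
  "nat \<Rightarrow> 'v::linorder set set \<Rightarrow> ('g, 'b) monoid_scheme \<Rightarrow> ('v set \<Rightarrow> 'g) set monoid" where
  "simplicial_cohomology k \<Delta> G =
     (cochains \<Delta> G k)\<lparr>carrier := kernel (cochains \<Delta> G k) (cochains \<Delta> G (k + 1)) (coboundary \<Delta> G k)\<rparr>
       Mod coboundaries \<Delta> G k"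


section \<open>Monomial ideals\<close>

type_synonym monom = "nat \<Rightarrow>\<^sub>0 nat"
type_synonym 'k mpoly = "monom \<Rightarrow>\<^sub>0 'k"

definition monomial :: "monom \<Rightarrow> 'k::field mpoly" where
  "monomial m = Poly_Mapping.single m 1"

definition pvar :: "nat \<Rightarrow> 'k::field mpoly" where
  "pvar i = monomial (Poly_Mapping.single i 1)"

definition monoms :: "nat \<Rightarrow> monom set" where
  "monoms n = {m. Poly_Mapping.keys m \<subseteq> {1..n}}"

definition mpoly_ring :: "nat \<Rightarrow> 'k::field mpoly ring" where
  "mpoly_ring n = ring_of_type_algebra\<lparr>carrier := {p. Poly_Mapping.keys p \<subseteq> monoms n}\<rparr>"

definition monomial_ideal :: "nat \<Rightarrow> 'k::field mpoly set \<Rightarrow> bool" where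
  "monomial_ideal n I \<longleftrightarrow> (\<exists>A \<subseteq> monoms n. I = Idl\<^bsub>mpoly_ring n\<^esub> (monomial ` A))"

definition ideal_radical :: "('a, 'b) ring_scheme \<Rightarrow> 'a set \<Rightarrow> 'a set" where
  "ideal_radical R I = {f \<in> carrier R. \<exists>k::nat. f [^]\<^bsub>R\<^esub> k \<in> I}"

definition Pic_loc ::
  "nat \<Rightarrow> 'k::field mpoly set \<Rightarrow>
    ('k mpoly set set, 'k mpoly set set \<Rightarrow> ('k mpoly set \<times> 'k mpoly set) set,
      'k mpoly set set \<Rightarrow> ('k mpoly set \<times> 'k mpoly set) set) module_sheaf set monoid" where
  "Pic_loc n I = (let R = mpoly_ring n Quot I in
     Pic (puncture (Spec R) (Idl\<^bsub>R\<^esub> ((\<lambda>i. I +>\<^bsub>mpoly_ring n\<^esub> pvar i) ` {1..n}))) (structure_sheaf R))"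

text \<open>
  The class of the vectors identified with \<open>\<infinity>\<close> is represented by \<open>None\<close>; the other classes are
  singletons.
\<close>

definition monomial_binoid :: "nat \<Rightarrow> 'k::field mpoly set \<Rightarrow> monom option binoid" where
  "monomial_binoid n I = (let q = (\<lambda>m. if (monomial m :: 'k mpoly) \<in> I then None else Some m) in
     \<lparr>carrier = insert None (q ` monoms n),
      monoid.mult = (\<lambda>x y. case (x, y) of (Some a, Some b) \<Rightarrow> q (a + b) | _ \<Rightarrow> None),
      monoid.one = q 0,
      absorb = None\<rparr>)"

definition stanley_reisner_complex :: "nat \<Rightarrow> 'k::field mpoly set \<Rightarrow> nat set set" where
  "stanley_reisner_complex n J = {F. F \<subseteq> {1..n} \<and> (\<Prod>i\<in>F. pvar i) \<notin> J}"

end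

theory Submission
  imports Defs
begin

text \<open>Let \<open>\<Delta>\<close> be the Stanley-Reisner complex.  The punctured spectra of \<open>R\<close>, of \<open>R\<^sub>r\<^sub>e\<^sub>d\<close> and of the binoid
  \<open>M\<close> are covered by the open sets \<open>D(X\<^sub>j)\<close>, and an intersection of these is nonempty exactly if its
  indices form a face.  Consider cocycles of terms \<open>\<kappa>\<^sub>j\<^sub>k X\<^bsup>w\<^esup>\<close>, \<open>w\<close> an integral vector supported on the edge
  \<open>{j, k}\<close>, with \<open>\<kappa>\<^sub>j\<^sub>k \<noteq> 0\<close>.

  Every such cocycle glues copies of the structure sheaf to an invertible sheaf on the punctured
  spectrum of \<open>R\<close>, whatever the nilpotent elements are.  If \<open>Pic\<^bsup>loc\<^esup>(R)\<close> is trivial, this sheaf has a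
  global generator.  Restricted to \<open>D(X\<^sub>j)\<close> and to a face containing \<open>j\<close> the generator is a unit of
  \<open>K[X\<^sub>i | i \<in> F]\<close> with \<open>X\<^sub>j\<close> inverted, hence a constant times a power of \<open>X\<^sub>j\<close>.  So the cocycle is the
  coboundary of a family of terms \<open>\<mu>\<^sub>j X\<^sub>j\<^bsup>t\<^esup>\<close>.

  If all cocycles split in this way, all three groups of the theorem vanish.  Cocycles with \<open>w = 0\<close> are those
  of \<open>H\<^sup>1(\<Delta>, K\<^sup>*)\<close>.  An invertible sheaf over \<open>M\<close> is free on each \<open>D(X\<^sub>j)\<close>, which is the smallest
  neighbourhood of a point, and its transition functions are monomials.  An invertible sheaf over
  \<open>R\<^sub>r\<^sub>e\<^sub>d\<close> is also free on each \<open>D(X\<^sub>j)\<close>, by patching generators over the faces containing \<open>j\<close>, where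
  unique factorization provides them; and units on \<open>D(X\<^sub>j X\<^sub>k)\<close> are terms.\<close>


section \<open>Polynomials in a set of variables\<close>

text \<open>The argument is by contraposition, and no homomorphism between the groups is
  constructed. The obstacle is lifting: transition units over R_red can be lifted to units over R
  one by one, but the lifts satisfy the cocycle identity only up to nilpotents. A fraction of
  monomials lifts as it stands, since its cocycle identity is one of exponents and of scalars. Hence
  cocycles of terms, which depend on the complex alone, are what the three groups share with R.
  Conversely, a splitting over R is read off at the generic points of the faces: there the domain
  K[X_i | i in F] forgets the nilpotents and turns an equation of fractions into an identity of
  terms.

  That a single term serves on all faces through an edge has a simple reason. Inverting X_j X_k
  leaves only the faces that contain {j, k}, and the terms found on them all restrict to the term
  found on that edge.\<close>

lemma poly_mapping_single_induct:
  assumes "P 0" and "\<And>m a p. P p \<Longrightarrow> P (Poly_Mapping.single m a + p)"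
  shows "P (p :: 'a \<Rightarrow>\<^sub>0 'b::monoid_add)"
proof (induction "card (Poly_Mapping.keys p)" arbitrary: p)
  case 0
  then show ?case using assms(1) by (simp add: poly_mapping_eqI in_keys_iff)
next
  case (Suc n)
  then obtain m where m: "m \<in> Poly_Mapping.keys p" by fastforce
  let ?q = "Poly_Mapping.update m 0 p"
  have "Poly_Mapping.keys ?q = Poly_Mapping.keys p - {m}" by (simp add: keys_update)
  with Suc m have "P ?q" by (metis card_Diff_singleton diff_Suc_1)
  moreover have "p = Poly_Mapping.single m (Poly_Mapping.lookup p m) + ?q"
    by (rule poly_mapping_eqI) (simp add: lookup_add lookup_single lookup_update when_def)
  ultimately show ?case using assms(2) by metis
qed

section \<open>Additive extension from terms to polynomials\<close>

definition lin_ext :: "('a \<Rightarrow> 'b \<Rightarrow> 'c::comm_monoid_add) \<Rightarrow> ('a \<Rightarrow>\<^sub>0 'b::zero) \<Rightarrow> 'c" where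
  "lin_ext f p = (\<Sum>m\<in>Poly_Mapping.keys p. f m (Poly_Mapping.lookup p m))"

locale coeff_additive =
  fixes f :: "'a::comm_monoid_add \<Rightarrow> 'b::comm_ring_1 \<Rightarrow> 'c::comm_ring_1"
  assumes f_add: "f m (a + b) = f m a + f m b"
begin

lemma f_zero [simp]: "f m 0 = 0"
  using f_add[of m 0 0] by simp

lemma lin_ext_superset:
  "finite A \<Longrightarrow> Poly_Mapping.keys p \<subseteq> A \<Longrightarrow> lin_ext f p = (\<Sum>m\<in>A. f m (Poly_Mapping.lookup p m))"
  unfolding lin_ext_def by (rule sum.mono_neutral_left) (auto simp: in_keys_iff)

lemma lin_ext_zero [simp]: "lin_ext f 0 = 0"
  by (simp add: lin_ext_def)

lemma lin_ext_single [simp]: "lin_ext f (Poly_Mapping.single m a) = f m a"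
  using lin_ext_superset[of "{m}" "Poly_Mapping.single m a"] by simp

lemma lin_ext_add: "lin_ext f (p + q) = lin_ext f p + lin_ext f q"
proof -
  let ?A = "Poly_Mapping.keys p \<union> Poly_Mapping.keys q"
  have "lin_ext f (p + q) = (\<Sum>m\<in>?A. f m (Poly_Mapping.lookup (p + q) m))"
    by (rule lin_ext_superset) (auto simp: keys_add)
  also have "\<dots> = (\<Sum>m\<in>?A. f m (Poly_Mapping.lookup p m)) + (\<Sum>m\<in>?A. f m (Poly_Mapping.lookup q m))"
    by (simp add: lookup_add f_add sum.distrib)
  also have "\<dots> = lin_ext f p + lin_ext f q"
    by (simp add: lin_ext_superset[of ?A])
  finally show ?thesis .
qed

end

text \<open>Under these hypotheses \<open>lin_ext f\<close> is a ring homomorphism out of the monoid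
  algebra. Both \<open>rst\<close> and \<open>univ\<close> arise in this way, so each of them is
  checked on single terms only.\<close>

locale coeff_multiplicative = coeff_additive +
  assumes f_mult: "f (m + m') (a * b) = f m a * f m' b"
    and f_one: "f 0 1 = 1"
begin

lemma lin_ext_one [simp]: "lin_ext f 1 = 1"
  using lin_ext_single[of 0 1] f_one by simp

lemma lin_ext_mult: "lin_ext f (p * q) = lin_ext f p * lin_ext f q"
proof (induction p rule: poly_mapping_single_induct)
  case (2 m a p)
  have "lin_ext f (Poly_Mapping.single m a * q) = f m a * lin_ext f q"
    by (induction q rule: poly_mapping_single_induct)
      (simp_all add: distrib_left lin_ext_add mult_single f_mult)
  then show ?case by (simp add: distrib_right lin_ext_add 2)
qed simp

lemma lin_ext_uminus: "lin_ext f (- p) = - lin_ext f p"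
  using lin_ext_add[of p "- p"] by (simp add: add_eq_0_iff)

lemma lin_ext_diff: "lin_ext f (p - q) = lin_ext f p - lin_ext f q"
  using lin_ext_add[of p "- q"] by (simp add: lin_ext_uminus)

lemma lin_ext_power: "lin_ext f (p ^ n) = lin_ext f p ^ n"
  by (induction n) (simp_all add: lin_ext_mult)

lemma lin_ext_sum: "lin_ext f (\<Sum>i\<in>A. g i) = (\<Sum>i\<in>A. lin_ext f (g i))"
  by (induction A rule: infinite_finite_induct) (simp_all add: lin_ext_add)

end

lemma keys_add_monom: "Poly_Mapping.keys (m + m' :: 'a \<Rightarrow>\<^sub>0 nat) = Poly_Mapping.keys m \<union> Poly_Mapping.keys m'"
  by (auto simp: in_keys_iff lookup_add)

text \<open>Setting the variables outside \<open>V\<close> to zero.  Through this idempotent endomorphism the coordinate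
  ring of a face becomes a subring of the polynomial ring.\<close>

definition rst :: "nat set \<Rightarrow> 'k::comm_ring_1 mpoly \<Rightarrow> 'k mpoly" where
  "rst V = lin_ext (\<lambda>m a. if Poly_Mapping.keys m \<subseteq> V then Poly_Mapping.single m a else 0)"

interpretation rst: coeff_multiplicative "\<lambda>(m::monom) (a::'k::comm_ring_1). if Poly_Mapping.keys m \<subseteq> V then Poly_Mapping.single m a else 0"
  for V
  by unfold_locales (auto simp: single_add keys_add_monom mult_single)

lemmas rst_simps [simp] =
  rst.lin_ext_zero[folded rst_def] rst.lin_ext_one[folded rst_def] rst.lin_ext_single[folded rst_def]
  rst.lin_ext_add[folded rst_def] rst.lin_ext_mult[folded rst_def] rst.lin_ext_diff[folded rst_def]
  rst.lin_ext_uminus[folded rst_def] rst.lin_ext_power[folded rst_def] rst.lin_ext_sum[folded rst_def]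

lemma rst_rst [simp]: "rst V (rst W p) = rst (V \<inter> W) p"
  by (induction p rule: poly_mapping_single_induct) auto

lemma lookup_rst: "Poly_Mapping.lookup (rst V p) m = (if Poly_Mapping.keys m \<subseteq> V then Poly_Mapping.lookup p m else 0)"
  by (induction p rule: poly_mapping_single_induct) (auto simp: lookup_add lookup_single when_def)

lemma rst_eq_iff: "rst V p = p \<longleftrightarrow> (\<forall>m\<in>Poly_Mapping.keys p. Poly_Mapping.keys m \<subseteq> V)"
  by (auto simp: poly_mapping_eq_iff fun_eq_iff lookup_rst in_keys_iff)

lemma rst_mono: "rst V p = p \<Longrightarrow> V \<subseteq> W \<Longrightarrow> rst W p = p"
  unfolding rst_eq_iff by blast

lemma rst_finite: "\<exists>V. finite V \<and> rst V p = p"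
  unfolding rst_eq_iff
  by (rule exI[of _ "\<Union>(Poly_Mapping.keys ` Poly_Mapping.keys p)"]) auto

lemma rst_fixed_Inter: "(\<And>v. v \<notin> W \<Longrightarrow> rst (- {v}) p = p) \<Longrightarrow> rst W p = p"
  unfolding rst_eq_iff by fastforce


text \<open>The convolution sum for the coefficient at \<open>M + M'\<close> has a single summand.
  Extreme exponents of the two factors satisfy the uniqueness hypothesis.\<close>

lemma lookup_mult_extreme:
  fixes p q :: "'a::comm_monoid_add \<Rightarrow>\<^sub>0 'b::comm_ring_1"
  assumes "M \<in> Poly_Mapping.keys p" "M' \<in> Poly_Mapping.keys q"
    and "\<And>k l. k \<in> Poly_Mapping.keys p \<Longrightarrow> l \<in> Poly_Mapping.keys q \<Longrightarrow> k + l = M + M' \<Longrightarrow> k = M \<and> l = M'"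
  shows "Poly_Mapping.lookup (p * q) (M + M') = Poly_Mapping.lookup p M * Poly_Mapping.lookup q M'"
proof -
  let ?s = "\<lambda>p. \<Sum>k\<in>Poly_Mapping.keys p. Poly_Mapping.single k (Poly_Mapping.lookup p k)"
  have sum_single: "p = ?s p" for p :: "'a \<Rightarrow>\<^sub>0 'b"
    by (rule poly_mapping_eqI) (auto simp: lookup_sum lookup_single when_def in_keys_iff)
  have "p * q = ?s p * ?s q" using sum_single by metis
  also have "\<dots> = (\<Sum>(k, l)\<in>Poly_Mapping.keys p \<times> Poly_Mapping.keys q.
      Poly_Mapping.single (k + l) (Poly_Mapping.lookup p k * Poly_Mapping.lookup q l))"
    by (simp add: sum_product mult_single sum.cartesian_product)
  finally have "Poly_Mapping.lookup (p * q) (M + M') = (\<Sum>(k, l)\<in>Poly_Mapping.keys p \<times> Poly_Mapping.keys q.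
      Poly_Mapping.lookup p k * Poly_Mapping.lookup q l when k + l = M + M')"
    by (simp add: lookup_sum case_prod_unfold lookup_single)
  also have "\<dots> = (\<Sum>x\<in>{(M, M')}. Poly_Mapping.lookup p (fst x) * Poly_Mapping.lookup q (snd x))"
    using assms by (intro sum.mono_neutral_cong_right) (auto simp: when_def split: if_splits)
  finally show ?thesis by simp
qed

text \<open>The largest exponents of the two factors add up to an exponent of the product, and so do
  the smallest ones. The product has only one exponent, so both sums agree, which forces largest and
  smallest to coincide in each factor. This is the source of the fact that units of Laurent
  polynomial rings are terms.\<close>

lemma monomial_factor:
  fixes p q :: "'a::{ordered_cancel_comm_monoid_add, linorder} \<Rightarrow>\<^sub>0 'b::idom"
  assumes pq: "p * q = Poly_Mapping.single m c" and "c \<noteq> 0"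
  obtains m' c' where "p = Poly_Mapping.single m' c'" "c' \<noteq> 0"
proof -
  let ?K = "Poly_Mapping.keys p" and ?L = "Poly_Mapping.keys q"
  have "Poly_Mapping.lookup (p * q) m \<noteq> 0" using assms by simp
  then have "p \<noteq> 0" "q \<noteq> 0" by auto
  then have ne: "?K \<noteq> {}" "?L \<noteq> {}" by (auto simp: poly_mapping_eq_iff fun_eq_iff in_keys_iff)
  \<comment> \<open>A sum of exponents that is attained in only one way has a nonzero coefficient in
    the product, hence is \<open>m\<close>.\<close>
  have *: "M + M' = m" if "M \<in> ?K" "M' \<in> ?L"
      "\<And>k l. k \<in> ?K \<Longrightarrow> l \<in> ?L \<Longrightarrow> k + l = M + M' \<Longrightarrow> k = M \<and> l = M'" for M M'
  proof -
    have "Poly_Mapping.lookup (p * q) (M + M') \<noteq> 0"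
      using that(1,2) by (subst lookup_mult_extreme[OF that]) (simp_all add: in_keys_iff)
    then show ?thesis unfolding pq by (simp add: lookup_single when_def split: if_splits)
  qed
  have "Max ?K + Max ?L = m"
  proof (rule *)
    fix k l assume kl: "k \<in> ?K" "l \<in> ?L" "k + l = Max ?K + Max ?L"
    then have "k \<le> Max ?K" "l \<le> Max ?L" by auto
    then show "k = Max ?K \<and> l = Max ?L"
      using kl(3) by (metis add_less_le_mono add_le_less_mono less_irrefl order_le_less)
  qed (use ne in auto)
  moreover have "Min ?K + Min ?L = m"
  proof (rule *)
    fix k l assume kl: "k \<in> ?K" "l \<in> ?L" "k + l = Min ?K + Min ?L"
    then have "Min ?K \<le> k" "Min ?L \<le> l" by auto
    then show "k = Min ?K \<and> l = Min ?L"
      using kl(3) by (metis add_less_le_mono add_le_less_mono less_irrefl order_le_less)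
  qed (use ne in auto)
  moreover have "Min ?K \<le> Max ?K" "Min ?L \<le> Max ?L" using ne by auto
  ultimately have "Min ?K = Max ?K"
    by (metis add_less_le_mono less_irrefl order_le_less)
  then have "?K = {Max ?K}" using ne
    by (metis Max_ge Max_in Min_le antisym finite_keys insertI1 is_singletonI is_singletonI' is_singleton_the_elem singletonD)
  then have "p = Poly_Mapping.single (Max ?K) (Poly_Mapping.lookup p (Max ?K))"
    by (intro poly_mapping_eqI) (metis in_keys_iff lookup_single when_def singletonD)
  moreover have "Poly_Mapping.lookup p (Max ?K) \<noteq> 0" using ne by (metis Max_in finite_keys in_keys_iff)
  ultimately show thesis using that by blast
qed


section \<open>Unique factorization of polynomials\<close>

lemma pvar_power: "(pvar v :: 'k::field mpoly) ^ n = Poly_Mapping.single (Poly_Mapping.single v n) 1"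
  by (induction n) (simp_all add: pvar_def monomial_def mult_single single_add[symmetric])

lemma rst_pvar [simp]: "rst V (pvar v) = (if v \<in> V then pvar v else 0)"
  by (simp add: pvar_def monomial_def)

text \<open>The identification of the polynomial ring with polynomials in \<open>v\<close> over the
  ring in the remaining variables. Coefficients keep the type \<open>'k mpoly\<close>; the absence
  of \<open>v\<close> from them is expressed through \<open>rst\<close>.\<close>

definition univ :: "nat \<Rightarrow> 'k::field mpoly \<Rightarrow> 'k mpoly poly" where
  "univ v = lin_ext (\<lambda>m a. Polynomial.monom (Poly_Mapping.single (Poly_Mapping.update v 0 m) a) (Poly_Mapping.lookup m v))"

lemma update_zero_add: "Poly_Mapping.update v 0 (m + m' :: monom) = Poly_Mapping.update v 0 m + Poly_Mapping.update v 0 m'"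
  by (rule poly_mapping_eqI) (simp add: lookup_update lookup_add)

lemma update_zero_zero [simp]: "Poly_Mapping.update v 0 0 = (0 :: monom)"
  by (rule poly_mapping_eqI) (simp add: lookup_update)

interpretation univ: coeff_multiplicative
  "\<lambda>(m::monom) (a::'k::field). Polynomial.monom (Poly_Mapping.single (Poly_Mapping.update v 0 m) a) (Poly_Mapping.lookup m v)"
  for v
  by unfold_locales
    (simp_all add: single_add Polynomial.add_monom mult_monom mult_single update_zero_add lookup_add monom_eq_1)

lemmas univ_simps [simp] =
  univ.lin_ext_zero[folded univ_def] univ.lin_ext_one[folded univ_def] univ.lin_ext_single[folded univ_def]
  univ.lin_ext_add[folded univ_def] univ.lin_ext_mult[folded univ_def] univ.lin_ext_diff[folded univ_def]
  univ.lin_ext_power[folded univ_def] univ.lin_ext_sum[folded univ_def]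

lemma poly_univ [simp]: "poly (univ v p) (pvar v) = p"
proof (induction p rule: poly_mapping_single_induct)
  case (2 m a p)
  have "Poly_Mapping.update v 0 m + Poly_Mapping.single v (Poly_Mapping.lookup m v) = m"
    by (rule poly_mapping_eqI) (simp add: lookup_update lookup_add lookup_single when_def)
  with 2 show ?case by (simp add: poly_monom pvar_power mult_single)
qed simp

lemma univ_inj: "univ v p = univ v q \<longleftrightarrow> p = q"
  by (metis poly_univ)

lemma univ_eq_0_iff [simp]: "univ v p = 0 \<longleftrightarrow> p = 0"
  using univ_inj[of v p 0] by simp

lemma coeff_univ_rst: "coeff (univ v (rst (insert v V) p)) n = rst (V - {v}) (coeff (univ v p) n)"
proof (induction p rule: poly_mapping_single_induct)
  case (2 m a p)
  have "Poly_Mapping.keys (Poly_Mapping.update v 0 m) \<subseteq> V - {v} \<longleftrightarrow> Poly_Mapping.keys m \<subseteq> insert v V"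
    by (auto simp: keys_update)
  with 2 show ?case by simp
qed simp

lemma coeff_univ_fixed: "rst (insert v V) p = p \<Longrightarrow> rst (V - {v}) (coeff (univ v p) n) = coeff (univ v p) n"
  by (metis coeff_univ_rst)

lemma univ_const: "rst (- {v}) p = p \<longleftrightarrow> univ v p = [:p:]"
proof
  have "univ v (rst (- {v}) p) = [:rst (- {v}) p:]"
  proof (induction p rule: poly_mapping_single_induct)
    case (2 m a p)
    have "Poly_Mapping.update v 0 m = m" "Poly_Mapping.lookup m v = 0" if "Poly_Mapping.keys m \<subseteq> - {v}"
      using that by (auto intro!: poly_mapping_eqI simp: lookup_update in_keys_iff)
    with 2 show ?case by (auto simp: monom_0)
  qed simp
  then show "rst (- {v}) p = p \<Longrightarrow> univ v p = [:p:]" by simp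
next
  assume "univ v p = [:p:]"
  then show "rst (- {v}) p = p"
    using coeff_univ_fixed[of v UNIV p 0] by (simp add: rst_eq_iff Compl_eq_Diff_UNIV)
qed

lemma univ_const_degree: "Polynomial.degree (univ v p) = 0 \<longleftrightarrow> rst (- {v}) p = p"
proof
  assume "Polynomial.degree (univ v p) = 0"
  then obtain c where c: "univ v p = [:c:]" by (meson degree_eq_zeroE)
  then have "p = c" using poly_univ[of v p] by simp
  with c show "rst (- {v}) p = p" by (simp add: univ_const)
qed (simp add: univ_const)

lemma univ_pvar [simp]: "univ v (pvar v) = Polynomial.monom 1 1"
proof -
  have "Poly_Mapping.update v 0 (Poly_Mapping.single v 1) = (0::monom)"
    by (rule poly_mapping_eqI) (simp add: lookup_update lookup_single when_def)
  then show ?thesis by (simp add: pvar_def monomial_def)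
qed

text \<open>The hypothesis keeps \<open>v\<close> out of the coefficients; otherwise the
  substitution would merge them with the powers of the variable. It makes substitution and
  \<open>univ v\<close> inverse to each other.\<close>

lemma univ_poly_pvar:
  assumes "\<And>i. rst (- {v}) (coeff P i) = coeff P i"
  shows "univ v (poly P (pvar v)) = P"
proof -
  have "univ v (poly P (pvar v)) = (\<Sum>i\<le>Polynomial.degree P. [:coeff P i:] * Polynomial.monom 1 1 ^ i)"
    using assms by (simp add: poly_altdef univ_const)
  also have "\<dots> = P" by (simp add: monom_power smult_monom poly_as_sum_of_monoms)
  finally show ?thesis .
qed

text \<open>The termination measure for factorization: the sum of the partial degrees. It is
  additive on products, and by \<open>vdeg_0_unit\<close> it is positive on nonzero nonunits in the
  variables of \<open>W\<close>.\<close>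

definition vdeg :: "nat set \<Rightarrow> 'k::field mpoly \<Rightarrow> nat" where
  "vdeg W p = (\<Sum>v\<in>W. Polynomial.degree (univ v p))"

lemma vdeg_mult: "p \<noteq> 0 \<Longrightarrow> q \<noteq> 0 \<Longrightarrow> vdeg W (p * q) = vdeg W p + vdeg W (q :: 'k::field mpoly)"
  by (simp add: vdeg_def degree_mult_eq sum.distrib)

text \<open>Degrees in a fixed variable add up because the coefficients form a domain. A variable
  that is absent from a nonzero product is therefore absent from the factors.\<close>

lemma rst_divisor:
  assumes "rst W (p * q) = p * q" "p * q \<noteq> (0 :: 'k::field mpoly)"
  shows "rst W p = p"
proof (rule rst_fixed_Inter)
  fix v assume "v \<notin> W"
  then have "rst (- {v}) (p * q) = p * q" by (intro rst_mono[OF assms(1)]) auto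
  then have "Polynomial.degree (univ v (p * q)) = 0" by (simp only: univ_const_degree)
  then have "Polynomial.degree (univ v p) = 0" using assms(2) by (simp add: degree_mult_eq)
  then show "rst (- {v}) p = p" by (simp only: univ_const_degree)
qed

lemma rst_factor:
  assumes "p = a * b" "rst W p = p" "p \<noteq> (0 :: 'k::field mpoly)"
  shows "rst W a = a" "rst W b = b"
  using rst_divisor[of W a b] rst_divisor[of W b a] assms by (auto simp del: rst_simps simp: mult.commute)

lemma rst_empty: "rst {} p = p \<longleftrightarrow> (\<exists>c. p = Poly_Mapping.single 0 c)"
proof
  assume p: "rst {} p = p"
  have "p = Poly_Mapping.single 0 (Poly_Mapping.lookup p 0)"
  proof (rule poly_mapping_eqI)
    fix m
    have "Poly_Mapping.lookup p m = 0" if "m \<noteq> 0"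
      using p that by (simp add: rst_eq_iff) (metis in_keys_iff)
    then show "Poly_Mapping.lookup p m = Poly_Mapping.lookup (Poly_Mapping.single 0 (Poly_Mapping.lookup p 0)) m"
      by (simp add: lookup_single when_def)
  qed
  then show "\<exists>c. p = Poly_Mapping.single 0 c" by blast
qed auto

lemma single_0_dvd_1: "c \<noteq> 0 \<Longrightarrow> Poly_Mapping.single 0 c dvd (1 :: 'k::field mpoly)"
  by (rule dvdI[of _ _ "Poly_Mapping.single 0 (inverse c)"]) (simp add: mult_single)

lemma vdeg_0_unit:
  fixes p :: "'k::field mpoly"
  assumes "finite W" "rst W p = p" "p \<noteq> 0" "vdeg W p = 0"
  shows "p dvd 1"
proof -
  have "rst (- {v}) p = p" for v
  proof (cases "v \<in> W")
    case True
    then show ?thesis using assms by (simp add: vdeg_def univ_const_degree)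
  next
    case False
    then show ?thesis using rst_mono[OF assms(2), of "- {v}"] by auto
  qed
  then have "rst {} p = p" using rst_fixed_Inter by blast
  then obtain c where "p = Poly_Mapping.single 0 c" by (auto simp: rst_empty)
  then show ?thesis using assms(3) single_0_dvd_1[of c] by (cases "c = 0") auto
qed

lemma irreducible_divisor:
  fixes p :: "'k::field mpoly"
  assumes "finite W" "rst W p = p" "p \<noteq> 0" "\<not> p dvd 1"
  shows "\<exists>q. irreducible q \<and> q dvd p"
  using assms(2-)
proof (induction "vdeg W p" arbitrary: p rule: less_induct)
  case less
  show ?case
  proof (cases "irreducible p")
    case False
    then obtain a b where ab: "p = a * b" "\<not> a dvd 1" "\<not> b dvd 1"
      using less.prems by (auto simp: irreducible_def)
    with less.prems have nz: "a \<noteq> 0" "b \<noteq> 0" by auto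
    have fixed: "rst W a = a" "rst W b = b"
      using rst_factor[OF ab(1) less.prems(1,2)] .
    have "vdeg W b \<noteq> 0" using vdeg_0_unit assms(1) fixed nz ab by blast
    then have "vdeg W a < vdeg W p" using ab nz by (simp add: vdeg_mult)
    then show ?thesis using less.hyps[of a] fixed nz ab by (metis dvd_trans dvd_triv_left)
  qed auto
qed

text \<open>Gauss's lemma is proved by induction on the finite set \<open>W\<close> of variables.\<close>

definition prime_on :: "nat set \<Rightarrow> 'k::field mpoly \<Rightarrow> bool" where
  "prime_on W p \<longleftrightarrow> (\<forall>a b. rst W a = a \<longrightarrow> rst W b = b \<longrightarrow> p dvd a * b \<longrightarrow> p dvd a \<or> p dvd b)"

text \<open>As a polynomial in \<open>v\<close>, the divisor is a constant, and divisibility by a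
  constant is tested coefficient by coefficient.\<close>

lemma dvd_iff_coeff_univ:
  assumes "rst (- {v}) p = (p :: 'k::field mpoly)"
  shows "p dvd a \<longleftrightarrow> (\<forall>n. p dvd coeff (univ v a) n)"
proof
  assume "p dvd a"
  then obtain k where "a = p * k" by blast
  then show "\<forall>n. p dvd coeff (univ v a) n" using assms by (simp add: univ_const)
next
  assume "\<forall>n. p dvd coeff (univ v a) n"
  then have "[:p:] dvd univ v a" by (simp add: const_poly_dvd_iff)
  then obtain K where "univ v a = [:p:] * K" by blast
  then have "poly (univ v a) (pvar v) = p * poly K (pvar v)" by simp
  then show "p dvd a" by simp
qed

text \<open>The classical argument of Gauss. If \<open>p\<close> divides neither factor, take the
  lowest coefficients in \<open>v\<close>, at \<open>i\<close> and \<open>j\<close>, that are not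
  divisible by \<open>p\<close>. Modulo \<open>p\<close> the coefficient of the product at
  \<open>i + j\<close> is the product of these two, so it is not divisible either.\<close>

lemma prime_on_insert:
  fixes p :: "'k::field mpoly"
  assumes p: "prime_on V p" "rst V p = p" and v: "v \<notin> V"
  shows "prime_on (insert v V) p"
  unfolding prime_on_def
proof (intro allI impI)
  fix a b assume a: "rst (insert v V) a = a" and b: "rst (insert v V) b = b" and ab: "p dvd a * b"
  have pv: "rst (- {v}) p = p" using p(2) v by (auto intro: rst_mono)
  note dvd = dvd_iff_coeff_univ[OF pv]
  let ?A = "coeff (univ v a)" and ?B = "coeff (univ v b)"
  have V: "V - {v} = V" using v by simp
  have fixed: "rst V (?A n) = ?A n" "rst V (?B n) = ?B n" for n
    using coeff_univ_fixed[OF a, of n] coeff_univ_fixed[OF b, of n] V by auto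
  show "p dvd a \<or> p dvd b"
  proof (rule ccontr)
    assume "\<not> (p dvd a \<or> p dvd b)"
    then have ex: "\<exists>n. \<not> p dvd ?A n" "\<exists>n. \<not> p dvd ?B n" using dvd by blast+
    define i where "i = (LEAST n. \<not> p dvd ?A n)"
    define j where "j = (LEAST n. \<not> p dvd ?B n)"
    have i: "\<not> p dvd ?A i" "\<And>n. n < i \<Longrightarrow> p dvd ?A n"
      unfolding i_def using LeastI_ex[OF ex(1)] not_less_Least by auto
    have j: "\<not> p dvd ?B j" "\<And>n. n < j \<Longrightarrow> p dvd ?B n"
      unfolding j_def using LeastI_ex[OF ex(2)] not_less_Least by auto
    have "p dvd coeff (univ v (a * b)) (i + j)" using ab dvd by blast
    also have "coeff (univ v (a * b)) (i + j) = (\<Sum>k\<le>i + j. ?A k * ?B (i + j - k))"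
      by (simp add: coeff_mult)
    also have "\<dots> = ?A i * ?B j + (\<Sum>k\<in>{..i + j} - {i}. ?A k * ?B (i + j - k))"
      by (subst sum.remove[of _ i]) auto
    finally have "p dvd ?A i * ?B j + (\<Sum>k\<in>{..i + j} - {i}. ?A k * ?B (i + j - k))" .
    moreover have "p dvd (\<Sum>k\<in>{..i + j} - {i}. ?A k * ?B (i + j - k))"
    proof (rule dvd_sum)
      fix k assume "k \<in> {..i + j} - {i}"
      then have "k < i \<or> i + j - k < j" by auto
      then show "p dvd ?A k * ?B (i + j - k)" using i(2) j(2) by (auto intro: dvd_mult dvd_mult2)
    qed
    ultimately have "p dvd ?A i * ?B j" by (simp add: dvd_add_left_iff)
    then show False using p(1) i(1) j(1) fixed by (auto simp: prime_on_def)
  qed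
qed

lemma pseudo_division:
  fixes g y :: "'k::field mpoly"
  assumes v: "v \<notin> V" and g: "rst (insert v V) g = g" "g \<noteq> 0" and y: "rst (insert v V) y = y"
  obtains c q r where "c \<noteq> 0" "rst V c = c" "rst (insert v V) q = q" "c * y = g * q + r"
    "r = 0 \<or> Polynomial.degree (univ v r) < Polynomial.degree (univ v g)"
proof -
  let ?G = "univ v g" and ?Y = "univ v y"
  have V: "V - {v} = V" "V \<subseteq> - {v}" using v by auto
  have fixed: "rst V (coeff ?G n) = coeff ?G n" "rst V (coeff ?Y n) = coeff ?Y n" for n
    using coeff_univ_fixed[OF g(1), of n] coeff_univ_fixed[OF y, of n] V by auto
  obtain Q R where QR: "pseudo_divmod ?Y ?G = (Q, R)" by force
  \<comment> \<open>The multiplier prescribed by pseudo-division, a power of the leading coefficient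
    of \<open>g\<close>. It only involves variables of \<open>V\<close>.\<close>
  define C where "C = coeff ?G (Polynomial.degree ?G) ^ (Suc (Polynomial.degree ?Y) - Polynomial.degree ?G)"
  have eq: "smult C ?Y = ?G * Q + R" and R: "R = 0 \<or> Polynomial.degree R < Polynomial.degree ?G"
    using pseudo_divmod[OF _ QR] g(2) by (auto simp: C_def)
  \<comment> \<open>The quotient and remainder returned by pseudo-division might contain foreign
    variables. Setting these to zero in the coefficients preserves the identity, because
    \<open>C\<close> and the coefficients of \<open>g\<close> and \<open>y\<close> are fixed by
    \<open>rst V\<close>.\<close>
  let ?h = "map_poly (rst V)"
  have C: "rst V C = C" "C \<noteq> 0" using fixed g(2) by (auto simp: C_def)
  have "smult C ?Y = ?G * ?h Q + ?h R"
  proof (rule poly_eqI)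
    fix n
    have "coeff (smult C ?Y) n = rst V (coeff (smult C ?Y) n)" using C fixed by simp
    also have "\<dots> = rst V (coeff (?G * Q + R) n)" by (simp only: eq)
    also have "\<dots> = coeff (?G * ?h Q + ?h R) n" by (simp add: coeff_mult coeff_map_poly fixed)
    finally show "coeff (smult C ?Y) n = coeff (?G * ?h Q + ?h R) n" .
  qed
  then have "poly (smult C ?Y) (pvar v) = poly (?G * ?h Q + ?h R) (pvar v)" by simp
  then have eq': "C * y = g * poly (?h Q) (pvar v) + poly (?h R) (pvar v)" by simp
  have co: "rst (- {v}) (coeff (?h P) i) = coeff (?h P) i" for P i
    using V(2) by (auto simp: coeff_map_poly Int_absorb1)
  have "univ v (poly (?h R) (pvar v)) = ?h R" by (rule univ_poly_pvar[OF co])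
  moreover have "?h R = 0 \<or> Polynomial.degree (?h R) < Polynomial.degree ?G"
    using R map_poly_degree_leq[of "rst V" R] by (metis le_less_trans map_poly_0)
  moreover have "rst (insert v V) (poly (?h Q) (pvar v)) = poly (?h Q) (pvar v)"
    by (simp add: poly_altdef coeff_map_poly Int_absorb1 subset_insertI)
  ultimately show thesis using that[OF C(2,1) _ eq'] by (metis univ_eq_0_iff)
qed

text \<open>Clears a denominator \<open>c\<close> that is free of \<open>v\<close>. Each irreducible
  factor of \<open>c\<close> is prime, divides \<open>p * z\<close> and does not divide the
  primitive polynomial \<open>p\<close>; so it divides \<open>z\<close>. The factors are removed one
  at a time, with \<open>vdeg V c\<close> as measure.\<close>

lemma dvd_cancel_primitive:
  fixes c :: "'k::field mpoly"
  assumes V: "finite V" "v \<notin> V"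
    and prime: "\<forall>\<pi> :: 'k mpoly. irreducible \<pi> \<longrightarrow> rst V \<pi> = \<pi> \<longrightarrow> prime_on (insert v V) \<pi>"
    and c: "rst V c = c" "c \<noteq> 0" and p: "rst (insert v V) p = p"
    and prim: "\<forall>\<pi>. irreducible \<pi> \<longrightarrow> rst V \<pi> = \<pi> \<longrightarrow> \<not> \<pi> dvd p"
    and y: "rst (insert v V) y = y" "c * y = p * z"
  shows "c dvd z"
  using c y
proof (induction "vdeg V c" arbitrary: c z rule: less_induct)
  case less
  show ?case
  proof (cases "c dvd 1 \<or> z = 0")
    case False
    then obtain \<pi> where \<pi>: "irreducible \<pi>" "\<pi> dvd c"
      using irreducible_divisor[OF V(1)] less.prems by blast
    then obtain c' where c': "c = \<pi> * c'" by blast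
    have nz: "\<pi> \<noteq> 0" "c' \<noteq> 0" using c' less.prems by auto
    have fix\<pi>: "rst V \<pi> = \<pi>" "rst V c' = c'" using rst_factor[OF c' less.prems(1,2)] .
    have pnz: "p \<noteq> 0" using prim[rule_format, OF \<pi>(1) fix\<pi>(1)] by auto
    have "rst (insert v V) c = c" using less.prems(1) by (rule rst_mono) blast
    then have "rst (insert v V) (p * z) = p * z"
      using less.prems(3) unfolding less.prems(4)[symmetric] by simp
    then have z: "rst (insert v V) z = z"
      using False pnz using rst_factor(2)[OF refl] by (metis no_zero_divisors)
    have "\<pi> dvd p * z" using \<pi>(2) less.prems(4) by (metis dvd_mult2)
    then have "\<pi> dvd z" using prime[rule_format, OF \<pi>(1) fix\<pi>(1)] p z prim[rule_format, OF \<pi>(1) fix\<pi>(1)] by (auto simp: prime_on_def)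
    then obtain z' where z': "z = \<pi> * z'" by blast
    have "\<pi> * (c' * y) = \<pi> * (p * z')" using less.prems(4) c' z' by (simp add: ac_simps)
    then have eq: "c' * y = p * z'" using nz by simp
    have "vdeg V \<pi> \<noteq> 0" using vdeg_0_unit[OF V(1) fix\<pi>(1) nz(1)] \<pi>(1) by (auto simp: irreducible_def)
    then have "vdeg V c' < vdeg V c" using c' nz by (simp add: vdeg_mult)
    from less.hyps[OF this fix\<pi>(2) nz(2) less.prems(3) eq] show ?thesis
      using c' z' by (simp add: mult_dvd_mono)
  qed (metis dvd_0_right dvd_trans one_dvd)
qed

text \<open>Irreducible factors in the variables of \<open>V\<close> are split off until none is
  left; each removal lowers the degree. The factor \<open>\<gamma>\<close> plays the role of the
  content.\<close>

lemma primitive_part: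
  fixes g :: "'k::field mpoly"
  assumes "finite W" "rst W g = g" "g \<noteq> 0"
  shows "\<exists>\<gamma> g'. g = \<gamma> * g' \<and> rst V \<gamma> = \<gamma> \<and> (\<forall>\<pi>. irreducible \<pi> \<longrightarrow> rst V \<pi> = \<pi> \<longrightarrow> \<not> \<pi> dvd g')"
  using assms(2,3)
proof (induction "vdeg W g" arbitrary: g rule: less_induct)
  case less
  show ?case
  proof (cases "\<exists>\<pi>. irreducible \<pi> \<and> rst V \<pi> = \<pi> \<and> \<pi> dvd g")
    case True
    then obtain \<pi> h where \<pi>: "irreducible \<pi>" "rst V \<pi> = \<pi>" "g = \<pi> * h" by blast
    with less.prems have nz: "\<pi> \<noteq> 0" "h \<noteq> 0" by auto
    have "rst W \<pi> = \<pi>" "rst W h = h" using rst_factor[OF \<pi>(3) less.prems(1,2)] .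
    moreover from this have "vdeg W \<pi> \<noteq> 0" using vdeg_0_unit[OF assms(1) _ nz(1)] \<pi>(1) by (auto simp: irreducible_def)
    then have "vdeg W h < vdeg W g" using \<pi> nz by (simp add: vdeg_mult)
    ultimately obtain \<gamma> g' where "h = \<gamma> * g'" "rst V \<gamma> = \<gamma>" "\<forall>\<pi>. irreducible \<pi> \<longrightarrow> rst V \<pi> = \<pi> \<longrightarrow> \<not> \<pi> dvd g'"
      using less.hyps[of h] nz by metis
    with \<pi> show ?thesis by (intro exI[of _ "\<pi> * \<gamma>"] exI[of _ g']) (auto simp: mult.assoc)
  next
    case False
    then show ?thesis by (intro exI[of _ 1] exI[of _ g]) auto
  qed
qed

text \<open>The Euclidean algorithm over the fraction field of the coefficient ring, with
  denominators cleared. An element \<open>g\<close> of least degree in the ideal generated by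
  \<open>p\<close> and \<open>a\<close> divides both, up to a factor free of \<open>v\<close>. Its
  primitive part \<open>g'\<close> divides \<open>p\<close> itself. As \<open>p\<close> is
  irreducible, either \<open>g'\<close> is a unit, and a Bezout relation gives
  \<open>p dvd b\<close>, or \<open>g'\<close> is associated to \<open>p\<close>, and
  \<open>p dvd a\<close>.\<close>

lemma irreducible_prime_on_primitive:
  fixes p :: "'k::field mpoly"
  assumes V: "finite V" "v \<notin> V"
    and prime: "\<forall>\<pi> :: 'k mpoly. irreducible \<pi> \<longrightarrow> rst V \<pi> = \<pi> \<longrightarrow> prime_on (insert v V) \<pi>"
    and irr: "irreducible p" and p: "rst (insert v V) p = p"
    and prim: "\<forall>\<pi>. irreducible \<pi> \<longrightarrow> rst V \<pi> = \<pi> \<longrightarrow> \<not> \<pi> dvd p"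
  shows "prime_on (insert v V) p"
  unfolding prime_on_def
proof (intro allI impI)
  let ?W = "insert v V"
  have pnz: "p \<noteq> 0" using irr by (auto simp: irreducible_def)
  note cancel = dvd_cancel_primitive[OF V prime]
  fix a b assume a: "rst ?W a = a" and b: "rst ?W b = b" and ab: "p dvd a * b"
  show "p dvd a \<or> p dvd b"
  proof (rule ccontr)
    assume "\<not> (p dvd a \<or> p dvd b)"
    then have na: "\<not> p dvd a" and nb: "\<not> p dvd b" by auto
    define I where "I = {r * p + s * a | r s. rst ?W r = r \<and> rst ?W s = s}"
    have I_fixed: "rst ?W g = g" if "g \<in> I" for g using that p a by (auto simp: I_def)
    have I_comb: "c * y - g * q \<in> I" if "y \<in> I" "g \<in> I" "rst ?W c = c" "rst ?W q = q" for c y g q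
    proof -
      from that obtain r s r' s' where *: "y = r * p + s * a" "g = r' * p + s' * a"
        "rst ?W r = r" "rst ?W s = s" "rst ?W r' = r'" "rst ?W s' = s'" by (auto simp: I_def)
      have "c * y - g * q = (c * r - r' * q) * p + (c * s - s' * q) * a"
        by (simp add: * algebra_simps)
      moreover have "rst ?W (c * r - r' * q) = c * r - r' * q" "rst ?W (c * s - s' * q) = c * s - s' * q"
        using * that by auto
      ultimately show ?thesis unfolding I_def by blast
    qed
    have pI: "p \<in> I" unfolding I_def by (intro CollectI exI[of _ 1] exI[of _ 0]) auto
    have aI: "a \<in> I" unfolding I_def by (intro CollectI exI[of _ 0] exI[of _ 1]) auto
    obtain g where g: "g \<in> I" "g \<noteq> 0"
      and gmin: "\<And>y. y \<in> I \<Longrightarrow> y \<noteq> 0 \<Longrightarrow> Polynomial.degree (univ v g) \<le> Polynomial.degree (univ v y)"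
      using ex_has_least_nat[of "\<lambda>y. y \<in> I \<and> y \<noteq> 0" p "\<lambda>y. Polynomial.degree (univ v y)"] pI pnz by auto
    have dvd_mult_g: "\<exists>c q. c \<noteq> 0 \<and> rst V c = c \<and> c * y = g * q" if y: "y \<in> I" for y
    proof -
      obtain c q r where c: "c \<noteq> 0" "rst V c = c" "rst ?W q = q" "c * y = g * q + r"
        and r: "r = 0 \<or> Polynomial.degree (univ v r) < Polynomial.degree (univ v g)"
        using pseudo_division[OF V(2) I_fixed[OF g(1)] g(2) I_fixed[OF y]] by blast
      have "rst ?W c = c" using c(2) by (rule rst_mono) blast
      from I_comb[OF y g(1) this c(3)] have "r \<in> I" using c(4) by simp
      then have "r = 0" using r gmin by fastforce
      with c show ?thesis by auto
    qed
    obtain \<gamma> g' where gg: "g = \<gamma> * g'" "rst V \<gamma> = \<gamma>"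
      and prim': "\<forall>\<pi>. irreducible \<pi> \<longrightarrow> rst V \<pi> = \<pi> \<longrightarrow> \<not> \<pi> dvd g'"
      using primitive_part[of ?W g V] V(1) I_fixed[OF g(1)] g(2) by auto
    have nz: "\<gamma> \<noteq> 0" "g' \<noteq> 0" using gg g by auto
    have g'W: "rst ?W g' = g'" using rst_factor(2)[OF gg(1) I_fixed[OF g(1)] g(2)] .
    obtain c q where c: "c \<noteq> 0" "rst V c = c" "c * p = g * q" using dvd_mult_g[OF pI] by blast
    \<comment> \<open>Cancelling \<open>c\<close> upgrades divisibility over the fraction field to
      divisibility of \<open>p\<close> by \<open>g'\<close> in the polynomial ring.\<close>
    have "c dvd \<gamma> * q"
      using cancel[OF c(2,1) g'W prim' p, of "\<gamma> * q"] c(3) gg by (simp add: ac_simps)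
    then obtain z where "\<gamma> * q = c * z" by blast
    then have "c * p = c * (g' * z)" using c(3) gg by (simp add: ac_simps)
    then have pz: "p = g' * z" using c(1) by simp
    then consider "g' dvd 1" | "z dvd 1" using irr pz unfolding irreducible_def by blast
    then show False
    proof cases
      case 1
      \<comment> \<open>The Bezout relation times \<open>b\<close> shows that \<open>p\<close>
        divides \<open>g * b\<close>, and so \<open>\<gamma> * b\<close> because \<open>g'\<close>
        is a unit. The content \<open>\<gamma>\<close> is then cancelled against the primitive
        \<open>p\<close>.\<close>
      obtain r s where rs: "g = r * p + s * a" using g(1) by (auto simp: I_def)
      have "g * b = p * (r * b) + s * (a * b)" using rs by (simp add: algebra_simps)
      then have "p dvd g * b" using ab by simp
      moreover obtain e where e: "1 = g' * e" using 1 by blast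
      have "e * (g * b) = (g' * e) * (\<gamma> * b)" unfolding gg(1) by (simp only: ac_simps)
      then have "\<gamma> * b = e * (g * b)" by (simp only: e[symmetric] mult_1)
      ultimately have "p dvd \<gamma> * b" by (metis dvd_mult)
      then obtain w where w: "\<gamma> * b = p * w" by blast
      have "\<gamma> dvd w" using cancel[OF gg(2) nz(1) p prim b w] .
      then obtain w' where "w = \<gamma> * w'" by blast
      then have "\<gamma> * b = \<gamma> * (p * w')" using w by (simp add: ac_simps)
      then show False using nz nb by simp
    next
      case 2
      then obtain e where e: "1 = z * e" by blast
      have g'e: "g' = p * e" using pz e by (metis mult.assoc mult.right_neutral)
      obtain c' q' where c': "c' \<noteq> 0" "rst V c' = c'" "c' * a = g * q'" using dvd_mult_g[OF aI] by blast
      have w: "c' * a = p * (e * \<gamma> * q')" using c'(3) gg(1) g'e by (simp add: ac_simps)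
      have "c' dvd e * \<gamma> * q'" using cancel[OF c'(2,1) p prim a w] .
      then obtain w' where "e * \<gamma> * q' = c' * w'" by blast
      then have "c' * a = c' * (p * w')" using w by (simp add: ac_simps)
      then show False using c'(1) na by simp
    qed
  qed
qed

text \<open>Induction on the variables. If \<open>p\<close> has an irreducible factor without the
  new variable \<open>v\<close>, then it is associated to that factor and Gauss's lemma applies.
  Otherwise \<open>p\<close> is primitive and the Euclidean argument applies.\<close>

lemma irreducible_prime_on:
  fixes p :: "'k::field mpoly"
  assumes "finite W" "irreducible p" "rst W p = p"
  shows "prime_on W p"
  using assms
proof (induction W arbitrary: p rule: finite_induct)
  case empty
  then obtain c where "p = Poly_Mapping.single 0 c" by (auto simp: rst_empty)
  moreover from this have "c \<noteq> 0" using empty by auto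
  ultimately have "p dvd 1" by (simp add: single_0_dvd_1)
  then show ?case using empty by (auto simp: irreducible_def)
next
  case (insert v V)
  have prime: "prime_on (insert v V) \<pi>" if "irreducible \<pi>" "rst V \<pi> = \<pi>" for \<pi> :: "'k mpoly"
    using insert.IH[OF that] that(2) insert.hyps(2) by (rule prime_on_insert)
  show ?case
  proof (cases "\<exists>\<pi>. irreducible \<pi> \<and> rst V \<pi> = \<pi> \<and> \<pi> dvd p")
    case True
    then obtain \<pi> u where \<pi>: "irreducible \<pi>" "rst V \<pi> = \<pi>" "p = \<pi> * u" by blast
    then have "u dvd 1" using insert.prems(1) by (auto simp: irreducible_def)
    then obtain e where "1 = u * e" by blast
    then have "\<pi> = p * e" using \<pi>(3) by (simp add: mult.assoc)
    then have "p dvd x \<longleftrightarrow> \<pi> dvd x" for x using \<pi>(3) by (metis dvd_mult_left)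
    then show ?thesis using prime[OF \<pi>(1,2)] by (simp add: prime_on_def)
  next
    case False
    then show ?thesis
      using irreducible_prime_on_primitive[OF insert.hyps(1,2) _ insert.prems] prime by blast
  qed
qed

text \<open>Three given polynomials involve only finitely many variables, so the finite case
  suffices although the type has infinitely many.\<close>

lemma irreducible_prime_elem:
  fixes p :: "'k::field mpoly"
  assumes "irreducible p"
  shows "prime_elem p"
  unfolding prime_elem_def
proof (intro conjI allI impI)
  fix a b assume ab: "p dvd a * b"
  obtain U V W where f: "finite U" "rst U p = p" "finite V" "rst V a = a" "finite W" "rst W b = b"
    using rst_finite by metis
  let ?X = "U \<union> V \<union> W"
  have X: "rst ?X p = p" "rst ?X a = a" "rst ?X b = b"
    by (rule rst_mono[OF f(2)] rst_mono[OF f(4)] rst_mono[OF f(6)]; blast)+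
  then show "p dvd a \<or> p dvd b"
    using irreducible_prime_on[of ?X p] f assms ab unfolding prime_on_def by blast
qed (use assms in \<open>auto simp: irreducible_def\<close>)

text \<open>The second clause is coprimeness in the form in which it is applied: what divides all
  multiples \<open>h' i * t\<close> divides \<open>t\<close>. Common irreducible factors are
  extracted until none remains, with the degree of the nonzero member \<open>h i0\<close> as
  measure. Then the irreducible factors of \<open>c\<close> pass to \<open>t\<close> one at a time,
  since each of them is prime and fails to divide some \<open>h' i\<close>.\<close>

lemma mpoly_gcd_family:
  fixes h :: "'i \<Rightarrow> 'k::field mpoly"
  assumes "i0 \<in> H" "h i0 \<noteq> 0"
  shows "\<exists>d h'. (\<forall>i\<in>H. h i = d * h' i) \<and> (\<forall>c t. (\<forall>i\<in>H. c dvd h' i * t) \<longrightarrow> c dvd t)"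
proof -
  obtain W where W: "finite W" "rst W (h i0) = h i0" using rst_finite by blast
  have "\<exists>d h'. (\<forall>i\<in>H. h i = d * h' i) \<and> (\<forall>\<pi>. irreducible \<pi> \<longrightarrow> (\<exists>i\<in>H. \<not> \<pi> dvd h' i))"
    using assms(2) W(2)
  proof (induction "vdeg W (h i0)" arbitrary: h rule: less_induct)
    case less
    show ?case
    proof (cases "\<exists>\<pi>. irreducible \<pi> \<and> (\<forall>i\<in>H. \<pi> dvd h i)")
      case True
      then obtain \<pi> where \<pi>: "irreducible \<pi>" "\<forall>i\<in>H. \<pi> dvd h i" by blast
      then have "\<forall>i\<in>H. \<exists>k. h i = \<pi> * k" by (simp add: dvd_def)
      then obtain k where k: "\<And>i. i \<in> H \<Longrightarrow> h i = \<pi> * k i" using bchoice[of H "\<lambda>i k. h i = \<pi> * k"] by blast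
      have nz: "\<pi> \<noteq> 0" "k i0 \<noteq> 0" using k[OF assms(1)] less.prems by auto
      have "rst W \<pi> = \<pi>" "rst W (k i0) = k i0" using rst_factor[OF k[OF assms(1)] less.prems(2,1)] .
      moreover from this have "vdeg W \<pi> \<noteq> 0"
        using vdeg_0_unit[OF W(1) _ nz(1)] \<pi>(1) by (auto simp: irreducible_def)
      then have "vdeg W (k i0) < vdeg W (h i0)" using k[OF assms(1)] nz by (simp add: vdeg_mult)
      ultimately obtain d h' where "\<forall>i\<in>H. k i = d * h' i" "\<forall>\<pi>. irreducible \<pi> \<longrightarrow> (\<exists>i\<in>H. \<not> \<pi> dvd h' i)"
        using less.hyps[of k] nz by metis
      then show ?thesis using k by (intro exI[of _ "\<pi> * d"] exI[of _ h']) (auto simp: mult.assoc)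
    next
      case False
      then show ?thesis by (intro exI[of _ 1] exI[of _ h]) auto
    qed
  qed
  then obtain d h' where h': "\<forall>i\<in>H. h i = d * h' i"
    and cop: "\<And>\<pi>. irreducible \<pi> \<Longrightarrow> \<exists>i\<in>H. \<not> \<pi> dvd h' i" by blast
  have "c dvd t" if "\<forall>i\<in>H. c dvd h' i * t" for c t
  proof (cases "c = 0")
    case True
    then show ?thesis using that assms h' by (metis dvd_0_left_iff mult_eq_0_iff)
  next
    case False
    obtain U where U: "finite U" "rst U c = c" using rst_finite by blast
    from False U(2) that show ?thesis
    proof (induction "vdeg U c" arbitrary: c t rule: less_induct)
      case less
      show ?case
      proof (cases "c dvd 1")
        case False
        then obtain \<pi> c' where \<pi>: "irreducible \<pi>" "c = \<pi> * c'"
          using irreducible_divisor[OF U(1)] less.prems by blast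
        then have nz: "\<pi> \<noteq> 0" "c' \<noteq> 0" using less.prems by auto
        obtain i where "i \<in> H" "\<not> \<pi> dvd h' i" using cop[OF \<pi>(1)] by blast
        moreover from this have "\<pi> dvd h' i * t" using less.prems(3) \<pi>(2) by (meson dvd_mult_left)
        ultimately have "\<pi> dvd t" using irreducible_prime_elem[OF \<pi>(1)] by (auto simp: prime_elem_dvd_mult_iff)
        then obtain t' where t': "t = \<pi> * t'" by blast
        have fixed: "rst U \<pi> = \<pi>" "rst U c' = c'" using rst_factor[OF \<pi>(2) less.prems(2,1)] .
        have "vdeg U \<pi> \<noteq> 0" using vdeg_0_unit[OF U(1) fixed(1) nz(1)] \<pi>(1) by (auto simp: irreducible_def)
        then have "vdeg U c' < vdeg U c" using \<pi> nz by (simp add: vdeg_mult)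
        moreover have "\<forall>i\<in>H. c' dvd h' i * t'"
        proof
          fix i assume "i \<in> H"
          then have "\<pi> * c' dvd \<pi> * (h' i * t')" using less.prems(3) \<pi>(2) t' by (metis mult.left_commute)
          then show "c' dvd h' i * t'" using nz by (metis dvd_mult_cancel_left)
        qed
        ultimately have "c' dvd t'" using less.hyps fixed nz by blast
        then show ?thesis using \<pi> t' by (simp add: mult_dvd_mono)
      qed (metis dvd_trans one_dvd)
    qed
  qed
  with h' show ?thesis by blast
qed


section \<open>Line bundles over the faces of a complex\<close>

abbreviation const :: "'k::field \<Rightarrow> 'k mpoly" where
  "const c \<equiv> Poly_Mapping.single 0 c"

lemma pvar_neq_0 [simp]: "pvar j \<noteq> (0 :: 'k::field mpoly)"
  by (metis lookup_single_eq lookup_zero monomial_def pvar_def zero_neq_one)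

text \<open>This determines the units after inverting one variable: the numerator of such a unit
  divides a power of \<open>pvar j\<close>.\<close>

lemma pvar_power_factor:
  fixes p q :: "'k::field mpoly"
  assumes "p * q = pvar j ^ k"
  obtains c s where "c \<noteq> 0" "p = const c * pvar j ^ s"
proof -
  have pq: "p * q = Poly_Mapping.single (Poly_Mapping.single j k) 1" using assms by (simp add: pvar_power)
  obtain m c where p: "p = Poly_Mapping.single m c" "c \<noteq> 0" using monomial_factor[OF pq] by auto
  obtain m' c' where q: "q = Poly_Mapping.single m' c'" "c' \<noteq> 0"
    using monomial_factor[of q p "Poly_Mapping.single j k" 1] pq by (metis mult.commute zero_neq_one)
  have "Poly_Mapping.keys (Poly_Mapping.single (m + m') (c * c')) = Poly_Mapping.keys (Poly_Mapping.single (Poly_Mapping.single j k) (1 :: 'k))"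
    using pq p(1) q(1) by (simp add: mult_single)
  then have "m + m' = Poly_Mapping.single j k" using p q by simp
  then have "Poly_Mapping.keys m \<subseteq> {j}" by (metis Un_subset_iff keys_add_monom keys_single empty_subsetI order_refl)
  then have "m = Poly_Mapping.single j (Poly_Mapping.lookup m j)"
    by (intro poly_mapping_eqI) (auto simp: lookup_single when_def in_keys_iff)
  then have "p = const c * pvar j ^ Poly_Mapping.lookup m j" using p by (simp add: pvar_power mult_single)
  with p(2) that show thesis by blast
qed

text \<open>Up to a common power of the \<open>f a\<close>, \<open>R a b\<close> is the numerator of the transition function from \<open>f a\<close> to
  \<open>f b\<close> of a line bundle on the locus where the variable \<open>j\<close> is invertible.  A family \<open>q\<close> defines
  the section whose component at \<open>a\<close> is \<open>E q a\<close>.  Milnor patching: on a single face a generator is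
  found by dividing by a greatest common divisor; generators on different faces differ on the
  intersection by a constant times a power of \<open>j\<close>, the same on all faces because they all contain
  the vertex \<open>j\<close>, and can therefore be glued face by face.\<close>

locale gluing_matrix =
  fixes H :: "'i set" and f :: "'i \<Rightarrow> 'k::field mpoly" and R :: "'i \<Rightarrow> 'i \<Rightarrow> 'k mpoly"
    and N j :: nat and \<Phi> :: "nat set set"
  assumes finite_H: "finite H" and finite_faces: "finite \<Phi>"
    and vertex: "F \<in> \<Phi> \<Longrightarrow> j \<in> F" "{j} \<in> \<Phi>"
    and inter: "F \<in> \<Phi> \<Longrightarrow> G \<in> \<Phi> \<Longrightarrow> F \<inter> G \<in> \<Phi>"
    and pvar_dvd: "a \<in> H \<Longrightarrow> pvar j dvd f a" and N: "0 < N"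
    and diag: "F \<in> \<Phi> \<Longrightarrow> a \<in> H \<Longrightarrow> rst F (f a) \<noteq> 0 \<Longrightarrow> rst F (R a a) = rst F (f a) ^ N"
    and cocycle: "F \<in> \<Phi> \<Longrightarrow> a \<in> H \<Longrightarrow> b \<in> H \<Longrightarrow> c \<in> H \<Longrightarrow> rst F (f a) \<noteq> 0 \<Longrightarrow> rst F (f b) \<noteq> 0
      \<Longrightarrow> rst F (R a b) * rst F (R b c) = rst F (R a c) * rst F (f b) ^ N"
    and cover: "\<exists>k c. \<forall>F\<in>\<Phi>. pvar j ^ k = (\<Sum>a\<in>H. rst F (c a) * rst F (f a) ^ M)"
begin

definition E :: "('i \<Rightarrow> 'k mpoly) \<Rightarrow> 'i \<Rightarrow> 'k mpoly" where
  "E q a = (\<Sum>b\<in>H. q b * R a b)"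

text \<open>Being invertible where \<open>f a\<close> is inverted means dividing a power of
  \<open>f a\<close>. If \<open>f a\<close> vanishes on \<open>F\<close>, the exponent 1 satisfies
  the condition for any \<open>q\<close>.\<close>

definition generates :: "nat set \<Rightarrow> ('i \<Rightarrow> 'k mpoly) \<Rightarrow> bool" where
  "generates F q \<longleftrightarrow> (\<forall>a\<in>H. \<exists>M. rst F (E q a) dvd rst F (f a) ^ M)"

lemma E_scale: "E (\<lambda>b. p * q b) a = p * E q a"
  by (simp add: E_def sum_distrib_left mult.assoc)

lemma E_diff: "E (\<lambda>b. q b - q' b) a = E q a - E q' a"
  by (simp add: E_def sum_subtractf algebra_simps)

text \<open>This is the cocycle identity summed against the entries of \<open>q\<close>: the
  components at \<open>a\<close> and \<open>b\<close> describe the same section.\<close>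

lemma E_transfer:
  assumes "F \<in> \<Phi>" "a \<in> H" "b \<in> H" "rst F (f a) \<noteq> 0" "rst F (f b) \<noteq> 0"
  shows "rst F (R a b) * rst F (E q b) = rst F (E q a) * rst F (f b) ^ N"
proof -
  have "rst F (R a b) * rst F (E q b) = (\<Sum>c\<in>H. rst F (q c) * (rst F (R a b) * rst F (R b c)))"
    by (simp add: E_def sum_distrib_left ac_simps)
  also have "\<dots> = (\<Sum>c\<in>H. rst F (q c) * (rst F (R a c) * rst F (f b) ^ N))"
    using cocycle[OF assms(1-3) _ assms(4,5)] by (intro sum.cong) auto
  also have "\<dots> = rst F (E q a) * rst F (f b) ^ N"
    by (simp add: E_def sum_distrib_left sum_distrib_right ac_simps)
  finally show ?thesis .
qed

lemma R_neq_0: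
  assumes "F \<in> \<Phi>" "a \<in> H" "b \<in> H" "rst F (f a) \<noteq> 0" "rst F (f b) \<noteq> 0"
  shows "rst F (R a b) \<noteq> 0"
proof -
  have "rst F (R a b) * rst F (R b a) = rst F (f a) ^ N * rst F (f b) ^ N"
    using cocycle[OF assms(1-3,2,4,5)] diag[OF assms(1,2,4)] by simp
  also have "\<dots> \<noteq> 0" using assms by simp
  finally show ?thesis by auto
qed

lemma generates_subset: "generates F q \<Longrightarrow> G \<subseteq> F \<Longrightarrow> generates G q"
  unfolding generates_def
proof (intro ballI)
  fix a assume *: "\<forall>a\<in>H. \<exists>M. rst F (E q a) dvd rst F (f a) ^ M" and G: "G \<subseteq> F" and "a \<in> H"
  then obtain M t where "rst F (f a) ^ M = rst F (E q a) * t" by (metis dvdE)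
  then have "rst G (rst F (f a) ^ M) = rst G (rst F (E q a) * t)" by simp
  then have "rst G (f a) ^ M = rst G (E q a) * rst G t" using G by (simp add: Int_absorb2)
  then show "\<exists>M. rst G (E q a) dvd rst G (f a) ^ M" by (metis dvd_triv_left)
qed

lemma generates_uniform:
  assumes "generates F q"
  shows "\<exists>M0. \<forall>M\<ge>M0. \<forall>a\<in>H. rst F (E q a) dvd rst F (f a) ^ M"
proof -
  obtain M where M: "\<And>a. a \<in> H \<Longrightarrow> rst F (E q a) dvd rst F (f a) ^ M a"
    using assms unfolding generates_def by metis
  have "rst F (E q a) dvd rst F (f a) ^ K" if "K \<ge> Max (M ` H)" "a \<in> H" for K a
  proof -
    have "M a \<le> K" using that finite_H by (meson Max_ge finite_imageI imageI le_trans)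
    then show ?thesis using M[OF that(2)] by (meson dvd_trans le_imp_power_dvd)
  qed
  then show ?thesis by blast
qed

lemma generates_neq_0:
  assumes "generates F q" "a \<in> H" "rst F (f a) \<noteq> 0"
  shows "rst F (E q a) \<noteq> 0"
  using assms unfolding generates_def by (metis dvd_0_left_iff power_not_zero)

text \<open>The factor is a unit once \<open>pvar j\<close> is inverted. As \<open>pvar j\<close>
  divides every \<open>f a\<close>, its power is absorbed by raising the exponent of
  \<open>f a\<close>.\<close>

lemma generates_scale:
  assumes F: "F \<in> \<Phi>" and q: "generates F q" and c: "c \<noteq> 0"
    and eq: "\<And>a. a \<in> H \<Longrightarrow> rst F (f a) \<noteq> 0 \<Longrightarrow> rst F (E q' a) = const c * pvar j ^ k * rst F (E q a)"
  shows "generates F q'"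
  unfolding generates_def
proof
  fix a assume a: "a \<in> H"
  show "\<exists>M. rst F (E q' a) dvd rst F (f a) ^ M"
  proof (cases "rst F (f a) = 0")
    case True
    then show ?thesis by (intro exI[of _ 1]) simp
  next
    case False
    obtain M where M: "rst F (E q a) dvd rst F (f a) ^ M" using q a by (auto simp: generates_def)
    obtain g where "f a = pvar j * g" using pvar_dvd[OF a] by blast
    then have "pvar j dvd rst F (f a)" using vertex(1)[OF F] by simp
    then have "pvar j ^ k dvd rst F (f a) ^ k" by (rule dvd_power_same)
    moreover have "const c * pvar j ^ k dvd pvar j ^ k"
      using single_0_dvd_1[OF c] by (simp add: mult_unit_dvd_iff)
    ultimately have "const c * pvar j ^ k * rst F (E q a) dvd rst F (f a) ^ k * rst F (f a) ^ M"
      using M by (meson dvd_trans mult_dvd_mono)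
    then show ?thesis using eq[OF a False] by (metis power_add)
  qed
qed

lemma cover_nonzero:
  assumes "F \<in> \<Phi>"
  obtains a where "a \<in> H" "rst F (f a) \<noteq> 0"
proof -
  obtain k c where "pvar j ^ k = (\<Sum>a\<in>H. rst F (c a) * rst F (f a) ^ 1)" using cover[of 1] assms by blast
  moreover have "pvar j ^ k \<noteq> (0 :: 'k mpoly)" by simp
  ultimately obtain a where "a \<in> H" "rst F (c a) * rst F (f a) ^ 1 \<noteq> 0" by (metis (no_types, lifting) sum.neutral)
  then show thesis using that by auto
qed

text \<open>On one face the ring is factorial, so a module of rank one is principal. The row of the
  matrix at \<open>a0\<close> embeds the module as a fractional ideal, and division by the greatest
  common divisor \<open>d\<close> makes it locally generated by the coprime entries
  \<open>h'\<close>. With cofactors \<open>w\<close> and a partition of unity one obtains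
  \<open>q\<close> such that \<open>h' a * E q a\<close> is a power of \<open>pvar j\<close> times
  \<open>f a ^ N\<close> on the face.\<close>

lemma exists_generates_simplex:
  assumes F: "F \<in> \<Phi>"
  shows "\<exists>q. generates F q"
proof -
  let ?r = "rst F"
  define H0 where "H0 = {a \<in> H. ?r (f a) \<noteq> 0}"
  have H0: "finite H0" "H0 \<subseteq> H" using finite_H by (auto simp: H0_def)
  obtain a0 where a0: "a0 \<in> H0" using cover_nonzero[OF F] by (auto simp: H0_def)
  define h where "h b = ?r (R a0 b)" for b
  have hnz: "h b \<noteq> 0" if "b \<in> H0" for b using R_neq_0[OF F] that a0 by (auto simp: h_def H0_def)
  obtain d h' where h': "\<And>b. b \<in> H0 \<Longrightarrow> h b = d * h' b"
    and gcd: "\<And>c t. (\<forall>b\<in>H0. c dvd h' b * t) \<Longrightarrow> c dvd t"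
    using mpoly_gcd_family[of a0 H0 h] a0 hnz by metis
  have d: "d \<noteq> 0" using h' hnz a0 by fastforce
  have rel: "h' a * ?r (R a b) = h' b * ?r (f a) ^ N" if "a \<in> H0" "b \<in> H0" for a b
  proof -
    have "h a * ?r (R a b) = h b * ?r (f a) ^ N"
      using cocycle[OF F, of a0 a b] that a0 by (auto simp: H0_def h_def)
    then show ?thesis using h' that d by (simp add: mult.assoc)
  qed
  \<comment> \<open>By \<open>rel\<close>, the entry \<open>h' a\<close> divides every
    \<open>h' b\<close> times the power of \<open>f a\<close>; coprimeness of the entries removes
    \<open>h' b\<close>.\<close>
  have "h' a dvd ?r (f a) ^ N" if "a \<in> H0" for a
    using rel[OF that] by (intro gcd) (metis dvd_triv_left)
  then have "\<forall>a\<in>H0. \<exists>w. ?r (f a) ^ N = h' a * w" by (simp add: dvd_def)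
  then obtain w where w: "\<And>a. a \<in> H0 \<Longrightarrow> ?r (f a) ^ N = h' a * w a"
    using bchoice[of H0 "\<lambda>a w. ?r (f a) ^ N = h' a * w"] by blast
  have fixw: "?r (w b) = w b" if "b \<in> H0" for b
    using rst_factor(2)[OF w[OF that], of F] that by (simp add: H0_def)
  obtain k c where kc: "pvar j ^ k = (\<Sum>a\<in>H. ?r (c a) * ?r (f a) ^ N)" using cover[of N] F by blast
  also have "\<dots> = (\<Sum>a\<in>H0. ?r (c a) * ?r (f a) ^ N)"
    using N finite_H by (intro sum.mono_neutral_right) (auto simp: H0_def)
  finally have kc: "pvar j ^ k = (\<Sum>a\<in>H0. ?r (c a) * ?r (f a) ^ N)" .
  \<comment> \<open>The weights combine the cofactors \<open>w\<close> with the partition of unity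
    \<open>kc\<close>: the products \<open>h' b * w b\<close> become the powers that occur in
    \<open>kc\<close>.\<close>
  define q where "q b = (if b \<in> H0 then c b * w b else 0)" for b
  have "generates F q"
    unfolding generates_def
  proof
    fix a assume a: "a \<in> H"
    show "\<exists>M. ?r (E q a) dvd ?r (f a) ^ M"
    proof (cases "a \<in> H0")
      case False
      then show ?thesis using a by (intro exI[of _ 1]) (simp add: H0_def)
    next
      case True
      have "?r (E q a) = (\<Sum>b\<in>H. ?r (q b) * ?r (R a b))" by (simp add: E_def)
      also have "\<dots> = (\<Sum>b\<in>H0. ?r (c b) * w b * ?r (R a b))"
        using H0 finite_H by (intro sum.mono_neutral_cong_right) (auto simp: q_def fixw)
      finally have "h' a * ?r (E q a) = (\<Sum>b\<in>H0. ?r (c b) * w b * (h' a * ?r (R a b)))"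
        by (simp add: sum_distrib_left ac_simps)
      also have "\<dots> = (\<Sum>b\<in>H0. ?r (c b) * (h' b * w b) * ?r (f a) ^ N)"
        using rel[OF True] by (intro sum.cong) (auto simp: ac_simps)
      also have "\<dots> = (\<Sum>b\<in>H0. ?r (c b) * ?r (f b) ^ N) * ?r (f a) ^ N"
        using w by (simp add: sum_distrib_right)
      finally have "?r (E q a) dvd pvar j ^ k * ?r (f a) ^ N" using kc by (metis dvd_triv_right)
      moreover obtain g where "f a = pvar j * g" using pvar_dvd[OF a] by blast
      then have "pvar j dvd ?r (f a)" using vertex(1)[OF F] by simp
      then have "pvar j ^ k dvd ?r (f a) ^ k" by (rule dvd_power_same)
      then have "pvar j ^ k * ?r (f a) ^ N dvd ?r (f a) ^ (k + N)"
        unfolding power_add by (intro mult_dvd_mono dvd_refl)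
      ultimately have "?r (E q a) dvd ?r (f a) ^ (k + N)" by (rule dvd_trans)
      then show ?thesis by blast
    qed
  qed
  then show ?thesis by blast
qed

text \<open>The ratio of two generators is a unit of the ring of the face with \<open>pvar j\<close>
  inverted, so it is a constant times a power of \<open>pvar j\<close>. To see this, numerators of
  the ratio and of its inverse are built globally as \<open>y1\<close> and \<open>y2\<close>, whose
  product is a power of \<open>pvar j\<close>.\<close>

lemma generates_ratio:
  assumes F: "F \<in> \<Phi>" and q: "generates F q1" "generates F q2"
  obtains c k s where "c \<noteq> 0"
    "\<And>b. b \<in> H \<Longrightarrow> rst F (f b) \<noteq> 0 \<Longrightarrow> pvar j ^ k * rst F (E q1 b) = const c * pvar j ^ s * rst F (E q2 b)"
proof -
  let ?r = "rst F"
  define H0 where "H0 = {a \<in> H. ?r (f a) \<noteq> 0}"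
  obtain M1 M2 where "\<forall>M\<ge>M1. \<forall>a\<in>H. ?r (E q1 a) dvd ?r (f a) ^ M" "\<forall>M\<ge>M2. \<forall>a\<in>H. ?r (E q2 a) dvd ?r (f a) ^ M"
    using generates_uniform q by meson
  then have dvd: "\<forall>a\<in>H. ?r (E q1 a) dvd ?r (f a) ^ (Suc (M1 + M2))" "\<forall>a\<in>H. ?r (E q2 a) dvd ?r (f a) ^ (Suc (M1 + M2))"
    by auto
  \<comment> \<open>A positive exponent makes the indices with \<open>f a\<close> zero on the face
    drop out of the partition of unity.\<close>
  define M where "M = Suc (M1 + M2)"
  obtain t1 t2 where t: "\<And>a. a \<in> H \<Longrightarrow> ?r (f a) ^ M = ?r (E q1 a) * t1 a" "\<And>a. a \<in> H \<Longrightarrow> ?r (f a) ^ M = ?r (E q2 a) * t2 a"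
    using dvd unfolding M_def dvd_def by metis
  obtain k c where kc: "pvar j ^ k = (\<Sum>a\<in>H. ?r (c a) * ?r (f a) ^ M)" using cover[of M] F by blast
  also have "\<dots> = (\<Sum>a\<in>H0. ?r (c a) * ?r (f a) ^ M)"
    using finite_H by (intro sum.mono_neutral_right) (auto simp: H0_def M_def)
  finally have kc: "pvar j ^ k = (\<Sum>a\<in>H0. ?r (c a) * ?r (f a) ^ M)" .
  \<comment> \<open>Rank one: two sections have the same ratio at every index.\<close>
  have cross: "?r (E q a) * ?r (E q' b) = ?r (E q' a) * ?r (E q b)" if "a \<in> H0" "b \<in> H0" for a b q q'
  proof -
    have ab: "a \<in> H" "b \<in> H" "?r (f a) \<noteq> 0" "?r (f b) \<noteq> 0" using that by (auto simp: H0_def)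
    have "(?r (R a b) * ?r (f b) ^ N) * (?r (E q a) * ?r (E q' b)) = (?r (R a b) * ?r (f b) ^ N) * (?r (E q' a) * ?r (E q b))"
    proof -
      have "(?r (R a b) * ?r (f b) ^ N) * (?r (E q a) * ?r (E q' b)) = (?r (E q a) * ?r (f b) ^ N) * (?r (R a b) * ?r (E q' b))"
        by (simp only: ac_simps)
      also have "\<dots> = (?r (R a b) * ?r (E q b)) * (?r (E q' a) * ?r (f b) ^ N)"
        by (simp only: E_transfer[OF F ab])
      finally show ?thesis by (simp only: ac_simps)
    qed
    then show ?thesis using R_neq_0[OF F ab] ab by simp
  qed
  \<comment> \<open>At index \<open>a\<close> the ratio is \<open>E q1 a * t2 a\<close> over
    \<open>f a ^ M\<close>; the partition of unity adds these local expressions up.\<close>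
  define y1 where "y1 = (\<Sum>a\<in>H0. ?r (c a) * (?r (E q1 a) * t2 a))"
  define y2 where "y2 = (\<Sum>a\<in>H0. ?r (c a) * (?r (E q2 a) * t1 a))"
  have y1: "y1 * ?r (E q2 b) = pvar j ^ k * ?r (E q1 b)" if "b \<in> H0" for b
  proof -
    have "y1 * ?r (E q2 b) = (\<Sum>a\<in>H0. ?r (c a) * t2 a * (?r (E q1 a) * ?r (E q2 b)))"
      by (simp add: y1_def sum_distrib_left sum_distrib_right ac_simps)
    also have "\<dots> = (\<Sum>a\<in>H0. ?r (c a) * (?r (E q2 a) * t2 a) * ?r (E q1 b))"
      using cross[OF _ that] by (intro sum.cong) (auto simp: ac_simps)
    also have "\<dots> = (\<Sum>a\<in>H0. ?r (c a) * ?r (f a) ^ M * ?r (E q1 b))"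
      using t by (intro sum.cong) (auto simp: H0_def)
    finally show ?thesis by (simp add: kc sum_distrib_right)
  qed
  have y2: "y2 * ?r (E q1 b) = pvar j ^ k * ?r (E q2 b)" if "b \<in> H0" for b
  proof -
    have "y2 * ?r (E q1 b) = (\<Sum>a\<in>H0. ?r (c a) * t1 a * (?r (E q2 a) * ?r (E q1 b)))"
      by (simp add: y2_def sum_distrib_left sum_distrib_right ac_simps)
    also have "\<dots> = (\<Sum>a\<in>H0. ?r (c a) * (?r (E q1 a) * t1 a) * ?r (E q2 b))"
      using cross[OF _ that] by (intro sum.cong) (auto simp: ac_simps)
    also have "\<dots> = (\<Sum>a\<in>H0. ?r (c a) * ?r (f a) ^ M * ?r (E q2 b))"
      using t by (intro sum.cong) (auto simp: H0_def)
    finally show ?thesis by (simp add: kc sum_distrib_right)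
  qed
  obtain b where b: "b \<in> H0" using cover_nonzero[OF F] by (auto simp: H0_def)
  have nz: "?r (E q1 b) \<noteq> 0" "?r (E q2 b) \<noteq> 0" using generates_neq_0 q b by (auto simp: H0_def)
  have "(y1 * y2) * (?r (E q1 b) * ?r (E q2 b)) = (y1 * ?r (E q2 b)) * (y2 * ?r (E q1 b))"
    by (simp only: ac_simps)
  also have "\<dots> = pvar j ^ (k + k) * (?r (E q1 b) * ?r (E q2 b))"
    by (simp only: y1[OF b] y2[OF b] power_add ac_simps)
  finally have "y1 * y2 = pvar j ^ (k + k)" using nz by simp
  then obtain e s where e: "e \<noteq> 0" "y1 = const e * pvar j ^ s" by (rule pvar_power_factor)
  show thesis
    by (rule that[OF e(1), of k s]) (use y1 e(2) in \<open>simp add: H0_def\<close>)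
qed

text \<open>After rescaling by the ratio at the vertex \<open>{j}\<close>, the two generators agree
  on every intersection with \<open>G\<close>. Their difference then vanishes there, so a lift of it
  in the variables of \<open>G\<close> vanishes on all faces of \<open>\<Psi>\<close>. Subtracting
  this lift changes the section on \<open>G\<close> only.\<close>

lemma exists_generates_insert:
  assumes \<Psi>: "\<Psi> \<subseteq> \<Phi>" "\<Psi> \<noteq> {}" and G: "G \<in> \<Phi>"
    and q1: "\<And>F. F \<in> \<Psi> \<Longrightarrow> generates F q1" and q2: "generates G q2"
  shows "\<exists>q. \<forall>F\<in>insert G \<Psi>. generates F q"
proof -
  obtain F0 where "F0 \<in> \<Psi>" using \<Psi>(2) by blast
  then have "generates {j} q1" "generates {j} q2"
    using generates_subset[OF q1] generates_subset[OF q2] vertex \<Psi> G by (auto dest!: subsetD)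
  then obtain c0 k0 s0 where c0: "c0 \<noteq> 0" and ratio: "\<And>b. b \<in> H \<Longrightarrow> rst {j} (f b) \<noteq> 0
      \<Longrightarrow> pvar j ^ k0 * rst {j} (E q1 b) = const c0 * pvar j ^ s0 * rst {j} (E q2 b)"
    using generates_ratio[OF vertex(2)] by metis
  \<comment> \<open>The ratio on the intersection is again a constant times a power of
    \<open>pvar j\<close>. Restriction to \<open>{j}\<close> leaves such an expression unchanged, so
    it equals the ratio at the vertex.\<close>
  have agree: "pvar j ^ k0 * rst (F \<inter> G) (E q1 b) = const c0 * pvar j ^ s0 * rst (F \<inter> G) (E q2 b)"
    if F: "F \<in> \<Psi>" and b: "b \<in> H" "rst (F \<inter> G) (f b) \<noteq> 0" for F b
  proof -
    let ?F = "F \<inter> G"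
    have FG: "?F \<in> \<Phi>" using inter F G \<Psi> by auto
    have gen: "generates ?F q1" "generates ?F q2"
      using generates_subset[OF q1[OF F]] generates_subset[OF q2] by auto
    obtain c k s where c: "c \<noteq> 0" and eq: "\<And>b. b \<in> H \<Longrightarrow> rst ?F (f b) \<noteq> 0
      \<Longrightarrow> pvar j ^ k * rst ?F (E q1 b) = const c * pvar j ^ s * rst ?F (E q2 b)"
      using generates_ratio[OF FG gen] by metis
    obtain a where a: "a \<in> H" "rst {j} (f a) \<noteq> 0" using cover_nonzero[OF vertex(2)] .
    have jF: "{j} \<inter> ?F = {j}" "j \<in> ?F" using vertex(1)[OF FG] by auto
    have "rst {j} (rst ?F (f a)) \<noteq> 0" using a jF by simp
    then have "rst ?F (f a) \<noteq> 0" by fastforce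
    then have "rst {j} (pvar j ^ k * rst ?F (E q1 a)) = rst {j} (const c * pvar j ^ s * rst ?F (E q2 a))"
      using eq[OF a(1)] by simp
    then have 1: "pvar j ^ k * rst {j} (E q1 a) = const c * pvar j ^ s * rst {j} (E q2 a)"
      using jF by simp
    have "(const c * pvar j ^ (s + k0)) * rst {j} (E q2 a) = pvar j ^ k0 * (pvar j ^ k * rst {j} (E q1 a))"
      unfolding 1 by (simp add: power_add ac_simps)
    also have "\<dots> = pvar j ^ k * (pvar j ^ k0 * rst {j} (E q1 a))" by (simp only: ac_simps)
    also have "\<dots> = (const c0 * pvar j ^ (s0 + k)) * rst {j} (E q2 a)"
      unfolding ratio[OF a] by (simp add: power_add ac_simps)
    finally have c_eq: "const c * pvar j ^ (s + k0) = const c0 * pvar j ^ (s0 + k)"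
      using generates_neq_0[OF \<open>generates {j} q2\<close> a] by simp
    have "pvar j ^ k * (pvar j ^ k0 * rst ?F (E q1 b)) = pvar j ^ k0 * (pvar j ^ k * rst ?F (E q1 b))"
      by (simp only: ac_simps)
    also have "\<dots> = (const c * pvar j ^ (s + k0)) * rst ?F (E q2 b)"
      unfolding eq[OF b] by (simp add: power_add ac_simps)
    also have "\<dots> = pvar j ^ k * (const c0 * pvar j ^ s0 * rst ?F (E q2 b))"
      unfolding c_eq by (simp add: power_add ac_simps)
    finally show ?thesis by simp
  qed
  define Q1 where "Q1 b = pvar j ^ k0 * q1 b" for b
  define Q2 where "Q2 b = const c0 * pvar j ^ s0 * q2 b" for b
  have EQ: "E Q1 a = pvar j ^ k0 * E q1 a" "E Q2 a = const c0 * pvar j ^ s0 * E q2 a" for a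
    unfolding Q1_def Q2_def by (rule E_scale)+
  define D where "D a = E Q1 a - E Q2 a" for a
  \<comment> \<open>The factor \<open>f a\<close> is included because \<open>D a\<close> is known to
    vanish on the intersections only where \<open>f a\<close> does not.\<close>
  define y where "y a = rst G (f a * D a)" for a
  have y0: "rst F (y a) = 0" if "F \<in> \<Psi>" "a \<in> H" for F a
  proof -
    have "rst F (y a) = rst (F \<inter> G) (f a) * rst (F \<inter> G) (D a)" by (simp add: y_def)
    also have "\<dots> = 0"
    proof (cases "rst (F \<inter> G) (f a) = 0")
      case False
      have "j \<in> F \<inter> G" using vertex(1) that \<Psi> G by auto
      then show ?thesis using agree[OF that False] by (simp add: D_def EQ)
    qed simp
    finally show ?thesis .
  qed
  \<comment> \<open>Of the exponent \<open>N + 1\<close>, the part \<open>N\<close> comes from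
    transferring \<open>D\<close> between indices and the last factor from the definition of
    \<open>y\<close>.\<close>
  obtain k c where kc: "\<And>F. F \<in> \<Phi> \<Longrightarrow> pvar j ^ k = (\<Sum>a\<in>H. rst F (c a) * rst F (f a) ^ (N + 1))"
    using cover[of "N + 1"] by blast
  \<comment> \<open>On the faces of \<open>\<Psi>\<close> the correction is zero; on
    \<open>G\<close> it exchanges the section of \<open>Q1\<close> for that of
    \<open>Q2\<close>.\<close>
  define q where "q a = pvar j ^ k * Q1 a - c a * y a" for a
  have Eq: "E q b = pvar j ^ k * E Q1 b - (\<Sum>a\<in>H. c a * y a * R b a)" for b
    unfolding q_def E_diff E_scale by (simp add: E_def)
  have "generates F q" if F: "F \<in> \<Psi>" for F
  proof (rule generates_scale[OF _ q1[OF F], of 1])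
    show "F \<in> \<Phi>" using F \<Psi> by blast
    then show "rst F (E q a) = const 1 * pvar j ^ (k + k0) * rst F (E q1 a)" for a
      using vertex(1) y0[OF F] by (simp add: Eq EQ power_add mult.assoc)
  qed simp
  moreover have "generates G q"
  proof (rule generates_scale[OF G q2 c0])
    fix b assume b: "b \<in> H" "rst G (f b) \<noteq> 0"
    have D_transfer: "rst G (R b a) * rst G (D a) = rst G (D b) * rst G (f a) ^ N"
      if a: "a \<in> H" "rst G (f a) \<noteq> 0" for a
      using E_transfer[OF G b(1) a(1) b(2) a(2), of Q1] E_transfer[OF G b(1) a(1) b(2) a(2), of Q2]
      by (simp add: D_def algebra_simps)
    have "(\<Sum>a\<in>H. rst G (c a) * rst G (y a) * rst G (R b a))
        = (\<Sum>a\<in>H. rst G (c a) * rst G (f a) ^ (N + 1) * rst G (D b))"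
    proof (rule sum.cong)
      fix a assume a: "a \<in> H"
      show "rst G (c a) * rst G (y a) * rst G (R b a) = rst G (c a) * rst G (f a) ^ (N + 1) * rst G (D b)"
      proof (cases "rst G (f a) = 0")
        case False
        have "rst G (c a) * rst G (y a) * rst G (R b a) = rst G (c a) * rst G (f a) * (rst G (R b a) * rst G (D a))"
          by (simp add: y_def ac_simps)
        then show ?thesis unfolding D_transfer[OF a False] by (simp add: ac_simps)
      qed (simp add: y_def)
    qed simp
    also have "\<dots> = pvar j ^ k * rst G (D b)" by (simp add: kc[OF G] sum_distrib_right)
    finally have "rst G (E q b) = pvar j ^ k * rst G (E Q1 b) - pvar j ^ k * rst G (D b)"
      using vertex(1)[OF G] by (simp add: Eq)
    also have "\<dots> = pvar j ^ k * rst G (E Q2 b)" by (simp add: D_def algebra_simps)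
    also have "\<dots> = const c0 * pvar j ^ (k + s0) * rst G (E q2 b)"
      using vertex(1)[OF G] by (simp add: EQ power_add ac_simps)
    finally show "rst G (E q b) = const c0 * pvar j ^ (k + s0) * rst G (E q2 b)" .
  qed
  ultimately show ?thesis by blast
qed

lemma exists_generates: "\<exists>q. \<forall>F\<in>\<Phi>. generates F q"
proof -
  have "\<exists>q. \<forall>F\<in>\<Psi>. generates F q" if "\<Psi> \<subseteq> \<Phi>" "finite \<Psi>" for \<Psi>
    using that(2,1)
  proof (induction rule: finite_induct)
    case (insert G \<Psi>)
    then obtain q1 where q1: "\<forall>F\<in>\<Psi>. generates F q1" by auto
    obtain q2 where "generates G q2" using exists_generates_simplex insert.prems by blast
    then show ?case
      using exists_generates_insert[of \<Psi> G q1 q2] q1 insert.prems by (cases "\<Psi> = {}") auto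
  qed simp
  then show ?thesis using finite_faces by blast
qed

text \<open>Cofactors found on single faces need not be restrictions of one polynomial. They are
  combined one face at a time into a \<open>t\<close> that works for all faces, as is required for a
  unit of the reduced quotient.\<close>

theorem exists_generator:
  "\<exists>q. \<forall>a\<in>H. \<exists>M t. \<forall>F\<in>\<Phi>. rst F (E q a * t) = rst F (f a) ^ M"
proof -
  obtain q where q: "\<And>F. F \<in> \<Phi> \<Longrightarrow> generates F q" using exists_generates by blast
  have "\<exists>M t. \<forall>F\<in>\<Psi>. rst F (E q a * t) = rst F (f a) ^ M" if a: "a \<in> H" and "finite \<Psi>" "\<Psi> \<subseteq> \<Phi>" for \<Psi> a
    using that(2,3)
  proof (induction rule: finite_induct)
    case (insert G \<Psi>)
    then obtain M t where t: "\<And>F. F \<in> \<Psi> \<Longrightarrow> rst F (E q a * t) = rst F (f a) ^ M" by auto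
    obtain M' where "rst G (E q a) dvd rst G (f a) ^ M'"
      using q[of G] insert.prems a by (auto simp: generates_def)
    then obtain t' where "rst G (f a) ^ M' = rst G (E q a) * t'" by (auto elim: dvdE)
    then have "rst G (rst G (f a) ^ M') = rst G (rst G (E q a) * t')" by simp
    then have t': "rst G (E q a) * rst G t' = rst G (f a) ^ M'" by simp
    \<comment> \<open>Chosen such that \<open>f a ^ (M + M') - E q a * ?T\<close> is the product of
      the two defects \<open>f a ^ M - E q a * t\<close> and \<open>f a ^ M' - E q a * t'\<close>.
      It vanishes on a face as soon as one defect does.\<close>
    let ?T = "t * f a ^ M' + t' * f a ^ M - E q a * t * t'"
    have *: "rst F (E q a * ?T) - rst F (f a) ^ (M + M')
        = - ((rst F (f a) ^ M - rst F (E q a) * rst F t) * (rst F (f a) ^ M' - rst F (E q a) * rst F t'))" for F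
      by (simp add: algebra_simps power_add)
    have "rst F (E q a * ?T) = rst F (f a) ^ (M + M')" if "F \<in> insert G \<Psi>" for F
      using that *[of F] t[of F] t' by (cases "F = G") (auto simp del: rst_simps(5) simp: rst_simps(5)[symmetric])
    then show ?case by blast
  qed auto
  then show ?thesis using finite_faces by blast
qed

end


section \<open>Generators of sheaves with an action\<close>

context sheaf
begin

text \<open>The gluing axiom speaks of sets of open sets. Two indices may have the same open set;
  agreement on the overlap then says that their sections are equal, so the choice of an index is
  harmless.\<close>

lemma glue_indexed:
  assumes D: "\<And>i. i \<in> J \<Longrightarrow> openin T (D i)" and s: "\<And>i. i \<in> J \<Longrightarrow> s i \<in> carrier (sec F (D i))"
    and agree: "\<And>i k. i \<in> J \<Longrightarrow> k \<in> J \<Longrightarrow> res F (D i) (D i \<inter> D k) (s i) = res F (D k) (D i \<inter> D k) (s k)"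
  shows "\<exists>!t. t \<in> carrier (sec F (\<Union>(D ` J))) \<and> (\<forall>i\<in>J. res F (\<Union>(D ` J)) (D i) t = s i)"
proof -
  define \<sigma> where "\<sigma> V = s (SOME i. i \<in> J \<and> D i = V)" for V
  have ind: "(SOME k. k \<in> J \<and> D k = D i) \<in> J \<and> D (SOME k. k \<in> J \<and> D k = D i) = D i" if "i \<in> J" for i
    using that by (intro someI_ex[of "\<lambda>k. k \<in> J \<and> D k = D i"]) blast
  have \<sigma>: "\<sigma> (D i) = s i" if "i \<in> J" for i
  proof -
    let ?k = "SOME k. k \<in> J \<and> D k = D i"
    have k: "?k \<in> J" "D ?k = D i" using ind[OF that] by auto
    have "res F (D ?k) (D i) (s ?k) = res F (D i) (D i) (s i)"
      using agree[OF k(1) that] k(2) by simp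
    moreover have "s ?k \<in> carrier (sec F (D i))" using s[OF k(1)] k(2) by simp
    ultimately show ?thesis
      using res_id[OF D[OF that]] s[OF that] k(2) by (simp add: \<sigma>_def)
  qed
  have "\<exists>!t. t \<in> carrier (sec F (\<Union>(D ` J))) \<and> (\<forall>V\<in>D ` J. res F (\<Union>(D ` J)) V t = \<sigma> V)"
    by (rule gluing) (use D s agree \<sigma> in auto)
  then show ?thesis using \<sigma> by simp
qed

text \<open>Both sections glue the same local data, and gluing is unique.\<close>

lemma eq_local:
  assumes D: "\<And>i. i \<in> J \<Longrightarrow> openin T (D i)" and U: "U = \<Union>(D ` J)"
    and s: "s \<in> carrier (sec F U)" "t \<in> carrier (sec F U)"
    and eq: "\<And>i. i \<in> J \<Longrightarrow> res F U (D i) s = res F U (D i) t"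
  shows "s = t"
proof -
  have oU: "openin T U" using D U by blast
  have sub: "D i \<subseteq> U" if "i \<in> J" for i using that U by blast
  have "\<exists>!t. t \<in> carrier (sec F (\<Union>(D ` J))) \<and> (\<forall>i\<in>J. res F (\<Union>(D ` J)) (D i) t = res F U (D i) s)"
  proof (rule glue_indexed)
    show "res F U (D i) s \<in> carrier (sec F (D i))" if "i \<in> J" for i
      using res_closed[OF oU D[OF that] sub[OF that] s(1)] .
    show "res F (D i) (D i \<inter> D k) (res F U (D i) s) = res F (D k) (D i \<inter> D k) (res F U (D k) s)"
      if "i \<in> J" "k \<in> J" for i k
      using res_res[OF oU D[OF that(1)] _ _ sub[OF that(1)] s(1)] res_res[OF oU D[OF that(2)] _ _ sub[OF that(2)] s(1)]
        D that by (simp add: openin_Int)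
  qed (use D in auto)
  then have "\<exists>!r. r \<in> carrier (sec F U) \<and> (\<forall>i\<in>J. res F U (D i) r = res F U (D i) s)"
    by (simp only: U[symmetric])
  then show ?thesis using s eq by metis
qed

end

text \<open>Covers both sheaves of modules and sheaves of binoid sets; the additive structure plays no role
  in the classification of the invertible ones.\<close>

locale act_sheaf = F: sheaf T F + O: sheaf T \<O>
  for T :: "'p topology" and \<O> :: "('p, ('a, 'y) monoid_scheme, 'a) sheaf_data"
    and F :: "('p, ('s, 'z) partial_object_scheme, 's) sheaf_data" +
  fixes actn :: "'p set \<Rightarrow> 'a \<Rightarrow> 's \<Rightarrow> 's"
  assumes monoid: "openin T U \<Longrightarrow> comm_monoid (sec \<O> U)"
    and act_closed: "\<lbrakk>openin T U; a \<in> carrier (sec \<O> U); s \<in> carrier (sec F U)\<rbrakk> \<Longrightarrow> actn U a s \<in> carrier (sec F U)"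
    and act_one: "\<lbrakk>openin T U; s \<in> carrier (sec F U)\<rbrakk> \<Longrightarrow> actn U \<one>\<^bsub>sec \<O> U\<^esub> s = s"
    and act_mult: "\<lbrakk>openin T U; a \<in> carrier (sec \<O> U); b \<in> carrier (sec \<O> U); s \<in> carrier (sec F U)\<rbrakk>
      \<Longrightarrow> actn U (a \<otimes>\<^bsub>sec \<O> U\<^esub> b) s = actn U a (actn U b s)"
    and res_one: "\<lbrakk>openin T U; openin T V; V \<subseteq> U\<rbrakk> \<Longrightarrow> res \<O> U V \<one>\<^bsub>sec \<O> U\<^esub> = \<one>\<^bsub>sec \<O> V\<^esub>"
    and res_mult: "\<lbrakk>openin T U; openin T V; V \<subseteq> U; a \<in> carrier (sec \<O> U); b \<in> carrier (sec \<O> U)\<rbrakk>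
      \<Longrightarrow> res \<O> U V (a \<otimes>\<^bsub>sec \<O> U\<^esub> b) = res \<O> U V a \<otimes>\<^bsub>sec \<O> V\<^esub> res \<O> U V b"
    and res_act: "\<lbrakk>openin T U; openin T V; V \<subseteq> U; a \<in> carrier (sec \<O> U); s \<in> carrier (sec F U)\<rbrakk>
      \<Longrightarrow> res F U V (actn U a s) = actn V (res \<O> U V a) (res F U V s)"
begin

text \<open>\<open>e\<close> is a basis of the restriction of the sheaf to \<open>U\<close>.
  Bijectivity is demanded on all smaller open sets, which makes the map given by \<open>e\<close> an
  isomorphism of sheaves.\<close>

definition gen :: "'p set \<Rightarrow> 's \<Rightarrow> bool" where
  "gen U e \<longleftrightarrow> openin T U \<and> e \<in> carrier (sec F U) \<and>
     (\<forall>W. openin T W \<and> W \<subseteq> U \<longrightarrow>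
        bij_betw (\<lambda>a. actn W a (res F U W e)) (carrier (sec \<O> W)) (carrier (sec F W)))"

lemma genD:
  assumes "gen U e"
  shows "openin T U" "e \<in> carrier (sec F U)"
    "openin T W \<Longrightarrow> W \<subseteq> U \<Longrightarrow> bij_betw (\<lambda>a. actn W a (res F U W e)) (carrier (sec \<O> W)) (carrier (sec F W))"
  using assms by (auto simp: gen_def)

lemma gen_res:
  assumes "gen U e" "openin T V" "V \<subseteq> U"
  shows "gen V (res F U V e)"
  unfolding gen_def
proof (intro conjI allI impI)
  fix W assume W: "openin T W \<and> W \<subseteq> V"
  then have "res F V W (res F U V e) = res F U W e" using F.res_res genD(1,2)[OF assms(1)] assms(2,3) by auto
  then show "bij_betw (\<lambda>a. actn W a (res F V W (res F U V e))) (carrier (sec \<O> W)) (carrier (sec F W))"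
    using genD(3)[OF assms(1), of W] W assms(3) by (simp add: subset_trans[of W V U])
qed (use assms genD F.res_closed in auto)

lemma gen_inj:
  assumes "gen U e" "a \<in> carrier (sec \<O> U)" "b \<in> carrier (sec \<O> U)" "actn U a e = actn U b e"
  shows "a = b"
  using genD(3)[OF assms(1), of U] genD(1,2)[OF assms(1)] F.res_id assms(2-)
  by (auto simp: bij_betw_def inj_on_def)

lemma gen_surj:
  assumes "gen U e" "s \<in> carrier (sec F U)"
  obtains a where "a \<in> carrier (sec \<O> U)" "s = actn U a e"
proof -
  have "bij_betw (\<lambda>a. actn U a (res F U U e)) (carrier (sec \<O> U)) (carrier (sec F U))"
    using genD(1,3)[OF assms(1)] by blast
  moreover have "res F U U e = e" using F.res_id genD[OF assms(1)] by blast
  ultimately have "s \<in> (\<lambda>a. actn U a e) ` carrier (sec \<O> U)" using assms(2) by (simp add: bij_betw_def)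
  then show thesis using that by blast
qed

text \<open>Coefficients with respect to \<open>e\<close> are unique locally, hence globally by
  separatedness of the structure sheaf. Local uniqueness also makes local coefficients agree on
  overlaps, so that they glue.\<close>

lemma gen_local:
  assumes D: "\<And>i. i \<in> J \<Longrightarrow> openin T (D i)" and U: "U = \<Union>(D ` J)" and e: "e \<in> carrier (sec F U)"
    and gen: "\<And>i. i \<in> J \<Longrightarrow> gen (D i) (res F U (D i) e)"
  shows "gen U e"
  unfolding gen_def
proof (intro conjI allI impI e)
  show oU: "openin T U" using D U by blast
  fix W assume "openin T W \<and> W \<subseteq> U"
  then have W: "openin T W" "W \<subseteq> U" by auto
  have WD: "openin T (W \<inter> D i)" "W \<inter> D i \<subseteq> D i" "W \<inter> D i \<subseteq> W" if "i \<in> J" for i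
    using that D W by (auto simp: openin_Int)
  have WU: "W = \<Union>((\<lambda>i. W \<inter> D i) ` J)" using W U by blast
  have gV: "gen V (res F U V e)" if "openin T V" "V \<subseteq> D i" "i \<in> J" for V i
  proof -
    have "D i \<subseteq> U" using U that(3) by blast
    then show ?thesis
      using gen_res[OF gen[OF that(3)] that(1,2)] F.res_res[OF oU D[OF that(3)] that(1,2) _ e] by simp
  qed
  have eW: "res F U W e \<in> carrier (sec F W)" using F.res_closed[OF oU W e] .
  have res_actW: "res F W V (actn W a (res F U W e)) = actn V (res \<O> W V a) (res F U V e)"
    if "openin T V" "V \<subseteq> W" "a \<in> carrier (sec \<O> W)" for V a
    using res_act[OF W(1) that(1,2,3) eW] F.res_res[OF oU W(1) that(1,2) W(2) e] by simp
  show "bij_betw (\<lambda>a. actn W a (res F U W e)) (carrier (sec \<O> W)) (carrier (sec F W))"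
    unfolding bij_betw_def
  proof (intro conjI inj_onI)
    fix a b assume a: "a \<in> carrier (sec \<O> W)" and b: "b \<in> carrier (sec \<O> W)"
      and eq: "actn W a (res F U W e) = actn W b (res F U W e)"
    show "a = b"
    proof (rule O.eq_local[OF _ WU a b])
      fix i assume i: "i \<in> J"
      have "actn (W \<inter> D i) (res \<O> W (W \<inter> D i) a) (res F U (W \<inter> D i) e)
          = actn (W \<inter> D i) (res \<O> W (W \<inter> D i) b) (res F U (W \<inter> D i) e)"
        using res_actW[OF WD(1,3)[OF i]] a b eq by metis
      then show "res \<O> W (W \<inter> D i) a = res \<O> W (W \<inter> D i) b"
        using gen_inj[OF gV[OF WD(1,2)[OF i] i]] O.res_closed[OF W(1) WD(1,3)[OF i]] a b by blast
    qed (use WD in auto)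
  next
    show "(\<lambda>a. actn W a (res F U W e)) ` carrier (sec \<O> W) = carrier (sec F W)"
    proof (intro equalityI subsetI)
      fix t assume t: "t \<in> carrier (sec F W)"
      have "\<exists>a. a \<in> carrier (sec \<O> (W \<inter> D i)) \<and> res F W (W \<inter> D i) t = actn (W \<inter> D i) a (res F U (W \<inter> D i) e)"
        if i: "i \<in> J" for i
        using gen_surj[OF gV[OF WD(1,2)[OF i] i] F.res_closed[OF W(1) WD(1,3)[OF i] t]] by metis
      then obtain a where a: "\<And>i. i \<in> J \<Longrightarrow> a i \<in> carrier (sec \<O> (W \<inter> D i))"
        and at: "\<And>i. i \<in> J \<Longrightarrow> res F W (W \<inter> D i) t = actn (W \<inter> D i) (a i) (res F U (W \<inter> D i) e)"
        by metis
      have res_at: "actn V (res \<O> (W \<inter> D i) V (a i)) (res F U V e) = res F W V t"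
        if i: "i \<in> J" and V: "openin T V" "V \<subseteq> W \<inter> D i" for i V
      proof -
        have "res F (W \<inter> D i) V (actn (W \<inter> D i) (a i) (res F U (W \<inter> D i) e))
            = actn V (res \<O> (W \<inter> D i) V (a i)) (res F (W \<inter> D i) V (res F U (W \<inter> D i) e))"
          using res_act[OF WD(1)[OF i] V a[OF i]] F.res_closed[OF oU WD(1)[OF i] _ e] W(2) by auto
        moreover have "res F (W \<inter> D i) V (res F U (W \<inter> D i) e) = res F U V e"
          using F.res_res[OF oU WD(1)[OF i] V _ e] W(2) by auto
        moreover have "res F (W \<inter> D i) V (res F W (W \<inter> D i) t) = res F W V t"
          using F.res_res[OF W(1) WD(1)[OF i] V WD(3)[OF i] t] .
        ultimately show ?thesis using at[OF i] by simp
      qed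
      have "\<exists>!b. b \<in> carrier (sec \<O> (\<Union>((\<lambda>i. W \<inter> D i) ` J))) \<and> (\<forall>i\<in>J. res \<O> (\<Union>((\<lambda>i. W \<inter> D i) ` J)) (W \<inter> D i) b = a i)"
      proof (rule O.glue_indexed)
        fix i k assume i: "i \<in> J" and k: "k \<in> J"
        let ?V = "(W \<inter> D i) \<inter> (W \<inter> D k)"
        have V: "openin T ?V" using WD(1) i k by (auto simp: openin_Int)
        show "res \<O> (W \<inter> D i) ?V (a i) = res \<O> (W \<inter> D k) ?V (a k)"
        proof (rule gen_inj[OF gV[OF V _ i]])
          have "?V \<subseteq> W \<inter> D i" "?V \<subseteq> W \<inter> D k" by blast+
          then show "actn ?V (res \<O> (W \<inter> D i) ?V (a i)) (res F U ?V e) = actn ?V (res \<O> (W \<inter> D k) ?V (a k)) (res F U ?V e)"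
            using res_at[OF i V] res_at[OF k V] by simp
        qed (use O.res_closed[OF WD(1)[OF i] V _ a[OF i]] O.res_closed[OF WD(1)[OF k] V _ a[OF k]] in auto)
      qed (use WD a in auto)
      then have "\<exists>!b. b \<in> carrier (sec \<O> W) \<and> (\<forall>i\<in>J. res \<O> W (W \<inter> D i) b = a i)"
        by (simp only: WU[symmetric])
      then obtain b where b: "b \<in> carrier (sec \<O> W)" "\<And>i. i \<in> J \<Longrightarrow> res \<O> W (W \<inter> D i) b = a i"
        by blast
      have "t = actn W b (res F U W e)"
      proof (rule F.eq_local[OF _ WU t])
        show "actn W b (res F U W e) \<in> carrier (sec F W)" using act_closed[OF W(1) b(1) eW] .
        show "res F W (W \<inter> D i) t = res F W (W \<inter> D i) (actn W b (res F U W e))" if i: "i \<in> J" for i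
          using res_actW[OF WD(1,3)[OF i] b(1)] b(2)[OF i] at[OF i] by simp
      qed (use WD in auto)
      then show "t \<in> (\<lambda>a. actn W a (res F U W e)) ` carrier (sec \<O> W)" using b by blast
    qed (use act_closed[OF W(1) _ eW] in auto)
  qed
qed

lemma gen_glue:
  assumes gen: "\<And>i. i \<in> J \<Longrightarrow> gen (D i) (e i)"
    and agree: "\<And>i k. i \<in> J \<Longrightarrow> k \<in> J \<Longrightarrow> res F (D i) (D i \<inter> D k) (e i) = res F (D k) (D i \<inter> D k) (e k)"
  shows "\<exists>t. gen (\<Union>(D ` J)) t"
proof -
  have "\<exists>!t. t \<in> carrier (sec F (\<Union>(D ` J))) \<and> (\<forall>i\<in>J. res F (\<Union>(D ` J)) (D i) t = e i)"
    by (rule F.glue_indexed) (use genD[OF gen] agree in auto)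
  then obtain t where "t \<in> carrier (sec F (\<Union>(D ` J)))" "\<And>i. i \<in> J \<Longrightarrow> res F (\<Union>(D ` J)) (D i) t = e i"
    by auto
  then show ?thesis using gen_local[of J D "\<Union>(D ` J)" t] gen genD(1)[OF gen] by auto
qed

lemma gen_unit:
  assumes e: "gen U e" and a: "a \<in> carrier (sec \<O> U)" and b: "b \<in> carrier (sec \<O> U)"
    and ab: "a \<otimes>\<^bsub>sec \<O> U\<^esub> b = \<one>\<^bsub>sec \<O> U\<^esub>"
  shows "gen U (actn U a e)"
  unfolding gen_def
proof (intro conjI allI impI)
  show oU: "openin T U" using genD(1)[OF e] .
  have eU: "e \<in> carrier (sec F U)" using genD(2)[OF e] .
  show "actn U a e \<in> carrier (sec F U)" using act_closed[OF oU a eU] .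
  fix W assume "openin T W \<and> W \<subseteq> U"
  then have W: "openin T W" "W \<subseteq> U" by auto
  interpret M: comm_monoid "sec \<O> W" using monoid[OF W(1)] .
  let ?a = "res \<O> U W a" and ?b = "res \<O> U W b" and ?e = "res F U W e"
  have cl: "?a \<in> carrier (sec \<O> W)" "?b \<in> carrier (sec \<O> W)" "?e \<in> carrier (sec F W)"
    using O.res_closed[OF oU W] F.res_closed[OF oU W] a b eU by auto
  have ab': "?a \<otimes>\<^bsub>sec \<O> W\<^esub> ?b = \<one>\<^bsub>sec \<O> W\<^esub>"
    using res_mult[OF oU W a b] res_one[OF oU W] ab by simp
  have bij: "bij_betw (\<lambda>c. c \<otimes>\<^bsub>sec \<O> W\<^esub> ?a) (carrier (sec \<O> W)) (carrier (sec \<O> W))"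
  proof (rule bij_betw_byWitness[of _ "\<lambda>c. c \<otimes>\<^bsub>sec \<O> W\<^esub> ?b"])
    show "\<forall>c\<in>carrier (sec \<O> W). c \<otimes>\<^bsub>sec \<O> W\<^esub> ?a \<otimes>\<^bsub>sec \<O> W\<^esub> ?b = c"
      using cl ab' by (simp add: M.m_assoc)
    show "\<forall>c\<in>carrier (sec \<O> W). c \<otimes>\<^bsub>sec \<O> W\<^esub> ?b \<otimes>\<^bsub>sec \<O> W\<^esub> ?a = c"
      using cl ab' by (simp add: M.m_assoc M.m_comm[of ?b ?a])
  qed (use cl in auto)
  have "bij_betw ((\<lambda>c. actn W c ?e) \<circ> (\<lambda>c. c \<otimes>\<^bsub>sec \<O> W\<^esub> ?a)) (carrier (sec \<O> W)) (carrier (sec F W))"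
    using bij genD(3)[OF e W] by (rule bij_betw_trans)
  then show "bij_betw (\<lambda>c. actn W c (res F U W (actn U a e))) (carrier (sec \<O> W)) (carrier (sec F W))"
    by (rule bij_betw_cong[THEN iffD1, rotated]) (simp add: res_act[OF oU W a eU] act_mult[OF W(1) _ cl(1,3)])
qed

lemma gen_ratio:
  assumes e: "gen U e" and e': "gen U e'"
  obtains a b where "a \<in> carrier (sec \<O> U)" "b \<in> carrier (sec \<O> U)" "e' = actn U a e" "e = actn U b e'"
    "a \<otimes>\<^bsub>sec \<O> U\<^esub> b = \<one>\<^bsub>sec \<O> U\<^esub>"
proof -
  have U: "openin T U" "e \<in> carrier (sec F U)" "e' \<in> carrier (sec F U)" using genD e e' by auto
  interpret M: comm_monoid "sec \<O> U" using monoid[OF U(1)] .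
  obtain a where a: "a \<in> carrier (sec \<O> U)" "e' = actn U a e" using gen_surj[OF e U(3)] .
  obtain b where b: "b \<in> carrier (sec \<O> U)" "e = actn U b e'" using gen_surj[OF e' U(2)] .
  have "actn U (a \<otimes>\<^bsub>sec \<O> U\<^esub> b) e' = actn U a (actn U b e')"
    using act_mult[OF U(1) a(1) b(1) U(3)] .
  also have "\<dots> = actn U \<one>\<^bsub>sec \<O> U\<^esub> e'"
    by (simp only: a(2)[symmetric] b(2)[symmetric] act_one[OF U(1,3)])
  finally have "a \<otimes>\<^bsub>sec \<O> U\<^esub> b = \<one>\<^bsub>sec \<O> U\<^esub>" using gen_inj[OF e'] a b by blast
  with a b that show thesis by blast
qed

text \<open>The generator is the section that \<open>\<phi> U\<close> maps to the unit
  section.\<close>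

lemma gen_of_iso:
  assumes U: "openin T U"
    and bij: "\<And>W. openin T W \<Longrightarrow> W \<subseteq> U \<Longrightarrow> bij_betw (\<phi> W) (carrier (sec F W)) (carrier (sec \<O> W))"
    and act: "\<And>W a s. \<lbrakk>openin T W; W \<subseteq> U; a \<in> carrier (sec \<O> W); s \<in> carrier (sec F W)\<rbrakk>
      \<Longrightarrow> \<phi> W (actn W a s) = a \<otimes>\<^bsub>sec \<O> W\<^esub> \<phi> W s"
    and res: "\<And>W s. \<lbrakk>openin T W; W \<subseteq> U; s \<in> carrier (sec F U)\<rbrakk> \<Longrightarrow> \<phi> W (res F U W s) = res \<O> U W (\<phi> U s)"
  shows "\<exists>e. gen U e"
proof -
  interpret MU: comm_monoid "sec \<O> U" using monoid[OF U] .
  obtain e where e: "e \<in> carrier (sec F U)" "\<phi> U e = \<one>\<^bsub>sec \<O> U\<^esub>"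
    using bij[OF U] MU.one_closed by (metis bij_betw_def image_iff order_refl)
  have "bij_betw (\<lambda>a. actn W a (res F U W e)) (carrier (sec \<O> W)) (carrier (sec F W))"
    if W: "openin T W" "W \<subseteq> U" for W
  proof -
    interpret M: comm_monoid "sec \<O> W" using monoid[OF W(1)] .
    have eW: "res F U W e \<in> carrier (sec F W)" "\<phi> W (res F U W e) = \<one>\<^bsub>sec \<O> W\<^esub>"
      using F.res_closed[OF U W e(1)] res[OF W e(1)] res_one[OF U W] e(2) by auto
    have inv: "\<phi> W (actn W a (res F U W e)) = a" if "a \<in> carrier (sec \<O> W)" for a
      using act[OF W that eW(1)] eW(2) that by simp
    have cl: "actn W a (res F U W e) \<in> carrier (sec F W)" if "a \<in> carrier (sec \<O> W)" for a
      using act_closed[OF W(1) that eW(1)] .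
    have \<phi>: "\<phi> W s \<in> carrier (sec \<O> W)" if "s \<in> carrier (sec F W)" for s
      using bij[OF W] that by (auto simp: bij_betw_def)
    show ?thesis
    proof (rule bij_betw_byWitness[of _ "\<phi> W"])
      show "\<forall>s\<in>carrier (sec F W). actn W (\<phi> W s) (res F U W e) = s"
        using inv[OF \<phi>] cl[OF \<phi>] bij[OF W] by (auto simp: bij_betw_def inj_on_def)
    qed (use inv cl \<phi> in auto)
  qed
  then show ?thesis using U e(1) by (auto simp: gen_def)
qed

lemma gen_of_iso':
  assumes bij: "\<And>W. openin T W \<Longrightarrow> bij_betw (\<psi> W) (carrier (sec \<O> W)) (carrier (sec F W))"
    and act: "\<And>W a b. \<lbrakk>openin T W; a \<in> carrier (sec \<O> W); b \<in> carrier (sec \<O> W)\<rbrakk>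
      \<Longrightarrow> \<psi> W (a \<otimes>\<^bsub>sec \<O> W\<^esub> b) = actn W a (\<psi> W b)"
    and res: "\<And>W a. \<lbrakk>openin T W; a \<in> carrier (sec \<O> (topspace T))\<rbrakk>
      \<Longrightarrow> \<psi> W (res \<O> (topspace T) W a) = res F (topspace T) W (\<psi> (topspace T) a)"
  shows "\<exists>e. gen (topspace T) e"
proof -
  let ?X = "topspace T"
  interpret MX: comm_monoid "sec \<O> ?X" using monoid[OF openin_topspace] .
  define e where "e = \<psi> ?X \<one>\<^bsub>sec \<O> ?X\<^esub>"
  have e: "e \<in> carrier (sec F ?X)" using bij[OF openin_topspace] by (auto simp: e_def bij_betw_def)
  have "bij_betw (\<lambda>a. actn W a (res F ?X W e)) (carrier (sec \<O> W)) (carrier (sec F W))" if W: "openin T W" for W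
  proof -
    interpret M: comm_monoid "sec \<O> W" using monoid[OF W] .
    have "res F ?X W e = \<psi> W \<one>\<^bsub>sec \<O> W\<^esub>"
      using res[OF W MX.one_closed] res_one[OF openin_topspace W openin_subset[OF W]] by (simp add: e_def)
    then have "actn W a (res F ?X W e) = \<psi> W a" if "a \<in> carrier (sec \<O> W)" for a
      using act[OF W that M.one_closed] that by simp
    then show ?thesis using bij[OF W] by (simp cong: bij_betw_cong)
  qed
  then show ?thesis using e by (auto simp: gen_def)
qed

text \<open>Both sides are the coefficient of \<open>e''\<close> with respect to \<open>e\<close>
  over \<open>W\<close>, and this coefficient is unique.\<close>

lemma transition_cocycle:
  assumes e: "gen U e" "gen U' e'" "gen U'' e''"
    and a: "a \<in> carrier (sec \<O> (U \<inter> U'))" "res F U' (U \<inter> U') e' = actn (U \<inter> U') a (res F U (U \<inter> U') e)"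
    and b: "b \<in> carrier (sec \<O> (U' \<inter> U''))" "res F U'' (U' \<inter> U'') e'' = actn (U' \<inter> U'') b (res F U' (U' \<inter> U'') e')"
    and c: "c \<in> carrier (sec \<O> (U \<inter> U''))" "res F U'' (U \<inter> U'') e'' = actn (U \<inter> U'') c (res F U (U \<inter> U'') e)"
    and W: "openin T W" "W \<subseteq> U \<inter> U' \<inter> U''"
  shows "res \<O> (U' \<inter> U'') W b \<otimes>\<^bsub>sec \<O> W\<^esub> res \<O> (U \<inter> U') W a = res \<O> (U \<inter> U'') W c"
proof -
  have op: "openin T U" "openin T U'" "openin T U''" using genD(1) e by auto
  then have op2: "openin T (U \<inter> U')" "openin T (U' \<inter> U'')" "openin T (U \<inter> U'')" by (auto simp: openin_Int)
  have cl: "e \<in> carrier (sec F U)" "e' \<in> carrier (sec F U')" "e'' \<in> carrier (sec F U'')" using genD(2) e by auto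
  have sub: "W \<subseteq> U" "W \<subseteq> U'" "W \<subseteq> U''" "W \<subseteq> U \<inter> U'" "W \<subseteq> U' \<inter> U''" "W \<subseteq> U \<inter> U''" using W by auto
  have restrict_eq: "res F Y W y = actn W (res \<O> (A \<inter> Y) W d) (res F A W x)"
    if "openin T A" "openin T Y" "x \<in> carrier (sec F A)" "y \<in> carrier (sec F Y)" "d \<in> carrier (sec \<O> (A \<inter> Y))"
      "res F Y (A \<inter> Y) y = actn (A \<inter> Y) d (res F A (A \<inter> Y) x)" "W \<subseteq> A \<inter> Y" for A Y x y d
  proof -
    have XY: "openin T (A \<inter> Y)" using that(1,2) by (rule openin_Int)
    have "res F Y W y = res F (A \<inter> Y) W (res F Y (A \<inter> Y) y)"
      using F.res_res[OF that(2) XY W(1) that(7) _ that(4)] by simp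
    also have "\<dots> = actn W (res \<O> (A \<inter> Y) W d) (res F (A \<inter> Y) W (res F A (A \<inter> Y) x))"
      unfolding that(6) using F.res_closed[OF that(1) XY _ that(3)] by (intro res_act[OF XY W(1) that(7,5)]) auto
    also have "res F (A \<inter> Y) W (res F A (A \<inter> Y) x) = res F A W x"
      using F.res_res[OF that(1) XY W(1) that(7) _ that(3)] by simp
    finally show ?thesis .
  qed
  let ?a = "res \<O> (U \<inter> U') W a" and ?b = "res \<O> (U' \<inter> U'') W b" and ?c = "res \<O> (U \<inter> U'') W c"
  have abc: "?a \<in> carrier (sec \<O> W)" "?b \<in> carrier (sec \<O> W)" "?c \<in> carrier (sec \<O> W)"
    using O.res_closed op2 W(1) sub a(1) b(1) c(1) by auto
  interpret M: comm_monoid "sec \<O> W" using monoid[OF W(1)] .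
  have eW: "res F U W e \<in> carrier (sec F W)" using F.res_closed[OF op(1) W(1) sub(1) cl(1)] .
  have "actn W (?b \<otimes>\<^bsub>sec \<O> W\<^esub> ?a) (res F U W e) = actn W ?c (res F U W e)"
    using restrict_eq[OF op(1,2) cl(1,2) a sub(4)] restrict_eq[OF op(2,3) cl(2,3) b sub(5)] restrict_eq[OF op(1,3) cl(1,3) c sub(6)]
      act_mult[OF W(1) abc(2,1) eW] by simp
  then show ?thesis using gen_inj[OF gen_res[OF e(1) W(1) sub(1)]] abc by blast
qed

definition transitions :: "'i set \<Rightarrow> ('i \<Rightarrow> 'p set) \<Rightarrow> ('i \<Rightarrow> 's) \<Rightarrow> ('i \<Rightarrow> 'i \<Rightarrow> 'a) \<Rightarrow> bool" where
  "transitions J D e \<rho> \<longleftrightarrow> (\<forall>j\<in>J. \<forall>k\<in>J. \<rho> j k \<in> carrier (sec \<O> (D j \<inter> D k)) \<and>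
     (\<exists>b\<in>carrier (sec \<O> (D j \<inter> D k)). \<rho> j k \<otimes>\<^bsub>sec \<O> (D j \<inter> D k)\<^esub> b = \<one>\<^bsub>sec \<O> (D j \<inter> D k)\<^esub>) \<and>
     res F (D k) (D j \<inter> D k) (e k) = actn (D j \<inter> D k) (\<rho> j k) (res F (D j) (D j \<inter> D k) (e j)))"

lemma transitionsD:
  assumes "transitions J D e \<rho>" "j \<in> J" "k \<in> J"
  shows "\<rho> j k \<in> carrier (sec \<O> (D j \<inter> D k))"
    "\<exists>b\<in>carrier (sec \<O> (D j \<inter> D k)). \<rho> j k \<otimes>\<^bsub>sec \<O> (D j \<inter> D k)\<^esub> b = \<one>\<^bsub>sec \<O> (D j \<inter> D k)\<^esub>"
    "res F (D k) (D j \<inter> D k) (e k) = actn (D j \<inter> D k) (\<rho> j k) (res F (D j) (D j \<inter> D k) (e j))"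
  using assms unfolding transitions_def by auto

lemma exists_transitions:
  assumes e: "\<And>j. j \<in> J \<Longrightarrow> gen (D j) (e j)"
  shows "\<exists>\<rho>. transitions J D e \<rho>"
proof -
  have "\<exists>a\<in>carrier (sec \<O> (D j \<inter> D k)).
      (\<exists>b\<in>carrier (sec \<O> (D j \<inter> D k)). a \<otimes>\<^bsub>sec \<O> (D j \<inter> D k)\<^esub> b = \<one>\<^bsub>sec \<O> (D j \<inter> D k)\<^esub>) \<and>
      res F (D k) (D j \<inter> D k) (e k) = actn (D j \<inter> D k) a (res F (D j) (D j \<inter> D k) (e j))"
    if jk: "j \<in> J" "k \<in> J" for j k
  proof -
    have "openin T (D j \<inter> D k)" using genD(1)[OF e[OF jk(1)]] genD(1)[OF e[OF jk(2)]] by (rule openin_Int)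
    then show ?thesis
      using gen_ratio[OF gen_res[OF e[OF jk(1)], of "D j \<inter> D k"] gen_res[OF e[OF jk(2)], of "D j \<inter> D k"]] by (metis inf_le1 inf_le2)
  qed
  then show ?thesis unfolding transitions_def by metis
qed

lemma transitions_diag:
  assumes e: "gen (D j) (e j)" and \<rho>: "transitions J D e \<rho>" "j \<in> J"
  shows "\<rho> j j = \<one>\<^bsub>sec \<O> (D j)\<^esub>"
proof (rule gen_inj[OF e])
  interpret M: comm_monoid "sec \<O> (D j)" using monoid[OF genD(1)[OF e]] .
  show "\<one>\<^bsub>sec \<O> (D j)\<^esub> \<in> carrier (sec \<O> (D j))" by (rule M.one_closed)
  show "\<rho> j j \<in> carrier (sec \<O> (D j))" using transitionsD(1)[OF \<rho> \<rho>(2)] by simp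
  show "actn (D j) (\<rho> j j) (e j) = actn (D j) \<one>\<^bsub>sec \<O> (D j)\<^esub> (e j)"
    using transitionsD(3)[OF \<rho> \<rho>(2)] genD(1,2)[OF e] by (simp add: F.res_id act_one)
qed

lemma transitions_cocycle:
  assumes e: "\<And>j. j \<in> J \<Longrightarrow> gen (D j) (e j)" and \<rho>: "transitions J D e \<rho>" and ijk: "i \<in> J" "j \<in> J" "k \<in> J"
  defines "W \<equiv> D i \<inter> D j \<inter> D k"
  shows "res \<O> (D j \<inter> D k) W (\<rho> j k) \<otimes>\<^bsub>sec \<O> W\<^esub> res \<O> (D i \<inter> D j) W (\<rho> i j) = res \<O> (D i \<inter> D k) W (\<rho> i k)"
proof -
  have "openin T W" unfolding W_def using genD(1)[OF e] ijk by (intro openin_Int) auto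
  then show ?thesis
    by (intro transition_cocycle[OF e e e] transitionsD[OF \<rho>] ijk) (simp_all add: W_def)
qed

text \<open>If the transition functions are the coboundary of units, rescaling the local generators
  by these units makes them agree on overlaps, and they glue to a global generator.\<close>

lemma gen_glue_units:
  assumes e: "\<And>j. j \<in> J \<Longrightarrow> gen (D j) (e j)"
    and \<rho>: "transitions J D e \<rho>"
    and a: "\<And>j. j \<in> J \<Longrightarrow> a j \<in> carrier (sec \<O> (D j))"
      "\<And>j. j \<in> J \<Longrightarrow> \<exists>b\<in>carrier (sec \<O> (D j)). a j \<otimes>\<^bsub>sec \<O> (D j)\<^esub> b = \<one>\<^bsub>sec \<O> (D j)\<^esub>"
    and agree: "\<And>j k. j \<in> J \<Longrightarrow> k \<in> J \<Longrightarrow>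
      res \<O> (D k) (D j \<inter> D k) (a k) \<otimes>\<^bsub>sec \<O> (D j \<inter> D k)\<^esub> \<rho> j k = res \<O> (D j) (D j \<inter> D k) (a j)"
  shows "\<exists>t. gen (\<Union>(D ` J)) t"
proof (rule gen_glue)
  show "gen (D j) (actn (D j) (a j) (e j))" if "j \<in> J" for j
    using gen_unit[OF e[OF that] a(1)[OF that]] a(2)[OF that] by blast
  fix j k assume j: "j \<in> J" and k: "k \<in> J"
  let ?W = "D j \<inter> D k"
  note oj = genD(1,2)[OF e[OF j]] and ok = genD(1,2)[OF e[OF k]]
  have W: "openin T ?W" using oj(1) ok(1) by (rule openin_Int)
  have sub: "?W \<subseteq> D j" "?W \<subseteq> D k" by auto
  have "actn ?W (res \<O> (D k) ?W (a k)) (res F (D k) ?W (e k)) = actn ?W (res \<O> (D j) ?W (a j)) (res F (D j) ?W (e j))"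
    using act_mult[OF W O.res_closed[OF ok(1) W sub(2) a(1)[OF k]] transitionsD(1)[OF \<rho> j k] F.res_closed[OF oj(1) W sub(1) oj(2)]]
      agree[OF j k] transitionsD(3)[OF \<rho> j k] by simp
  then show "res F (D j) ?W (actn (D j) (a j) (e j)) = res F (D k) ?W (actn (D k) (a k) (e k))"
    using res_act[OF oj(1) W sub(1) a(1)[OF j] oj(2)] res_act[OF ok(1) W sub(2) a(1)[OF k] ok(2)] by simp
qed

end

text \<open>Functions subject to a condition tested near each point form a sheaf, whatever the
  condition. The neighbourhoods in the condition are open for \<open>T\<close>, while the sheaf
  lives on \<open>T'\<close>; so sections over the punctured spectrum keep their description from
  the whole spectrum.\<close>

lemma local_sections_sheaf:
  assumes car: "\<And>U. openin T' U \<Longrightarrow> carrier (sec F U) =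
      {s \<in> extensional U. \<forall>P\<in>U. \<exists>V. openin T V \<and> P \<in> V \<and> V \<subseteq> U \<and> Q V s}"
    and loc: "\<And>V V' s s'. Q V s \<Longrightarrow> V' \<subseteq> V \<Longrightarrow> (\<And>P. P \<in> V' \<Longrightarrow> s' P = s P) \<Longrightarrow> Q V' s'"
    and res: "\<And>U V s. res F U V s = restrict s V"
    and T': "\<And>U. openin T' U \<Longrightarrow> openin T U"
  shows "sheaf T' F"
proof
  fix U V s assume U: "openin T' U" "openin T' V" "V \<subseteq> U" and s: "s \<in> carrier (sec F U)"
  show "res F U V s \<in> carrier (sec F V)"
    unfolding car[OF U(2)] res
  proof (intro CollectI conjI ballI)
    fix P assume P: "P \<in> V"
    then obtain W where W: "openin T W" "P \<in> W" "W \<subseteq> U" "Q W s" using s U car[OF U(1)] by blast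
    have "Q (W \<inter> V) (restrict s V)" by (rule loc[OF W(4)]) auto
    then show "\<exists>W. openin T W \<and> P \<in> W \<and> W \<subseteq> V \<and> Q W (restrict s V)"
      using W P T'[OF U(2)] by (intro exI[of _ "W \<inter> V"]) auto
  qed auto
next
  fix U s assume "openin T' U" "s \<in> carrier (sec F U)"
  then show "res F U U s = s" by (simp add: res car extensional_restrict)
next
  fix \<U> and \<sigma> :: "'a set \<Rightarrow> 'a \<Rightarrow> 'b"
  assume op: "\<And>V. V \<in> \<U> \<Longrightarrow> openin T' V" and \<sigma>: "\<And>V. V \<in> \<U> \<Longrightarrow> \<sigma> V \<in> carrier (sec F V)"
    and ag: "\<And>V W. \<lbrakk>V \<in> \<U>; W \<in> \<U>\<rbrakk> \<Longrightarrow> res F V (V \<inter> W) (\<sigma> V) = res F W (V \<inter> W) (\<sigma> W)"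
  define t where "t = (\<lambda>P\<in>\<Union>\<U>. \<sigma> (SOME V. V \<in> \<U> \<and> P \<in> V) P)"
  have t: "t P = \<sigma> V P" if V: "V \<in> \<U>" "P \<in> V" for V P
  proof -
    let ?W = "SOME V. V \<in> \<U> \<and> P \<in> V"
    have W: "?W \<in> \<U> \<and> P \<in> ?W" using that by (intro someI[of "\<lambda>V. V \<in> \<U> \<and> P \<in> V"]) auto
    then have "restrict (\<sigma> V) (V \<inter> ?W) P = restrict (\<sigma> ?W) (V \<inter> ?W) P" using ag[of V ?W] V by (simp add: res)
    then show ?thesis using V W by (auto simp: t_def)
  qed
  have oU: "openin T' (\<Union>\<U>)" using op by blast
  show "\<exists>!t. t \<in> carrier (sec F (\<Union>\<U>)) \<and> (\<forall>V\<in>\<U>. res F (\<Union>\<U>) V t = \<sigma> V)"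
  proof (intro ex1I conjI ballI)
    show "t \<in> carrier (sec F (\<Union>\<U>))"
      unfolding car[OF oU]
    proof (intro CollectI conjI ballI)
      fix P assume "P \<in> \<Union>\<U>"
      then obtain V where V: "V \<in> \<U>" "P \<in> V" by blast
      then obtain W where W: "openin T W" "P \<in> W" "W \<subseteq> V" "Q W (\<sigma> V)" using \<sigma>[OF V(1)] car[OF op[OF V(1)]] by blast
      have "Q W t" by (rule loc[OF W(4)]) (use t V W in auto)
      then show "\<exists>W. openin T W \<and> P \<in> W \<and> W \<subseteq> \<Union>\<U> \<and> Q W t" using W V by blast
    qed (simp add: t_def)
    show "res F (\<Union>\<U>) V t = \<sigma> V" if V: "V \<in> \<U>" for V
    proof (rule extensionalityI[of _ V])
      show "\<sigma> V \<in> extensional V" using \<sigma>[OF V] car[OF op[OF V]] by blast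
    qed (use t V in \<open>auto simp: res\<close>)
    fix t' assume t': "t' \<in> carrier (sec F (\<Union>\<U>)) \<and> (\<forall>V\<in>\<U>. res F (\<Union>\<U>) V t' = \<sigma> V)"
    show "t' = t"
    proof (rule extensionalityI[of _ "\<Union>\<U>"])
      show "t' \<in> extensional (\<Union>\<U>)" using t' car[OF oU] by blast
      fix P assume "P \<in> \<Union>\<U>"
      then obtain V where V: "V \<in> \<U>" "P \<in> V" by blast
      then have "restrict t' V P = \<sigma> V P" using t' by (auto simp: res)
      then show "t' P = t P" using t[OF V] V by simp
    qed (simp add: t_def)
  qed
qed (auto simp: res Int_absorb1 restrict_restrict)

text \<open>The isomorphism sends \<open>a\<close> times one generator to \<open>a\<close> times the
  other. It is stated by coordinates so that modules can derive additivity from it and binoid sets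
  the preservation of base points.\<close>

lemma gen_iso_map:
  assumes F: "act_sheaf T \<O> F aF" and G: "act_sheaf T \<O> G aG"
    and e: "act_sheaf.gen T \<O> F aF (topspace T) e" and d: "act_sheaf.gen T \<O> G aG (topspace T) d"
  obtains \<phi> e' d' where
    "\<And>U. openin T U \<Longrightarrow> bij_betw (\<phi> U) (carrier (sec F U)) (carrier (sec G U))"
    "\<And>U a. \<lbrakk>openin T U; a \<in> carrier (sec \<O> U)\<rbrakk> \<Longrightarrow> \<phi> U (aF U a (e' U)) = aG U a (d' U)"
    "\<And>U s. \<lbrakk>openin T U; s \<in> carrier (sec F U)\<rbrakk> \<Longrightarrow> \<exists>a\<in>carrier (sec \<O> U). s = aF U a (e' U)"
    "\<And>U. openin T U \<Longrightarrow> e' U \<in> carrier (sec F U)" "\<And>U. openin T U \<Longrightarrow> d' U \<in> carrier (sec G U)"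
    "\<And>U a s. \<lbrakk>openin T U; a \<in> carrier (sec \<O> U); s \<in> carrier (sec F U)\<rbrakk> \<Longrightarrow> \<phi> U (aF U a s) = aG U a (\<phi> U s)"
    "\<And>U V s. \<lbrakk>openin T U; openin T V; V \<subseteq> U; s \<in> carrier (sec F U)\<rbrakk> \<Longrightarrow> \<phi> V (res F U V s) = res G U V (\<phi> U s)"
proof -
  interpret F: act_sheaf T \<O> F aF using F .
  interpret G: act_sheaf T \<O> G aG using G .
  let ?X = "topspace T"
  define e' where "e' U = res F ?X U e" for U
  define d' where "d' U = res G ?X U d" for U
  have X: "openin T ?X" by simp
  have sub: "U \<subseteq> ?X" if "openin T U" for U using that by (rule openin_subset)
  have bF: "bij_betw (\<lambda>a. aF U a (e' U)) (carrier (sec \<O> U)) (carrier (sec F U))" if "openin T U" for U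
    using F.genD(3)[OF e that sub[OF that]] by (simp add: e'_def)
  have bG: "bij_betw (\<lambda>a. aG U a (d' U)) (carrier (sec \<O> U)) (carrier (sec G U))" if "openin T U" for U
    using G.genD(3)[OF d that sub[OF that]] by (simp add: d'_def)
  have e'U: "e' U \<in> carrier (sec F U)" if "openin T U" for U
    using F.F.res_closed[OF X that sub[OF that] F.genD(2)[OF e]] by (simp add: e'_def)
  have d'U: "d' U \<in> carrier (sec G U)" if "openin T U" for U
    using G.F.res_closed[OF X that sub[OF that] G.genD(2)[OF d]] by (simp add: d'_def)
  define co where "co U = the_inv_into (carrier (sec \<O> U)) (\<lambda>a. aF U a (e' U))" for U
  have bco: "bij_betw (co U) (carrier (sec F U)) (carrier (sec \<O> U))" if "openin T U" for U
    unfolding co_def by (rule bij_betw_the_inv_into[OF bF[OF that]])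
  have co: "co U (aF U a (e' U)) = a" if "openin T U" "a \<in> carrier (sec \<O> U)" for U a
    unfolding co_def using bF[OF that(1)] that(2) by (auto simp: bij_betw_def intro: the_inv_into_f_f)
  have surj: "\<exists>a\<in>carrier (sec \<O> U). s = aF U a (e' U)" if "openin T U" "s \<in> carrier (sec F U)" for U s
    using bF[OF that(1)] that(2) by (auto simp: bij_betw_def)
  define \<phi> where "\<phi> U s = aG U (co U s) (d' U)" for U s
  show thesis
  proof (rule that[of \<phi> e' d'])
    show "bij_betw (\<phi> U) (carrier (sec F U)) (carrier (sec G U))" if "openin T U" for U
      using bij_betw_trans[OF bco[OF that] bG[OF that]] by (simp add: comp_def \<phi>_def[abs_def])
    show "\<phi> U (aF U a s) = aG U a (\<phi> U s)"
      if U: "openin T U" and a: "a \<in> carrier (sec \<O> U)" and s: "s \<in> carrier (sec F U)" for U a s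
    proof -
      interpret M: comm_monoid "sec \<O> U" using F.monoid[OF U] .
      obtain b where "b \<in> carrier (sec \<O> U)" "s = aF U b (e' U)" using surj[OF U s] by auto
      then show ?thesis
        using co[OF U] e'U[OF U] d'U[OF U] a U by (simp add: \<phi>_def F.act_mult[symmetric] G.act_mult)
    qed
    show "\<phi> V (res F U V s) = res G U V (\<phi> U s)"
      if U: "openin T U" "openin T V" "V \<subseteq> U" and s: "s \<in> carrier (sec F U)" for U V s
    proof -
      obtain a where a: "a \<in> carrier (sec \<O> U)" "s = aF U a (e' U)" using surj[OF U(1) s] by auto
      have r: "res F U V (e' U) = e' V" "res G U V (d' U) = d' V"
        using F.F.res_res[OF X U(1,2,3) sub[OF U(1)] F.genD(2)[OF e]] G.F.res_res[OF X U(1,2,3) sub[OF U(1)] G.genD(2)[OF d]]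
        by (simp_all add: e'_def d'_def)
      have aV: "res \<O> U V a \<in> carrier (sec \<O> V)" using F.O.res_closed[OF U a(1)] .
      show ?thesis
        using F.res_act[OF U a(1) e'U[OF U(1)]] G.res_act[OF U a(1) d'U[OF U(1)]] a co[OF U(1) a(1)] co[OF U(2) aV] r
        by (simp add: \<phi>_def)
    qed
  qed (simp_all add: \<phi>_def co surj e'U d'U)
qed


section \<open>Invertible module sheaves\<close>

lemma class_group_trivialD:
  assumes "carrier (class_group L isom tens e) = {\<one>\<^bsub>class_group L isom tens e\<^esub>}" "F \<in> L" "isom F F"
  shows "isom e F"
proof -
  let ?r = "{(F, G). F \<in> L \<and> G \<in> L \<and> isom F G}"
  have "?r `` {F} \<in> carrier (class_group L isom tens e)"
    using assms(2) by (auto simp: class_group_def quotient_def)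
  then have "?r `` {F} = {N \<in> L. isom e N}" using assms(1) by (simp add: class_group_def)
  then show ?thesis using assms(2,3) by blast
qed

lemma class_group_trivialI:
  assumes "F0 \<in> L" "\<And>F. F \<in> L \<Longrightarrow> isom e F" "\<And>F G. F \<in> L \<Longrightarrow> G \<in> L \<Longrightarrow> isom F G"
  shows "carrier (class_group L isom tens e) = {\<one>\<^bsub>class_group L isom tens e\<^esub>}"
proof -
  let ?r = "{(F, G). F \<in> L \<and> G \<in> L \<and> isom F G}"
  have "?r `` {F} = L" if "F \<in> L" for F using that assms(3) by blast
  then have "L // ?r = {L}" using assms(1) by (auto simp: quotient_def)
  moreover have "{N \<in> L. isom e N} = L" using assms(2) by blast
  ultimately show ?thesis by (simp add: class_group_def)
qed

locale ring_space = sheaf T \<O> for T :: "'p topology" and \<O> :: "('p, 'r) ring_sheaf" +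
  assumes res_one: "\<lbrakk>openin T U; openin T V; V \<subseteq> U\<rbrakk> \<Longrightarrow> res \<O> U V \<one>\<^bsub>sec \<O> U\<^esub> = \<one>\<^bsub>sec \<O> V\<^esub>"
    and res_mult: "\<lbrakk>openin T U; openin T V; V \<subseteq> U; a \<in> carrier (sec \<O> U); b \<in> carrier (sec \<O> U)\<rbrakk>
      \<Longrightarrow> res \<O> U V (a \<otimes>\<^bsub>sec \<O> U\<^esub> b) = res \<O> U V a \<otimes>\<^bsub>sec \<O> V\<^esub> res \<O> U V b"
begin

lemma act_sheaf_module:
  assumes F: "module_sheaf T \<O> F"
  shows "act_sheaf T \<O> F (\<lambda>U. module.smult (sec F U))"
proof -
  interpret F: module_sheaf T \<O> F using F .
  show ?thesis
  proof (intro act_sheaf.intro act_sheaf_axioms.intro F.sheaf_axioms sheaf_axioms)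
    fix U assume "openin T U"
    then interpret module "sec \<O> U" "sec F U" by (rule F.module)
    show "comm_monoid (sec \<O> U)" by (rule R.comm_monoid_axioms)
  qed (auto intro: F.module module.smult_closed module.smult_assoc1 module.smult_one F.res_smult res_one res_mult)
qed

definition free_generator :: "('p, 'r, 'm) module_sheaf \<Rightarrow> 'p set \<Rightarrow> 'm \<Rightarrow> bool" where
  "free_generator F = act_sheaf.gen T \<O> F (\<lambda>U. module.smult (sec F U))"

lemma module_sheaf_iso_of_generators:
  assumes mF: "module_sheaf T \<O> F" and mG: "module_sheaf T \<O> G"
    and e: "free_generator F (topspace T) e" and d: "free_generator G (topspace T) d"
  shows "module_sheaf_iso T \<O> F G"
proof -
  interpret mF: module_sheaf T \<O> F using mF .
  interpret mG: module_sheaf T \<O> G using mG .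
  obtain \<phi> e' d' where bij: "\<And>U. openin T U \<Longrightarrow> bij_betw (\<phi> U) (carrier (sec F U)) (carrier (sec G U))"
    and \<phi>: "\<And>U a. \<lbrakk>openin T U; a \<in> carrier (sec \<O> U)\<rbrakk> \<Longrightarrow> \<phi> U (a \<odot>\<^bsub>sec F U\<^esub> e' U) = a \<odot>\<^bsub>sec G U\<^esub> d' U"
    and surj: "\<And>U s. \<lbrakk>openin T U; s \<in> carrier (sec F U)\<rbrakk> \<Longrightarrow> \<exists>a\<in>carrier (sec \<O> U). s = a \<odot>\<^bsub>sec F U\<^esub> e' U"
    and cl: "\<And>U. openin T U \<Longrightarrow> e' U \<in> carrier (sec F U)" "\<And>U. openin T U \<Longrightarrow> d' U \<in> carrier (sec G U)"
    and act: "\<And>U a s. \<lbrakk>openin T U; a \<in> carrier (sec \<O> U); s \<in> carrier (sec F U)\<rbrakk>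
      \<Longrightarrow> \<phi> U (a \<odot>\<^bsub>sec F U\<^esub> s) = a \<odot>\<^bsub>sec G U\<^esub> \<phi> U s"
    and res: "\<And>U V s. \<lbrakk>openin T U; openin T V; V \<subseteq> U; s \<in> carrier (sec F U)\<rbrakk> \<Longrightarrow> \<phi> V (res F U V s) = res G U V (\<phi> U s)"
    using gen_iso_map[OF act_sheaf_module[OF mF] act_sheaf_module[OF mG] e[unfolded free_generator_def] d[unfolded free_generator_def]]
    by blast
  have "\<phi> \<in> module_sheaf_hom T \<O> F G"
    unfolding module_sheaf_hom_def
  proof (intro CollectI conjI allI impI ballI)
    fix U assume U: "openin T U"
    interpret MF: module "sec \<O> U" "sec F U" using mF.module[OF U] .
    interpret MG: module "sec \<O> U" "sec G U" using mG.module[OF U] .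
    show "\<phi> U \<in> carrier (sec F U) \<rightarrow> carrier (sec G U)" using bij[OF U] by (auto simp: bij_betw_def)
    show "\<phi> U (s \<oplus>\<^bsub>sec F U\<^esub> t) = \<phi> U s \<oplus>\<^bsub>sec G U\<^esub> \<phi> U t"
      if s: "s \<in> carrier (sec F U)" "t \<in> carrier (sec F U)" for s t
    proof -
      obtain a b where "a \<in> carrier (sec \<O> U)" "b \<in> carrier (sec \<O> U)"
        and "s = a \<odot>\<^bsub>sec F U\<^esub> e' U" "t = b \<odot>\<^bsub>sec F U\<^esub> e' U"
        using surj[OF U] s by metis
      then show ?thesis
        using \<phi>[OF U] cl[OF U] by (simp add: MF.smult_l_distr[symmetric] MG.smult_l_distr)
    qed
  qed (use act res in auto)
  then show ?thesis using bij by (auto simp: module_sheaf_iso_def)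
qed

lemma structure_iso_of_generator:
  assumes mF: "module_sheaf T \<O> F" and e: "free_generator F (topspace T) e"
  shows "module_sheaf_iso T \<O> (structure_module \<O>) F"
proof -
  interpret mF: module_sheaf T \<O> F using mF .
  interpret F: act_sheaf T \<O> F "\<lambda>U. module.smult (sec F U)" using act_sheaf_module[OF mF] .
  note e = e[unfolded free_generator_def]
  let ?X = "topspace T"
  let ?e = "\<lambda>U. res F ?X U e"
  have eU: "?e U \<in> carrier (sec F U)" if "openin T U" for U
    using mF.res_closed[OF openin_topspace that openin_subset[OF that] F.genD(2)[OF e]] .
  have "(\<lambda>U a. a \<odot>\<^bsub>sec F U\<^esub> ?e U) \<in> module_sheaf_hom T \<O> (structure_module \<O>) F"
    unfolding module_sheaf_hom_def structure_module_def ring_as_module_def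
  proof (intro CollectI conjI allI impI ballI, goal_cases)
    case (1 U)
    interpret M: module "sec \<O> U" "sec F U" using mF.module[OF 1] .
    show ?case using eU[OF 1] by auto
  next
    case (2 U a b)
    interpret M: module "sec \<O> U" "sec F U" using mF.module[OF 2(1)] .
    show ?case using 2 eU[OF 2(1)] by (simp add: M.smult_l_distr)
  next
    case (3 U a b)
    interpret M: module "sec \<O> U" "sec F U" using mF.module[OF 3(1)] .
    show ?case using 3 eU[OF 3(1)] by (simp add: M.smult_assoc1)
  next
    case (4 U V a)
    then show ?case
      using F.res_act[of U V a "?e U"] eU[of U] mF.res_res[of ?X U V e] F.genD(2)[OF e] by (simp add: openin_subset)
  qed
  moreover have "bij_betw (\<lambda>a. a \<odot>\<^bsub>sec F U\<^esub> ?e U) (carrier (sec \<O> U)) (carrier (sec F U))" if "openin T U" for U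
    using F.genD(3)[OF e that openin_subset[OF that]] .
  ultimately show ?thesis
    unfolding module_sheaf_iso_def by (intro bexI) (simp_all add: structure_module_def ring_as_module_def)
qed

lemma generator_of_structure_iso:
  assumes mF: "module_sheaf T \<O> F" and iso: "module_sheaf_iso T \<O> (structure_module \<O>) F"
  shows "\<exists>e. free_generator F (topspace T) e"
proof -
  interpret F: act_sheaf T \<O> F "\<lambda>U. module.smult (sec F U)" using act_sheaf_module[OF mF] .
  obtain \<psi> where hom: "\<psi> \<in> module_sheaf_hom T \<O> (structure_module \<O>) F"
    and bij: "\<And>U. openin T U \<Longrightarrow> bij_betw (\<psi> U) (carrier (sec (structure_module \<O>) U)) (carrier (sec F U))"
    using iso by (auto simp: module_sheaf_iso_def)
  note [simp] = structure_module_def ring_as_module_def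
  have "\<exists>e. F.gen (topspace T) e"
  proof (rule F.gen_of_iso'[of \<psi>])
    show "bij_betw (\<psi> W) (carrier (sec \<O> W)) (carrier (sec F W))" if "openin T W" for W
      using bij[OF that] by simp
    show "\<psi> W (a \<otimes>\<^bsub>sec \<O> W\<^esub> b) = a \<odot>\<^bsub>sec F W\<^esub> \<psi> W b"
      if "openin T W" "a \<in> carrier (sec \<O> W)" "b \<in> carrier (sec \<O> W)" for W a b
      using hom that by (auto simp: module_sheaf_hom_def)
    show "\<psi> W (res \<O> (topspace T) W a) = res F (topspace T) W (\<psi> (topspace T) a)"
      if "openin T W" "a \<in> carrier (sec \<O> (topspace T))" for W a
      using hom that openin_subset[OF that(1)] by (auto simp: module_sheaf_hom_def)
  qed
  then show ?thesis by (simp add: free_generator_def)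
qed

lemma invertible_local_generator:
  assumes F: "invertible_sheaf T \<O> F" and x: "x \<in> topspace T"
  shows "\<exists>U e. x \<in> U \<and> free_generator F U e"
proof -
  have mF: "module_sheaf T \<O> F" using F by (simp add: invertible_sheaf_def)
  interpret F: act_sheaf T \<O> F "\<lambda>U. module.smult (sec F U)" using act_sheaf_module[OF mF] .
  obtain U where U: "openin T U" "x \<in> U" and iso: "module_sheaf_iso (subtopology T U) \<O> F (structure_module \<O>)"
    using F x by (auto simp: invertible_sheaf_def)
  obtain \<phi> where hom: "\<phi> \<in> module_sheaf_hom (subtopology T U) \<O> F (structure_module \<O>)"
    and bij: "\<And>W. openin (subtopology T U) W \<Longrightarrow> bij_betw (\<phi> W) (carrier (sec F W)) (carrier (sec (structure_module \<O>) W))"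
    using iso by (auto simp: module_sheaf_iso_def)
  note [simp] = structure_module_def ring_as_module_def openin_open_subtopology[OF U(1)]
  have "\<exists>e. F.gen U e"
  proof (rule F.gen_of_iso[OF U(1), of \<phi>])
    show "bij_betw (\<phi> W) (carrier (sec F W)) (carrier (sec \<O> W))" if "openin T W" "W \<subseteq> U" for W
      using bij[of W] that by simp
    show "\<phi> W (a \<odot>\<^bsub>sec F W\<^esub> s) = a \<otimes>\<^bsub>sec \<O> W\<^esub> \<phi> W s"
      if "openin T W" "W \<subseteq> U" "a \<in> carrier (sec \<O> W)" "s \<in> carrier (sec F W)" for W a s
      using hom that by (auto simp: module_sheaf_hom_def)
    show "\<phi> W (res F U W s) = res \<O> U W (\<phi> U s)" if "openin T W" "W \<subseteq> U" "s \<in> carrier (sec F U)" for W s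
      using hom that U(1) by (auto simp: module_sheaf_hom_def)
  qed
  then show ?thesis using U(2) by (auto simp: free_generator_def)
qed

lemma Pic_trivialD:
  fixes F :: "('p, 'r, 'r) module_sheaf"
  assumes "carrier (Pic T \<O>) = {\<one>\<^bsub>Pic T \<O>\<^esub>}" "invertible_sheaf T \<O> F"
  shows "\<exists>e. free_generator F (topspace T) e"
proof (rule generator_of_structure_iso)
  show F: "module_sheaf T \<O> F" using assms(2) by (simp add: invertible_sheaf_def)
  have "module_sheaf_iso T \<O> F F"
    unfolding module_sheaf_iso_def
    by (rule bexI[of _ "\<lambda>U s. s"]) (auto simp: module_sheaf_hom_def bij_betw_def)
  then show "module_sheaf_iso T \<O> (structure_module \<O>) F"
    using class_group_trivialD[OF assms(1)[unfolded Pic_def]] assms(2) by blast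
qed

text \<open>\<open>F0\<close> guarantees that there is a class at all: without an invertible sheaf
  the set of classes would be empty instead of a singleton.\<close>

lemma Pic_trivialI:
  fixes F0 :: "('p, 'r, 'r) module_sheaf"
  assumes "invertible_sheaf T \<O> F0"
    and gen: "\<And>F :: ('p, 'r, 'r) module_sheaf. invertible_sheaf T \<O> F \<Longrightarrow> \<exists>e. free_generator F (topspace T) e"
  shows "carrier (Pic T \<O>) = {\<one>\<^bsub>Pic T \<O>\<^esub>}"
  unfolding Pic_def
proof (rule class_group_trivialI)
  show "F0 \<in> {F. invertible_sheaf T \<O> F}" using assms(1) by simp
  fix F G :: "('p, 'r, 'r) module_sheaf"
  assume "F \<in> {F. invertible_sheaf T \<O> F}"
  then have F: "module_sheaf T \<O> F" and "\<exists>e. free_generator F (topspace T) e"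
    using gen by (auto simp: invertible_sheaf_def)
  then obtain e where e: "free_generator F (topspace T) e" by blast
  show "module_sheaf_iso T \<O> (structure_module \<O>) F" by (rule structure_iso_of_generator[OF F e])
  assume "G \<in> {F. invertible_sheaf T \<O> F}"
  then have G: "module_sheaf T \<O> G" and "\<exists>e. free_generator G (topspace T) e"
    using gen by (auto simp: invertible_sheaf_def)
  then obtain d where d: "free_generator G (topspace T) d" by blast
  show "module_sheaf_iso T \<O> F G" by (rule module_sheaf_iso_of_generators[OF F G e d])
qed

end


section \<open>Affine schemes\<close>

context comm_monoid
begin

lemma fraction_eq_iff:
  assumes S: "submonoid S G" and [simp]: "a \<in> carrier G" "b \<in> carrier G" and st: "s \<in> S" "t \<in> S"
  shows "fraction G S a s = fraction G S b t \<longleftrightarrow> (\<exists>u\<in>S. u \<otimes> (a \<otimes> t) = u \<otimes> (b \<otimes> s))"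
proof -
  interpret S: submonoid S G using S .
  have sub: "fraction G S a s \<subseteq> fraction G S b t"
    if a: "a \<in> carrier G" "b \<in> carrier G" and st: "s \<in> S" "t \<in> S" and u: "u \<in> S" "u \<otimes> (a \<otimes> t) = u \<otimes> (b \<otimes> s)"
    for a b s t u
  proof
    fix x assume "x \<in> fraction G S a s"
    then obtain c r v where x: "x = (c, r)" "c \<in> carrier G" "r \<in> S" "v \<in> S" and v: "v \<otimes> (a \<otimes> r) = v \<otimes> (c \<otimes> s)"
      by (auto simp: fraction_def)
    have cl: "u \<in> carrier G" "v \<in> carrier G" "s \<in> carrier G" "t \<in> carrier G" "r \<in> carrier G"
      using S.subset st u x by auto
    \<comment> \<open>Transitivity of equality of fractions: the extra factor \<open>s\<close>, the
      denominator to be eliminated, enters the multiplier.\<close>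
    have "(u \<otimes> v \<otimes> s) \<otimes> (b \<otimes> r) = (v \<otimes> r) \<otimes> (u \<otimes> (b \<otimes> s))" using cl a x by (simp add: m_ac)
    also have "\<dots> = (u \<otimes> t) \<otimes> (v \<otimes> (a \<otimes> r))" using cl a x by (simp add: u(2)[symmetric] m_ac)
    also have "\<dots> = (u \<otimes> v \<otimes> s) \<otimes> (c \<otimes> t)" using cl a x by (simp add: v m_ac)
    finally show "x \<in> fraction G S b t"
      using x st u S.m_closed by (auto simp: fraction_def intro!: bexI[of _ "u \<otimes> v \<otimes> s"])
  qed
  show ?thesis
  proof
    assume "fraction G S a s = fraction G S b t"
    moreover have "(a, s) \<in> fraction G S a s" using st by (auto simp: fraction_def intro!: bexI[of _ s])
    ultimately have "(a, s) \<in> fraction G S b t" by simp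
    then obtain u where "u \<in> S" "u \<otimes> (b \<otimes> s) = u \<otimes> (a \<otimes> t)" by (auto simp: fraction_def)
    then show "\<exists>u\<in>S. u \<otimes> (a \<otimes> t) = u \<otimes> (b \<otimes> s)" by metis
  next
    assume "\<exists>u\<in>S. u \<otimes> (a \<otimes> t) = u \<otimes> (b \<otimes> s)"
    then obtain u where u: "u \<in> S" "u \<otimes> (a \<otimes> t) = u \<otimes> (b \<otimes> s)" by blast
    then show "fraction G S a s = fraction G S b t"
      using sub[of a b s t u] sub[of b a t s u] st by auto
  qed
qed

lemma fraction_memD:
  assumes S: "submonoid S G" and "a \<in> carrier G" "s \<in> S" "(b, t) \<in> fraction G S a s"
  shows "b \<in> carrier G" "t \<in> S" "fraction G S b t = fraction G S a s"
  using assms fraction_eq_iff[OF S, of a b s t] by (auto simp: fraction_def)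

lemma fraction_self:
  assumes S: "submonoid S G" and "a \<in> carrier G" "s \<in> S"
  shows "(a, s) \<in> fraction G S a s"
  using assms by (auto simp: fraction_def)

text \<open>All members of the union are equal, and the union is not over an empty set since a pair
  represents its own class. This evaluates the operations defined as unions over
  representatives.\<close>

lemma fraction_UN:
  assumes S: "submonoid S G" and "a \<in> carrier G" "s \<in> S" "b \<in> carrier G" "t \<in> S"
    and eq: "\<And>a' s' b' t'. \<lbrakk>a' \<in> carrier G; s' \<in> S; b' \<in> carrier G; t' \<in> S;
      fraction G S a' s' = fraction G S a s; fraction G S b' t' = fraction G S b t\<rbrakk> \<Longrightarrow> h a' s' b' t' = h a s b t"
  shows "(\<Union>(a', s')\<in>fraction G S a s. \<Union>(b', t')\<in>fraction G S b t. h a' s' b' t') = h a s b t"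
proof -
  have *: "h a' s' b' t' = h a s b t"
    if "(a', s') \<in> fraction G S a s" "(b', t') \<in> fraction G S b t" for a' s' b' t'
    using fraction_memD[OF S assms(2,3) that(1)] fraction_memD[OF S assms(4,5) that(2)] eq by blast
  have mem: "(a, s) \<in> fraction G S a s" "(b, t) \<in> fraction G S b t"
    using fraction_self[OF S] assms by auto
  show ?thesis
  proof (intro equalityI subsetI)
    fix z assume "z \<in> (\<Union>(a', s')\<in>fraction G S a s. \<Union>(b', t')\<in>fraction G S b t. h a' s' b' t')"
    then show "z \<in> h a s b t" using * by auto
  qed (use mem in blast)
qed

lemma fraction_mult_eq:
  assumes S: "submonoid S G" and a: "a \<in> carrier G" "s \<in> S" and b: "b \<in> carrier G" "t \<in> S"
  shows "fraction_mult G S (fraction G S a s) (fraction G S b t) = fraction G S (a \<otimes> b) (s \<otimes> t)"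
  unfolding fraction_mult_def
proof (rule fraction_UN[OF S a b])
  interpret S: submonoid S G using S .
  fix a' s' b' t' assume cl: "a' \<in> carrier G" "s' \<in> S" "b' \<in> carrier G" "t' \<in> S"
    and "fraction G S a' s' = fraction G S a s" "fraction G S b' t' = fraction G S b t"
  then obtain u v where u: "u \<in> S" "u \<otimes> (a' \<otimes> s) = u \<otimes> (a \<otimes> s')" and v: "v \<in> S" "v \<otimes> (b' \<otimes> t) = v \<otimes> (b \<otimes> t')"
    using fraction_eq_iff[OF S cl(1) a(1) cl(2) a(2)] fraction_eq_iff[OF S cl(3) b(1) cl(4) b(2)] by blast
  have c: "u \<in> carrier G" "v \<in> carrier G" "s \<in> carrier G" "t \<in> carrier G" "s' \<in> carrier G" "t' \<in> carrier G"
    using S.subset u v a b cl by auto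
  have "(u \<otimes> v) \<otimes> ((a' \<otimes> b') \<otimes> (s \<otimes> t)) = (u \<otimes> (a' \<otimes> s)) \<otimes> (v \<otimes> (b' \<otimes> t))" using c cl a b by (simp add: m_ac)
  also have "\<dots> = (u \<otimes> v) \<otimes> ((a \<otimes> b) \<otimes> (s' \<otimes> t'))" unfolding u(2) v(2) using c cl a b by (simp add: m_ac)
  finally show "fraction G S (a' \<otimes> b') (s' \<otimes> t') = fraction G S (a \<otimes> b) (s \<otimes> t)"
    using cl a b u v S.m_closed by (subst fraction_eq_iff[OF S]) auto
qed

end

text \<open>A generating family that is closed under binary intersections is already a
  basis.\<close>

lemma generated_topology_basis:
  assumes "openin (topology_generated_by (D ` B)) U" "P \<in> U"
    and inter: "\<And>f g. f \<in> B \<Longrightarrow> g \<in> B \<Longrightarrow> \<exists>h\<in>B. D h = D f \<inter> D g"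
  shows "\<exists>f\<in>B. P \<in> D f \<and> D f \<subseteq> U"
proof -
  have "generate_topology_on (D ` B) U" using assms(1) by (simp add: openin_topology_generated_by_iff)
  then show ?thesis using assms(2)
  proof (induction rule: generate_topology_on.induct)
    case (Int U V)
    then obtain f g where fg: "f \<in> B" "g \<in> B" "P \<in> D f \<inter> D g" "D f \<subseteq> U" "D g \<subseteq> V" by auto
    then obtain h where "h \<in> B" "D h = D f \<inter> D g" using inter by metis
    then show ?case using fg by blast
  qed blast+
qed

text \<open>An ideal of a type-class ring. The primes of a presented ring will be obtained as images
  of such sets.\<close>

definition ideal_set :: "'r::comm_ring_1 set \<Rightarrow> bool" where
  "ideal_set J \<longleftrightarrow> 0 \<in> J \<and> (\<forall>x\<in>J. \<forall>y\<in>J. x + y \<in> J) \<and> (\<forall>r. \<forall>x\<in>J. r * x \<in> J)"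

text \<open>By Zorn's lemma there is an ideal that is maximal among those containing
  \<open>J\<close> and no power of \<open>h\<close>; maximality makes it prime.\<close>

lemma prime_avoiding_powers:
  fixes J :: "'r::comm_ring_1 set"
  assumes J: "ideal_set J" and h: "\<And>n. h ^ n \<notin> J"
  obtains P where "ideal_set P" "J \<subseteq> P" "h \<notin> P" "1 \<notin> P" "\<And>a b. a * b \<in> P \<Longrightarrow> a \<in> P \<or> b \<in> P"
proof -
  let ?A = "{K. ideal_set K \<and> J \<subseteq> K \<and> (\<forall>n. h ^ n \<notin> K)}"
  have "\<exists>M\<in>?A. \<forall>K\<in>?A. M \<subseteq> K \<longrightarrow> K = M"
  proof (rule subset_Zorn_nonempty)
    show "?A \<noteq> {}" using J h by blast
    fix C assume C: "C \<noteq> {}" "subset.chain ?A C"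
    then have sub: "C \<subseteq> ?A" and chain: "\<And>K Y. K \<in> C \<Longrightarrow> Y \<in> C \<Longrightarrow> K \<subseteq> Y \<or> Y \<subseteq> K"
      by (auto simp: subset.chain_def)
    have "ideal_set (\<Union>C)"
      unfolding ideal_set_def
    proof (intro conjI ballI allI)
      show "0 \<in> \<Union>C" using C(1) sub by (fastforce simp: ideal_set_def)
      show "r * x \<in> \<Union>C" if "x \<in> \<Union>C" for r x using that sub by (fastforce simp: ideal_set_def)
      fix x y assume "x \<in> \<Union>C" "y \<in> \<Union>C"
      then obtain K Y where XY: "K \<in> C" "Y \<in> C" "x \<in> K" "y \<in> Y" by blast
      then obtain Z where "Z \<in> C" "x \<in> Z" "y \<in> Z" using chain[OF XY(1,2)] by blast
      moreover from this have "ideal_set Z" using sub by blast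
      ultimately show "x + y \<in> \<Union>C" unfolding ideal_set_def by blast
    qed
    then show "\<Union>C \<in> ?A" using C(1) sub by blast
  qed
  then obtain M where "M \<in> ?A" and max: "\<forall>K\<in>?A. M \<subseteq> K \<longrightarrow> K = M" by blast
  then have M: "ideal_set M" "J \<subseteq> M" "\<And>n. h ^ n \<notin> M" by auto
  note Mi = M(1)[unfolded ideal_set_def]
  \<comment> \<open>Adjoining an element \<open>a\<close> outside \<open>M\<close> gives a strictly
    larger ideal, which must contain a power of \<open>h\<close>.\<close>
  have power: "\<exists>n r m. m \<in> M \<and> h ^ n = m + r * a" if "a \<notin> M" for a
  proof (rule ccontr)
    let ?K = "{m + r * a | m r. m \<in> M}"
    assume no: "\<not> ?thesis"
    have "ideal_set ?K"
      unfolding ideal_set_def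
    proof (intro conjI ballI allI)
      show "0 \<in> ?K" using Mi by (intro CollectI exI[of _ 0]) auto
    next
      fix x y assume "x \<in> ?K" "y \<in> ?K"
      then obtain m r m' r' where "x = m + r * a" "y = m' + r' * a" "m \<in> M" "m' \<in> M" by blast
      then show "x + y \<in> ?K"
        using Mi by (intro CollectI exI[of _ "m + m'"] exI[of _ "r + r'"]) (auto simp: algebra_simps)
    next
      fix c x assume "x \<in> ?K"
      then obtain m r where "x = m + r * a" "m \<in> M" by blast
      then show "c * x \<in> ?K"
        using Mi by (intro CollectI exI[of _ "c * m"] exI[of _ "c * r"]) (auto simp: algebra_simps)
    qed
    moreover have MK: "M \<subseteq> ?K"
    proof
      show "x \<in> ?K" if "x \<in> M" for x using that by (intro CollectI exI[of _ x] exI[of _ 0]) auto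
    qed
    moreover have "h ^ n \<notin> ?K" for n using no by blast
    ultimately have "?K \<in> ?A" using M(2) by blast
    then have "?K = M" using max MK by blast
    moreover have "a \<in> ?K" using Mi by (intro CollectI exI[of _ 0] exI[of _ 1]) auto
    ultimately show False using that by blast
  qed
  show thesis
  proof (rule that[OF M(1,2)])
    show "h \<notin> M" using M(3)[of 1] by simp
    show "1 \<notin> M" using M(3)[of 0] by simp
    show "a \<in> M \<or> b \<in> M" if ab: "a * b \<in> M" for a b
    proof (rule ccontr)
      assume "\<not> (a \<in> M \<or> b \<in> M)"
      then obtain n r m n' r' m' where *: "m \<in> M" "h ^ n = m + r * a" "m' \<in> M" "h ^ n' = m' + r' * b"
        using power by metis
      have "h ^ (n + n') = (m' + r' * b) * m + (r * a) * m' + (r * r') * (a * b)"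
        unfolding power_add * by (simp add: algebra_simps)
      also have "\<dots> \<in> M" using Mi * ab by blast
      finally show False using M(3) by blast
    qed
  qed
qed

text \<open>A ring \<open>A\<close> with carrier is handled through a surjection \<open>\<pi>\<close> from a type-class ring, so that
  calculations need no carrier conditions.\<close>

locale presented_ring = cring A for A (structure) +
  fixes \<pi> :: "'r::comm_ring_1 \<Rightarrow> 'a"
  assumes pi_closed [simp]: "\<pi> p \<in> carrier A" and pi_surj: "a \<in> carrier A \<Longrightarrow> \<exists>p. a = \<pi> p"
    and pi_add: "\<pi> (p + q) = \<pi> p \<oplus> \<pi> q" and pi_mult: "\<pi> (p * q) = \<pi> p \<otimes> \<pi> q" and pi_one: "\<pi> 1 = \<one>"
begin

lemma pi_zero: "\<pi> 0 = \<zero>"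
  using pi_add[of 0 0] by (metis add.l_cancel_one pi_closed add_0)

lemma pi_uminus: "\<pi> (- p) = \<ominus> \<pi> p"
  using pi_add[of "- p" p] by (simp add: pi_zero minus_equality)

lemma pi_eq_iff: "\<pi> p = \<pi> q \<longleftrightarrow> \<pi> (p - q) = \<zero>"
proof -
  have "\<pi> (p - q) = \<pi> p \<ominus> \<pi> q" using pi_add[of p "- q"] by (simp add: pi_uminus a_minus_def)
  then show ?thesis by (simp add: r_right_minus_eq)
qed

lemma pi_cong_mult: "\<pi> p = \<pi> q \<Longrightarrow> \<pi> (r * p) = \<pi> (r * q)"
  by (simp add: pi_mult)

definition fr :: "'a set \<Rightarrow> 'r \<Rightarrow> 'r \<Rightarrow> ('a \<times> 'a) set" where
  "fr P a s = fraction A (carrier A - P) (\<pi> a) (\<pi> s)"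

abbreviation stalk :: "'a set \<Rightarrow> ('a \<times> 'a) set ring" where
  "stalk P \<equiv> ring_localization A (carrier A - P)"

definition D :: "'r \<Rightarrow> 'a set set" where
  "D f = {P. primeideal P A \<and> \<pi> f \<notin> P}"

lemma prime_submonoid: "primeideal P A \<Longrightarrow> submonoid (carrier A - P) A"
proof
  assume P: "primeideal P A"
  then interpret P: primeideal P A .
  show "\<one> \<in> carrier A - P" using P.I_notcarr P.one_imp_carrier by auto
  show "x \<otimes> y \<in> carrier A - P" if "x \<in> carrier A - P" "y \<in> carrier A - P" for x y
    using that P.I_prime by auto
qed auto

lemma prime_mult: "primeideal P A \<Longrightarrow> \<pi> (s * t) \<in> P \<longleftrightarrow> \<pi> s \<in> P \<or> \<pi> t \<in> P"
proof -
  assume P: "primeideal P A"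
  then interpret P: primeideal P A .
  show ?thesis
    using P.I_prime[of "\<pi> s" "\<pi> t"] P.I_l_closed[of "\<pi> t" "\<pi> s"] P.I_r_closed[of "\<pi> s" "\<pi> t"]
    by (auto simp: pi_mult)
qed

lemma prime_one: "primeideal P A \<Longrightarrow> \<pi> 1 \<notin> P"
  using submonoid.one_closed[OF prime_submonoid] by (auto simp: pi_one)

lemma prime_power: "primeideal P A \<Longrightarrow> \<pi> s \<notin> P \<Longrightarrow> \<pi> (s ^ n) \<notin> P"
  by (induction n) (auto simp: prime_mult prime_one)

lemma prime_zero: "primeideal P A \<Longrightarrow> \<pi> p = \<zero> \<Longrightarrow> \<pi> p \<in> P"
  by (simp add: additive_subgroup.zero_closed ideal.axioms(1) primeideal.axioms(1))

lemma fr_eq_iff: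
  assumes P: "primeideal P A" "\<pi> s \<notin> P" "\<pi> t \<notin> P"
  shows "fr P a s = fr P b t \<longleftrightarrow> (\<exists>u. \<pi> u \<notin> P \<and> \<pi> (u * (a * t)) = \<pi> (u * (b * s)))"
proof -
  have "fr P a s = fr P b t \<longleftrightarrow> (\<exists>u\<in>carrier A - P. u \<otimes> (\<pi> a \<otimes> \<pi> t) = u \<otimes> (\<pi> b \<otimes> \<pi> s))"
    unfolding fr_def using P by (intro fraction_eq_iff prime_submonoid) auto
  also have "\<dots> \<longleftrightarrow> (\<exists>u. \<pi> u \<notin> P \<and> \<pi> (u * (a * t)) = \<pi> (u * (b * s)))"
    unfolding pi_mult using pi_surj by (metis Diff_iff pi_closed)
  finally show ?thesis .
qed

lemma fr_eqI:
  assumes "primeideal P A" "\<pi> s \<notin> P" "\<pi> t \<notin> P" "\<pi> (a * t) = \<pi> (b * s)"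
  shows "fr P a s = fr P b t"
  using assms(4) prime_one[OF assms(1)] by (subst fr_eq_iff[OF assms(1-3)]) (auto intro!: exI[of _ 1])

lemma stalk_carrier: "x \<in> carrier (stalk P) \<longleftrightarrow> (\<exists>a s. \<pi> s \<notin> P \<and> x = fr P a s)"
  unfolding ring_localization_def fr_def using pi_surj by simp (metis Diff_iff pi_closed)

lemma fr_stalk: "\<pi> s \<notin> P \<Longrightarrow> fr P a s \<in> carrier (stalk P)"
  by (auto simp: stalk_carrier)

lemma fr_mult:
  assumes "primeideal P A" "\<pi> s \<notin> P" "\<pi> t \<notin> P"
  shows "fr P a s \<otimes>\<^bsub>stalk P\<^esub> fr P b t = fr P (a * b) (s * t)"
  using fraction_mult_eq[OF prime_submonoid[OF assms(1)], of "\<pi> a" "\<pi> s" "\<pi> b" "\<pi> t"] assms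
  by (simp add: ring_localization_def fr_def pi_mult)

lemma fr_add:
  assumes P: "primeideal P A" and s: "\<pi> s \<notin> P" and t: "\<pi> t \<notin> P"
  shows "fr P a s \<oplus>\<^bsub>stalk P\<^esub> fr P b t = fr P (a * t + b * s) (s * t)"
proof -
  have "fraction_add A (carrier A - P) (fr P a s) (fr P b t)
      = fraction A (carrier A - P) (\<pi> a \<otimes> \<pi> t \<oplus> \<pi> b \<otimes> \<pi> s) (\<pi> s \<otimes> \<pi> t)"
    unfolding fraction_add_def fr_def
  proof (rule fraction_UN[OF prime_submonoid[OF P]])
    fix a' s' b' t' assume cl: "a' \<in> carrier A" "s' \<in> carrier A - P" "b' \<in> carrier A" "t' \<in> carrier A - P"
      and eq: "fraction A (carrier A - P) a' s' = fraction A (carrier A - P) (\<pi> a) (\<pi> s)"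
        "fraction A (carrier A - P) b' t' = fraction A (carrier A - P) (\<pi> b) (\<pi> t)"
    obtain x y z w where xyzw: "a' = \<pi> x" "s' = \<pi> y" "b' = \<pi> z" "t' = \<pi> w" using cl pi_surj by (metis Diff_iff)
    then have y: "\<pi> y \<notin> P" and w: "\<pi> w \<notin> P" using cl by auto
    obtain u where u: "\<pi> u \<notin> P" "\<pi> (u * (x * s)) = \<pi> (u * (a * y))"
      using eq(1) fr_eq_iff[OF P y s, of x a] unfolding xyzw fr_def by blast
    obtain v where v: "\<pi> v \<notin> P" "\<pi> (v * (z * t)) = \<pi> (v * (b * w))"
      using eq(2) fr_eq_iff[OF P w t, of z b] unfolding xyzw fr_def by blast
    have "\<pi> ((u * v) * ((x * w + z * y) * (s * t))) = \<pi> ((v * w * t) * (u * (x * s)) + (u * y * s) * (v * (z * t)))"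
      by (simp add: algebra_simps)
    also have "\<dots> = \<pi> ((v * w * t) * (u * (a * y)) + (u * y * s) * (v * (b * w)))"
      using pi_cong_mult[OF u(2)] pi_cong_mult[OF v(2)] by (simp only: pi_add)
    also have "\<dots> = \<pi> ((u * v) * ((a * t + b * s) * (y * w)))"
      by (simp add: algebra_simps)
    finally have "fr P (x * w + z * y) (y * w) = fr P (a * t + b * s) (s * t)"
      using P s t u v y w by (subst fr_eq_iff) (auto simp: prime_mult intro!: exI[of _ "u * v"])
    then show "fraction A (carrier A - P) (a' \<otimes> t' \<oplus> b' \<otimes> s') (s' \<otimes> t')
        = fraction A (carrier A - P) (\<pi> a \<otimes> \<pi> t \<oplus> \<pi> b \<otimes> \<pi> s) (\<pi> s \<otimes> \<pi> t)"
      unfolding xyzw fr_def pi_add pi_mult .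
  qed (use s t in auto)
  then show ?thesis by (simp add: ring_localization_def fr_def pi_add pi_mult)
qed

lemma stalk_one: "\<one>\<^bsub>stalk P\<^esub> = fr P 1 1"
  by (simp add: ring_localization_def fr_def pi_one)

lemma stalk_zero: "\<zero>\<^bsub>stalk P\<^esub> = fr P 0 1"
  by (simp add: ring_localization_def fr_def pi_one pi_zero)

lemma stalk_cring:
  assumes P: "primeideal P A"
  shows "cring (stalk P)"
proof (intro cringI abelian_groupI comm_monoidI)
  note [simp] = fr_mult[OF P] fr_add[OF P] prime_mult[OF P] prime_one[OF P] stalk_one stalk_zero fr_stalk
  note eqI = fr_eqI[OF P]
  fix x y z assume "x \<in> carrier (stalk P)"
  then obtain a s where x [simp]: "x = fr P a s" "\<pi> s \<notin> P" by (auto simp: stalk_carrier)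
  show "\<exists>y\<in>carrier (stalk P). y \<oplus>\<^bsub>stalk P\<^esub> x = \<zero>\<^bsub>stalk P\<^esub>"
    by (rule bexI[of _ "fr P (- a) s"]) (simp_all, rule eqI, simp_all)
  show "\<zero>\<^bsub>stalk P\<^esub> \<oplus>\<^bsub>stalk P\<^esub> x = x" by (auto intro!: eqI)
  show "\<one>\<^bsub>stalk P\<^esub> \<otimes>\<^bsub>stalk P\<^esub> x = x" by (auto intro!: eqI)
  assume "y \<in> carrier (stalk P)"
  then obtain b t where y [simp]: "y = fr P b t" "\<pi> t \<notin> P" by (auto simp: stalk_carrier)
  show "x \<oplus>\<^bsub>stalk P\<^esub> y \<in> carrier (stalk P)" "x \<otimes>\<^bsub>stalk P\<^esub> y \<in> carrier (stalk P)" by auto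
  show "x \<oplus>\<^bsub>stalk P\<^esub> y = y \<oplus>\<^bsub>stalk P\<^esub> x" by (auto intro!: eqI simp: algebra_simps)
  show "x \<otimes>\<^bsub>stalk P\<^esub> y = y \<otimes>\<^bsub>stalk P\<^esub> x" by (auto intro!: eqI simp: algebra_simps)
  assume "z \<in> carrier (stalk P)"
  then obtain c r where z [simp]: "z = fr P c r" "\<pi> r \<notin> P" by (auto simp: stalk_carrier)
  show "x \<oplus>\<^bsub>stalk P\<^esub> y \<oplus>\<^bsub>stalk P\<^esub> z = x \<oplus>\<^bsub>stalk P\<^esub> (y \<oplus>\<^bsub>stalk P\<^esub> z)" by (auto intro!: eqI simp: algebra_simps)
  show "x \<otimes>\<^bsub>stalk P\<^esub> y \<otimes>\<^bsub>stalk P\<^esub> z = x \<otimes>\<^bsub>stalk P\<^esub> (y \<otimes>\<^bsub>stalk P\<^esub> z)" by (auto intro!: eqI simp: algebra_simps)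
  show "(x \<oplus>\<^bsub>stalk P\<^esub> y) \<otimes>\<^bsub>stalk P\<^esub> z = x \<otimes>\<^bsub>stalk P\<^esub> z \<oplus>\<^bsub>stalk P\<^esub> y \<otimes>\<^bsub>stalk P\<^esub> z"
    by (simp, rule eqI) (simp_all add: algebra_simps)
qed (auto simp: stalk_one stalk_zero fr_stalk prime_one[OF P])

section \<open>Basic open sets and quasi-compactness\<close>

lemma D_mult: "D (f * g) = D f \<inter> D g"
  by (auto simp: D_def prime_mult)

lemma D_one: "D 1 = {P. primeideal P A}"
  by (auto simp: D_def prime_one)

lemma D_power: "0 < n \<Longrightarrow> D (f ^ n) = D f"
  by (induction n rule: nat_induct_non_zero) (auto simp: D_mult)

lemma Spec_eq: "Spec A = topology_generated_by (D ` UNIV)"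
proof -
  have "{{P. primeideal P A \<and> f \<notin> P} | f. f \<in> carrier A} = D ` UNIV"
    unfolding D_def using pi_surj pi_closed by blast
  then show ?thesis by (simp add: Spec_def)
qed

lemma open_D: "openin (Spec A) (D f)"
  unfolding Spec_eq by (rule topology_generated_by_Basis) simp

lemma topspace_Spec: "topspace (Spec A) = {P. primeideal P A}"
proof -
  have "D f \<subseteq> {P. primeideal P A}" for f by (auto simp: D_def)
  then show ?thesis unfolding Spec_eq using D_one by (auto simp: topology_generated_by_topspace)
qed

lemma Spec_basis: "openin (Spec A) U \<Longrightarrow> P \<in> U \<Longrightarrow> \<exists>h. P \<in> D h \<and> D h \<subseteq> U"
proof -
  assume U: "openin (Spec A) U" "P \<in> U"
  have "\<exists>h\<in>UNIV. D h = D f \<inter> D g" for f g using D_mult by blast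
  then show ?thesis using generated_topology_basis[of D UNIV U P] U by (auto simp: Spec_eq)
qed

lemma open_prime: "openin (Spec A) U \<Longrightarrow> P \<in> U \<Longrightarrow> primeideal P A"
  using openin_subset topspace_Spec by fastforce

text \<open>The primes of \<open>A\<close> correspond to the primes upstairs that contain the kernel
  of \<open>\<pi>\<close>. Containing the kernel is what lets membership be tested on any
  preimage.\<close>

lemma prime_ideal_of_set:
  assumes M: "ideal_set M" "{p. \<pi> p = \<zero>} \<subseteq> M" "1 \<notin> M" "\<And>a b. a * b \<in> M \<Longrightarrow> a \<in> M \<or> b \<in> M"
  shows "primeideal (\<pi> ` M) A" "\<pi> p \<in> \<pi> ` M \<longleftrightarrow> p \<in> M"
proof -
  note Mi = M(1)[unfolded ideal_set_def]
  have mem: "\<pi> p \<in> \<pi> ` M \<longleftrightarrow> p \<in> M" for p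
  proof
    assume "\<pi> p \<in> \<pi> ` M"
    then obtain q where q: "q \<in> M" "\<pi> p = \<pi> q" by blast
    then have "p - q \<in> M" using M(2) pi_eq_iff by blast
    then have "(p - q) + q \<in> M" using Mi q by blast
    then show "p \<in> M" by simp
  qed auto
  show "\<pi> p \<in> \<pi> ` M \<longleftrightarrow> p \<in> M" by (rule mem)
  show "primeideal (\<pi> ` M) A"
  proof (rule primeidealI)
    show "ideal (\<pi> ` M) A"
    proof (rule idealI)
      show "ring A" by (rule ring_axioms)
      show "subgroup (\<pi> ` M) (add_monoid A)"
      proof (rule add.subgroupI)
        show "\<pi> ` M \<noteq> {}" using Mi by blast
        show "\<ominus> a \<in> \<pi> ` M" if "a \<in> \<pi> ` M" for a
        proof -
          obtain p where "p \<in> M" "a = \<pi> p" using \<open>a \<in> \<pi> ` M\<close> by blast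
          moreover from this have "(- 1) * p \<in> M" using Mi by blast
          ultimately show ?thesis by (auto simp: pi_uminus[symmetric])
        qed
        show "a \<oplus> b \<in> \<pi> ` M" if "a \<in> \<pi> ` M" "b \<in> \<pi> ` M" for a b
          using that Mi by (auto simp: pi_add[symmetric])
      qed auto
      show "x \<otimes> a \<in> \<pi> ` M" "a \<otimes> x \<in> \<pi> ` M" if a: "a \<in> \<pi> ` M" and x: "x \<in> carrier A" for a x
      proof -
        obtain p q where "p \<in> M" "a = \<pi> p" "x = \<pi> q" using a x pi_surj by blast
        moreover from this have "q * p \<in> M" using Mi by blast
        ultimately show "x \<otimes> a \<in> \<pi> ` M" "a \<otimes> x \<in> \<pi> ` M"
          by (auto simp: pi_mult[symmetric] mem mult.commute)
      qed
    qed
    show "cring A" by (rule cring_axioms)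
    show "carrier A \<noteq> \<pi> ` M" using mem[of 1] M(3) pi_closed by blast
    show "a \<in> \<pi> ` M \<or> b \<in> \<pi> ` M" if ab: "a \<in> carrier A" "b \<in> carrier A" "a \<otimes> b \<in> \<pi> ` M" for a b
    proof -
      obtain p q where "a = \<pi> p" "b = \<pi> q" using ab(1,2) pi_surj by blast
      then show ?thesis using ab(3) M(4)[of p q] by (simp add: pi_mult[symmetric] mem)
    qed
  qed
qed

text \<open>The radical of an ideal is the intersection of the primes above it: if no power of
  \<open>h\<close> were in \<open>J\<close>, some prime in \<open>D h\<close> would contain
  \<open>J\<close>.\<close>

lemma power_in_ideal:
  assumes J: "ideal_set J" "{p. \<pi> p = \<zero>} \<subseteq> J" and "\<And>P. P \<in> D h \<Longrightarrow> \<exists>u\<in>J. \<pi> u \<notin> P"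
  shows "\<exists>n. h ^ n \<in> J"
proof (rule ccontr)
  assume "\<not> ?thesis"
  then obtain M where M: "ideal_set M" "J \<subseteq> M" "h \<notin> M" "1 \<notin> M" "\<And>a b. a * b \<in> M \<Longrightarrow> a \<in> M \<or> b \<in> M"
    using prime_avoiding_powers[OF J(1), of h] by metis
  note p = prime_ideal_of_set[OF M(1) subset_trans[OF J(2) M(2)] M(4,5)]
  have "\<pi> ` M \<in> D h" using p M(3) by (auto simp: D_def)
  then show False using assms(3) p(2) M(2) by blast
qed

text \<open>Apply \<open>power_in_ideal\<close> to the annihilator of \<open>w\<close>. An element
  that vanishes in all stalks over \<open>D h\<close> is killed by one power of
  \<open>h\<close>.\<close>

lemma support_power:
  assumes "\<And>P. P \<in> D h \<Longrightarrow> \<exists>u. \<pi> u \<notin> P \<and> \<pi> (u * w) = \<zero>"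
  shows "\<exists>m. \<pi> (h ^ m * w) = \<zero>"
proof -
  have "\<exists>m. h ^ m \<in> {u. \<pi> (u * w) = \<zero>}"
    by (rule power_in_ideal)
      (use assms in \<open>auto simp: ideal_set_def pi_zero pi_add pi_mult l_distr m_assoc\<close>)
  then show ?thesis by simp
qed

text \<open>The ideal generated by the \<open>g i\<close>, together with the kernel of
  \<open>\<pi>\<close>, lies in no prime of \<open>D f\<close>, so it contains a power of
  \<open>f\<close>. The power is a finite combination, which is quasi-compactness.\<close>

lemma cover_combination:
  assumes "D f \<subseteq> (\<Union>i\<in>I. D (g i))"
  shows "\<exists>N H c. finite H \<and> H \<subseteq> I \<and> \<pi> (f ^ N) = \<pi> (\<Sum>i\<in>H. c i * g i)"
proof -
  let ?J = "{x. \<exists>H c. finite H \<and> H \<subseteq> I \<and> \<pi> x = \<pi> (\<Sum>i\<in>H. c i * g i)}"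
  have "\<exists>N. f ^ N \<in> ?J"
  proof (rule power_in_ideal)
    show "ideal_set ?J"
      unfolding ideal_set_def
    proof (intro conjI ballI allI)
      show "0 \<in> ?J" by (intro CollectI exI[of _ "{}"]) auto
    next
      fix x y assume "x \<in> ?J" "y \<in> ?J"
      then obtain H c H' c' where H: "finite H" "H \<subseteq> I" "\<pi> x = \<pi> (\<Sum>i\<in>H. c i * g i)"
        and H': "finite H'" "H' \<subseteq> I" "\<pi> y = \<pi> (\<Sum>i\<in>H'. c' i * g i)" by blast
      let ?c = "\<lambda>i. (if i \<in> H then c i else 0) + (if i \<in> H' then c' i else 0)"
      have "(\<Sum>i\<in>H. c i * g i) = (\<Sum>i\<in>H \<union> H'. (if i \<in> H then c i else 0) * g i)"
        "(\<Sum>i\<in>H'. c' i * g i) = (\<Sum>i\<in>H \<union> H'. (if i \<in> H' then c' i else 0) * g i)"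
        using H(1) H'(1) by (auto intro!: sum.mono_neutral_cong_left)
      then have "\<pi> (x + y) = \<pi> (\<Sum>i\<in>H \<union> H'. ?c i * g i)"
        unfolding pi_add H(3) H'(3) by (simp only: pi_add[symmetric] distrib_right sum.distrib)
      then show "x + y \<in> ?J" using H H' by (intro CollectI exI[of _ "H \<union> H'"] exI[of _ ?c]) auto
    next
      fix r x assume "x \<in> ?J"
      then obtain H c where H: "finite H" "H \<subseteq> I" "\<pi> x = \<pi> (\<Sum>i\<in>H. c i * g i)" by blast
      then have "\<pi> (r * x) = \<pi> (\<Sum>i\<in>H. (r * c i) * g i)"
        using pi_cong_mult[OF H(3), of r] by (simp add: sum_distrib_left mult.assoc)
      then show "r * x \<in> ?J" using H by (intro CollectI exI[of _ H] exI[of _ "\<lambda>i. r * c i"]) auto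
    qed
    show "{p. \<pi> p = \<zero>} \<subseteq> ?J" by (auto simp: pi_zero intro!: exI[of _ "{}"])
    fix P assume "P \<in> D f"
    then obtain i where "i \<in> I" "P \<in> D (g i)" using assms by blast
    moreover from this have "g i \<in> ?J" by (intro CollectI exI[of _ "{i}"] exI[of _ "\<lambda>_. 1"]) auto
    ultimately show "\<exists>u\<in>?J. \<pi> u \<notin> P" by (auto simp: D_def)
  qed
  then show ?thesis by blast
qed

section \<open>Sections of the structure sheaf over basic open sets\<close>

definition regular :: "'a set set \<Rightarrow> ('a set \<Rightarrow> ('a \<times> 'a) set) \<Rightarrow> bool" where
  "regular V s \<longleftrightarrow> (\<exists>a f. \<forall>Q\<in>V. \<pi> f \<notin> Q \<and> s Q = fr Q a f)"

lemma regular_mono: "regular V s \<Longrightarrow> V' \<subseteq> V \<Longrightarrow> (\<And>P. P \<in> V' \<Longrightarrow> s' P = s P) \<Longrightarrow> regular V' s'"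
  unfolding regular_def by (metis subsetD)

abbreviation \<O> where "\<O> \<equiv> structure_sheaf A"

lemma sections_eq: "carrier (sec \<O> U) =
    {s \<in> extensional U. \<forall>P\<in>U. \<exists>V. openin (Spec A) V \<and> P \<in> V \<and> V \<subseteq> U \<and> regular V s}"
proof -
  have eq: "(\<exists>a f. a \<in> carrier A \<and> f \<in> carrier A \<and> (\<forall>Q\<in>V. f \<notin> Q \<and> s Q = fraction A (carrier A - Q) a f)) \<longleftrightarrow> regular V s" for V s
  proof (rule iffI)
    assume "\<exists>a f. a \<in> carrier A \<and> f \<in> carrier A \<and> (\<forall>Q\<in>V. f \<notin> Q \<and> s Q = fraction A (carrier A - Q) a f)"
    then obtain a f where af: "a \<in> carrier A" "f \<in> carrier A"
      and *: "\<forall>Q\<in>V. f \<notin> Q \<and> s Q = fraction A (carrier A - Q) a f" by blast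
    obtain p where p: "a = \<pi> p" using pi_surj[OF af(1)] by blast
    obtain q where q: "f = \<pi> q" using pi_surj[OF af(2)] by blast
    show "regular V s" unfolding regular_def fr_def using * unfolding p q by blast
  next
    assume "regular V s"
    then obtain p q where "\<forall>Q\<in>V. \<pi> q \<notin> Q \<and> s Q = fraction A (carrier A - Q) (\<pi> p) (\<pi> q)"
      unfolding regular_def fr_def by blast
    then show "\<exists>a f. a \<in> carrier A \<and> f \<in> carrier A \<and> (\<forall>Q\<in>V. f \<notin> Q \<and> s Q = fraction A (carrier A - Q) a f)"
      by (intro exI[of _ "\<pi> p"] exI[of _ "\<pi> q"]) simp
  qed
  have "(\<exists>a f. openin (Spec A) V \<and> P \<in> V \<and> V \<subseteq> U \<and> a \<in> carrier A \<and> f \<in> carrier A \<and>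
      (\<forall>Q\<in>V. f \<notin> Q \<and> s Q = fraction A (carrier A - Q) a f)) \<longleftrightarrow>
      openin (Spec A) V \<and> P \<in> V \<and> V \<subseteq> U \<and> regular V s" for V P s
    unfolding eq[symmetric] by blast
  then show ?thesis by (simp add: structure_sheaf_def fraction_sections_def)
qed

lemma res_eq [simp]: "res \<O> U V s = restrict s V"
  by (simp add: structure_sheaf_def)

lemma section_stalk:
  assumes "s \<in> carrier (sec \<O> U)" "P \<in> U"
  obtains a f where "\<pi> f \<notin> P" "s P = fr P a f"
  using assms unfolding sections_eq regular_def by blast

lemma basic_section: "(\<And>P. P \<in> U \<Longrightarrow> primeideal P A \<and> \<pi> f \<notin> P) \<Longrightarrow> openin (Spec A) U \<Longrightarrow> (\<lambda>P\<in>U. fr P a f) \<in> carrier (sec \<O> U)"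
  unfolding sections_eq regular_def by fastforce

lemma prime_sum:
  assumes P: "primeideal P A" and "finite H" "\<And>i. i \<in> H \<Longrightarrow> \<pi> (g i) \<in> P"
  shows "\<pi> (\<Sum>i\<in>H. g i) \<in> P"
  using assms(2,3)
proof (induction rule: finite_induct)
  interpret P: primeideal P A by (rule P)
  case empty
  then show ?case using prime_zero[OF P] by (simp add: pi_zero)
next
  interpret P: primeideal P A by (rule P)
  case (insert i H)
  then show ?case by (simp add: pi_add P.a_closed)
qed

lemma finite_subcover:
  assumes "D f \<subseteq> (\<Union>i\<in>I. D (g i))"
  obtains N H c where "finite H" "H \<subseteq> I" "\<pi> (f ^ N) = \<pi> (\<Sum>i\<in>H. c i * g i)" "D f \<subseteq> (\<Union>i\<in>H. D (g i))"
proof -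
  obtain N H c where H: "finite H" "H \<subseteq> I" "\<pi> (f ^ N) = \<pi> (\<Sum>i\<in>H. c i * g i)"
    using cover_combination[OF assms] by blast
  have "P \<in> (\<Union>i\<in>H. D (g i))" if P: "P \<in> D f" for P
  proof (rule ccontr)
    assume no: "P \<notin> (\<Union>i\<in>H. D (g i))"
    have pr: "primeideal P A" "\<pi> f \<notin> P" using P by (auto simp: D_def)
    have "\<pi> (\<Sum>i\<in>H. c i * g i) \<in> P"
      using no pr prime_mult[OF pr(1)] by (intro prime_sum[OF pr(1) H(1)]) (auto simp: D_def)
    then show False using H(3) prime_power[OF pr, of N] by simp
  qed
  then show thesis using that[OF H] by blast
qed

text \<open>Sections over \<open>D f\<close> are fractions with a power of \<open>f\<close> as
  denominator. Finitely many \<open>D h\<close> on which the section is a fraction over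
  \<open>h\<close> cover \<open>D f\<close>. On overlaps the cross products agree up to a power of
  \<open>h * h'\<close>; enlarging numerators and denominators makes them agree exactly, and a
  partition of unity then produces one global numerator.\<close>

theorem section_on_D:
  assumes s: "s \<in> carrier (sec \<O> (D f))"
  obtains a N where "\<And>P. P \<in> D f \<Longrightarrow> s P = fr P a (f ^ N)"
proof -
  let ?X = "{h. D h \<subseteq> D f \<and> (\<exists>a. \<forall>Q\<in>D h. s Q = fr Q a h)}"
  have cov: "D f \<subseteq> (\<Union>h\<in>?X. D h)"
  proof
    fix P assume P: "P \<in> D f"
    then obtain V where V: "openin (Spec A) V" "P \<in> V" "V \<subseteq> D f" "regular V s" using s by (auto simp: sections_eq)
    then obtain a g where g: "\<And>Q. Q \<in> V \<Longrightarrow> \<pi> g \<notin> Q \<and> s Q = fr Q a g" unfolding regular_def by blast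
    obtain h where h: "P \<in> D h" "D h \<subseteq> V" using Spec_basis V by blast
    \<comment> \<open>Since \<open>D h\<close> lies in \<open>D g\<close>, a power of
      \<open>h\<close> is a multiple of \<open>g\<close>. The fraction can then be rewritten with a
      power of \<open>h\<close> as denominator, whose nonvanishing locus is \<open>D h\<close>
      itself.\<close>
    have "D h \<subseteq> D g" using h(2) g V(3) by (auto simp: D_def)
    then have "D h \<subseteq> (\<Union>i\<in>{g}. D i)" by simp
    then obtain k H c where "finite H" "H \<subseteq> {g}" "\<pi> (h ^ k) = \<pi> (\<Sum>i\<in>H. c i * i)"
      using cover_combination[of h "\<lambda>i. i" "{g}"] by blast
    then have "\<exists>e. \<pi> (h ^ k) = \<pi> (e * g)" by (cases "H = {}") (auto simp: subset_singleton_iff intro: exI[of _ 0])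
    then obtain e where e: "\<pi> (h ^ k) = \<pi> (e * g)" by blast
    \<comment> \<open>The exponent \<open>Suc k\<close> is positive, so that the new denominator
      still defines \<open>D h\<close> when \<open>k\<close> is 0.\<close>
    have "s Q = fr Q (a * e * h) (h ^ Suc k)" if Q: "Q \<in> D h" for Q
    proof -
      have pr: "primeideal Q A" "\<pi> h \<notin> Q" using Q by (auto simp: D_def)
      have "s Q = fr Q a g" "\<pi> g \<notin> Q" using g Q h(2) by auto
      moreover have "\<pi> (a * h ^ Suc k) = \<pi> ((a * e * h) * g)"
        using pi_cong_mult[OF e, of "a * h"] by (simp add: ac_simps)
      ultimately show ?thesis using fr_eqI[OF pr(1), of g "h ^ Suc k" a "a * e * h"] prime_power[OF pr, of "Suc k"] by simp
    qed
    moreover have Dh: "D (h ^ Suc k) = D h" by (rule D_power) simp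
    ultimately have "h ^ Suc k \<in> ?X" using h(2) V(3) by blast
    then show "P \<in> (\<Union>h\<in>?X. D h)" using h(1) Dh by blast
  qed
  obtain N H c where H: "finite H" "H \<subseteq> ?X" and "\<pi> (f ^ N) = \<pi> (\<Sum>h\<in>H. c h * h)" and cov: "D f \<subseteq> (\<Union>h\<in>H. D h)"
    by (rule finite_subcover[OF cov])
  obtain a where a: "\<And>h Q. h \<in> H \<Longrightarrow> Q \<in> D h \<Longrightarrow> s Q = fr Q (a h) h" using H(2) by (simp add: subset_iff) metis
  have "\<exists>m. \<pi> ((h * h') ^ m * (a h * h' - a h' * h)) = \<zero>" if h: "h \<in> H" "h' \<in> H" for h h'
  proof (rule support_power)
    fix P assume P: "P \<in> D (h * h')"
    then have pr: "primeideal P A" "\<pi> h \<notin> P" "\<pi> h' \<notin> P" using D_mult[of h h'] by (auto simp: D_def)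
    have "fr P (a h) h = fr P (a h') h'" using a[OF h(1), of P] a[OF h(2), of P] P by (simp add: D_mult)
    then obtain u where "\<pi> u \<notin> P" "\<pi> (u * (a h * h')) = \<pi> (u * (a h' * h))" using fr_eq_iff[OF pr] by blast
    then show "\<exists>u. \<pi> u \<notin> P \<and> \<pi> (u * (a h * h' - a h' * h)) = \<zero>"
      using pi_eq_iff by (auto simp: right_diff_distrib)
  qed
  then have "\<forall>x\<in>H \<times> H. \<exists>m. \<pi> ((fst x * snd x) ^ m * (a (fst x) * snd x - a (snd x) * fst x)) = \<zero>" by auto
  then obtain m where m: "\<forall>x\<in>H \<times> H. \<pi> ((fst x * snd x) ^ m x * (a (fst x) * snd x - a (snd x) * fst x)) = \<zero>"
    using bchoice[of "H \<times> H" "\<lambda>x m. \<pi> ((fst x * snd x) ^ m * (a (fst x) * snd x - a (snd x) * fst x)) = \<zero>"] by blast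
  define K where "K = Max (m ` (H \<times> H))"
  have K: "\<pi> ((h * h') ^ K * (a h * h' - a h' * h)) = \<zero>" if "h \<in> H" "h' \<in> H" for h h'
  proof -
    have "m (h, h') \<le> K" unfolding K_def using that H(1) by (intro Max_ge) auto
    then have "(h * h') ^ K * (a h * h' - a h' * h)
        = (h * h') ^ (K - m (h, h')) * ((h * h') ^ m (h, h') * (a h * h' - a h' * h))"
      by (simp add: mult.assoc[symmetric] power_add[symmetric])
    moreover have "\<pi> ((h * h') ^ m (h, h') * (a h * h' - a h' * h)) = \<zero>" using m that by auto
    ultimately show ?thesis by (simp add: pi_mult)
  qed
  \<comment> \<open>Multiplying numerator and denominator by \<open>h ^ K\<close> inserts the factor
    \<open>(h * h') ^ K\<close> into the difference of the cross products, and that factor kills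
    it.\<close>
  define A' where "A' h = a h * h ^ K" for h
  define B where "B h = h ^ Suc K" for h :: 'r
  have cross: "\<pi> (A' h * B h') = \<pi> (A' h' * B h)" if "h \<in> H" "h' \<in> H" for h h'
  proof -
    have "A' h * B h' - A' h' * B h = (h * h') ^ K * (a h * h' - a h' * h)"
      by (simp add: A'_def B_def power_mult_distrib algebra_simps)
    then show ?thesis using K[OF that] pi_eq_iff by metis
  qed
  have DB: "D (B h) = D h" for h unfolding B_def by (rule D_power) simp
  have "D f \<subseteq> (\<Union>h\<in>H. D (B h))" using cov DB by auto
  then obtain N' H' c' where H': "finite H'" "H' \<subseteq> H" "\<pi> (f ^ N') = \<pi> (\<Sum>h\<in>H'. c' h * B h)"
    using cover_combination[of f B H] by blast
  have pi_sum_cong: "\<pi> (\<Sum>i\<in>I. p i) = \<pi> (\<Sum>i\<in>I. q i)" if "finite I" "\<And>i. i \<in> I \<Longrightarrow> \<pi> (p i) = \<pi> (q i)" for I and p q :: "'r \<Rightarrow> 'r"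
    using that by (induction I rule: finite_induct) (auto simp: pi_add)
  have "s P = fr P (\<Sum>h\<in>H'. c' h * A' h) (f ^ N')" if P: "P \<in> D f" for P
  proof -
    obtain h where h: "h \<in> H" "P \<in> D h" using cov P by blast
    have pr: "primeideal P A" "\<pi> f \<notin> P" "\<pi> h \<notin> P" using P h by (auto simp: D_def)
    have "\<pi> ((\<Sum>k\<in>H'. c' k * A' k) * B h) = \<pi> (\<Sum>k\<in>H'. c' k * (A' k * B h))"
      by (simp add: sum_distrib_right mult.assoc)
    also have "\<dots> = \<pi> (\<Sum>k\<in>H'. c' k * (A' h * B k))"
      by (rule pi_sum_cong[OF H'(1)]) (use cross h(1) H'(2) in \<open>auto intro!: pi_cong_mult\<close>)
    also have "\<dots> = \<pi> (A' h * (\<Sum>k\<in>H'. c' k * B k))" by (simp add: sum_distrib_left ac_simps)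
    also have "\<dots> = \<pi> (A' h * f ^ N')" by (rule pi_cong_mult[OF H'(3)[symmetric]])
    finally have eq: "\<pi> ((\<Sum>k\<in>H'. c' k * A' k) * B h) = \<pi> (A' h * f ^ N')" .
    have "fr P (\<Sum>k\<in>H'. c' k * A' k) (f ^ N') = fr P (A' h) (B h)"
      using eq pr prime_power[OF pr(1)] by (intro fr_eqI) (auto simp: B_def simp del: power_Suc)
    also have "\<dots> = fr P (a h) h"
      using pr prime_power[OF pr(1,3)] by (intro fr_eqI) (auto simp: B_def A'_def ac_simps simp del: power_Suc, simp add: ac_simps)
    finally show ?thesis using a h by simp
  qed
  then show thesis by (rule that)
qed

lemma sec_simps:
  "s \<otimes>\<^bsub>sec \<O> U\<^esub> t = (\<lambda>P\<in>U. s P \<otimes>\<^bsub>stalk P\<^esub> t P)" "\<one>\<^bsub>sec \<O> U\<^esub> = (\<lambda>P\<in>U. \<one>\<^bsub>stalk P\<^esub>)"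
  "\<zero>\<^bsub>sec \<O> U\<^esub> = (\<lambda>P\<in>U. \<zero>\<^bsub>stalk P\<^esub>)" "s \<oplus>\<^bsub>sec \<O> U\<^esub> t = (\<lambda>P\<in>U. s P \<oplus>\<^bsub>stalk P\<^esub> t P)"
  by (simp_all add: structure_sheaf_def)

lemma section_in_stalk: "s \<in> carrier (sec \<O> U) \<Longrightarrow> P \<in> U \<Longrightarrow> s P \<in> carrier (stalk P)"
  by (metis fr_stalk section_stalk)

lemma regular_mult:
  assumes "openin (Spec A) V" "regular V s" "regular V t"
  shows "regular V (\<lambda>P. s P \<otimes>\<^bsub>stalk P\<^esub> t P)"
proof -
  obtain a f b g where "\<forall>Q\<in>V. \<pi> f \<notin> Q \<and> s Q = fr Q a f" "\<forall>Q\<in>V. \<pi> g \<notin> Q \<and> t Q = fr Q b g"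
    using assms by (auto simp: regular_def)
  then have "\<forall>Q\<in>V. \<pi> (f * g) \<notin> Q \<and> s Q \<otimes>\<^bsub>stalk Q\<^esub> t Q = fr Q (a * b) (f * g)"
    using open_prime[OF assms(1)] by (auto simp: fr_mult prime_mult)
  then show ?thesis unfolding regular_def by blast
qed

lemma regular_add:
  assumes "openin (Spec A) V" "regular V s" "regular V t"
  shows "regular V (\<lambda>P. s P \<oplus>\<^bsub>stalk P\<^esub> t P)"
proof -
  obtain a f b g where "\<forall>Q\<in>V. \<pi> f \<notin> Q \<and> s Q = fr Q a f" "\<forall>Q\<in>V. \<pi> g \<notin> Q \<and> t Q = fr Q b g"
    using assms by (auto simp: regular_def)
  then have "\<forall>Q\<in>V. \<pi> (f * g) \<notin> Q \<and> s Q \<oplus>\<^bsub>stalk Q\<^esub> t Q = fr Q (a * g + b * f) (f * g)"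
    using open_prime[OF assms(1)] by (auto simp: fr_add prime_mult)
  then show ?thesis unfolding regular_def by blast
qed

end


section \<open>Twisting the structure sheaf by a cocycle\<close>

context presented_ring
begin

lemma cring_stalk: "openin (Spec A) U \<Longrightarrow> P \<in> U \<Longrightarrow> cring (stalk P)"
  using stalk_cring open_prime by blast

lemma section_mult_closed:
  assumes U: "openin (Spec A) U" and s: "s \<in> carrier (sec \<O> U)" and t: "t \<in> carrier (sec \<O> U)"
  shows "s \<otimes>\<^bsub>sec \<O> U\<^esub> t \<in> carrier (sec \<O> U)"
  unfolding sections_eq sec_simps
proof (intro CollectI conjI ballI)
  fix P assume P: "P \<in> U"
  obtain V where V: "openin (Spec A) V" "P \<in> V" "V \<subseteq> U" "regular V s" using s P by (auto simp: sections_eq)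
  obtain W where W: "openin (Spec A) W" "P \<in> W" "W \<subseteq> U" "regular W t" using t P by (auto simp: sections_eq)
  have VW: "openin (Spec A) (V \<inter> W)" using V W by blast
  have "regular (V \<inter> W) (\<lambda>P. s P \<otimes>\<^bsub>stalk P\<^esub> t P)"
    by (rule regular_mult[OF VW]) (rule regular_mono[OF V(4)] regular_mono[OF W(4)]; auto)+
  then have "regular (V \<inter> W) (\<lambda>P\<in>U. s P \<otimes>\<^bsub>stalk P\<^esub> t P)" by (rule regular_mono) (use V in auto)
  then show "\<exists>V. openin (Spec A) V \<and> P \<in> V \<and> V \<subseteq> U \<and> regular V (\<lambda>P\<in>U. s P \<otimes>\<^bsub>stalk P\<^esub> t P)"
    using VW V W by (intro exI[of _ "V \<inter> W"]) auto
qed auto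

lemma section_add_closed:
  assumes U: "openin (Spec A) U" and s: "s \<in> carrier (sec \<O> U)" and t: "t \<in> carrier (sec \<O> U)"
  shows "s \<oplus>\<^bsub>sec \<O> U\<^esub> t \<in> carrier (sec \<O> U)"
  unfolding sections_eq sec_simps
proof (intro CollectI conjI ballI)
  fix P assume P: "P \<in> U"
  obtain V where V: "openin (Spec A) V" "P \<in> V" "V \<subseteq> U" "regular V s" using s P by (auto simp: sections_eq)
  obtain W where W: "openin (Spec A) W" "P \<in> W" "W \<subseteq> U" "regular W t" using t P by (auto simp: sections_eq)
  have VW: "openin (Spec A) (V \<inter> W)" using V W by blast
  have "regular (V \<inter> W) (\<lambda>P. s P \<oplus>\<^bsub>stalk P\<^esub> t P)"
    by (rule regular_add[OF VW]) (rule regular_mono[OF V(4)] regular_mono[OF W(4)]; auto)+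
  then have "regular (V \<inter> W) (\<lambda>P\<in>U. s P \<oplus>\<^bsub>stalk P\<^esub> t P)" by (rule regular_mono) (use V in auto)
  then show "\<exists>V. openin (Spec A) V \<and> P \<in> V \<and> V \<subseteq> U \<and> regular V (\<lambda>P\<in>U. s P \<oplus>\<^bsub>stalk P\<^esub> t P)"
    using VW V W by (intro exI[of _ "V \<inter> W"]) auto
qed auto

lemma constant_section: "openin (Spec A) U \<Longrightarrow> (\<lambda>P\<in>U. fr P a 1) \<in> carrier (sec \<O> U)"
  by (rule basic_section) (auto dest: open_prime simp: prime_one)

lemma stalk_neg_one: "primeideal P A \<Longrightarrow> fr P (- 1) 1 \<oplus>\<^bsub>stalk P\<^esub> \<one>\<^bsub>stalk P\<^esub> = \<zero>\<^bsub>stalk P\<^esub>"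
  by (simp add: stalk_one stalk_zero fr_add prime_one)

lemma stalk_neg:
  assumes P: "primeideal P A" and x: "x \<in> carrier (stalk P)"
  shows "fr P (- 1) 1 \<otimes>\<^bsub>stalk P\<^esub> x \<oplus>\<^bsub>stalk P\<^esub> x = \<zero>\<^bsub>stalk P\<^esub>"
proof -
  interpret S: cring "stalk P" using stalk_cring[OF P] .
  have n: "fr P (- 1) 1 \<in> carrier (stalk P)" using prime_one[OF P] by (rule fr_stalk)
  have "fr P (- 1) 1 \<otimes>\<^bsub>stalk P\<^esub> x \<oplus>\<^bsub>stalk P\<^esub> \<one>\<^bsub>stalk P\<^esub> \<otimes>\<^bsub>stalk P\<^esub> x = \<zero>\<^bsub>stalk P\<^esub> \<otimes>\<^bsub>stalk P\<^esub> x"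
    using S.l_distr[OF n S.one_closed x] stalk_neg_one[OF P] by simp
  then show ?thesis using x by simp
qed

lemma stalk_simps:
  assumes "primeideal P A" "x \<in> carrier (stalk P)"
  shows "\<one>\<^bsub>stalk P\<^esub> \<otimes>\<^bsub>stalk P\<^esub> x = x" "\<zero>\<^bsub>stalk P\<^esub> \<oplus>\<^bsub>stalk P\<^esub> x = x"
proof -
  interpret S: cring "stalk P" using stalk_cring[OF assms(1)] .
  show "\<one>\<^bsub>stalk P\<^esub> \<otimes>\<^bsub>stalk P\<^esub> x = x" "\<zero>\<^bsub>stalk P\<^esub> \<oplus>\<^bsub>stalk P\<^esub> x = x" using assms(2) by auto
qed

lemma stalk_distr:
  assumes "primeideal P A" "x \<in> carrier (stalk P)" "y \<in> carrier (stalk P)" "z \<in> carrier (stalk P)"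
  shows "x \<otimes>\<^bsub>stalk P\<^esub> (y \<oplus>\<^bsub>stalk P\<^esub> z) = x \<otimes>\<^bsub>stalk P\<^esub> y \<oplus>\<^bsub>stalk P\<^esub> x \<otimes>\<^bsub>stalk P\<^esub> z"
proof -
  interpret S: cring "stalk P" using stalk_cring[OF assms(1)] .
  show ?thesis using S.r_distr[OF assms(3,4,2)] .
qed

lemma sections_cring:
  assumes U: "openin (Spec A) U"
  shows "cring (sec \<O> U)"
proof (intro cringI abelian_groupI comm_monoidI)
  have pr: "cring (stalk P)" if "P \<in> U" for P using cring_stalk[OF U that] .
  note ext = extensionalityI[of _ U]
  have one: "\<one>\<^bsub>sec \<O> U\<^esub> \<in> carrier (sec \<O> U)" using constant_section[OF U, of 1] by (simp add: sec_simps stalk_one)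
  have zero: "\<zero>\<^bsub>sec \<O> U\<^esub> \<in> carrier (sec \<O> U)" using constant_section[OF U, of 0] by (simp add: sec_simps stalk_zero)
  show "\<one>\<^bsub>sec \<O> U\<^esub> \<in> carrier (sec \<O> U)" "\<zero>\<^bsub>sec \<O> U\<^esub> \<in> carrier (sec \<O> U)" by (rule one zero)+
  fix s t r assume s: "s \<in> carrier (sec \<O> U)"
  have sP: "s P \<in> carrier (stalk P)" if "P \<in> U" for P using section_in_stalk[OF s that] .
  have sE: "s \<in> extensional U" using s by (auto simp: sections_eq)
  show "\<zero>\<^bsub>sec \<O> U\<^esub> \<oplus>\<^bsub>sec \<O> U\<^esub> s = s" "\<one>\<^bsub>sec \<O> U\<^esub> \<otimes>\<^bsub>sec \<O> U\<^esub> s = s"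
    by (rule ext; simp add: sec_simps sE stalk_simps[OF open_prime[OF U]] sP cring.cring_simprules(2,6)[OF pr])+
  show "\<exists>y\<in>carrier (sec \<O> U). y \<oplus>\<^bsub>sec \<O> U\<^esub> s = \<zero>\<^bsub>sec \<O> U\<^esub>"
  proof
    show "(\<lambda>P\<in>U. fr P (- 1) 1) \<otimes>\<^bsub>sec \<O> U\<^esub> s \<in> carrier (sec \<O> U)"
      using section_mult_closed[OF U constant_section[OF U] s] .
    show "(\<lambda>P\<in>U. fr P (- 1) 1) \<otimes>\<^bsub>sec \<O> U\<^esub> s \<oplus>\<^bsub>sec \<O> U\<^esub> s = \<zero>\<^bsub>sec \<O> U\<^esub>"
      by (rule ext) (simp_all add: sec_simps stalk_neg[OF open_prime[OF U]] sP)
  qed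
  assume t: "t \<in> carrier (sec \<O> U)"
  show "s \<oplus>\<^bsub>sec \<O> U\<^esub> t \<in> carrier (sec \<O> U)" using section_add_closed[OF U s t] .
  show "s \<otimes>\<^bsub>sec \<O> U\<^esub> t \<in> carrier (sec \<O> U)" using section_mult_closed[OF U s t] .
  have tP: "t P \<in> carrier (stalk P)" if "P \<in> U" for P using section_in_stalk[OF t that] .
  show "s \<oplus>\<^bsub>sec \<O> U\<^esub> t = t \<oplus>\<^bsub>sec \<O> U\<^esub> s" "s \<otimes>\<^bsub>sec \<O> U\<^esub> t = t \<otimes>\<^bsub>sec \<O> U\<^esub> s"
    by (rule ext; simp add: sec_simps cring.cring_simprules[OF pr] sP tP)+
  assume r: "r \<in> carrier (sec \<O> U)"
  have rP: "r P \<in> carrier (stalk P)" if "P \<in> U" for P using section_in_stalk[OF r that] .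
  show "s \<oplus>\<^bsub>sec \<O> U\<^esub> t \<oplus>\<^bsub>sec \<O> U\<^esub> r = s \<oplus>\<^bsub>sec \<O> U\<^esub> (t \<oplus>\<^bsub>sec \<O> U\<^esub> r)"
    "s \<otimes>\<^bsub>sec \<O> U\<^esub> t \<otimes>\<^bsub>sec \<O> U\<^esub> r = s \<otimes>\<^bsub>sec \<O> U\<^esub> (t \<otimes>\<^bsub>sec \<O> U\<^esub> r)"
    "(s \<oplus>\<^bsub>sec \<O> U\<^esub> t) \<otimes>\<^bsub>sec \<O> U\<^esub> r = s \<otimes>\<^bsub>sec \<O> U\<^esub> r \<oplus>\<^bsub>sec \<O> U\<^esub> t \<otimes>\<^bsub>sec \<O> U\<^esub> r"
    by (rule ext; simp add: sec_simps cring.cring_simprules[OF pr] sP tP rP)+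
qed

lemma ring_space:
  assumes T: "\<And>U. openin T U \<Longrightarrow> openin (Spec A) U"
  shows "ring_space T \<O>"
proof (intro ring_space.intro ring_space_axioms.intro)
  show "sheaf T \<O>"
    by (rule local_sections_sheaf[of T _ "Spec A" regular]) (use sections_eq regular_mono T in auto)
qed (auto simp: sec_simps fun_eq_iff)

end

text \<open>The invertible sheaf with transition functions \<open>h k / h j\<close>.  Its sections are germs in the stalks of
  the structure sheaf itself, made regular on \<open>C j\<close> by the unit \<open>h j\<close>; the family \<open>h j\<close> of germs need
  not be locally given by one fraction, only the quotients are.\<close>

locale twisted_module = presented_ring A \<pi>
  for A :: "'a ring" (structure) and \<pi> :: "'r::comm_ring_1 \<Rightarrow> 'a" +
  fixes T :: "'a set topology" and J :: "'j set" and C :: "'j \<Rightarrow> 'a set set"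
    and h h' :: "'j \<Rightarrow> 'a set \<Rightarrow> ('a \<times> 'a) set"
  assumes T: "openin T U \<Longrightarrow> openin (Spec A) U"
    and open_C: "j \<in> J \<Longrightarrow> openin T (C j)" and cover: "topspace T \<subseteq> \<Union>(C ` J)"
    and h: "j \<in> J \<Longrightarrow> P \<in> C j \<Longrightarrow> h j P \<in> carrier (stalk P)"
      "j \<in> J \<Longrightarrow> P \<in> C j \<Longrightarrow> h' j P \<in> carrier (stalk P)"
      "j \<in> J \<Longrightarrow> P \<in> C j \<Longrightarrow> h j P \<otimes>\<^bsub>stalk P\<^esub> h' j P = \<one>\<^bsub>stalk P\<^esub>"
    and transition: "j \<in> J \<Longrightarrow> k \<in> J \<Longrightarrow> P \<in> C j \<inter> C k \<Longrightarrow>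
      \<exists>V. openin (Spec A) V \<and> P \<in> V \<and> V \<subseteq> C j \<inter> C k \<and> regular V (\<lambda>Q. h k Q \<otimes>\<^bsub>stalk Q\<^esub> h' j Q)"
begin

text \<open>Membership in the stalks is demanded separately: that the product with
  \<open>h j Q\<close> is a fraction does not make \<open>s Q\<close> an element of the
  stalk.\<close>

definition twisted_regular :: "'a set set \<Rightarrow> ('a set \<Rightarrow> ('a \<times> 'a) set) \<Rightarrow> bool" where
  "twisted_regular V s \<longleftrightarrow> (\<forall>P\<in>V. s P \<in> carrier (stalk P)) \<and>
     (\<exists>j\<in>J. V \<subseteq> C j \<and> regular V (\<lambda>Q. h j Q \<otimes>\<^bsub>stalk Q\<^esub> s Q))"

definition \<L> :: "('a set, 'a set \<Rightarrow> ('a \<times> 'a) set, 'a set \<Rightarrow> ('a \<times> 'a) set) module_sheaf" where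
  "\<L> = \<lparr>sec = (\<lambda>U.
     \<lparr>carrier = {s \<in> extensional U. \<forall>P\<in>U. \<exists>V. openin (Spec A) V \<and> P \<in> V \<and> V \<subseteq> U \<and> twisted_regular V s},
      monoid.mult = (\<lambda>s t. s), monoid.one = (\<lambda>P\<in>U. \<zero>\<^bsub>stalk P\<^esub>),
      ring.zero = (\<lambda>P\<in>U. \<zero>\<^bsub>stalk P\<^esub>), ring.add = (\<lambda>s t. \<lambda>P\<in>U. s P \<oplus>\<^bsub>stalk P\<^esub> t P),
      module.smult = (\<lambda>a s. \<lambda>P\<in>U. a P \<otimes>\<^bsub>stalk P\<^esub> s P)\<rparr>),
     res = (\<lambda>U V s. restrict s V)\<rparr>"

lemma L_simps:
  "carrier (sec \<L> U) = {s \<in> extensional U. \<forall>P\<in>U. \<exists>V. openin (Spec A) V \<and> P \<in> V \<and> V \<subseteq> U \<and> twisted_regular V s}"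
  "\<zero>\<^bsub>sec \<L> U\<^esub> = (\<lambda>P\<in>U. \<zero>\<^bsub>stalk P\<^esub>)"
  "s \<oplus>\<^bsub>sec \<L> U\<^esub> t = (\<lambda>P\<in>U. s P \<oplus>\<^bsub>stalk P\<^esub> t P)"
  "a \<odot>\<^bsub>sec \<L> U\<^esub> s = (\<lambda>P\<in>U. a P \<otimes>\<^bsub>stalk P\<^esub> s P)"
  "res \<L> U V s = restrict s V"
  by (simp_all add: \<L>_def)

lemma twisted_regular_mono:
  "twisted_regular V s \<Longrightarrow> V' \<subseteq> V \<Longrightarrow> (\<And>P. P \<in> V' \<Longrightarrow> s' P = s P) \<Longrightarrow> twisted_regular V' s'"
proof -
  assume s: "twisted_regular V s" and V': "V' \<subseteq> V" and eq: "\<And>P. P \<in> V' \<Longrightarrow> s' P = s P"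
  then obtain j where j: "j \<in> J" "V \<subseteq> C j" "regular V (\<lambda>Q. h j Q \<otimes>\<^bsub>stalk Q\<^esub> s Q)" by (auto simp: twisted_regular_def)
  have "regular V' (\<lambda>Q. h j Q \<otimes>\<^bsub>stalk Q\<^esub> s' Q)" by (rule regular_mono[OF j(3) V']) (simp add: eq)
  moreover have "s' P \<in> carrier (stalk P)" if "P \<in> V'" for P
    using s V' eq[OF that] that unfolding twisted_regular_def by auto
  moreover have "V' \<subseteq> C j" using V' j(2) by blast
  ultimately show ?thesis using j(1) unfolding twisted_regular_def by blast
qed

lemma sheaf_L: "sheaf T \<L>"
  by (rule local_sections_sheaf[of T _ "Spec A" twisted_regular]) (use L_simps twisted_regular_mono T in auto)

lemma open_int: "openin T U \<Longrightarrow> openin T V \<Longrightarrow> openin (Spec A) (U \<inter> V)"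
  using T by (meson openin_Int)

lemma stalk_of_open: "openin T U \<Longrightarrow> P \<in> U \<Longrightarrow> cring (stalk P)"
  using cring_stalk T by blast

lemma L_stalk: "s \<in> carrier (sec \<L> U) \<Longrightarrow> P \<in> U \<Longrightarrow> s P \<in> carrier (stalk P)"
  unfolding L_simps twisted_regular_def by blast

text \<open>Regularity in one chart implies regularity in any other one containing the point:
  multiply by the transition function, which is regular.\<close>

lemma L_regular:
  assumes s: "s \<in> carrier (sec \<L> U)" and P: "P \<in> U" and k: "k \<in> J" "P \<in> C k"
  shows "\<exists>V. openin (Spec A) V \<and> P \<in> V \<and> V \<subseteq> U \<inter> C k \<and> regular V (\<lambda>Q. h k Q \<otimes>\<^bsub>stalk Q\<^esub> s Q)"
proof -
  obtain V j where V: "openin (Spec A) V" "P \<in> V" "V \<subseteq> U" and j: "j \<in> J" "V \<subseteq> C j"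
    and reg: "regular V (\<lambda>Q. h j Q \<otimes>\<^bsub>stalk Q\<^esub> s Q)"
    using s P unfolding L_simps twisted_regular_def by blast
  obtain W where W: "openin (Spec A) W" "P \<in> W" "W \<subseteq> C j \<inter> C k" and tr: "regular W (\<lambda>Q. h k Q \<otimes>\<^bsub>stalk Q\<^esub> h' j Q)"
    using transition[OF j(1) k(1), of P] V j k by blast
  have VW: "openin (Spec A) (V \<inter> W)" using V W by blast
  have "regular (V \<inter> W) (\<lambda>Q. (h k Q \<otimes>\<^bsub>stalk Q\<^esub> h' j Q) \<otimes>\<^bsub>stalk Q\<^esub> (h j Q \<otimes>\<^bsub>stalk Q\<^esub> s Q))"
    by (rule regular_mult[OF VW]) (rule regular_mono[OF tr] regular_mono[OF reg]; auto)+
  then have "regular (V \<inter> W) (\<lambda>Q. h k Q \<otimes>\<^bsub>stalk Q\<^esub> s Q)"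
  proof (rule regular_mono)
    fix Q assume Q: "Q \<in> V \<inter> W"
    interpret SQ: cring "stalk Q" using cring_stalk[OF V(1)] Q by blast
    have cl: "h k Q \<in> carrier (stalk Q)" "h j Q \<in> carrier (stalk Q)" "h' j Q \<in> carrier (stalk Q)" "s Q \<in> carrier (stalk Q)"
      using h j k Q V W L_stalk[OF s] by auto
    have "(h k Q \<otimes>\<^bsub>stalk Q\<^esub> h' j Q) \<otimes>\<^bsub>stalk Q\<^esub> (h j Q \<otimes>\<^bsub>stalk Q\<^esub> s Q)
        = (h j Q \<otimes>\<^bsub>stalk Q\<^esub> h' j Q) \<otimes>\<^bsub>stalk Q\<^esub> (h k Q \<otimes>\<^bsub>stalk Q\<^esub> s Q)"
      using cl by (simp add: SQ.m_ac)
    then show "h k Q \<otimes>\<^bsub>stalk Q\<^esub> s Q = (h k Q \<otimes>\<^bsub>stalk Q\<^esub> h' j Q) \<otimes>\<^bsub>stalk Q\<^esub> (h j Q \<otimes>\<^bsub>stalk Q\<^esub> s Q)"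
      using cl h(3)[OF j(1)] Q j by auto
  qed auto
  then show ?thesis using VW V W by (intro exI[of _ "V \<inter> W"]) auto
qed

lemma L_sectionI:
  assumes "s \<in> extensional U" and U: "openin T U" and s: "\<And>P. P \<in> U \<Longrightarrow> s P \<in> carrier (stalk P)"
    and "\<And>P. P \<in> U \<Longrightarrow> \<exists>k\<in>J. \<exists>V. openin (Spec A) V \<and> P \<in> V \<and> V \<subseteq> U \<inter> C k \<and> regular V (\<lambda>Q. h k Q \<otimes>\<^bsub>stalk Q\<^esub> s Q)"
  shows "s \<in> carrier (sec \<L> U)"
  unfolding L_simps twisted_regular_def
proof (intro CollectI conjI ballI assms(1))
  fix P assume "P \<in> U"
  then obtain k V where "k \<in> J" "openin (Spec A) V" "P \<in> V" "V \<subseteq> U \<inter> C k" "regular V (\<lambda>Q. h k Q \<otimes>\<^bsub>stalk Q\<^esub> s Q)"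
    using assms(4) by blast
  then show "\<exists>V. openin (Spec A) V \<and> P \<in> V \<and> V \<subseteq> U \<and> (\<forall>P\<in>V. s P \<in> carrier (stalk P)) \<and>
      (\<exists>j\<in>J. V \<subseteq> C j \<and> regular V (\<lambda>Q. h j Q \<otimes>\<^bsub>stalk Q\<^esub> s Q))"
    using s by blast
qed

lemma in_cover: "openin T U \<Longrightarrow> P \<in> U \<Longrightarrow> \<exists>k\<in>J. P \<in> C k"
  using cover openin_subset by fastforce

lemma L_smult_closed:
  assumes U: "openin T U" and a: "a \<in> carrier (sec \<O> U)" and s: "s \<in> carrier (sec \<L> U)"
  shows "a \<odot>\<^bsub>sec \<L> U\<^esub> s \<in> carrier (sec \<L> U)"
proof (rule L_sectionI[OF _ U])
  show "a \<odot>\<^bsub>sec \<L> U\<^esub> s \<in> extensional U" by (simp add: L_simps)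
  fix P assume P: "P \<in> U"
  have cl: "a P \<in> carrier (stalk P)" "s P \<in> carrier (stalk P)" if "P \<in> U" for P
    using section_in_stalk[OF a that] L_stalk[OF s that] by auto
  interpret S: cring "stalk P" using stalk_of_open[OF U P] .
  show "(a \<odot>\<^bsub>sec \<L> U\<^esub> s) P \<in> carrier (stalk P)" using cl[OF P] P by (simp add: L_simps)
  obtain k where k: "k \<in> J" "P \<in> C k" using in_cover[OF U P] by blast
  obtain V where V: "openin (Spec A) V" "P \<in> V" "V \<subseteq> U \<inter> C k" "regular V (\<lambda>Q. h k Q \<otimes>\<^bsub>stalk Q\<^esub> s Q)"
    using L_regular[OF s P k] by blast
  obtain W where W: "openin (Spec A) W" "P \<in> W" "W \<subseteq> U" "regular W a" using a P unfolding sections_eq by blast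
  have VW: "openin (Spec A) (V \<inter> W)" using V W by blast
  have "regular (V \<inter> W) (\<lambda>Q. a Q \<otimes>\<^bsub>stalk Q\<^esub> (h k Q \<otimes>\<^bsub>stalk Q\<^esub> s Q))"
    by (rule regular_mult[OF VW]) (rule regular_mono[OF W(4)] regular_mono[OF V(4)]; auto)+
  then have "regular (V \<inter> W) (\<lambda>Q. h k Q \<otimes>\<^bsub>stalk Q\<^esub> (a \<odot>\<^bsub>sec \<L> U\<^esub> s) Q)"
  proof (rule regular_mono)
    fix Q assume "Q \<in> V \<inter> W"
    then have Q: "Q \<in> U" "Q \<in> C k" using V by auto
    interpret SQ: cring "stalk Q" using stalk_of_open[OF U Q(1)] .
    show "h k Q \<otimes>\<^bsub>stalk Q\<^esub> (a \<odot>\<^bsub>sec \<L> U\<^esub> s) Q = a Q \<otimes>\<^bsub>stalk Q\<^esub> (h k Q \<otimes>\<^bsub>stalk Q\<^esub> s Q)"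
      using cl[OF Q(1)] h(1)[OF k(1) Q(2)] Q by (simp add: L_simps SQ.m_lcomm)
  qed auto
  then show "\<exists>k\<in>J. \<exists>V. openin (Spec A) V \<and> P \<in> V \<and> V \<subseteq> U \<inter> C k \<and> regular V (\<lambda>Q. h k Q \<otimes>\<^bsub>stalk Q\<^esub> (a \<odot>\<^bsub>sec \<L> U\<^esub> s) Q)"
    using VW V W k by (intro bexI[of _ k] exI[of _ "V \<inter> W"]) auto
qed

lemma L_add_closed:
  assumes U: "openin T U" and s: "s \<in> carrier (sec \<L> U)" and t: "t \<in> carrier (sec \<L> U)"
  shows "s \<oplus>\<^bsub>sec \<L> U\<^esub> t \<in> carrier (sec \<L> U)"
proof (rule L_sectionI[OF _ U])
  show "s \<oplus>\<^bsub>sec \<L> U\<^esub> t \<in> extensional U" by (simp add: L_simps)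
  fix P assume P: "P \<in> U"
  have cl: "s P \<in> carrier (stalk P)" "t P \<in> carrier (stalk P)" if "P \<in> U" for P
    using L_stalk[OF s that] L_stalk[OF t that] by auto
  interpret S: cring "stalk P" using stalk_of_open[OF U P] .
  show "(s \<oplus>\<^bsub>sec \<L> U\<^esub> t) P \<in> carrier (stalk P)" using cl[OF P] P by (simp add: L_simps)
  obtain k where k: "k \<in> J" "P \<in> C k" using in_cover[OF U P] by blast
  obtain V where V: "openin (Spec A) V" "P \<in> V" "V \<subseteq> U \<inter> C k" "regular V (\<lambda>Q. h k Q \<otimes>\<^bsub>stalk Q\<^esub> s Q)"
    using L_regular[OF s P k] by blast
  obtain W where W: "openin (Spec A) W" "P \<in> W" "W \<subseteq> U \<inter> C k" "regular W (\<lambda>Q. h k Q \<otimes>\<^bsub>stalk Q\<^esub> t Q)"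
    using L_regular[OF t P k] by blast
  have VW: "openin (Spec A) (V \<inter> W)" using V W by blast
  have "regular (V \<inter> W) (\<lambda>Q. h k Q \<otimes>\<^bsub>stalk Q\<^esub> s Q \<oplus>\<^bsub>stalk Q\<^esub> h k Q \<otimes>\<^bsub>stalk Q\<^esub> t Q)"
    by (rule regular_add[OF VW]) (rule regular_mono[OF V(4)] regular_mono[OF W(4)]; auto)+
  then have "regular (V \<inter> W) (\<lambda>Q. h k Q \<otimes>\<^bsub>stalk Q\<^esub> (s \<oplus>\<^bsub>sec \<L> U\<^esub> t) Q)"
  proof (rule regular_mono)
    fix Q assume "Q \<in> V \<inter> W"
    then have Q: "Q \<in> U" "Q \<in> C k" using V by auto
    interpret SQ: cring "stalk Q" using stalk_of_open[OF U Q(1)] .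
    show "h k Q \<otimes>\<^bsub>stalk Q\<^esub> (s \<oplus>\<^bsub>sec \<L> U\<^esub> t) Q = h k Q \<otimes>\<^bsub>stalk Q\<^esub> s Q \<oplus>\<^bsub>stalk Q\<^esub> h k Q \<otimes>\<^bsub>stalk Q\<^esub> t Q"
      using cl[OF Q(1)] h(1)[OF k(1) Q(2)] Q by (simp add: L_simps SQ.r_distr)
  qed auto
  then show "\<exists>k\<in>J. \<exists>V. openin (Spec A) V \<and> P \<in> V \<and> V \<subseteq> U \<inter> C k \<and> regular V (\<lambda>Q. h k Q \<otimes>\<^bsub>stalk Q\<^esub> (s \<oplus>\<^bsub>sec \<L> U\<^esub> t) Q)"
    using VW V W k by (intro bexI[of _ k] exI[of _ "V \<inter> W"]) auto
qed

lemma L_zero_closed: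
  assumes U: "openin T U"
  shows "\<zero>\<^bsub>sec \<L> U\<^esub> \<in> carrier (sec \<L> U)"
proof (rule L_sectionI[OF _ U])
  show "\<zero>\<^bsub>sec \<L> U\<^esub> \<in> extensional U" by (simp add: L_simps)
  fix P assume P: "P \<in> U"
  interpret S: cring "stalk P" using stalk_of_open[OF U P] .
  show "\<zero>\<^bsub>sec \<L> U\<^esub> P \<in> carrier (stalk P)" using P by (simp add: L_simps)
  obtain k where k: "k \<in> J" "P \<in> C k" using in_cover[OF U P] by blast
  let ?V = "U \<inter> C k"
  have V: "openin (Spec A) ?V" using open_int[OF U open_C[OF k(1)]] .
  have "\<pi> 1 \<notin> Q \<and> h k Q \<otimes>\<^bsub>stalk Q\<^esub> \<zero>\<^bsub>sec \<L> U\<^esub> Q = fr Q 0 1" if Q: "Q \<in> ?V" for Q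
  proof -
    interpret SQ: cring "stalk Q" using stalk_of_open[OF U] Q by blast
    have "h k Q \<otimes>\<^bsub>stalk Q\<^esub> \<zero>\<^bsub>stalk Q\<^esub> = \<zero>\<^bsub>stalk Q\<^esub>" using h(1) k(1) Q by simp
    then show ?thesis using Q prime_one[OF open_prime[OF V Q]] by (simp add: L_simps stalk_zero)
  qed
  then have "regular ?V (\<lambda>Q. h k Q \<otimes>\<^bsub>stalk Q\<^esub> \<zero>\<^bsub>sec \<L> U\<^esub> Q)" unfolding regular_def by blast
  then show "\<exists>k\<in>J. \<exists>V. openin (Spec A) V \<and> P \<in> V \<and> V \<subseteq> U \<inter> C k \<and> regular V (\<lambda>Q. h k Q \<otimes>\<^bsub>stalk Q\<^esub> \<zero>\<^bsub>sec \<L> U\<^esub> Q)"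
    using V P k by (intro bexI[of _ k] exI[of _ ?V]) auto
qed

lemma L_module:
  assumes U: "openin T U"
  shows "module (sec \<O> U) (sec \<L> U)"
proof (intro moduleI abelian_groupI)
  show "cring (sec \<O> U)" using sections_cring[OF T[OF U]] .
  have pr: "cring (stalk P)" if "P \<in> U" for P using stalk_of_open[OF U that] .
  note ext = extensionalityI[of _ U]
  show "\<zero>\<^bsub>sec \<L> U\<^esub> \<in> carrier (sec \<L> U)" by (rule L_zero_closed[OF U])
  {
    fix s assume s: "s \<in> carrier (sec \<L> U)"
    have sP: "s P \<in> carrier (stalk P)" if "P \<in> U" for P using L_stalk[OF s that] .
    have sE: "s \<in> extensional U" using s by (auto simp: L_simps)
    show "\<zero>\<^bsub>sec \<L> U\<^esub> \<oplus>\<^bsub>sec \<L> U\<^esub> s = s" "\<one>\<^bsub>sec \<O> U\<^esub> \<odot>\<^bsub>sec \<L> U\<^esub> s = s"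
      by (rule ext; simp add: L_simps(2-) sec_simps sE stalk_simps[OF open_prime[OF T[OF U]]] sP cring.cring_simprules(2,6)[OF pr])+
    show "\<exists>y\<in>carrier (sec \<L> U). y \<oplus>\<^bsub>sec \<L> U\<^esub> s = \<zero>\<^bsub>sec \<L> U\<^esub>"
    proof
      show "(\<lambda>P\<in>U. fr P (- 1) 1) \<odot>\<^bsub>sec \<L> U\<^esub> s \<in> carrier (sec \<L> U)"
        using L_smult_closed[OF U constant_section[OF T[OF U]] s] .
      show "(\<lambda>P\<in>U. fr P (- 1) 1) \<odot>\<^bsub>sec \<L> U\<^esub> s \<oplus>\<^bsub>sec \<L> U\<^esub> s = \<zero>\<^bsub>sec \<L> U\<^esub>"
        by (rule ext) (simp_all add: L_simps(2-) stalk_neg[OF open_prime[OF T[OF U]]] sP)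
    qed
    fix t assume t: "t \<in> carrier (sec \<L> U)"
    have tP: "t P \<in> carrier (stalk P)" if "P \<in> U" for P using L_stalk[OF t that] .
    show "s \<oplus>\<^bsub>sec \<L> U\<^esub> t \<in> carrier (sec \<L> U)" using L_add_closed[OF U s t] .
    show "s \<oplus>\<^bsub>sec \<L> U\<^esub> t = t \<oplus>\<^bsub>sec \<L> U\<^esub> s"
      by (rule ext; simp add: L_simps(2-) cring.cring_simprules[OF pr] sP tP)
    fix r assume r: "r \<in> carrier (sec \<L> U)"
    have rP: "r P \<in> carrier (stalk P)" if "P \<in> U" for P using L_stalk[OF r that] .
    show "s \<oplus>\<^bsub>sec \<L> U\<^esub> t \<oplus>\<^bsub>sec \<L> U\<^esub> r = s \<oplus>\<^bsub>sec \<L> U\<^esub> (t \<oplus>\<^bsub>sec \<L> U\<^esub> r)"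
      by (rule ext; simp add: L_simps(2-) cring.cring_simprules[OF pr] sP tP rP)
  }
  fix a b s t assume a: "a \<in> carrier (sec \<O> U)" and s: "s \<in> carrier (sec \<L> U)"
  have cl: "a P \<in> carrier (stalk P)" "s P \<in> carrier (stalk P)" if "P \<in> U" for P
    using section_in_stalk[OF a that] L_stalk[OF s that] by auto
  show "a \<odot>\<^bsub>sec \<L> U\<^esub> s \<in> carrier (sec \<L> U)" using L_smult_closed[OF U a s] .
  {
    assume t: "t \<in> carrier (sec \<L> U)"
    have tP: "t P \<in> carrier (stalk P)" if "P \<in> U" for P using L_stalk[OF t that] .
    show "a \<odot>\<^bsub>sec \<L> U\<^esub> (s \<oplus>\<^bsub>sec \<L> U\<^esub> t) = a \<odot>\<^bsub>sec \<L> U\<^esub> s \<oplus>\<^bsub>sec \<L> U\<^esub> a \<odot>\<^bsub>sec \<L> U\<^esub> t"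
      by (rule ext; simp add: L_simps(2-) cring.cring_simprules[OF pr] cl tP)
  }
  assume b: "b \<in> carrier (sec \<O> U)"
  have bP: "b P \<in> carrier (stalk P)" if "P \<in> U" for P using section_in_stalk[OF b that] .
  show "(a \<oplus>\<^bsub>sec \<O> U\<^esub> b) \<odot>\<^bsub>sec \<L> U\<^esub> s = a \<odot>\<^bsub>sec \<L> U\<^esub> s \<oplus>\<^bsub>sec \<L> U\<^esub> b \<odot>\<^bsub>sec \<L> U\<^esub> s"
    by (rule ext; simp add: L_simps(2-) sec_simps cring.cring_simprules[OF pr] cl bP)
  show "a \<otimes>\<^bsub>sec \<O> U\<^esub> b \<odot>\<^bsub>sec \<L> U\<^esub> s = a \<odot>\<^bsub>sec \<L> U\<^esub> (b \<odot>\<^bsub>sec \<L> U\<^esub> s)"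
    by (rule ext; simp add: L_simps(2-) sec_simps cring.cring_simprules[OF pr] cl bP)
qed

lemma module_sheaf_L: "module_sheaf T \<O> \<L>"
  by (intro module_sheaf.intro module_sheaf_axioms.intro sheaf_L L_module) (auto simp: L_simps(2-) fun_eq_iff)

lemma h'_section:
  assumes j: "j \<in> J" and W: "openin T W" "W \<subseteq> C j" and s: "s \<in> carrier (sec \<O> W)"
  shows "(\<lambda>P\<in>W. h' j P \<otimes>\<^bsub>stalk P\<^esub> s P) \<in> carrier (sec \<L> W)"
proof (rule L_sectionI[OF _ W(1)])
  have cl: "h j P \<in> carrier (stalk P)" "h' j P \<in> carrier (stalk P)" "s P \<in> carrier (stalk P)" if "P \<in> W" for P
    using h j W that section_in_stalk[OF s] by auto
  fix P assume P: "P \<in> W"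
  interpret S: cring "stalk P" using stalk_of_open[OF W(1) P] .
  show "(\<lambda>P\<in>W. h' j P \<otimes>\<^bsub>stalk P\<^esub> s P) P \<in> carrier (stalk P)" using P cl by simp
  obtain V where V: "openin (Spec A) V" "P \<in> V" "V \<subseteq> W" "regular V s" using s P unfolding sections_eq by blast
  have "regular V (\<lambda>Q. h j Q \<otimes>\<^bsub>stalk Q\<^esub> (\<lambda>P\<in>W. h' j P \<otimes>\<^bsub>stalk P\<^esub> s P) Q)"
  proof (rule regular_mono[OF V(4)])
    fix Q assume "Q \<in> V"
    then have Q: "Q \<in> W" using V by auto
    interpret SQ: cring "stalk Q" using stalk_of_open[OF W(1) Q] .
    show "h j Q \<otimes>\<^bsub>stalk Q\<^esub> (\<lambda>P\<in>W. h' j P \<otimes>\<^bsub>stalk P\<^esub> s P) Q = s Q"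
      using cl[OF Q] Q W h(3)[OF j] by (simp add: SQ.m_assoc[symmetric] subset_iff)
  qed auto
  then show "\<exists>k\<in>J. \<exists>V. openin (Spec A) V \<and> P \<in> V \<and> V \<subseteq> W \<inter> C k \<and> regular V (\<lambda>Q. h k Q \<otimes>\<^bsub>stalk Q\<^esub> (\<lambda>P\<in>W. h' j P \<otimes>\<^bsub>stalk P\<^esub> s P) Q)"
    using V W j by (intro bexI[of _ j] exI[of _ V]) auto
qed auto

lemma h_section:
  assumes j: "j \<in> J" and W: "openin T W" "W \<subseteq> C j" and s: "s \<in> carrier (sec \<L> W)"
  shows "(\<lambda>P\<in>W. h j P \<otimes>\<^bsub>stalk P\<^esub> s P) \<in> carrier (sec \<O> W)"
  unfolding sections_eq
proof (intro CollectI conjI ballI)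
  fix P assume P: "P \<in> W"
  obtain V where V: "openin (Spec A) V" "P \<in> V" "V \<subseteq> W \<inter> C j" "regular V (\<lambda>Q. h j Q \<otimes>\<^bsub>stalk Q\<^esub> s Q)"
    using L_regular[OF s P j] P W by blast
  have "regular V (\<lambda>P\<in>W. h j P \<otimes>\<^bsub>stalk P\<^esub> s P)" by (rule regular_mono[OF V(4)]) (use V in auto)
  then show "\<exists>V. openin (Spec A) V \<and> P \<in> V \<and> V \<subseteq> W \<and> regular V (\<lambda>P\<in>W. h j P \<otimes>\<^bsub>stalk P\<^esub> s P)"
    using V by blast
qed auto

text \<open>Over \<open>C j\<close>, multiplication by \<open>h j\<close> identifies the twisted
  sheaf with the structure sheaf; multiplication by \<open>h' j\<close> is the inverse.\<close>

lemma invertible_L: "invertible_sheaf T \<O> \<L>"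
  unfolding invertible_sheaf_def
proof (intro conjI ballI module_sheaf_L)
  fix x assume "x \<in> topspace T"
  then obtain j where j: "j \<in> J" "x \<in> C j" using cover by blast
  let ?\<phi> = "\<lambda>W s. \<lambda>P\<in>W. h j P \<otimes>\<^bsub>stalk P\<^esub> s P"
  have op: "openin (subtopology T (C j)) W \<longleftrightarrow> openin T W \<and> W \<subseteq> C j" for W
    using openin_open_subtopology[OF open_C[OF j(1)]] .
  note [simp] = structure_module_def ring_as_module_def
  have "?\<phi> \<in> module_sheaf_hom (subtopology T (C j)) \<O> \<L> (structure_module \<O>)"
    unfolding module_sheaf_hom_def
  proof (intro CollectI conjI allI impI ballI Pi_I)
    fix W assume "openin (subtopology T (C j)) W"
    then have W: "openin T W" "W \<subseteq> C j" using op by auto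
    have pr: "cring (stalk P)" if "P \<in> W" for P using stalk_of_open[OF W(1) that] .
    have hP: "h j P \<in> carrier (stalk P)" if "P \<in> W" for P using h(1) j W that by auto
    show "?\<phi> W s \<in> carrier (sec (structure_module \<O>) W)" if "s \<in> carrier (sec \<L> W)" for s
      using h_section[OF j(1) W that] by simp
    show "?\<phi> W (s \<oplus>\<^bsub>sec \<L> W\<^esub> t) = ?\<phi> W s \<oplus>\<^bsub>sec (structure_module \<O>) W\<^esub> ?\<phi> W t"
      if "s \<in> carrier (sec \<L> W)" "t \<in> carrier (sec \<L> W)" for s t
      using L_stalk[OF that(1)] L_stalk[OF that(2)] hP
      by (intro ext) (simp add: L_simps(2-) sec_simps stalk_distr[OF open_prime[OF T[OF W(1)]]])
    show "?\<phi> W (a \<odot>\<^bsub>sec \<L> W\<^esub> s) = a \<odot>\<^bsub>sec (structure_module \<O>) W\<^esub> ?\<phi> W s"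
      if "a \<in> carrier (sec \<O> W)" "s \<in> carrier (sec \<L> W)" for a s
      using section_in_stalk[OF that(1)] L_stalk[OF that(2)] hP
      by (auto simp: L_simps(2-) sec_simps fun_eq_iff cring.cring_simprules[OF pr])
  qed (auto simp: L_simps(2-) fun_eq_iff op)
  moreover have "bij_betw (?\<phi> W) (carrier (sec \<L> W)) (carrier (sec (structure_module \<O>) W))"
    if "openin (subtopology T (C j)) W" for W
  proof -
    have W: "openin T W" "W \<subseteq> C j" using op that by auto
    have pr: "cring (stalk P)" if "P \<in> W" for P using stalk_of_open[OF W(1) that] .
    have hP: "h j P \<in> carrier (stalk P)" "h' j P \<in> carrier (stalk P)" "h j P \<otimes>\<^bsub>stalk P\<^esub> h' j P = \<one>\<^bsub>stalk P\<^esub>" if "P \<in> W" for P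
      using h[OF j(1)] W that by auto
    have cancel: "h' j P \<otimes>\<^bsub>stalk P\<^esub> (h j P \<otimes>\<^bsub>stalk P\<^esub> x) = x" "h j P \<otimes>\<^bsub>stalk P\<^esub> (h' j P \<otimes>\<^bsub>stalk P\<^esub> x) = x"
      if P: "P \<in> W" and x: "x \<in> carrier (stalk P)" for P x
    proof -
      interpret S: cring "stalk P" using pr[OF P] .
      show "h j P \<otimes>\<^bsub>stalk P\<^esub> (h' j P \<otimes>\<^bsub>stalk P\<^esub> x) = x"
        using hP[OF P] x by (simp add: S.m_assoc[symmetric])
      then show "h' j P \<otimes>\<^bsub>stalk P\<^esub> (h j P \<otimes>\<^bsub>stalk P\<^esub> x) = x"
        using hP[OF P] x by (simp add: S.m_lcomm)
    qed
    show ?thesis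
    proof (rule bij_betw_byWitness[of _ "\<lambda>s. \<lambda>P\<in>W. h' j P \<otimes>\<^bsub>stalk P\<^esub> s P"])
      show "\<forall>s\<in>carrier (sec \<L> W). (\<lambda>P\<in>W. h' j P \<otimes>\<^bsub>stalk P\<^esub> ?\<phi> W s P) = s"
      proof
        fix s assume s: "s \<in> carrier (sec \<L> W)"
        show "(\<lambda>P\<in>W. h' j P \<otimes>\<^bsub>stalk P\<^esub> ?\<phi> W s P) = s"
          by (rule extensionalityI[of _ W]) (use s cancel L_stalk[OF s] in \<open>auto simp: L_simps(1)\<close>)
      qed
      show "\<forall>s\<in>carrier (sec (structure_module \<O>) W). ?\<phi> W (\<lambda>P\<in>W. h' j P \<otimes>\<^bsub>stalk P\<^esub> s P) = s"
      proof
        fix s assume "s \<in> carrier (sec (structure_module \<O>) W)"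
        then have s: "s \<in> carrier (sec \<O> W)" by simp
        show "?\<phi> W (\<lambda>P\<in>W. h' j P \<otimes>\<^bsub>stalk P\<^esub> s P) = s"
          by (rule extensionalityI[of _ W]) (use s cancel section_in_stalk[OF s] in \<open>auto simp: sections_eq\<close>)
      qed
    qed (use h_section[OF j(1) W] h'_section[OF j(1) W] in auto)
  qed
  ultimately have "module_sheaf_iso (subtopology T (C j)) \<O> \<L> (structure_module \<O>)"
    unfolding module_sheaf_iso_def by (intro bexI[of _ ?\<phi>]) blast
  then show "\<exists>U. openin T U \<and> x \<in> U \<and> module_sheaf_iso (subtopology T U) \<O> \<L> (structure_module \<O>)"
    using open_C[OF j(1)] j(2) by blast
qed

text \<open>\<open>b j\<close> is the global generator read in the chart \<open>C j\<close>. It is a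
  unit because the section \<open>h' j\<close>, which corresponds to 1 in this chart, is a multiple
  of the generator.\<close>

lemma generator_trivializes:
  assumes e: "ring_space.free_generator T \<O> \<L> (topspace T) e"
  shows "\<exists>b a. \<forall>j\<in>J. b j \<in> carrier (sec \<O> (C j)) \<and> a j \<in> carrier (sec \<O> (C j)) \<and>
      (\<forall>P\<in>C j. a j P \<otimes>\<^bsub>stalk P\<^esub> b j P = \<one>\<^bsub>stalk P\<^esub>) \<and>
      (\<forall>k\<in>J. \<forall>P\<in>C j \<inter> C k. b k P = (h k P \<otimes>\<^bsub>stalk P\<^esub> h' j P) \<otimes>\<^bsub>stalk P\<^esub> b j P)"
proof -
  interpret RS: ring_space T \<O> using ring_space[OF T] .
  interpret G: act_sheaf T \<O> \<L> "\<lambda>U. module.smult (sec \<L> U)" using RS.act_sheaf_module[OF module_sheaf_L] .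
  have gen: "G.gen (topspace T) e" using e by (simp add: RS.free_generator_def)
  have sub: "C j \<subseteq> topspace T" if "j \<in> J" for j using open_C[OF that] by (rule openin_subset)
  have e: "e \<in> carrier (sec \<L> (topspace T))" using G.genD(2)[OF gen] .
  have genC: "G.gen (C j) (restrict e (C j))" if "j \<in> J" for j
    using G.gen_res[OF gen open_C[OF that] sub[OF that]] by (simp add: L_simps)
  define b where "b j = (\<lambda>P\<in>C j. h j P \<otimes>\<^bsub>stalk P\<^esub> e P)" for j
  have "\<exists>a. a \<in> carrier (sec \<O> (C j)) \<and> (\<forall>P\<in>C j. a P \<otimes>\<^bsub>stalk P\<^esub> b j P = \<one>\<^bsub>stalk P\<^esub>)" if j: "j \<in> J" for j
  proof -
    interpret R: cring "sec \<O> (C j)" using sections_cring[OF T[OF open_C[OF j]]] .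
    have unit: "(\<lambda>P\<in>C j. h' j P \<otimes>\<^bsub>stalk P\<^esub> \<one>\<^bsub>sec \<O> (C j)\<^esub> P) \<in> carrier (sec \<L> (C j))"
      by (rule h'_section[OF j open_C[OF j]]) auto
    obtain a where a: "a \<in> carrier (sec \<O> (C j))"
      and eq: "(\<lambda>P\<in>C j. h' j P \<otimes>\<^bsub>stalk P\<^esub> \<one>\<^bsub>sec \<O> (C j)\<^esub> P) = a \<odot>\<^bsub>sec \<L> (C j)\<^esub> restrict e (C j)"
      using G.gen_surj[OF genC[OF j] unit] .
    have "a P \<otimes>\<^bsub>stalk P\<^esub> b j P = \<one>\<^bsub>stalk P\<^esub>" if P: "P \<in> C j" for P
    proof -
      interpret S: cring "stalk P" using stalk_of_open[OF open_C[OF j] P] .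
      have cl: "a P \<in> carrier (stalk P)" "e P \<in> carrier (stalk P)" "h j P \<in> carrier (stalk P)" "h' j P \<in> carrier (stalk P)"
        using section_in_stalk[OF a P] L_stalk[OF e] sub[OF j] P h[OF j P] by auto
      have "h' j P = a P \<otimes>\<^bsub>stalk P\<^esub> e P" using fun_cong[OF eq, of P] P cl by (simp add: L_simps(4) sec_simps)
      then have "h j P \<otimes>\<^bsub>stalk P\<^esub> (a P \<otimes>\<^bsub>stalk P\<^esub> e P) = \<one>\<^bsub>stalk P\<^esub>" using h(3)[OF j P] by simp
      then show ?thesis using cl P by (simp add: b_def S.m_lcomm)
    qed
    with a show ?thesis by blast
  qed
  then have "\<exists>a. \<forall>j\<in>J. a j \<in> carrier (sec \<O> (C j)) \<and> (\<forall>P\<in>C j. a j P \<otimes>\<^bsub>stalk P\<^esub> b j P = \<one>\<^bsub>stalk P\<^esub>)"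
    by (intro bchoice) blast
  then obtain a where a: "\<And>j. j \<in> J \<Longrightarrow> a j \<in> carrier (sec \<O> (C j)) \<and> (\<forall>P\<in>C j. a j P \<otimes>\<^bsub>stalk P\<^esub> b j P = \<one>\<^bsub>stalk P\<^esub>)"
    by blast
  have bO: "b j \<in> carrier (sec \<O> (C j))" if j: "j \<in> J" for j
  proof -
    have "restrict e (C j) \<in> carrier (sec \<L> (C j))" using G.genD(2)[OF genC[OF j]] .
    from h_section[OF j open_C[OF j] order_refl this] show ?thesis by (simp add: b_def cong: restrict_cong)
  qed
  have tr: "b k P = (h k P \<otimes>\<^bsub>stalk P\<^esub> h' j P) \<otimes>\<^bsub>stalk P\<^esub> b j P" if j: "j \<in> J" "k \<in> J" and P: "P \<in> C j \<inter> C k" for j k P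
  proof -
    interpret S: cring "stalk P" using stalk_of_open[OF open_C[OF j(1)]] P by blast
    have cl: "e P \<in> carrier (stalk P)" "h j P \<in> carrier (stalk P)" "h' j P \<in> carrier (stalk P)" "h k P \<in> carrier (stalk P)"
      using L_stalk[OF e] sub[OF j(1)] P h[OF j(1)] h[OF j(2)] by auto
    have "(h k P \<otimes>\<^bsub>stalk P\<^esub> h' j P) \<otimes>\<^bsub>stalk P\<^esub> (h j P \<otimes>\<^bsub>stalk P\<^esub> e P) = (h j P \<otimes>\<^bsub>stalk P\<^esub> h' j P) \<otimes>\<^bsub>stalk P\<^esub> (h k P \<otimes>\<^bsub>stalk P\<^esub> e P)"
      using cl by (simp add: S.m_ac)
    then show ?thesis using h(3)[OF j(1)] P cl by (simp add: b_def)
  qed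
  show ?thesis
  proof (rule exI[of _ b], rule exI[of _ a], intro ballI conjI)
    fix j assume j: "j \<in> J"
    show "b j \<in> carrier (sec \<O> (C j))" by (rule bO[OF j])
    show "a j \<in> carrier (sec \<O> (C j))" using a[OF j] ..
    show "a j P \<otimes>\<^bsub>stalk P\<^esub> b j P = \<one>\<^bsub>stalk P\<^esub>" if "P \<in> C j" for P using a[OF j] that by blast
    show "b k P = (h k P \<otimes>\<^bsub>stalk P\<^esub> h' j P) \<otimes>\<^bsub>stalk P\<^esub> b j P" if "k \<in> J" "P \<in> C j \<inter> C k" for k P
      using tr[OF j that] .
  qed
qed

end


section \<open>Quotients of polynomial rings by monomial ideals\<close>

lemma mpoly_ring_simps [simp]:
  "carrier (mpoly_ring n) = {p. rst {1..n} p = p}" "p \<otimes>\<^bsub>mpoly_ring n\<^esub> q = p * q"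
  "p \<oplus>\<^bsub>mpoly_ring n\<^esub> q = p + q" "\<one>\<^bsub>mpoly_ring n\<^esub> = 1" "\<zero>\<^bsub>mpoly_ring n\<^esub> = 0"
  by (auto simp: mpoly_ring_def ring_of_type_algebra_def monoms_def rst_eq_iff)

lemma mpoly_ring_cring: "cring (mpoly_ring n)"
proof (intro cringI abelian_groupI comm_monoidI)
  show "\<exists>y\<in>carrier (mpoly_ring n). y \<oplus>\<^bsub>mpoly_ring n\<^esub> p = \<zero>\<^bsub>mpoly_ring n\<^esub>" if "p \<in> carrier (mpoly_ring n)" for p :: "'a mpoly"
    using that by (intro bexI[of _ "- p"]) auto
qed (auto simp: algebra_simps)

lemma mpoly_ring_pow [simp]: "p [^]\<^bsub>mpoly_ring n\<^esub> (k::nat) = p ^ k"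
proof -
  interpret cring "mpoly_ring n" by (rule mpoly_ring_cring)
  show ?thesis by (induction k) (auto simp: mult.commute)
qed

lemma pvar_eq_single: "pvar i = Poly_Mapping.single (Poly_Mapping.single i 1) 1"
  by (simp add: pvar_def monomial_def)

lemma single_eq_pvar_mult:
  assumes "i \<in> Poly_Mapping.keys m"
  obtains m' where "m = Poly_Mapping.single i 1 + m'" "\<And>a. Poly_Mapping.single m a = (pvar i :: 'k::field mpoly) * Poly_Mapping.single m' a"
proof -
  define m' where "m' = m - Poly_Mapping.single i 1"
  have m: "m = Poly_Mapping.single i 1 + m'"
    using assms by (intro poly_mapping_eqI) (auto simp: m'_def lookup_add lookup_minus lookup_single when_def in_keys_iff)
  have "Poly_Mapping.single m a = (pvar i :: 'k mpoly) * Poly_Mapping.single m' a" for a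
    unfolding pvar_eq_single by (simp only: mult_single m[symmetric] mult_1)
  with m that show thesis by blast
qed

text \<open>The ideal need not be radical; \<open>\<Delta>\<close> is the complex of its radical.\<close>

locale monomial_quotient =
  fixes n :: nat and I :: "'k::field mpoly set" and \<Delta> :: "nat set set"
  assumes ideal_I: "ideal I (mpoly_ring n)"
    and face_sub: "F \<in> \<Delta> \<Longrightarrow> F \<subseteq> {1..n}" and face_mono: "F \<in> \<Delta> \<Longrightarrow> G \<subseteq> F \<Longrightarrow> G \<in> \<Delta>"
    and face_zero: "F \<in> \<Delta> \<Longrightarrow> p \<in> I \<Longrightarrow> rst F p = 0"
    and nonface: "F \<subseteq> {1..n} \<Longrightarrow> F \<notin> \<Delta> \<Longrightarrow> \<exists>k. (\<Prod>i\<in>F. pvar i) ^ k \<in> I"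
begin

text \<open>The polynomial type has infinitely many variables. Those outside \<open>{1..n}\<close>
  are set to zero first, which extends the residue map to a homomorphism on the whole type.\<close>

definition proj :: "'k mpoly \<Rightarrow> 'k mpoly set" where
  "proj p = I +>\<^bsub>mpoly_ring n\<^esub> rst {1..n} p"

sublocale presented_ring "mpoly_ring n Quot I" proj
proof -
  interpret R: cring "mpoly_ring n" by (rule mpoly_ring_cring)
  interpret I: ideal I "mpoly_ring n" by (rule ideal_I)
  interpret Q: cring "mpoly_ring n Quot I" by (rule I.quotient_is_cring[OF mpoly_ring_cring])
  have hom: "(+>\<^bsub>mpoly_ring n\<^esub>) I \<in> ring_hom (mpoly_ring n) (mpoly_ring n Quot I)" by (rule I.rcos_ring_hom)
  show "presented_ring (mpoly_ring n Quot I) proj"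
  proof
    show "proj p \<in> carrier (mpoly_ring n Quot I)" for p
      using ring_hom_closed[OF hom, of "rst {1..n} p"] by (simp add: proj_def)
    show "\<exists>p. a = proj p" if a: "a \<in> carrier (mpoly_ring n Quot I)" for a
    proof -
      obtain p where "p \<in> carrier (mpoly_ring n)" "a = I +>\<^bsub>mpoly_ring n\<^esub> p"
        using a unfolding FactRing_def by (auto simp: A_RCOSETS_def')
      then show ?thesis by (auto simp: proj_def intro: exI[of _ p])
    qed
    show "proj (p + q) = proj p \<oplus>\<^bsub>mpoly_ring n Quot I\<^esub> proj q" for p q
      using ring_hom_add[OF hom, of "rst {1..n} p" "rst {1..n} q"] by (simp add: proj_def)
    show "proj (p * q) = proj p \<otimes>\<^bsub>mpoly_ring n Quot I\<^esub> proj q" for p q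
      using ring_hom_mult[OF hom, of "rst {1..n} p" "rst {1..n} q"] by (simp add: proj_def)
    show "proj 1 = \<one>\<^bsub>mpoly_ring n Quot I\<^esub>"
      using ring_hom_one[OF hom] by (simp add: proj_def)
  qed
qed

abbreviation R :: "'k mpoly set ring" where "R \<equiv> mpoly_ring n Quot I"

lemma proj_zero_iff: "proj p = \<zero>\<^bsub>R\<^esub> \<longleftrightarrow> rst {1..n} p \<in> I"
proof -
  interpret R: cring "mpoly_ring n" by (rule mpoly_ring_cring)
  interpret I: ideal I "mpoly_ring n" by (rule ideal_I)
  have sg: "subgroup I (add_monoid (mpoly_ring n))" by (rule I.a_subgroup)
  have "I +>\<^bsub>mpoly_ring n\<^esub> rst {1..n} p = I \<longleftrightarrow> rst {1..n} p \<in> I"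
    using R.a_coset_join1[of I "rst {1..n} p"] R.a_coset_join2[of "rst {1..n} p" I] sg by auto
  then show ?thesis by (simp add: proj_def FactRing_def)
qed

section \<open>Generic points of faces\<close>

lemma rst_of_proj_zero: "proj p = \<zero>\<^bsub>R\<^esub> \<Longrightarrow> F \<in> \<Delta> \<Longrightarrow> rst F p = 0"
  using face_zero[of F "rst {1..n} p"] face_sub[of F] by (simp add: proj_zero_iff Int_absorb2)

text \<open>The generic point of the coordinate subspace of \<open>F\<close>. It is prime because
  restriction to \<open>F\<close> has values in a domain.\<close>

definition face_prime :: "nat set \<Rightarrow> 'k mpoly set set" where
  "face_prime F = proj ` {p. rst F p = 0}"

lemma face_prime:
  assumes "F \<in> \<Delta>"
  shows "primeideal (face_prime F) R" "proj p \<in> face_prime F \<longleftrightarrow> rst F p = 0"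
proof -
  have *: "ideal_set {p. rst F p = (0 :: 'k mpoly)}" "{p. proj p = \<zero>\<^bsub>R\<^esub>} \<subseteq> {p. rst F p = 0}"
    using rst_of_proj_zero[OF _ assms] by (auto simp: ideal_set_def)
  show "primeideal (face_prime F) R" "proj p \<in> face_prime F \<longleftrightarrow> rst F p = 0"
    using prime_ideal_of_set[OF *] by (auto simp: face_prime_def)
qed

text \<open>An equation in the stalk at the generic point is mapped to the fraction field of the
  polynomial ring of the face, where it means equality of cross products.\<close>

lemma fr_eq_face_prime:
  assumes F: "F \<in> \<Delta>" and s: "rst F s \<noteq> 0" and t: "rst F t \<noteq> 0"
    and eq: "fr (face_prime F) a s = fr (face_prime F) b t"
  shows "rst F a * rst F t = rst F b * rst F s"
proof -
  obtain u where u: "proj u \<notin> face_prime F" "proj (u * (a * t)) = proj (u * (b * s))"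
    using eq s t fr_eq_iff[OF face_prime(1)[OF F]] by (auto simp: face_prime(2)[OF F])
  then have "rst F (u * (a * t) - u * (b * s)) = 0" using rst_of_proj_zero[OF _ F] pi_eq_iff by blast
  then have "rst F u * (rst F a * rst F t - rst F b * rst F s) = 0" by (simp add: algebra_simps)
  then show ?thesis using u(1) by (simp add: face_prime(2)[OF F])
qed

text \<open>The product of the variables of a nonface is nilpotent in the quotient and hence lies in
  every prime.\<close>

lemma face_of_point:
  assumes P: "primeideal P R" and F: "F \<subseteq> {1..n}" "\<And>i. i \<in> F \<Longrightarrow> proj (pvar i) \<notin> P"
  shows "F \<in> \<Delta>"
proof (rule ccontr)
  assume "F \<notin> \<Delta>"
  then obtain k where k: "(\<Prod>i\<in>F. pvar i) ^ k \<in> I" using nonface F(1) by blast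
  have "finite F" using F(1) finite_subset by blast
  then have "proj (\<Prod>i\<in>F. pvar i) \<notin> P" using F(2)
    by (induction rule: finite_induct) (auto simp: prime_one[OF P] prime_mult[OF P])
  then have "proj ((\<Prod>i\<in>F. pvar i) ^ k) \<notin> P" by (rule prime_power[OF P])
  moreover have "rst {1..n} ((\<Prod>i\<in>F. pvar i) ^ k) = ((\<Prod>i\<in>F. pvar i) ^ k :: 'k mpoly)"
  proof -
    have "rst {1..n} (\<Prod>i\<in>F. pvar i :: 'k mpoly) = (\<Prod>i\<in>F. pvar i)"
      using \<open>finite F\<close> F(1) by (induction rule: finite_induct) auto
    then show ?thesis by simp
  qed
  ultimately show False using prime_zero[OF P] k by (simp add: proj_zero_iff)
qed

definition origin :: "'k mpoly set set" where
  "origin = Idl\<^bsub>R\<^esub> ((\<lambda>i. I +>\<^bsub>mpoly_ring n\<^esub> pvar i) ` {1..n})"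

lemma origin_gens: "(\<lambda>i. I +>\<^bsub>mpoly_ring n\<^esub> pvar i) ` {1..n} = proj ` pvar ` {1..n}"
  unfolding proj_def image_image by (rule image_cong) auto

text \<open>Every term other than the constant one has some variable as a factor.\<close>

lemma proj_in_vertex_ideal:
  assumes J: "ideal J R" "\<And>i. i \<in> {1..n} \<Longrightarrow> proj (pvar i) \<in> J" and p: "rst {} p = 0"
  shows "proj p \<in> J"
proof -
  interpret J: ideal J R by (rule J(1))
  have "proj (p - rst {} p) \<in> J" for p
  proof (induction p rule: poly_mapping_single_induct)
    case 1
    then show ?case by (simp add: pi_zero J.zero_closed)
  next
    case (2 m a p)
    have "proj (Poly_Mapping.single m a - rst {} (Poly_Mapping.single m a)) \<in> J"
    proof (cases "m = 0")
      case True
      then show ?thesis by (simp add: pi_zero J.zero_closed)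
    next
      case False
      then obtain i where i: "i \<in> Poly_Mapping.keys m" by fastforce
      then obtain m' where m': "Poly_Mapping.single m a = pvar i * Poly_Mapping.single m' a"
        using single_eq_pvar_mult by metis
      \<comment> \<open>A variable outside \<open>{1..n}\<close> is mapped to zero, so it needs no
        generator.\<close>
      have "proj (pvar i) \<in> J"
      proof (cases "i \<in> {1..n}")
        case False
        have "proj (pvar i) = \<zero>\<^bsub>R\<^esub>"
          using False ideal_I by (simp add: proj_zero_iff additive_subgroup.zero_closed[OF ideal.axioms(1)]
            del: atLeastAtMost_iff) (metis additive_subgroup.zero_closed ideal.axioms(1) mpoly_ring_simps(5))
        then show ?thesis by (simp add: J.zero_closed)
      qed (rule J(2))
      then have "proj (pvar i * Poly_Mapping.single m' a) \<in> J"
        unfolding pi_mult by (rule J.I_r_closed) simp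
      moreover have "rst {} (Poly_Mapping.single m a) = 0" using False by simp
      ultimately show ?thesis using m' by simp
    qed
    then have "proj ((Poly_Mapping.single m a - rst {} (Poly_Mapping.single m a)) + (p - rst {} p)) \<in> J"
      unfolding pi_add using 2 by (rule J.a_closed)
    moreover have "Poly_Mapping.single m a + p - rst {} (Poly_Mapping.single m a + p)
        = (Poly_Mapping.single m a - rst {} (Poly_Mapping.single m a)) + (p - rst {} p)"
      by (simp only: rst_simps(4) add_diff_add)
    ultimately show ?case by (simp only:)
  qed
  from this[of p] show ?thesis using p by simp
qed

text \<open>Nonzero constants are units, so a prime that contains all variables consists of images
  of polynomials without constant term.\<close>

lemma prime_origin_iff:
  assumes P: "primeideal P R"
  shows "P = origin \<longleftrightarrow> (\<forall>i\<in>{1..n}. proj (pvar i) \<in> P)"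
proof
  have sub: "proj ` pvar ` {1..n} \<subseteq> carrier R" by auto
  have idl: "ideal origin R" unfolding origin_def origin_gens by (rule genideal_ideal[OF sub])
  have gens: "proj (pvar i) \<in> origin" if "i \<in> {1..n}" for i
    using genideal_self[OF sub] that unfolding origin_def origin_gens by blast
  show "\<forall>i\<in>{1..n}. proj (pvar i) \<in> P" if "P = origin" using gens that by blast
  assume all: "\<forall>i\<in>{1..n}. proj (pvar i) \<in> P"
  interpret P: primeideal P R by (rule P)
  show "P = origin"
  proof
    show "origin \<subseteq> P" unfolding origin_def origin_gens
      by (rule genideal_minimal) (use all P.is_ideal in auto)
    show "P \<subseteq> origin"
    proof
      fix x assume x: "x \<in> P"
      then obtain p where p: "x = proj p" using pi_surj P.a_Hcarr by blast
      obtain c where c: "rst {} p = const c" using rst_empty[of "rst {} p"] by auto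
      show "x \<in> origin"
      proof (cases "c = 0")
        case True
        then show ?thesis using proj_in_vertex_ideal[OF idl gens, of p] c p by simp
      next
        case False
        have "rst {} (p - const c) = 0" using c by simp
        then have "proj (p - const c) \<in> P" using proj_in_vertex_ideal[OF P.is_ideal] all by blast
        then have "proj (const c) \<in> P"
        proof -
          have "proj ((- 1) * (p - const c)) \<in> P" unfolding pi_mult by (rule P.I_l_closed) (use \<open>proj (p - const c) \<in> P\<close> in auto)
          then have "proj (p + (- 1) * (p - const c)) \<in> P" unfolding pi_add using P.a_closed x p by blast
          then show ?thesis by simp
        qed
        then have "proj (const (inverse c) * const c) \<in> P" unfolding pi_mult by (rule P.I_l_closed) simp
        then show ?thesis using False prime_one[OF P] by (simp add: mult_single)
      qed
    qed
  qed
qed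

section \<open>The punctured spectrum and its cover\<close>

definition punctured :: "'k mpoly set set topology" where
  "punctured = puncture (Spec R) origin"

definition V :: "nat \<Rightarrow> 'k mpoly set set set" where
  "V j = D (pvar j)"

lemma in_V: "P \<in> V j \<longleftrightarrow> primeideal P R \<and> proj (pvar j) \<notin> P"
  by (simp add: V_def D_def)

lemma punctured_set: "topspace (Spec R) - {origin} = \<Union>(V ` {1..n})"
proof (rule Set.set_eqI)
  show "P \<in> topspace (Spec R) - {origin} \<longleftrightarrow> P \<in> \<Union>(V ` {1..n})" for P
    using prime_origin_iff[of P] by (cases "primeideal P R") (auto simp: topspace_Spec in_V)
qed

lemma openin_punctured: "openin punctured U \<longleftrightarrow> openin (Spec R) U \<and> U \<subseteq> \<Union>(V ` {1..n})"
proof -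
  have "openin (Spec R) (\<Union>(V ` {1..n}))" unfolding V_def using open_D by blast
  then show ?thesis unfolding punctured_def puncture_def punctured_set by (rule openin_open_subtopology)
qed

lemma topspace_punctured: "topspace punctured = \<Union>(V ` {1..n})"
  unfolding punctured_def puncture_def punctured_set by (auto simp: topspace_Spec in_V)

lemma open_V: "j \<in> {1..n} \<Longrightarrow> openin punctured (V j)"
  unfolding openin_punctured V_def using open_D by blast

lemma Spec_open: "openin punctured U \<Longrightarrow> openin (Spec R) U"
  by (simp add: openin_punctured)

lemma Pic_loc_eq: "Pic_loc n I = Pic punctured \<O>"
  by (simp add: Pic_loc_def Let_def punctured_def origin_def)

sublocale ring_space punctured \<O>
  by (rule ring_space) (rule Spec_open)

lemma face_of_V: "F \<subseteq> {1..n} \<Longrightarrow> F \<noteq> {} \<Longrightarrow> (\<And>i. i \<in> F \<Longrightarrow> P \<in> V i) \<Longrightarrow> F \<in> \<Delta>"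
  using face_of_point[of P F] by (auto simp: in_V)

lemma single_notin:
  assumes P: "primeideal P R" and "c \<noteq> 0" "\<And>i. i \<in> Poly_Mapping.keys m \<Longrightarrow> proj (pvar i) \<notin> P"
  shows "proj (Poly_Mapping.single m c) \<notin> P"
  using assms(3)
proof (induction m rule: poly_mapping_single_induct)
  case 1
  have "proj (const (inverse c) * const c) \<notin> P" using prime_one[OF P] assms(2) by (simp add: mult_single)
  then show ?case using prime_mult[OF P] by blast
next
  case (2 i a m)
  have "proj (Poly_Mapping.single m c) \<notin> P" using 2 by (simp add: keys_add_monom)
  moreover have "proj (pvar i ^ a) \<notin> P"
  proof (cases "a = 0")
    case False
    then have "i \<in> Poly_Mapping.keys (Poly_Mapping.single i a + m)" by (simp add: keys_add_monom)
    then show ?thesis using 2(2) by (intro prime_power[OF P]) blast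
  qed (simp add: prime_one[OF P])
  moreover have "Poly_Mapping.single (Poly_Mapping.single i a + m) c = pvar i ^ a * Poly_Mapping.single m c"
    by (simp add: pvar_power mult_single)
  ultimately show ?case by (simp add: prime_mult[OF P])
qed

end

text \<open>The terms \<open>\<kappa> j k X\<^bsup>u j k - v j k\<^esup>\<close> are the coboundary of the terms \<open>\<mu> j X\<^sub>j\<^bsup>s j - N j\<^esup>\<close>; numerators and
  denominators are kept apart since exponents are natural numbers.\<close>

definition cocycle_splits :: "nat set set \<Rightarrow> (nat \<Rightarrow> nat \<Rightarrow> 'k::field) \<Rightarrow> (nat \<Rightarrow> nat \<Rightarrow> monom) \<Rightarrow> (nat \<Rightarrow> nat \<Rightarrow> monom) \<Rightarrow> bool" where
  "cocycle_splits \<Delta> \<kappa> u v \<longleftrightarrow> (\<exists>\<mu> s N. (\<forall>j. {j} \<in> \<Delta> \<longrightarrow> \<mu> j \<noteq> 0) \<and>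
     (\<forall>j k. {j, k} \<in> \<Delta> \<longrightarrow> \<mu> k = \<kappa> k j * \<mu> j \<and>
       Poly_Mapping.single k (s k) + v k j + Poly_Mapping.single j (N j)
         = u k j + Poly_Mapping.single j (s j) + Poly_Mapping.single k (N k)))"

locale monomial_cocycle = monomial_quotient +
  fixes \<kappa> :: "nat \<Rightarrow> nat \<Rightarrow> 'a" and u v :: "nat \<Rightarrow> nat \<Rightarrow> monom"
  assumes kappa: "{j, k} \<in> \<Delta> \<Longrightarrow> \<kappa> j k \<noteq> 0"
    and keys_uv: "{j, k} \<in> \<Delta> \<Longrightarrow> Poly_Mapping.keys (u j k) \<subseteq> {j, k}" "{j, k} \<in> \<Delta> \<Longrightarrow> Poly_Mapping.keys (v j k) \<subseteq> {j, k}"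
    and cocycle: "{i, j, k} \<in> \<Delta> \<Longrightarrow> \<kappa> i j * \<kappa> j k = \<kappa> i k"
      "{i, j, k} \<in> \<Delta> \<Longrightarrow> u i j + u j k + v i k = v i j + v j k + u i k"
begin

definition c :: "nat \<Rightarrow> nat \<Rightarrow> 'a mpoly set set \<Rightarrow> ('a mpoly set \<times> 'a mpoly set) set" where
  "c j k P = fr P (Poly_Mapping.single (u j k) (\<kappa> j k)) (Poly_Mapping.single (v j k) 1)"

definition c' :: "nat \<Rightarrow> nat \<Rightarrow> 'a mpoly set set \<Rightarrow> ('a mpoly set \<times> 'a mpoly set) set" where
  "c' j k P = fr P (Poly_Mapping.single (v j k) 1) (Poly_Mapping.single (u j k) (\<kappa> j k))"

lemma edge: "j \<in> {1..n} \<Longrightarrow> k \<in> {1..n} \<Longrightarrow> P \<in> V j \<Longrightarrow> P \<in> V k \<Longrightarrow> {j, k} \<in> \<Delta>"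
  by (rule face_of_V[of _ P]) auto

lemma triangle: "i \<in> {1..n} \<Longrightarrow> j \<in> {1..n} \<Longrightarrow> k \<in> {1..n} \<Longrightarrow> P \<in> V i \<Longrightarrow> P \<in> V j \<Longrightarrow> P \<in> V k \<Longrightarrow> {i, j, k} \<in> \<Delta>"
  by (rule face_of_V[of _ P]) auto

lemma notin:
  assumes "j \<in> {1..n}" "k \<in> {1..n}" "P \<in> V j" "P \<in> V k"
  shows "primeideal P R" "proj (Poly_Mapping.single (u j k) (\<kappa> j k)) \<notin> P" "proj (Poly_Mapping.single (v j k) 1) \<notin> P"
proof -
  show P: "primeideal P R" using assms(3) by (simp add: in_V)
  have e: "{j, k} \<in> \<Delta>" using edge assms by blast
  have nP: "proj (pvar i) \<notin> P" if "i \<in> {j, k}" for i using that assms(3,4) by (auto simp: in_V)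
  show "proj (Poly_Mapping.single (u j k) (\<kappa> j k)) \<notin> P"
    by (rule single_notin[OF P kappa[OF e]]) (use keys_uv(1)[OF e] nP in blast)
  show "proj (Poly_Mapping.single (v j k) 1) \<notin> P"
    by (rule single_notin[OF P]) (use keys_uv(2)[OF e] nP in \<open>simp, blast\<close>)
qed

lemma c_stalk:
  assumes "j \<in> {1..n}" "k \<in> {1..n}" "P \<in> V j" "P \<in> V k"
  shows "c j k P \<in> carrier (stalk P)" "c' j k P \<in> carrier (stalk P)" "c j k P \<otimes>\<^bsub>stalk P\<^esub> c' j k P = \<one>\<^bsub>stalk P\<^esub>"
proof -
  note nn = notin[OF assms]
  show "c j k P \<in> carrier (stalk P)" "c' j k P \<in> carrier (stalk P)"
    unfolding c_def c'_def using nn by (auto intro: fr_stalk)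
  show "c j k P \<otimes>\<^bsub>stalk P\<^esub> c' j k P = \<one>\<^bsub>stalk P\<^esub>"
    unfolding c_def c'_def stalk_one fr_mult[OF nn(1,3,2)]
    using nn by (intro fr_eqI) (auto simp: prime_mult prime_one mult.commute)
qed

lemma c_cocycle:
  assumes ijk: "i \<in> {1..n}" "j \<in> {1..n}" "k \<in> {1..n}" "P \<in> V i" "P \<in> V j" "P \<in> V k"
  shows "c k i P \<otimes>\<^bsub>stalk P\<^esub> c' j i P = c k j P"
proof -
  have "{k, j, i} \<in> \<Delta>" using triangle[OF ijk] by (simp add: insert_commute)
  note co = cocycle[OF this]
  note ki = notin[OF ijk(3,1,6,4)] and ji = notin[OF ijk(2,1,5,4)] and kj = notin[OF ijk(3,2,6,5)]
  have "Poly_Mapping.single (u k i) (\<kappa> k i) * Poly_Mapping.single (v j i) 1 * Poly_Mapping.single (v k j) 1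
      = Poly_Mapping.single (u k j) (\<kappa> k j) * (Poly_Mapping.single (v k i) 1 * Poly_Mapping.single (u j i) (\<kappa> j i))"
    using co by (simp add: mult_single ac_simps)
  then show ?thesis
    unfolding c_def c'_def fr_mult[OF ki(1,3) ji(2)]
    using ki ji kj by (intro fr_eqI) (auto simp: prime_mult)
qed

text \<open>A choice of chart for every point turns the cocycle into families of germs as required by
  \<open>twisted_module\<close>.\<close>

definition idx :: "'a mpoly set set \<Rightarrow> nat" where
  "idx P = (LEAST i. i \<in> {1..n} \<and> P \<in> V i)"

lemma idx: "j \<in> {1..n} \<Longrightarrow> P \<in> V j \<Longrightarrow> idx P \<in> {1..n} \<and> P \<in> V (idx P)"
  unfolding idx_def by (rule LeastI) blast

sublocale twist: twisted_module R proj punctured "{1..n}" V "\<lambda>j P. c j (idx P) P" "\<lambda>j P. c' j (idx P) P"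
proof
  show "openin (Spec R) U" if "openin punctured U" for U using Spec_open[OF that] .
  show "openin punctured (V j)" if "j \<in> {1..n}" for j using open_V[OF that] .
  show "topspace punctured \<subseteq> \<Union>(V ` {1..n})" by (simp add: topspace_punctured)
  fix j P assume j: "j \<in> {1..n}" and P: "P \<in> V j"
  then show "c j (idx P) P \<in> carrier (stalk P)" "c' j (idx P) P \<in> carrier (stalk P)"
    "c j (idx P) P \<otimes>\<^bsub>stalk P\<^esub> c' j (idx P) P = \<one>\<^bsub>stalk P\<^esub>"
    using idx[OF j P] c_stalk by blast+
next
  fix j k P assume jk: "j \<in> {1..n}" "k \<in> {1..n}" and P: "P \<in> V j \<inter> V k"
  have op: "openin (Spec R) (V j \<inter> V k)" using open_V jk Spec_open by blast
  \<comment> \<open>By the cocycle identity the chart \<open>idx Q\<close> cancels, and the quotient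
    is the single fraction that defines \<open>c k j\<close>.\<close>
  have "regular (V j \<inter> V k) (\<lambda>Q. c k (idx Q) Q \<otimes>\<^bsub>stalk Q\<^esub> c' j (idx Q) Q)"
    unfolding regular_def
  proof (intro exI ballI conjI)
    fix Q assume "Q \<in> V j \<inter> V k"
    then have Q: "Q \<in> V j" "Q \<in> V k" by auto
    show "proj (Poly_Mapping.single (v k j) 1) \<notin> Q" using notin[OF jk(2,1) Q(2,1)] by blast
    show "c k (idx Q) Q \<otimes>\<^bsub>stalk Q\<^esub> c' j (idx Q) Q = fr Q (Poly_Mapping.single (u k j) (\<kappa> k j)) (Poly_Mapping.single (v k j) 1)"
      using c_cocycle[of "idx Q" j k Q] idx[OF jk(1) Q(1)] jk Q by (simp add: c_def)
  qed
  then show "\<exists>W. openin (Spec R) W \<and> P \<in> W \<and> W \<subseteq> V j \<inter> V k \<and> regular W (\<lambda>Q. c k (idx Q) Q \<otimes>\<^bsub>stalk Q\<^esub> c' j (idx Q) Q)"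
    using op P by blast
qed

text \<open>At the generic point of a face, units of the structure sheaf on \<open>D(X\<^sub>j)\<close> are terms in \<open>X\<^sub>j\<close> alone.
  Comparing a global generator of the twisted sheaf with the charts there splits the cocycle.\<close>

theorem splits_of_trivial_Pic:
  assumes triv: "carrier (Pic_loc n I) = {\<one>\<^bsub>Pic_loc n I\<^esub>}"
  shows "cocycle_splits \<Delta> \<kappa> u v"
proof -
  obtain e where "free_generator twist.\<L> (topspace punctured) e"
    using Pic_trivialD[of twist.\<L>] triv twist.invertible_L unfolding Pic_loc_eq by blast
  then have "\<exists>b a. \<forall>j\<in>{1..n}. b j \<in> carrier (sec \<O> (V j)) \<and> a j \<in> carrier (sec \<O> (V j)) \<and>
      (\<forall>P\<in>V j. a j P \<otimes>\<^bsub>stalk P\<^esub> b j P = \<one>\<^bsub>stalk P\<^esub>) \<and>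
      (\<forall>k\<in>{1..n}. \<forall>P\<in>V j \<inter> V k. b k P = (c k (idx P) P \<otimes>\<^bsub>stalk P\<^esub> c' j (idx P) P) \<otimes>\<^bsub>stalk P\<^esub> b j P)"
    by (rule twist.generator_trivializes)
  then obtain b a where all: "\<forall>j\<in>{1..n}. b j \<in> carrier (sec \<O> (V j)) \<and> a j \<in> carrier (sec \<O> (V j)) \<and>
      (\<forall>P\<in>V j. a j P \<otimes>\<^bsub>stalk P\<^esub> b j P = \<one>\<^bsub>stalk P\<^esub>) \<and>
      (\<forall>k\<in>{1..n}. \<forall>P\<in>V j \<inter> V k. b k P = (c k (idx P) P \<otimes>\<^bsub>stalk P\<^esub> c' j (idx P) P) \<otimes>\<^bsub>stalk P\<^esub> b j P)"
    by (elim exE)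
  have ba: "b j \<in> carrier (sec \<O> (V j))" "a j \<in> carrier (sec \<O> (V j))" if "j \<in> {1..n}" for j
    using bspec[OF all that] by auto
  have ab: "a j P \<otimes>\<^bsub>stalk P\<^esub> b j P = \<one>\<^bsub>stalk P\<^esub>" if "j \<in> {1..n}" "P \<in> V j" for j P
    using bspec[OF all that(1)] that(2) by blast
  have tr: "b k P = (c k (idx P) P \<otimes>\<^bsub>stalk P\<^esub> c' j (idx P) P) \<otimes>\<^bsub>stalk P\<^esub> b j P"
    if "j \<in> {1..n}" "k \<in> {1..n}" "P \<in> V j \<inter> V k" for j k P
    using bspec[OF all that(1)] that(2,3) by blast
  have "\<exists>p N. \<forall>P\<in>V j. b j P = fr P p (pvar j ^ N)" if "j \<in> {1..n}" for j
    using section_on_D[of "b j" "pvar j"] ba(1)[OF that] unfolding V_def by metis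
  then obtain p N where p: "\<And>j P. j \<in> {1..n} \<Longrightarrow> P \<in> V j \<Longrightarrow> b j P = fr P (p j) (pvar j ^ N j)" by metis
  have "\<exists>p N. \<forall>P\<in>V j. a j P = fr P p (pvar j ^ N)" if "j \<in> {1..n}" for j
    using section_on_D[of "a j" "pvar j"] ba(2)[OF that] unfolding V_def by metis
  then obtain q M where q: "\<And>j P. j \<in> {1..n} \<Longrightarrow> P \<in> V j \<Longrightarrow> a j P = fr P (q j) (pvar j ^ M j)" by metis
  have VF: "face_prime F \<in> V j" if "F \<in> \<Delta>" "j \<in> F" for F j
    using face_prime[OF that(1)] that(2) by (simp add: in_V)
  have inF: "j \<in> {1..n}" if "F \<in> \<Delta>" "j \<in> F" for F j using face_sub that by blast
  \<comment> \<open>At the generic point of \<open>F\<close> the section \<open>b j\<close> has an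
    inverse whose denominator is a power of \<open>pvar j\<close>. So its numerator, restricted to
    \<open>F\<close>, divides such a power.\<close>
  have pF: "\<exists>\<mu> s. \<mu> \<noteq> 0 \<and> rst F (p j) = const \<mu> * pvar j ^ s" if F: "F \<in> \<Delta>" and j: "j \<in> F" for F j
  proof -
    let ?P = "face_prime F"
    have nn: "proj (pvar j ^ k) \<notin> ?P" for k using face_prime[OF F] j by simp
    have "fr ?P (q j * p j) (pvar j ^ M j * pvar j ^ N j) = fr ?P 1 1"
      using ab[OF inF[OF F j] VF[OF F j]] p[OF inF[OF F j] VF[OF F j]] q[OF inF[OF F j] VF[OF F j]] nn face_prime(1)[OF F]
      by (simp add: fr_mult stalk_one)
    then have "rst F (q j * p j) * rst F 1 = rst F 1 * rst F (pvar j ^ M j * pvar j ^ N j)"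
      using j by (intro fr_eq_face_prime[OF F]) auto
    then have "rst F (p j) * rst F (q j) = pvar j ^ (M j + N j)" using j by (simp add: power_add ac_simps)
    then show ?thesis by (metis pvar_power_factor)
  qed
  have "\<exists>\<mu> s. {j} \<in> \<Delta> \<longrightarrow> \<mu> \<noteq> 0 \<and> rst {j} (p j) = const \<mu> * pvar j ^ s" for j
    using pF[of "{j}" j] by auto
  then obtain \<mu> s where \<mu>: "\<And>j. {j} \<in> \<Delta> \<Longrightarrow> \<mu> j \<noteq> 0" "\<And>j. {j} \<in> \<Delta> \<Longrightarrow> rst {j} (p j) = const (\<mu> j) * pvar j ^ s j"
    by metis
  \<comment> \<open>A constant times a power of \<open>pvar j\<close> survives restriction to
    \<open>{j}\<close>; hence the data found on \<open>F\<close> are those found at the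
    vertex.\<close>
  have pF': "rst F (p j) = const (\<mu> j) * pvar j ^ s j" if F: "F \<in> \<Delta>" and j: "j \<in> F" for F j
  proof -
    obtain \<mu>' s' where *: "rst F (p j) = const \<mu>' * pvar j ^ s'" using pF[OF F j] by blast
    have "{j} \<inter> F = {j}" using j by auto
    then have "rst {j} (p j) = rst {j} (rst F (p j))" by (simp only: rst_rst)
    also have "\<dots> = const \<mu>' * pvar j ^ s'" unfolding * by simp
    finally have "rst {j} (p j) = rst F (p j)" unfolding * .
    moreover have "{j} \<in> \<Delta>" using face_mono[OF F] j by simp
    ultimately show ?thesis using \<mu>(2) by metis
  qed
  have "\<mu> k = \<kappa> k j * \<mu> j \<and> Poly_Mapping.single k (s k) + v k j + Poly_Mapping.single j (N j)
      = u k j + Poly_Mapping.single j (s j) + Poly_Mapping.single k (N k)" if F: "{j, k} \<in> \<Delta>" for j k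
  proof -
    let ?F = "{j, k}" and ?P = "face_prime {j, k}"
    have jk: "j \<in> {1..n}" "k \<in> {1..n}" using inF[OF F] by auto
    have P: "?P \<in> V j" "?P \<in> V k" using VF[OF F] by auto
    have F': "{k, j} \<in> \<Delta>" using F by (simp add: insert_commute)
    have nn: "proj (pvar j ^ m) \<notin> ?P" "proj (pvar k ^ m) \<notin> ?P" for m using face_prime[OF F] by auto
    \<comment> \<open>The comparison of the charts \<open>j\<close> and \<open>k\<close> takes place
      at the generic point of the edge, where it becomes an identity of terms.\<close>
    have "b k ?P = c k j ?P \<otimes>\<^bsub>stalk ?P\<^esub> b j ?P"
      using tr[OF jk, of ?P] c_cocycle[of "idx ?P" j k ?P] idx[OF jk(1) P(1)] jk P by simp
    then have "fr ?P (p k) (pvar k ^ N k) = fr ?P (Poly_Mapping.single (u k j) (\<kappa> k j) * p j) (Poly_Mapping.single (v k j) 1 * pvar j ^ N j)"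
      unfolding p[OF jk(1) P(1)] p[OF jk(2) P(2)] c_def
      using fr_mult[OF face_prime(1)[OF F] notin(3)[OF jk(2,1) P(2,1)] nn(1)] by simp
    then have "rst ?F (p k) * rst ?F (Poly_Mapping.single (v k j) 1 * pvar j ^ N j)
        = rst ?F (Poly_Mapping.single (u k j) (\<kappa> k j) * p j) * rst ?F (pvar k ^ N k)"
    proof (rule fr_eq_face_prime[OF F, rotated -1])
      have "proj (Poly_Mapping.single (v k j) 1 * pvar j ^ N j) \<notin> ?P"
        using prime_mult[OF face_prime(1)[OF F]] notin(3)[OF jk(2,1) P(2,1)] nn(1) by blast
      then show "rst ?F (Poly_Mapping.single (v k j) 1 * pvar j ^ N j) \<noteq> (0 :: 'a mpoly)" unfolding face_prime(2)[OF F] .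
    qed simp
    then have "const (\<mu> k) * pvar k ^ s k * (Poly_Mapping.single (v k j) 1 * pvar j ^ N j)
        = Poly_Mapping.single (u k j) (\<kappa> k j) * (const (\<mu> j) * pvar j ^ s j) * pvar k ^ N k"
      using keys_uv[OF F'] by (simp add: pF'[OF F] insert_commute)
    then have eq: "Poly_Mapping.single (Poly_Mapping.single k (s k) + v k j + Poly_Mapping.single j (N j)) (\<mu> k)
        = Poly_Mapping.single (u k j + Poly_Mapping.single j (s j) + Poly_Mapping.single k (N k)) (\<kappa> k j * \<mu> j)"
      (is "Poly_Mapping.single ?m _ = Poly_Mapping.single ?m' _")
      by (simp add: pvar_power mult_single add.assoc)
    have "\<mu> k \<noteq> 0" "\<kappa> k j * \<mu> j \<noteq> 0" using \<mu>(1) face_mono[OF F] kappa[OF F'] by auto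
    then have "{?m} = {?m'}" using arg_cong[OF eq, of Poly_Mapping.keys] by simp
    then show ?thesis using eq by simp (metis lookup_single_eq)
  qed
  then show ?thesis unfolding cocycle_splits_def using \<mu>(1) by (intro exI[of _ \<mu>] exI[of _ s] exI[of _ N]) blast
qed

end


section \<open>Invertible sheaves over the reduced quotient\<close>

locale reduced_monomial_quotient = monomial_quotient +
  assumes reduced: "rst {1..n} p = p \<Longrightarrow> (\<And>F. F \<in> \<Delta> \<Longrightarrow> rst F p = 0) \<Longrightarrow> p \<in> I"
begin

lemma proj_zeroI: "(\<And>F. F \<in> \<Delta> \<Longrightarrow> rst F p = 0) \<Longrightarrow> proj p = \<zero>\<^bsub>R\<^esub>"
  unfolding proj_zero_iff using face_sub by (intro reduced) (auto simp: Int_absorb2)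

text \<open>In the reduced quotient equality can be tested face by face. The element
  \<open>w\<close>, a unit at \<open>P\<close>, serves as multiplier, so only the faces on which it
  does not vanish count.\<close>

lemma fr_eq_reducedI:
  assumes P: "primeideal P R" "proj s \<notin> P" "proj t \<notin> P" "proj w \<notin> P"
    and eq: "\<And>F. F \<in> \<Delta> \<Longrightarrow> rst F w \<noteq> 0 \<Longrightarrow> rst F a * rst F t = rst F b * rst F s"
  shows "fr P a s = fr P b t"
proof -
  have "proj (w * (a * t) - w * (b * s)) = \<zero>\<^bsub>R\<^esub>"
  proof (rule proj_zeroI)
    fix F assume F: "F \<in> \<Delta>"
    have "rst F w * (rst F a * rst F t) = rst F w * (rst F b * rst F s)"
      using eq[OF F] by (cases "rst F w = 0") auto
    then show "rst F (w * (a * t) - w * (b * s)) = 0" by simp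
  qed
  then show ?thesis using P pi_eq_iff by (subst fr_eq_iff[OF P(1-3)]) blast
qed

lemma fraction_section:
  assumes "openin (Spec R) U" "\<And>P. P \<in> U \<Longrightarrow> proj s \<notin> P"
  shows "(\<lambda>P\<in>U. fr P a s) \<in> carrier (sec \<O> U)"
  using assms open_prime by (intro basic_section) auto

text \<open>On \<open>D(X\<^sub>j)\<close> an invertible sheaf over the reduced quotient is free: it is trivial on a finite cover by
  basic open sets, and the numerators of its transition functions form a \<open>gluing_matrix\<close>.\<close>

lemma vertex_generator:
  assumes F: "invertible_sheaf punctured \<O> F" and j: "j \<in> {1..n}" "{j} \<in> \<Delta>"
  shows "\<exists>e. free_generator F (V j) e"
proof -
  have mF: "module_sheaf punctured \<O> F" using F by (simp add: invertible_sheaf_def)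
  interpret G: act_sheaf punctured \<O> F "\<lambda>U. module.smult (sec F U)" using act_sheaf_module[OF mF] .
  let ?x = "pvar j :: 'a mpoly"
  let ?\<H> = "{f. ?x dvd f \<and> (\<exists>e. G.gen (D f) e)}"
  have subV: "D f \<subseteq> V j" if "?x dvd f" for f using that by (auto simp: V_def D_mult elim!: dvdE)
  have opD: "openin punctured (D f)" if "?x dvd f" for f
    using subV[OF that] open_D[of f] j(1) by (auto simp: openin_punctured)
  have "D ?x \<subseteq> (\<Union>f\<in>?\<H>. D f)"
  proof
    fix P assume P: "P \<in> D ?x"
    then have "P \<in> topspace punctured" using j(1) by (auto simp: topspace_punctured V_def)
    from invertible_local_generator[OF F this] obtain U e where "P \<in> U" "free_generator F U e" by blast
    then have U: "P \<in> U" "G.gen U e" by (auto simp: free_generator_def)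
    have "openin (Spec R) U" using G.genD(1)[OF U(2)] by (rule Spec_open)
    then obtain h where h: "P \<in> D h" "D h \<subseteq> U" using Spec_basis U(1) by blast
    have "G.gen (D (?x * h)) (res F U (D (?x * h)) e)"
      by (rule G.gen_res[OF U(2) opD]) (use h in \<open>auto simp: D_mult\<close>)
    then show "P \<in> (\<Union>f\<in>?\<H>. D f)" using P h(1) by (intro UN_I[of "?x * h"]) (auto simp: D_mult)
  qed
  then obtain N H c where H: "finite H" "H \<subseteq> ?\<H>" and "proj (?x ^ N) = proj (\<Sum>f\<in>H. c f * f)"
    and cov: "D ?x \<subseteq> (\<Union>f\<in>H. D f)"
    by (rule finite_subcover[of ?x "\<lambda>f. f" ?\<H>])
  have xdvd: "?x dvd f" if "f \<in> H" for f using H(2) that by blast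
  have VH: "V j = \<Union>(D ` H)" using cov subV xdvd unfolding V_def by blast
  have "\<forall>f\<in>H. \<exists>e. G.gen (D f) e" using H(2) by blast
  then obtain e where e: "\<And>f. f \<in> H \<Longrightarrow> G.gen (D f) (e f)" by metis
  have "\<exists>\<rho>. G.transitions H D e \<rho>" by (rule G.exists_transitions) (rule e)
  then obtain \<rho> where tr: "G.transitions H D e \<rho>" by blast
  note \<rho> = G.transitionsD(1)[OF tr]
  have "\<exists>a N. \<forall>P\<in>D f \<inter> D g. \<rho> f g P = fr P a ((f * g) ^ N)" if "f \<in> H" "g \<in> H" for f g
    using section_on_D[of "\<rho> f g" "f * g"] \<rho>[OF that] unfolding D_mult by metis
  then obtain r0 N where r0: "\<And>f g P. f \<in> H \<Longrightarrow> g \<in> H \<Longrightarrow> P \<in> D f \<inter> D g \<Longrightarrow> \<rho> f g P = fr P (r0 f g) ((f * g) ^ N f g)"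
    by metis
  \<comment> \<open>A common exponent for the denominators of all transition functions.\<close>
  define M where "M = Max ((\<lambda>(f, g). N f g) ` (H \<times> H))"
  have NM: "N f g \<le> M" if "f \<in> H" "g \<in> H" for f g
    unfolding M_def using that H(1) by (intro Max_ge) auto
  have pw: "x ^ (2 * M) = x ^ M * x ^ M" for x :: "'a mpoly" by (simp add: mult_2 power_add)
  define r where "r f g = r0 f g * (f * g) ^ (M - N f g)" for f g
  have prD: "primeideal P R" "proj f \<notin> P" if "P \<in> D f" for P f using that by (auto simp: D_def)
  have r: "\<rho> f g P = fr P (r f g) ((f * g) ^ M)" if fg: "f \<in> H" "g \<in> H" "P \<in> D f \<inter> D g" for f g P
  proof -
    have P: "primeideal P R" "proj (f * g) \<notin> P" using fg(3) prime_mult by (auto simp: D_def)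
    show ?thesis unfolding r0[OF fg] r_def using prime_power[OF P] NM[OF fg(1,2)]
      by (intro fr_eqI[OF P(1)]) (auto simp: mult.assoc power_add[symmetric])
  qed
  have D_face: "face_prime K \<in> D f \<longleftrightarrow> rst K f \<noteq> 0" if "K \<in> \<Delta>" for K f
    using face_prime[OF that] by (simp add: D_def)
  have r_diag: "rst K (r f f) = rst K f ^ (2 * M)" if K: "K \<in> \<Delta>" and f: "f \<in> H" "rst K f \<noteq> 0" for K f
  proof -
    have "\<rho> f f = \<one>\<^bsub>sec \<O> (D f)\<^esub>" by (rule G.transitions_diag[OF e tr, OF f(1) f(1)])
    then have "fr (face_prime K) (r f f) ((f * f) ^ M) = fr (face_prime K) 1 1"
      using r[OF f(1) f(1), of "face_prime K"] D_face[OF K] f(2) by (simp add: sec_simps stalk_one)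
    from fr_eq_face_prime[OF K _ _ this] show ?thesis using f(2)
      by (simp add: power_mult_distrib power_add[symmetric] mult_2)
  qed
  have r_cocycle: "rst K (r f g) * rst K (r g h) = rst K (r f h) * rst K g ^ (2 * M)"
    if K: "K \<in> \<Delta>" and fgh: "f \<in> H" "g \<in> H" "h \<in> H" and nz: "rst K f \<noteq> 0" "rst K g \<noteq> 0" "rst K h \<noteq> 0" for K f g h
  proof -
    let ?W = "D f \<inter> D g \<inter> D h" and ?P = "face_prime K"
    have P: "?P \<in> ?W" using D_face[OF K] nz by simp
    have pr: "primeideal ?P R" by (rule face_prime(1)[OF K])
    have "restrict (\<rho> g h) ?W \<otimes>\<^bsub>sec \<O> ?W\<^esub> restrict (\<rho> f g) ?W = restrict (\<rho> f h) ?W"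
      using G.transitions_cocycle[OF e tr fgh] by simp
    from fun_cong[OF this, of ?P]
    have eq: "\<rho> g h ?P \<otimes>\<^bsub>stalk ?P\<^esub> \<rho> f g ?P = \<rho> f h ?P" using P by (simp add: sec_simps)
    have nn: "proj ((f * g) ^ M) \<notin> ?P" "proj ((g * h) ^ M) \<notin> ?P" using face_prime(2)[OF K] nz by auto
    have in3: "?P \<in> D f \<inter> D g" "?P \<in> D g \<inter> D h" "?P \<in> D f \<inter> D h" using P by auto
    have "fr ?P (r g h * r f g) ((g * h) ^ M * (f * g) ^ M) = fr ?P (r f h) ((f * h) ^ M)"
      using eq unfolding r[OF fgh(2,3) in3(2)] r[OF fgh(1,2) in3(1)] r[OF fgh(1,3) in3(3)] fr_mult[OF pr nn(2,1)] .
    then have "rst K (r g h * r f g) * rst K ((f * h) ^ M) = rst K (r f h) * rst K ((g * h) ^ M * (f * g) ^ M)"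
      using nz by (intro fr_eq_face_prime[OF K]) auto
    then have "rst K (f * h) ^ M * (rst K (r f g) * rst K (r g h)) = rst K (f * h) ^ M * (rst K (r f h) * rst K g ^ (2 * M))"
      unfolding pw by (simp add: power_mult_distrib ac_simps)
    then show ?thesis using nz by simp
  qed
  define \<Phi> where "\<Phi> = {K \<in> \<Delta>. j \<in> K}"
  \<comment> \<open>The cocycle identity of \<open>gluing_matrix\<close> is also required when the
    third function vanishes on the face. The extra factor makes both sides zero then; it accounts
    for the 1 in the exponent \<open>2 * M + 1\<close>, while \<open>2 * M\<close> comes from the
    denominators.\<close>
  define RR where "RR f g = r f g * g" for f g
  interpret gm: gluing_matrix H "\<lambda>f. f" RR "2 * M + 1" j \<Phi>
  proof
    show "finite H" by (rule H(1))
    have "\<Phi> \<subseteq> Pow {1..n}" using face_sub by (auto simp: \<Phi>_def)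
    then show "finite \<Phi>" by (rule finite_subset) simp
    show "j \<in> K" if "K \<in> \<Phi>" for K using that by (simp add: \<Phi>_def)
    show "{j} \<in> \<Phi>" using j by (simp add: \<Phi>_def)
    show "K \<inter> L \<in> \<Phi>" if "K \<in> \<Phi>" "L \<in> \<Phi>" for K L using that face_mono[of K "K \<inter> L"] by (auto simp: \<Phi>_def)
    show "?x dvd f" if "f \<in> H" for f by (rule xdvd[OF that])
    show "rst K (RR f f) = rst K f ^ (2 * M + 1)" if "K \<in> \<Phi>" "f \<in> H" "rst K f \<noteq> 0" for K f
      using r_diag[of K f] that by (simp add: RR_def \<Phi>_def mult.commute)
    show "rst K (RR f g) * rst K (RR g h) = rst K (RR f h) * rst K g ^ (2 * M + 1)"
      if "K \<in> \<Phi>" "f \<in> H" "g \<in> H" "h \<in> H" "rst K f \<noteq> 0" "rst K g \<noteq> 0" for K f g h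
    proof (cases "rst K h = 0")
      case False
      have "rst K (RR f g) * rst K (RR g h) = (rst K (r f g) * rst K (r g h)) * rst K g * rst K h"
        by (simp add: RR_def ac_simps)
      also have "\<dots> = rst K (RR f h) * rst K g ^ (2 * M + 1)"
        using r_cocycle[of K f g h] that False by (simp add: RR_def \<Phi>_def ac_simps)
      finally show ?thesis .
    qed (simp add: RR_def)
    show "\<exists>k c. \<forall>K\<in>\<Phi>. ?x ^ k = (\<Sum>f\<in>H. rst K (c f) * rst K f ^ L)" for L
    proof -
      have "D ?x \<subseteq> (\<Union>f\<in>H. D (f ^ L))" using cov prime_power by (fastforce simp: D_def)
      then obtain k H' c where H': "H' \<subseteq> H" "proj (?x ^ k) = proj (\<Sum>f\<in>H'. c f * f ^ L)"
        using cover_combination[of ?x "\<lambda>f. f ^ L" H] by blast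
      have "?x ^ k = (\<Sum>f\<in>H. rst K (if f \<in> H' then c f else 0) * rst K f ^ L)" if "K \<in> \<Phi>" for K
      proof -
        have K: "K \<in> \<Delta>" "j \<in> K" using that by (auto simp: \<Phi>_def)
        have "rst K (?x ^ k - (\<Sum>f\<in>H'. c f * f ^ L)) = 0" using rst_of_proj_zero[OF _ K(1)] H'(2) pi_eq_iff by blast
        then have "?x ^ k = (\<Sum>f\<in>H'. rst K (c f) * rst K f ^ L)" using K(2) by simp
        also have "\<dots> = (\<Sum>f\<in>H. rst K (if f \<in> H' then c f else 0) * rst K f ^ L)"
          using H'(1) H(1) by (intro sum.mono_neutral_cong_left) auto
        finally show ?thesis .
      qed
      then show ?thesis by (intro exI[of _ k] exI[of _ "\<lambda>f. if f \<in> H' then c f else 0"]) blast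
    qed
  qed simp
  obtain q where q: "\<forall>f\<in>H. \<exists>L t. \<forall>K\<in>\<Phi>. rst K (gm.E q f * t) = rst K f ^ L" using gm.exists_generator by blast
  define a where "a f = (\<lambda>P\<in>D f. fr P (gm.E q f) (f ^ M))" for f
  have aO: "a f \<in> carrier (sec \<O> (D f))" for f
    unfolding a_def using prD prime_power by (intro fraction_section open_D) blast
  \<comment> \<open>All members of \<open>H\<close> are multiples of \<open>pvar j\<close>, so faces
    that avoid \<open>j\<close> are invisible on the sets \<open>D f\<close>.\<close>
  have rst_j: "j \<in> K" if nz: "rst K f \<noteq> 0" and f: "f \<in> H" for K f
  proof (rule ccontr)
    assume "j \<notin> K"
    obtain g where "f = ?x * g" using xdvd[OF f] by blast
    then show False using nz \<open>j \<notin> K\<close> by simp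
  qed
  have a_unit: "\<exists>b\<in>carrier (sec \<O> (D f)). a f \<otimes>\<^bsub>sec \<O> (D f)\<^esub> b = \<one>\<^bsub>sec \<O> (D f)\<^esub>" if f: "f \<in> H" for f
  proof -
    obtain L t where t: "\<And>K. K \<in> \<Phi> \<Longrightarrow> rst K (gm.E q f * t) = rst K f ^ L" using q f by blast
    \<comment> \<open>The inverse of the fraction \<open>a f\<close>: by the choice of
      \<open>t\<close>, the product of \<open>gm.E q f\<close> and \<open>t\<close> is the power
      \<open>f ^ L\<close> on all faces through \<open>j\<close>.\<close>
    let ?b = "\<lambda>P\<in>D f. fr P (t * f ^ M) (f ^ L)"
    have b: "?b \<in> carrier (sec \<O> (D f))"
      using prD prime_power by (intro fraction_section open_D) blast
    have "a f \<otimes>\<^bsub>sec \<O> (D f)\<^esub> ?b = \<one>\<^bsub>sec \<O> (D f)\<^esub>"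
    proof (rule extensionalityI[of _ "D f"])
      fix P assume P: "P \<in> D f"
      note pr = prD[OF P]
      have "fr P (gm.E q f * (t * f ^ M)) (f ^ M * f ^ L) = fr P 1 1"
      proof (rule fr_eq_reducedI[OF pr(1)])
        show "proj f \<notin> P" by (rule pr(2))
        show "proj (f ^ M * f ^ L) \<notin> P" using prime_power[OF pr] prime_mult[OF pr(1)] by blast
        show "proj 1 \<notin> P" by (rule prime_one[OF pr(1)])
        fix K assume K: "K \<in> \<Delta>" "rst K f \<noteq> 0"
        then have "K \<in> \<Phi>" using rst_j f by (simp add: \<Phi>_def)
        from t[OF this] show "rst K (gm.E q f * (t * f ^ M)) * rst K 1 = rst K 1 * rst K (f ^ M * f ^ L)"
          by (simp add: mult.assoc[symmetric])
      qed
      then show "(a f \<otimes>\<^bsub>sec \<O> (D f)\<^esub> ?b) P = \<one>\<^bsub>sec \<O> (D f)\<^esub> P"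
        using P fr_mult[OF pr(1) prime_power[OF pr] prime_power[OF pr]] by (simp add: sec_simps a_def stalk_one)
    qed (auto simp: sec_simps)
    then show ?thesis using b by blast
  qed
  have "\<exists>t. G.gen (\<Union>(D ` H)) t"
  proof (rule G.gen_glue_units[OF e tr aO a_unit])
    fix f g assume f: "f \<in> H" and g: "g \<in> H"
    let ?W = "D f \<inter> D g"
    have "restrict (a g) ?W \<otimes>\<^bsub>sec \<O> ?W\<^esub> \<rho> f g = restrict (a f) ?W"
    proof (rule extensionalityI[of _ ?W])
      fix P assume P: "P \<in> ?W"
      have pr: "primeideal P R" "proj f \<notin> P" "proj g \<notin> P" using P by (auto simp: D_def)
      have nn: "proj (f * g) \<notin> P" using pr prime_mult by blast
      have "fr P (gm.E q g * r f g) (g ^ M * (f * g) ^ M) = fr P (gm.E q f) (f ^ M)"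
      proof (rule fr_eq_reducedI[OF pr(1) _ _ nn])
        show "proj (g ^ M * (f * g) ^ M) \<notin> P" "proj (f ^ M) \<notin> P"
          using prime_power[OF pr(1)] prime_mult[OF pr(1)] pr nn by blast+
        fix K assume K: "K \<in> \<Delta>" "rst K (f * g) \<noteq> 0"
        then have nz: "rst K f \<noteq> 0" "rst K g \<noteq> 0" by auto
        then have "K \<in> \<Phi>" using K rst_j f by (simp add: \<Phi>_def)
        from gm.E_transfer[OF this f g nz, of q]
        have "rst K g * (rst K (r f g) * rst K (gm.E q g)) = rst K g * (rst K (gm.E q f) * rst K g ^ (2 * M))"
          by (simp add: RR_def ac_simps)
        then have "rst K (r f g) * rst K (gm.E q g) = rst K (gm.E q f) * rst K g ^ (2 * M)" using nz by simp
        then have "rst K f ^ M * (rst K (r f g) * rst K (gm.E q g)) = rst K f ^ M * (rst K (gm.E q f) * rst K g ^ (2 * M))"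
          by simp
        then show "rst K (gm.E q g * r f g) * rst K (f ^ M) = rst K (gm.E q f) * rst K (g ^ M * (f * g) ^ M)"
          unfolding pw by (simp add: power_mult_distrib ac_simps)
      qed
      then show "(restrict (a g) ?W \<otimes>\<^bsub>sec \<O> ?W\<^esub> \<rho> f g) P = restrict (a f) ?W P"
        using P r[OF f g P] fr_mult[OF pr(1) prime_power[OF pr(1,3)] prime_power[OF pr(1) nn]]
        by (simp add: sec_simps a_def)
    qed (auto simp: sec_simps)
    then show "res \<O> (D g) ?W (a g) \<otimes>\<^bsub>sec \<O> ?W\<^esub> \<rho> f g = res \<O> (D f) ?W (a f)" by simp
  qed
  then show ?thesis unfolding VH free_generator_def .
qed

end

section \<open>Transition functions over the edges\<close>

lemma single_factor:
  fixes p q :: "'k::field mpoly"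
  assumes pq: "p * q = Poly_Mapping.single M c" and c: "c \<noteq> 0"
  obtains m d where "d \<noteq> 0" "p = Poly_Mapping.single m d" "Poly_Mapping.keys m \<subseteq> Poly_Mapping.keys M"
proof -
  have qp: "q * p = Poly_Mapping.single M c" using pq by (simp only: mult.commute)
  obtain m d where p: "p = Poly_Mapping.single m d" "d \<noteq> 0" by (rule monomial_factor[OF pq c])
  obtain m' d' where q: "q = Poly_Mapping.single m' d'" "d' \<noteq> 0" by (rule monomial_factor[OF qp c])
  have "Poly_Mapping.single (m + m') (d * d') = Poly_Mapping.single M c"
    using pq unfolding p(1) q(1) mult_single .
  from arg_cong[OF this, of Poly_Mapping.keys] have "M = m + m'" using p(2) q(2) c by simp
  then have "Poly_Mapping.keys m \<subseteq> Poly_Mapping.keys M" by (simp add: keys_add_monom)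
  then show thesis by (rule that[OF p(2,1)])
qed

context reduced_monomial_quotient
begin

text \<open>On each face through \<open>j\<close> and \<open>k\<close> the numerator of the unit
  divides a power of \<open>pvar j * pvar k\<close>, so it is a term in these two variables.
  Restriction to the edge shows that the term is the same on all such faces. Faces that miss
  \<open>j\<close> or \<open>k\<close> are annihilated by the multiplier
  \<open>pvar j * pvar k\<close>.\<close>

lemma edge_transition:
  assumes jk: "{j, k} \<in> \<Delta>"
    and a: "a \<in> carrier (sec \<O> (V j \<inter> V k))" and b: "b \<in> carrier (sec \<O> (V j \<inter> V k))"
    and ab: "a \<otimes>\<^bsub>sec \<O> (V j \<inter> V k)\<^esub> b = \<one>\<^bsub>sec \<O> (V j \<inter> V k)\<^esub>"
  shows "\<exists>\<kappa> u v. \<kappa> \<noteq> 0 \<and> Poly_Mapping.keys u \<subseteq> {j, k} \<and> Poly_Mapping.keys v \<subseteq> {j, k} \<and>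
    (\<forall>P\<in>V j \<inter> V k. a P = fr P (Poly_Mapping.single u \<kappa>) (Poly_Mapping.single v 1))"
proof -
  let ?x = "pvar j * pvar k :: 'a mpoly"
  have VV: "V j \<inter> V k = D ?x" by (simp add: V_def D_mult)
  obtain p N where p: "\<And>P. P \<in> D ?x \<Longrightarrow> a P = fr P p (?x ^ N)" using section_on_D[of a ?x] a VV by auto
  obtain p' N' where p': "\<And>P. P \<in> D ?x \<Longrightarrow> b P = fr P p' (?x ^ N')" using section_on_D[of b ?x] b VV by auto
  let ?e = "Poly_Mapping.single j 1 + Poly_Mapping.single k 1 :: monom"
  have xpow: "?x ^ L = Poly_Mapping.single (Poly_Mapping.single j L + Poly_Mapping.single k L) 1" for L
    by (simp add: power_mult_distrib pvar_power mult_single)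
  have xF: "rst F ?x = ?x" if "j \<in> F" "k \<in> F" for F using that by simp
  have mono: "\<exists>m d. d \<noteq> 0 \<and> rst F p = Poly_Mapping.single m d \<and> Poly_Mapping.keys m \<subseteq> {j, k}"
    if F: "F \<in> \<Delta>" "j \<in> F" "k \<in> F" for F
  proof -
    let ?P = "face_prime F"
    have P: "?P \<in> D ?x" using face_prime[OF F(1)] xF[OF F(2,3)] by (simp add: D_def)
    have pr: "primeideal ?P R" "proj ?x \<notin> ?P" using P by (auto simp: D_def)
    have "a ?P \<otimes>\<^bsub>stalk ?P\<^esub> b ?P = \<one>\<^bsub>stalk ?P\<^esub>" using fun_cong[OF ab, of ?P] P VV by (simp add: sec_simps)
    then have "fr ?P (p * p') (?x ^ N * ?x ^ N') = fr ?P 1 1"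
      unfolding p[OF P] p'[OF P] fr_mult[OF pr(1) prime_power[OF pr] prime_power[OF pr]] stalk_one .
    then have "rst F (p * p') * rst F 1 = rst F 1 * rst F (?x ^ N * ?x ^ N')"
      using F by (intro fr_eq_face_prime[OF F(1)]) auto
    then have "rst F p * rst F p' = ?x ^ (N + N')" using F(2,3) by (simp add: power_add)
    then have "rst F p * rst F p' = Poly_Mapping.single (Poly_Mapping.single j (N + N') + Poly_Mapping.single k (N + N')) 1"
      using xpow by simp
    then obtain m d where "d \<noteq> 0" "rst F p = Poly_Mapping.single m d"
      "Poly_Mapping.keys m \<subseteq> Poly_Mapping.keys (Poly_Mapping.single j (N + N') + Poly_Mapping.single k (N + N'))"
      by (rule single_factor) simp
    moreover have "Poly_Mapping.keys (Poly_Mapping.single j (N + N') + Poly_Mapping.single k (N + N')) \<subseteq> {j, k}"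
      by (auto simp: keys_add_monom split: if_splits)
    ultimately show ?thesis by blast
  qed
  obtain m d where m: "d \<noteq> 0" "rst {j, k} p = Poly_Mapping.single m d" "Poly_Mapping.keys m \<subseteq> {j, k}"
    using mono[OF jk] by auto
  have rstp: "rst F p = Poly_Mapping.single m d" if F: "F \<in> \<Delta>" "j \<in> F" "k \<in> F" for F
  proof -
    obtain m' d' where m': "rst F p = Poly_Mapping.single m' d'" "Poly_Mapping.keys m' \<subseteq> {j, k}" using mono[OF F] by auto
    have "{j, k} \<inter> F = {j, k}" using F by auto
    then have "rst {j, k} p = rst {j, k} (rst F p)" by (simp only: rst_rst)
    also have "\<dots> = rst F p" using m' by simp
    finally show ?thesis using m(2) by simp
  qed
  let ?v = "Poly_Mapping.single j N + Poly_Mapping.single k N"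
  have "a P = fr P (Poly_Mapping.single m d) (Poly_Mapping.single ?v 1)" if P: "P \<in> D ?x" for P
  proof -
    have pr: "primeideal P R" "proj ?x \<notin> P" using P by (auto simp: D_def)
    have "fr P p (?x ^ N) = fr P (Poly_Mapping.single m d) (?x ^ N)"
    proof (rule fr_eq_reducedI[OF pr(1) prime_power[OF pr] prime_power[OF pr] pr(2)])
      fix F assume F: "F \<in> \<Delta>" "rst F ?x \<noteq> 0"
      then have jF: "j \<in> F" "k \<in> F" by (auto split: if_splits)
      then have "rst F (Poly_Mapping.single m d) = Poly_Mapping.single m d" using m(3) by auto
      then show "rst F p * rst F (?x ^ N) = rst F (Poly_Mapping.single m d) * rst F (?x ^ N)"
        using rstp[OF F(1) jF] by simp
    qed
    then show ?thesis using p[OF P] by (simp add: xpow)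
  qed
  then show ?thesis using m VV
    by (intro exI[of _ d] exI[of _ m] exI[of _ ?v]) (auto simp: keys_add_monom split: if_splits)
qed

text \<open>The generators on the sets \<open>V j\<close> differ by a cocycle of terms. A splitting
  of this cocycle provides units on the \<open>V j\<close> by which the generators are corrected
  before gluing.\<close>

theorem generator_of_splitting:
  assumes split: "\<And>\<kappa> u v. monomial_cocycle_axioms \<Delta> \<kappa> u v \<Longrightarrow> cocycle_splits \<Delta> (\<kappa> :: nat \<Rightarrow> nat \<Rightarrow> 'a) u v"
    and F: "invertible_sheaf punctured \<O> F"
  shows "\<exists>e. free_generator F (topspace punctured) e"
proof -
  have mF: "module_sheaf punctured \<O> F" using F by (simp add: invertible_sheaf_def)
  interpret G: act_sheaf punctured \<O> F "\<lambda>U. module.smult (sec F U)" using act_sheaf_module[OF mF] .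
  define J where "J = {j \<in> {1..n}. {j} \<in> \<Delta>}"
  have J: "j \<in> {1..n}" "{j} \<in> \<Delta>" if "j \<in> J" for j using that by (auto simp: J_def)
  have JF: "j \<in> J" if K: "K \<in> \<Delta>" "j \<in> K" for K j
    using face_sub[OF K(1)] face_mono[OF K(1), of "{j}"] K(2) by (auto simp: J_def)
  have cover: "topspace punctured = \<Union>(V ` J)"
  proof -
    have "{j} \<in> \<Delta>" if "P \<in> V j" "j \<in> {1..n}" for P j using that by (intro face_of_V[of _ P]) auto
    then show ?thesis by (auto simp: topspace_punctured J_def)
  qed
  obtain e where e: "\<And>j. j \<in> J \<Longrightarrow> G.gen (V j) (e j)"
    using vertex_generator[OF F] J unfolding free_generator_def by metis
  have "\<exists>\<rho>. G.transitions J V e \<rho>" by (rule G.exists_transitions) (rule e)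
  then obtain \<rho> where tr: "G.transitions J V e \<rho>" by blast
  note \<rho> = G.transitionsD(1)[OF tr]
  \<comment> \<open>The implication is part of \<open>Q\<close> so that the choice of coefficient
    and exponents is total in \<open>j\<close> and \<open>k\<close>.\<close>
  define Q where "Q j k \<kappa> u v \<longleftrightarrow> ({j, k} \<in> \<Delta> \<longrightarrow> \<kappa> \<noteq> 0 \<and> Poly_Mapping.keys u \<subseteq> {j, k} \<and> Poly_Mapping.keys v \<subseteq> {j, k} \<and>
      (\<forall>P\<in>V j \<inter> V k. \<rho> j k P = fr P (Poly_Mapping.single u \<kappa>) (Poly_Mapping.single v 1)))" for j k \<kappa> u v
  have "\<exists>\<kappa> u v. Q j k \<kappa> u v" for j k
  proof (cases "{j, k} \<in> \<Delta>")
    case True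
    then have jk: "j \<in> J" "k \<in> J" using JF by auto
    then obtain b where "b \<in> carrier (sec \<O> (V j \<inter> V k))" "\<rho> j k \<otimes>\<^bsub>sec \<O> (V j \<inter> V k)\<^esub> b = \<one>\<^bsub>sec \<O> (V j \<inter> V k)\<^esub>"
      using G.transitionsD(2)[OF tr] by blast
    then show ?thesis using edge_transition[OF True \<rho>[OF jk]] unfolding Q_def by blast
  qed (simp add: Q_def)
  then obtain \<kappa>0 where "\<And>j k. \<exists>u v. Q j k (\<kappa>0 j k) u v" by metis
  then obtain u0 where "\<And>j k. \<exists>v. Q j k (\<kappa>0 j k) (u0 j k) v" by metis
  then obtain v0 where Q: "\<And>j k. Q j k (\<kappa>0 j k) (u0 j k) (v0 j k)" by metis
  \<comment> \<open>The transition functions satisfy \<open>\<rho> j k\<close> times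
    \<open>\<rho> i j\<close> equals \<open>\<rho> i k\<close>; exchanging the indices turns this
    into the order of factors in \<open>monomial_cocycle\<close>.\<close>
  define \<kappa> where "\<kappa> j k = \<kappa>0 k j" for j k
  define u where "u j k = u0 k j" for j k
  define v where "v j k = v0 k j" for j k
  have kuv: "\<kappa> k j \<noteq> 0 \<and> Poly_Mapping.keys (u k j) \<subseteq> {j, k} \<and> Poly_Mapping.keys (v k j) \<subseteq> {j, k} \<and>
      (\<forall>P\<in>V j \<inter> V k. \<rho> j k P = fr P (Poly_Mapping.single (u k j) (\<kappa> k j)) (Poly_Mapping.single (v k j) 1))"
    if "{j, k} \<in> \<Delta>" for j k
    using Q[of j k] that unfolding Q_def \<kappa>_def u_def v_def by blast
  have "monomial_cocycle_axioms \<Delta> \<kappa> u v"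
  proof
    fix j k assume "{j, k} \<in> \<Delta>"
    then have "{k, j} \<in> \<Delta>" by (simp add: insert_commute)
    from kuv[OF this] show "\<kappa> j k \<noteq> 0" "Poly_Mapping.keys (u j k) \<subseteq> {j, k}" "Poly_Mapping.keys (v j k) \<subseteq> {j, k}"
      by auto
  next
    fix i j k assume K: "{i, j, k} \<in> \<Delta>"
    let ?P = "face_prime {i, j, k}" and ?W = "V k \<inter> V j \<inter> V i"
    have ijk: "i \<in> J" "j \<in> J" "k \<in> J" using JF[OF K] by auto
    have edges: "{j, i} \<in> \<Delta>" "{k, j} \<in> \<Delta>" "{k, i} \<in> \<Delta>" using face_mono[OF K] by auto
    have P: "?P \<in> V i" "?P \<in> V j" "?P \<in> V k" using face_prime[OF K] by (auto simp: in_V)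
    then have pr: "primeideal ?P R" by (simp add: in_V)
    have "restrict (\<rho> j i) ?W \<otimes>\<^bsub>sec \<O> ?W\<^esub> restrict (\<rho> k j) ?W = restrict (\<rho> k i) ?W"
      using G.transitions_cocycle[OF e tr ijk(3,2,1)] by simp
    from fun_cong[OF this, of ?P]
    have eq: "\<rho> j i ?P \<otimes>\<^bsub>stalk ?P\<^esub> \<rho> k j ?P = \<rho> k i ?P" using P by (simp add: sec_simps)
    have keys: "Poly_Mapping.keys (u i j) \<subseteq> {i, j, k}" "Poly_Mapping.keys (v i j) \<subseteq> {i, j, k}"
      "Poly_Mapping.keys (u j k) \<subseteq> {i, j, k}" "Poly_Mapping.keys (v j k) \<subseteq> {i, j, k}"
      "Poly_Mapping.keys (u i k) \<subseteq> {i, j, k}" "Poly_Mapping.keys (v i k) \<subseteq> {i, j, k}"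
      using kuv[OF edges(1)] kuv[OF edges(2)] kuv[OF edges(3)] by blast+
    have fixed: "rst {i, j, k} (Poly_Mapping.single m d) = Poly_Mapping.single m d"
      if "Poly_Mapping.keys m \<subseteq> {i, j, k}" for m and d :: 'a using that by simp
    have vnz: "Poly_Mapping.single m 1 \<noteq> (0 :: 'a mpoly)" for m
      by (metis lookup_single_eq lookup_zero zero_neq_one)
    have nn: "proj (Poly_Mapping.single (v i j) 1) \<notin> ?P" "proj (Poly_Mapping.single (v j k) 1) \<notin> ?P"
      using face_prime(2)[OF K] fixed[OF keys(2)] fixed[OF keys(4)] vnz by simp_all
    have "fr ?P (Poly_Mapping.single (u i j) (\<kappa> i j) * Poly_Mapping.single (u j k) (\<kappa> j k))
        (Poly_Mapping.single (v i j) 1 * Poly_Mapping.single (v j k) 1)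
      = fr ?P (Poly_Mapping.single (u i k) (\<kappa> i k)) (Poly_Mapping.single (v i k) 1)"
      using eq kuv[OF edges(1)] kuv[OF edges(2)] kuv[OF edges(3)] P fr_mult[OF pr nn] by simp
    then have "rst {i, j, k} (Poly_Mapping.single (u i j) (\<kappa> i j) * Poly_Mapping.single (u j k) (\<kappa> j k)) * rst {i, j, k} (Poly_Mapping.single (v i k) 1)
      = rst {i, j, k} (Poly_Mapping.single (u i k) (\<kappa> i k)) * rst {i, j, k} (Poly_Mapping.single (v i j) 1 * Poly_Mapping.single (v j k) 1)"
      using fixed keys vnz by (intro fr_eq_face_prime[OF K]) (simp_all only: rst_simps(5) mult_eq_0_iff, simp_all)
    then have "Poly_Mapping.single (u i j + u j k + v i k) (\<kappa> i j * \<kappa> j k) = Poly_Mapping.single (v i j + v j k + u i k) (\<kappa> i k)"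
      using keys by (simp add: mult_single keys_add_monom ac_simps)
    moreover have "\<kappa> i k \<noteq> 0" "\<kappa> i j * \<kappa> j k \<noteq> 0" using kuv[OF edges(1)] kuv[OF edges(2)] kuv[OF edges(3)] by auto
    ultimately show "\<kappa> i j * \<kappa> j k = \<kappa> i k" "u i j + u j k + v i k = v i j + v j k + u i k"
      by (metis keys_single lookup_single_eq singleton_inject)+
  qed
  from split[OF this] obtain \<mu> s N where *: "\<forall>j. {j} \<in> \<Delta> \<longrightarrow> \<mu> j \<noteq> 0"
    "\<forall>j k. {j, k} \<in> \<Delta> \<longrightarrow> \<mu> k = \<kappa> k j * \<mu> j \<and>
       Poly_Mapping.single k (s k) + v k j + Poly_Mapping.single j (N j)
         = u k j + Poly_Mapping.single j (s j) + Poly_Mapping.single k (N k)"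
    unfolding cocycle_splits_def by (elim exE conjE)
  have \<mu>: "\<And>j. {j} \<in> \<Delta> \<Longrightarrow> \<mu> j \<noteq> 0" "\<And>j k. {j, k} \<in> \<Delta> \<Longrightarrow> \<mu> k = \<kappa> k j * \<mu> j"
    and exps: "\<And>j k. {j, k} \<in> \<Delta> \<Longrightarrow> Poly_Mapping.single k (s k) + v k j + Poly_Mapping.single j (N j)
          = u k j + Poly_Mapping.single j (s j) + Poly_Mapping.single k (N k)"
    using * by blast+
  let ?S = "\<lambda>m c. Poly_Mapping.single m c :: 'a mpoly"
  let ?e = "\<lambda>k m. Poly_Mapping.single k m :: monom"
  \<comment> \<open>The inverses of the terms of the splitting; their exponents are
    \<open>N k - s k\<close>, written as a fraction.\<close>
  define g where "g k = (\<lambda>P\<in>V k. fr P (?S (?e k (N k)) (inverse (\<mu> k))) (?S (?e k (s k)) 1))" for k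
  define g' where "g' k = (\<lambda>P\<in>V k. fr P (?S (?e k (s k)) (\<mu> k)) (?S (?e k (N k)) 1))" for k
  have nn: "proj (?S (?e k m) 1) \<notin> P" if "P \<in> V k" for P k m
    using that by (intro single_notin) (auto simp: in_V split: if_splits)
  have gO: "g k \<in> carrier (sec \<O> (V k))" "g' k \<in> carrier (sec \<O> (V k))" for k
    unfolding g_def g'_def by (intro fraction_section nn; simp add: V_def open_D)+
  have prV: "primeideal P R" if "P \<in> V k" for P k using that by (simp add: in_V)
  have gg': "g k \<otimes>\<^bsub>sec \<O> (V k)\<^esub> g' k = \<one>\<^bsub>sec \<O> (V k)\<^esub>" if k: "k \<in> J" for k
  proof (rule extensionalityI[of _ "V k"])
    fix P assume P: "P \<in> V k"
    have "inverse (\<mu> k) * \<mu> k = 1" using \<mu>(1) J(2)[OF k] by simp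
    then have "fr P (?S (?e k (N k)) (inverse (\<mu> k)) * ?S (?e k (s k)) (\<mu> k)) (?S (?e k (s k)) 1 * ?S (?e k (N k)) 1) = fr P 1 1"
    proof (intro fr_eqI[OF prV[OF P]])
      show "proj (?S (?e k (s k)) 1 * ?S (?e k (N k)) 1) \<notin> P" using nn[OF P] prime_mult[OF prV[OF P]] by blast
      show "proj 1 \<notin> P" by (rule prime_one[OF prV[OF P]])
    qed (simp add: mult_single add.commute)
    then show "(g k \<otimes>\<^bsub>sec \<O> (V k)\<^esub> g' k) P = \<one>\<^bsub>sec \<O> (V k)\<^esub> P"
      using P fr_mult[OF prV[OF P] nn[OF P] nn[OF P]] by (simp add: sec_simps g_def g'_def stalk_one)
  qed (auto simp: sec_simps)
  have "\<exists>t. G.gen (\<Union>(V ` J)) t"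
  proof (rule G.gen_glue_units[OF e tr gO(1)])
    show "\<exists>b\<in>carrier (sec \<O> (V k)). g k \<otimes>\<^bsub>sec \<O> (V k)\<^esub> b = \<one>\<^bsub>sec \<O> (V k)\<^esub>" if "k \<in> J" for k
      using gO(2) gg'[OF that] by blast
    fix j k assume j: "j \<in> J" and k: "k \<in> J"
    let ?W = "V j \<inter> V k"
    have "restrict (g k) ?W \<otimes>\<^bsub>sec \<O> ?W\<^esub> \<rho> j k = restrict (g j) ?W"
    proof (rule extensionalityI[of _ ?W])
      fix P assume "P \<in> ?W"
      then have P: "P \<in> V j" "P \<in> V k" by auto
      have E: "{j, k} \<in> \<Delta>" using P J[OF j] J[OF k] by (intro face_of_V[of _ P]) auto
      have \<rho>P: "\<rho> j k P = fr P (?S (u k j) (\<kappa> k j)) (?S (v k j) 1)" using kuv[OF E] P by blast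
      have "proj (pvar i) \<notin> P" if "i \<in> Poly_Mapping.keys (v k j)" for i using kuv[OF E] that P by (auto simp: in_V)
      then have nv: "proj (?S (v k j) 1) \<notin> P" by (intro single_notin[OF prV[OF P(1)]]) auto
      have kE: "\<kappa> k j \<noteq> 0" using kuv[OF E] by blast
      have m1: "inverse (\<mu> k) * \<kappa> k j = inverse (\<mu> j)" using \<mu>(2)[OF E] kE by (simp add: field_simps)
      have m2: "?e k (N k) + u k j + ?e j (s j) = ?e j (N j) + (?e k (s k) + v k j)"
        using exps[OF E] by (simp add: ac_simps)
      have "fr P (?S (?e k (N k)) (inverse (\<mu> k)) * ?S (u k j) (\<kappa> k j)) (?S (?e k (s k)) 1 * ?S (v k j) 1)
          = fr P (?S (?e j (N j)) (inverse (\<mu> j))) (?S (?e j (s j)) 1)"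
      proof (rule fr_eqI[OF prV[OF P(1)]])
        show "proj (?S (?e k (s k)) 1 * ?S (v k j) 1) \<notin> P" using nn[OF P(2)] nv prime_mult[OF prV[OF P(1)]] by blast
        show "proj (?S (?e j (s j)) 1) \<notin> P" by (rule nn[OF P(1)])
        have "?S (?e k (N k)) (inverse (\<mu> k)) * ?S (u k j) (\<kappa> k j) * ?S (?e j (s j)) 1
            = ?S (?e j (N j)) (inverse (\<mu> j)) * (?S (?e k (s k)) 1 * ?S (v k j) 1)"
          by (simp only: mult_single m1 m2 mult_1_right)
        then show "proj (?S (?e k (N k)) (inverse (\<mu> k)) * ?S (u k j) (\<kappa> k j) * ?S (?e j (s j)) 1)
            = proj (?S (?e j (N j)) (inverse (\<mu> j)) * (?S (?e k (s k)) 1 * ?S (v k j) 1))" by (rule arg_cong)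
      qed
      then show "(restrict (g k) ?W \<otimes>\<^bsub>sec \<O> ?W\<^esub> \<rho> j k) P = restrict (g j) ?W P"
        using P \<rho>P fr_mult[OF prV[OF P(1)] nn[OF P(2)] nv] by (simp add: sec_simps g_def)
    qed (auto simp: sec_simps)
    then show "res \<O> (V k) ?W (g k) \<otimes>\<^bsub>sec \<O> ?W\<^esub> \<rho> j k = res \<O> (V j) ?W (g j)" by simp
  qed
  then show ?thesis by (simp add: cover free_generator_def)
qed

theorem Pic_trivial_of_splitting:
  assumes split: "\<And>\<kappa> u v. monomial_cocycle_axioms \<Delta> \<kappa> u v \<Longrightarrow> cocycle_splits \<Delta> (\<kappa> :: nat \<Rightarrow> nat \<Rightarrow> 'a) u v"
  shows "carrier (Pic_loc n I) = {\<one>\<^bsub>Pic_loc n I\<^esub>}"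
proof -
  \<comment> \<open>Twisting by the trivial cocycle supplies the invertible sheaf that witnesses a
    class.\<close>
  interpret trivial: monomial_cocycle n I \<Delta> "\<lambda>_ _. 1" "\<lambda>_ _. 0" "\<lambda>_ _. 0"
    by unfold_locales auto
  show ?thesis unfolding Pic_loc_eq
    by (rule Pic_trivialI[OF trivial.twist.invertible_L]) (rule generator_of_splitting[OF split])
qed

end


section \<open>Invertible sheaves of binoid sets\<close>

locale binoid_space = sheaf T \<O> for T :: "'p topology" and \<O> :: "('p, 'a) binoid_sheaf" +
  assumes res_one: "\<lbrakk>openin T U; openin T V; V \<subseteq> U\<rbrakk> \<Longrightarrow> res \<O> U V \<one>\<^bsub>sec \<O> U\<^esub> = \<one>\<^bsub>sec \<O> V\<^esub>"
    and res_mult: "\<lbrakk>openin T U; openin T V; V \<subseteq> U; a \<in> carrier (sec \<O> U); b \<in> carrier (sec \<O> U)\<rbrakk>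
      \<Longrightarrow> res \<O> U V (a \<otimes>\<^bsub>sec \<O> U\<^esub> b) = res \<O> U V a \<otimes>\<^bsub>sec \<O> V\<^esub> res \<O> U V b"
begin

lemma act_sheaf_binoid_set:
  assumes F: "binoid_set_sheaf T \<O> F"
  shows "act_sheaf T \<O> F (\<lambda>U. act (sec F U))"
proof -
  interpret F: binoid_set_sheaf T \<O> F using F .
  show ?thesis
  proof (intro act_sheaf.intro act_sheaf_axioms.intro F.sheaf_axioms sheaf_axioms)
    fix U assume "openin T U"
    then interpret binoid_set "sec \<O> U" "sec F U" by (rule F.binoid_set)
    show "comm_monoid (sec \<O> U)" by (rule comm_monoid_axioms)
  qed (auto intro: F.binoid_set binoid_set.act_closed binoid_set.act_one binoid_set.act_mult F.res_act res_one res_mult)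
qed

definition free_generator :: "('p, 'a, 's) binoid_set_sheaf \<Rightarrow> 'p set \<Rightarrow> 's \<Rightarrow> bool" where
  "free_generator F = act_sheaf.gen T \<O> F (\<lambda>U. act (sec F U))"

lemma binoid_set_sheaf_iso_of_generators:
  assumes mF: "binoid_set_sheaf T \<O> F" and mG: "binoid_set_sheaf T \<O> G"
    and e: "free_generator F (topspace T) e" and d: "free_generator G (topspace T) d"
  shows "binoid_set_sheaf_iso T \<O> F G"
proof -
  interpret mF: binoid_set_sheaf T \<O> F using mF .
  interpret mG: binoid_set_sheaf T \<O> G using mG .
  obtain \<phi> e' d' where bij: "\<And>U. openin T U \<Longrightarrow> bij_betw (\<phi> U) (carrier (sec F U)) (carrier (sec G U))"
    and \<phi>: "\<And>U a. \<lbrakk>openin T U; a \<in> carrier (sec \<O> U)\<rbrakk> \<Longrightarrow> \<phi> U (act (sec F U) a (e' U)) = act (sec G U) a (d' U)"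
    and surj: "\<And>U s. \<lbrakk>openin T U; s \<in> carrier (sec F U)\<rbrakk> \<Longrightarrow> \<exists>a\<in>carrier (sec \<O> U). s = act (sec F U) a (e' U)"
    and cl: "\<And>U. openin T U \<Longrightarrow> e' U \<in> carrier (sec F U)" "\<And>U. openin T U \<Longrightarrow> d' U \<in> carrier (sec G U)"
    and act: "\<And>U a s. \<lbrakk>openin T U; a \<in> carrier (sec \<O> U); s \<in> carrier (sec F U)\<rbrakk>
      \<Longrightarrow> \<phi> U (act (sec F U) a s) = act (sec G U) a (\<phi> U s)"
    and res: "\<And>U V s. \<lbrakk>openin T U; openin T V; V \<subseteq> U; s \<in> carrier (sec F U)\<rbrakk> \<Longrightarrow> \<phi> V (res F U V s) = res G U V (\<phi> U s)"
    using gen_iso_map[OF act_sheaf_binoid_set[OF mF] act_sheaf_binoid_set[OF mG] e[unfolded free_generator_def] d[unfolded free_generator_def]]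
    by blast
  have "\<phi> \<in> binoid_set_sheaf_hom T \<O> F G"
    unfolding binoid_set_sheaf_hom_def
  proof (intro CollectI conjI allI impI ballI)
    fix U assume U: "openin T U"
    interpret MF: binoid_set "sec \<O> U" "sec F U" using mF.binoid_set[OF U] .
    interpret MG: binoid_set "sec \<O> U" "sec G U" using mG.binoid_set[OF U] .
    show "\<phi> U \<in> carrier (sec F U) \<rightarrow> carrier (sec G U)" using bij[OF U] by (auto simp: bij_betw_def)
    show "\<phi> U (base (sec F U)) = base (sec G U)"
      using \<phi>[OF U MF.absorb_closed] MF.act_absorb[OF cl(1)[OF U]] MG.act_absorb[OF cl(2)[OF U]] by simp
  qed (use act res in auto)
  then show ?thesis using bij by (auto simp: binoid_set_sheaf_iso_def)
qed

lemma invertible_local_generator: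
  assumes F: "invertible_binoid_set_sheaf T \<O> F" and x: "x \<in> topspace T"
  shows "\<exists>U e. x \<in> U \<and> free_generator F U e"
proof -
  have mF: "binoid_set_sheaf T \<O> F" using F by (simp add: invertible_binoid_set_sheaf_def)
  interpret F: act_sheaf T \<O> F "\<lambda>U. act (sec F U)" using act_sheaf_binoid_set[OF mF] .
  obtain U where U: "openin T U" "x \<in> U" and iso: "binoid_set_sheaf_iso (subtopology T U) \<O> F (structure_binoid_set \<O>)"
    using F x by (auto simp: invertible_binoid_set_sheaf_def)
  obtain \<phi> where hom: "\<phi> \<in> binoid_set_sheaf_hom (subtopology T U) \<O> F (structure_binoid_set \<O>)"
    and bij: "\<And>W. openin (subtopology T U) W \<Longrightarrow> bij_betw (\<phi> W) (carrier (sec F W)) (carrier (sec (structure_binoid_set \<O>) W))"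
    using iso by (auto simp: binoid_set_sheaf_iso_def)
  note [simp] = structure_binoid_set_def binoid_as_set_def openin_open_subtopology[OF U(1)]
  have "\<exists>e. F.gen U e"
  proof (rule F.gen_of_iso[OF U(1), of \<phi>])
    show "bij_betw (\<phi> W) (carrier (sec F W)) (carrier (sec \<O> W))" if "openin T W" "W \<subseteq> U" for W
      using bij[of W] that by simp
    show "\<phi> W (act (sec F W) a s) = a \<otimes>\<^bsub>sec \<O> W\<^esub> \<phi> W s"
      if "openin T W" "W \<subseteq> U" "a \<in> carrier (sec \<O> W)" "s \<in> carrier (sec F W)" for W a s
      using hom that by (auto simp: binoid_set_sheaf_hom_def)
    show "\<phi> W (res F U W s) = res \<O> U W (\<phi> U s)" if "openin T W" "W \<subseteq> U" "s \<in> carrier (sec F U)" for W s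
      using hom that U(1) by (auto simp: binoid_set_sheaf_hom_def)
  qed
  then show ?thesis using U(2) by (auto simp: free_generator_def)
qed

lemma binoid_Pic_trivialI:
  assumes S: "invertible_binoid_set_sheaf T \<O> (structure_binoid_set \<O>)"
    and gen: "\<And>F :: ('p, 'a, 'a) binoid_set_sheaf. invertible_binoid_set_sheaf T \<O> F \<Longrightarrow> \<exists>e. free_generator F (topspace T) e"
  shows "carrier (binoid_Pic T \<O>) = {\<one>\<^bsub>binoid_Pic T \<O>\<^esub>}"
  unfolding binoid_Pic_def
proof (rule class_group_trivialI)
  have iso: "binoid_set_sheaf_iso T \<O> F G" if F: "invertible_binoid_set_sheaf T \<O> F" and G: "invertible_binoid_set_sheaf T \<O> G"
    for F G :: "('p, 'a, 'a) binoid_set_sheaf"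
  proof -
    obtain e where "free_generator F (topspace T) e" using gen[OF F] by blast
    moreover obtain d where "free_generator G (topspace T) d" using gen[OF G] by blast
    ultimately show ?thesis using binoid_set_sheaf_iso_of_generators F G by (auto simp: invertible_binoid_set_sheaf_def)
  qed
  show "structure_binoid_set \<O> \<in> {F. invertible_binoid_set_sheaf T \<O> F}" using S by simp
  show "binoid_set_sheaf_iso T \<O> (structure_binoid_set \<O>) F" if "F \<in> {F. invertible_binoid_set_sheaf T \<O> F}" for F :: "('p, 'a, 'a) binoid_set_sheaf"
    using iso[OF S] that by simp
  show "binoid_set_sheaf_iso T \<O> F G"
    if "F \<in> {F. invertible_binoid_set_sheaf T \<O> F}" "G \<in> {F. invertible_binoid_set_sheaf T \<O> F}" for F G :: "('p, 'a, 'a) binoid_set_sheaf"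
    using iso that by simp
qed

end

section \<open>Localizations and structure sheaf of a binoid\<close>

context binoid
begin

abbreviation frac :: "'a set \<Rightarrow> 'a \<Rightarrow> 'a \<Rightarrow> ('a \<times> 'a) set" where
  "frac P \<equiv> fraction M (carrier M - P)"

abbreviation stalk :: "'a set \<Rightarrow> ('a \<times> 'a) set binoid" where
  "stalk P \<equiv> binoid_localization M (carrier M - P)"

lemma prime_submonoid: "binoid_prime P M \<Longrightarrow> submonoid (carrier M - P) M"
  by (simp add: binoid_prime_def)

lemma prime_one: "binoid_prime P M \<Longrightarrow> \<one> \<notin> P"
  using submonoid.one_closed[OF prime_submonoid] by auto

lemma prime_mult:
  assumes P: "binoid_prime P M" and ab: "a \<in> carrier M" "b \<in> carrier M"
  shows "a \<otimes> b \<in> P \<longleftrightarrow> a \<in> P \<or> b \<in> P"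
proof
  show "a \<otimes> b \<in> P \<Longrightarrow> a \<in> P \<or> b \<in> P" using submonoid.m_closed[OF prime_submonoid[OF P], of a b] ab by auto
  have "a \<otimes> b = b \<otimes> a" using m_comm ab .
  then show "a \<in> P \<or> b \<in> P \<Longrightarrow> a \<otimes> b \<in> P" using P ab unfolding binoid_prime_def by metis
qed

lemma frac_eq_iff:
  assumes "binoid_prime P M" "a \<in> carrier M" "b \<in> carrier M" "s \<in> carrier M - P" "t \<in> carrier M - P"
  shows "frac P a s = frac P b t \<longleftrightarrow> (\<exists>u\<in>carrier M - P. u \<otimes> (a \<otimes> t) = u \<otimes> (b \<otimes> s))"
  using fraction_eq_iff[OF prime_submonoid[OF assms(1)] assms(2-)] .

lemma frac_eqI:
  assumes "binoid_prime P M" "a \<in> carrier M" "b \<in> carrier M" "s \<in> carrier M - P" "t \<in> carrier M - P" "a \<otimes> t = b \<otimes> s"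
  shows "frac P a s = frac P b t"
  using assms prime_one by (subst frac_eq_iff) (auto intro!: bexI[of _ \<one>])

lemma frac_mult:
  assumes "binoid_prime P M" "a \<in> carrier M" "b \<in> carrier M" "s \<in> carrier M - P" "t \<in> carrier M - P"
  shows "frac P a s \<otimes>\<^bsub>stalk P\<^esub> frac P b t = frac P (a \<otimes> b) (s \<otimes> t)"
  using fraction_mult_eq[OF prime_submonoid[OF assms(1)], of a s b t] assms by (simp add: binoid_localization_def)

lemma stalk_carrier: "x \<in> carrier (stalk P) \<longleftrightarrow> (\<exists>a\<in>carrier M. \<exists>s\<in>carrier M - P. x = frac P a s)"
  by (auto simp: binoid_localization_def)

lemma stalk_one: "\<one>\<^bsub>stalk P\<^esub> = frac P \<one> \<one>"
  by (simp add: binoid_localization_def)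

lemma stalk_absorb: "absorb (stalk P) = frac P (absorb M) \<one>"
  by (simp add: binoid_localization_def)

lemma stalk_binoid:
  assumes P: "binoid_prime P M"
  shows "binoid (stalk P)"
proof (intro binoid.intro comm_monoidI binoid_axioms.intro)
  have den: "s \<otimes> t \<in> carrier M - P" if "s \<in> carrier M - P" "t \<in> carrier M - P" for s t
    using that prime_mult[OF P] by auto
  have one: "\<one> \<in> carrier M - P" and [simp]: "\<one> \<notin> P" using prime_one[OF P] by simp_all
  note [simp] = frac_mult[OF P] den one stalk_one stalk_absorb absorb_closed
  note eqI = frac_eqI[OF P]
  show "\<one>\<^bsub>stalk P\<^esub> \<in> carrier (stalk P)" "absorb (stalk P) \<in> carrier (stalk P)"
    unfolding stalk_carrier stalk_one stalk_absorb using one absorb_closed one_closed by blast+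
  fix x y z assume "x \<in> carrier (stalk P)"
  then obtain a s where x: "x = frac P a s" "a \<in> carrier M" "s \<in> carrier M - P" by (auto simp: stalk_carrier)
  then have s: "s \<in> carrier M" by simp
  show "\<one>\<^bsub>stalk P\<^esub> \<otimes>\<^bsub>stalk P\<^esub> x = x" using x s by simp
  show "absorb (stalk P) \<otimes>\<^bsub>stalk P\<^esub> x = absorb (stalk P)"
    using x s by (simp add: absorb_mult) (rule eqI; simp add: absorb_mult absorb_closed)
  assume "y \<in> carrier (stalk P)"
  then obtain b t where y: "y = frac P b t" "b \<in> carrier M" "t \<in> carrier M - P" by (auto simp: stalk_carrier)
  then have t: "t \<in> carrier M" by simp
  show "x \<otimes>\<^bsub>stalk P\<^esub> y \<in> carrier (stalk P)" using x y den[OF x(3) y(3)] by (auto simp: stalk_carrier)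
  show "x \<otimes>\<^bsub>stalk P\<^esub> y = y \<otimes>\<^bsub>stalk P\<^esub> x" using x y s t by (simp add: m_comm)
  assume "z \<in> carrier (stalk P)"
  then obtain c r where z: "z = frac P c r" "c \<in> carrier M" "r \<in> carrier M - P" by (auto simp: stalk_carrier)
  then have r: "r \<in> carrier M" by simp
  show "x \<otimes>\<^bsub>stalk P\<^esub> y \<otimes>\<^bsub>stalk P\<^esub> z = x \<otimes>\<^bsub>stalk P\<^esub> (y \<otimes>\<^bsub>stalk P\<^esub> z)"
    unfolding x(1) y(1) z(1) using x(2,3) y(2,3) z(2,3) s t r
    by (simp only: frac_mult[OF P] den m_closed m_assoc)
qed

definition D :: "'a \<Rightarrow> 'a set set" where
  "D f = {P. binoid_prime P M \<and> f \<notin> P}"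

lemma Spec_eq: "binoid_Spec M = topology_generated_by (D ` carrier M)"
  unfolding binoid_Spec_def D_def by (rule arg_cong[of _ _ topology_generated_by]) auto

lemma open_D: "f \<in> carrier M \<Longrightarrow> openin (binoid_Spec M) (D f)"
  unfolding Spec_eq by (rule topology_generated_by_Basis) simp

lemma D_mult: "f \<in> carrier M \<Longrightarrow> g \<in> carrier M \<Longrightarrow> D (f \<otimes> g) = D f \<inter> D g"
  by (auto simp: D_def prime_mult)

lemma topspace_Spec: "topspace (binoid_Spec M) = {P. binoid_prime P M}"
proof -
  have "D \<one> = {P. binoid_prime P M}" by (auto simp: D_def prime_one)
  moreover have "D f \<subseteq> {P. binoid_prime P M}" for f by (auto simp: D_def)
  ultimately show ?thesis unfolding Spec_eq topology_generated_by_topspace using one_closed by blast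
qed

lemma Spec_basis: "openin (binoid_Spec M) U \<Longrightarrow> P \<in> U \<Longrightarrow> \<exists>f\<in>carrier M. P \<in> D f \<and> D f \<subseteq> U"
  unfolding Spec_eq by (erule generated_topology_basis) (use D_mult in blast)+

lemma open_prime: "openin (binoid_Spec M) U \<Longrightarrow> P \<in> U \<Longrightarrow> binoid_prime P M"
  using openin_subset topspace_Spec by fastforce

definition regular :: "'a set set \<Rightarrow> ('a set \<Rightarrow> ('a \<times> 'a) set) \<Rightarrow> bool" where
  "regular V s \<longleftrightarrow> (\<exists>a\<in>carrier M. \<exists>f\<in>carrier M. \<forall>Q\<in>V. f \<notin> Q \<and> s Q = frac Q a f)"

lemma regular_mono: "regular V s \<Longrightarrow> V' \<subseteq> V \<Longrightarrow> (\<And>P. P \<in> V' \<Longrightarrow> s' P = s P) \<Longrightarrow> regular V' s'"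
  unfolding regular_def by (metis subsetD)

lemma regular_mult:
  assumes "openin (binoid_Spec M) V" "regular V s" "regular V t"
  shows "regular V (\<lambda>P. s P \<otimes>\<^bsub>stalk P\<^esub> t P)"
proof -
  obtain a f b g where *: "a \<in> carrier M" "f \<in> carrier M" "b \<in> carrier M" "g \<in> carrier M"
    "\<forall>Q\<in>V. f \<notin> Q \<and> s Q = frac Q a f" "\<forall>Q\<in>V. g \<notin> Q \<and> t Q = frac Q b g"
    using assms(2,3) unfolding regular_def by blast
  then have "\<forall>Q\<in>V. f \<otimes> g \<notin> Q \<and> s Q \<otimes>\<^bsub>stalk Q\<^esub> t Q = frac Q (a \<otimes> b) (f \<otimes> g)"
    using open_prime[OF assms(1)] by (auto simp: frac_mult prime_mult)
  then show ?thesis unfolding regular_def using * by blast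
qed

abbreviation \<O> where "\<O> \<equiv> binoid_structure_sheaf M"

lemma sections_eq: "carrier (sec \<O> U) =
    {s \<in> extensional U. \<forall>P\<in>U. \<exists>V. openin (binoid_Spec M) V \<and> P \<in> V \<and> V \<subseteq> U \<and> regular V s}"
proof -
  have "(\<exists>a f. openin (binoid_Spec M) V \<and> P \<in> V \<and> V \<subseteq> U \<and> a \<in> carrier M \<and> f \<in> carrier M \<and>
      (\<forall>Q\<in>V. f \<notin> Q \<and> s Q = frac Q a f)) \<longleftrightarrow>
      openin (binoid_Spec M) V \<and> P \<in> V \<and> V \<subseteq> U \<and> regular V s" for V P s
    unfolding regular_def by blast
  then show ?thesis by (simp add: binoid_structure_sheaf_def fraction_sections_def)
qed

lemma sec_simps:
  "s \<otimes>\<^bsub>sec \<O> U\<^esub> t = (\<lambda>P\<in>U. s P \<otimes>\<^bsub>stalk P\<^esub> t P)" "\<one>\<^bsub>sec \<O> U\<^esub> = (\<lambda>P\<in>U. \<one>\<^bsub>stalk P\<^esub>)"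
  "absorb (sec \<O> U) = (\<lambda>P\<in>U. absorb (stalk P))"
  by (simp_all add: binoid_structure_sheaf_def)

lemma res_eq [simp]: "res \<O> U V s = restrict s V"
  by (simp add: binoid_structure_sheaf_def)

lemma section_in_stalk: "s \<in> carrier (sec \<O> U) \<Longrightarrow> P \<in> U \<Longrightarrow> s P \<in> carrier (stalk P)"
  unfolding sections_eq regular_def stalk_carrier by blast

lemma basic_section:
  "openin (binoid_Spec M) U \<Longrightarrow> a \<in> carrier M \<Longrightarrow> f \<in> carrier M \<Longrightarrow> (\<And>P. P \<in> U \<Longrightarrow> f \<notin> P) \<Longrightarrow> (\<lambda>P\<in>U. frac P a f) \<in> carrier (sec \<O> U)"
  unfolding sections_eq regular_def by fastforce

lemma section_mult_closed:
  assumes U: "openin (binoid_Spec M) U" and s: "s \<in> carrier (sec \<O> U)" and t: "t \<in> carrier (sec \<O> U)"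
  shows "s \<otimes>\<^bsub>sec \<O> U\<^esub> t \<in> carrier (sec \<O> U)"
  unfolding sections_eq sec_simps
proof (intro CollectI conjI ballI)
  fix P assume P: "P \<in> U"
  obtain V where V: "openin (binoid_Spec M) V" "P \<in> V" "V \<subseteq> U" "regular V s" using s P by (auto simp: sections_eq)
  obtain W where W: "openin (binoid_Spec M) W" "P \<in> W" "W \<subseteq> U" "regular W t" using t P by (auto simp: sections_eq)
  have VW: "openin (binoid_Spec M) (V \<inter> W)" using V W by blast
  have "regular (V \<inter> W) (\<lambda>P. s P \<otimes>\<^bsub>stalk P\<^esub> t P)"
    by (rule regular_mult[OF VW]) (rule regular_mono[OF V(4)] regular_mono[OF W(4)]; auto)+
  then have "regular (V \<inter> W) (\<lambda>P\<in>U. s P \<otimes>\<^bsub>stalk P\<^esub> t P)" by (rule regular_mono) (use V in auto)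
  then show "\<exists>V. openin (binoid_Spec M) V \<and> P \<in> V \<and> V \<subseteq> U \<and> regular V (\<lambda>P\<in>U. s P \<otimes>\<^bsub>stalk P\<^esub> t P)"
    using VW V W by (intro exI[of _ "V \<inter> W"]) auto
qed auto

lemma sections_binoid:
  assumes U: "openin (binoid_Spec M) U"
  shows "binoid (sec \<O> U)"
proof (intro binoid.intro comm_monoidI binoid_axioms.intro)
  have pr: "binoid (stalk P)" if "P \<in> U" for P using stalk_binoid open_prime[OF U that] .
  note ext = extensionalityI[of _ U]
  show "\<one>\<^bsub>sec \<O> U\<^esub> \<in> carrier (sec \<O> U)"
    using basic_section[OF U one_closed one_closed] prime_one open_prime[OF U] by (simp add: sec_simps stalk_one)
  show "absorb (sec \<O> U) \<in> carrier (sec \<O> U)"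
    using basic_section[OF U absorb_closed one_closed] prime_one open_prime[OF U] by (simp add: sec_simps stalk_absorb)
  fix s t r assume s: "s \<in> carrier (sec \<O> U)"
  have sP: "s P \<in> carrier (stalk P)" if "P \<in> U" for P using section_in_stalk[OF s that] .
  have sE: "s \<in> extensional U" using s by (auto simp: sections_eq)
  show "\<one>\<^bsub>sec \<O> U\<^esub> \<otimes>\<^bsub>sec \<O> U\<^esub> s = s"
    by (rule ext; simp add: sec_simps sE sP monoid.l_one[OF comm_monoid.axioms(1)[OF binoid.axioms(1)[OF pr]]])
  show "absorb (sec \<O> U) \<otimes>\<^bsub>sec \<O> U\<^esub> s = absorb (sec \<O> U)"
    by (rule ext; simp add: sec_simps sP binoid.absorb_mult[OF pr])
  assume t: "t \<in> carrier (sec \<O> U)"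
  show "s \<otimes>\<^bsub>sec \<O> U\<^esub> t \<in> carrier (sec \<O> U)" using section_mult_closed[OF U s t] .
  have tP: "t P \<in> carrier (stalk P)" if "P \<in> U" for P using section_in_stalk[OF t that] .
  show "s \<otimes>\<^bsub>sec \<O> U\<^esub> t = t \<otimes>\<^bsub>sec \<O> U\<^esub> s"
  proof (rule ext)
    fix P assume P: "P \<in> U"
    show "(s \<otimes>\<^bsub>sec \<O> U\<^esub> t) P = (t \<otimes>\<^bsub>sec \<O> U\<^esub> s) P"
      using comm_monoid.m_comm[OF binoid.axioms(1)[OF pr[OF P]] sP[OF P] tP[OF P]] P by (simp add: sec_simps)
  qed (auto simp: sec_simps)
  assume r: "r \<in> carrier (sec \<O> U)"
  have rP: "r P \<in> carrier (stalk P)" if "P \<in> U" for P using section_in_stalk[OF r that] .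
  show "s \<otimes>\<^bsub>sec \<O> U\<^esub> t \<otimes>\<^bsub>sec \<O> U\<^esub> r = s \<otimes>\<^bsub>sec \<O> U\<^esub> (t \<otimes>\<^bsub>sec \<O> U\<^esub> r)"
    by (rule ext; simp add: sec_simps sP tP rP monoid.m_assoc[OF comm_monoid.axioms(1)[OF binoid.axioms(1)[OF pr]]])
qed

lemma binoid_space:
  assumes T: "\<And>U. openin T U \<Longrightarrow> openin (binoid_Spec M) U"
  shows "binoid_space T \<O>"
proof (intro binoid_space.intro binoid_space_axioms.intro)
  show "sheaf T \<O>"
    by (rule local_sections_sheaf[of T _ "binoid_Spec M" regular]) (use sections_eq regular_mono T in auto)
qed (auto simp: sec_simps fun_eq_iff)

lemma invertible_structure:
  assumes T: "\<And>U. openin T U \<Longrightarrow> openin (binoid_Spec M) U"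
  shows "invertible_binoid_set_sheaf T \<O> (structure_binoid_set \<O>)"
proof -
  interpret binoid_space T \<O> using binoid_space[OF T] .
  let ?S = "structure_binoid_set \<O>"
  note [simp] = structure_binoid_set_def binoid_as_set_def
  have "sheaf T ?S"
    by (rule local_sections_sheaf[of T _ "binoid_Spec M" regular]) (use sections_eq regular_mono T in auto)
  moreover have "binoid_set (sec \<O> U) (sec ?S U)" if U: "openin T U" for U
  proof -
    interpret B: binoid "sec \<O> U" using sections_binoid[OF T[OF U]] .
    show ?thesis
      by unfold_locales (auto simp: B.absorb_closed B.absorb_mult B.m_assoc B.m_comm[of _ "absorb (sec \<O> U)"])
  qed
  ultimately have "binoid_set_sheaf T \<O> ?S"
    by (intro binoid_set_sheaf.intro binoid_set_sheaf_axioms.intro) (auto simp: sec_simps fun_eq_iff)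
  moreover have "binoid_set_sheaf_iso (subtopology T (topspace T)) \<O> ?S ?S"
    unfolding binoid_set_sheaf_iso_def
    by (rule bexI[of _ "\<lambda>U s. s"]) (auto simp: binoid_set_sheaf_hom_def bij_betw_def)
  ultimately show ?thesis unfolding invertible_binoid_set_sheaf_def by blast
qed

end


section \<open>The binoid of a monomial ideal\<close>

context monomial_quotient
begin

abbreviation B :: "monom option binoid" where
  "B \<equiv> monomial_binoid n I"

definition cls :: "monom \<Rightarrow> monom option" where
  "cls m = (if monomial m \<in> I then None else Some m)"

lemma B_simps:
  "carrier B = insert None (cls ` monoms n)" "\<one>\<^bsub>B\<^esub> = cls 0" "absorb B = None"
  "None \<otimes>\<^bsub>B\<^esub> x = None" "x \<otimes>\<^bsub>B\<^esub> None = None"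
  by (auto simp: monomial_binoid_def Let_def cls_def split: option.split)

lemma monomial_in_ideal_add:
  assumes "monomial a \<in> I" "b \<in> monoms n"
  shows "monomial (a + b) \<in> I"
proof -
  interpret I: ideal I "mpoly_ring n" by (rule ideal_I)
  have "monomial b \<in> carrier (mpoly_ring n)" using assms(2) by (simp add: monomial_def monoms_def)
  from I.I_r_closed[OF assms(1) this] show ?thesis by (simp add: monomial_def mult_single)
qed

lemma monoms_add [simp]: "a \<in> monoms n \<Longrightarrow> b \<in> monoms n \<Longrightarrow> a + b \<in> monoms n"
  by (auto simp: monoms_def keys_add_monom)

lemma monoms_0 [simp]: "0 \<in> monoms n"
  by (simp add: monoms_def)

lemma B_mult:
  assumes "a \<in> monoms n" "b \<in> monoms n"
  shows "cls a \<otimes>\<^bsub>B\<^esub> cls b = cls (a + b)"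
  using monomial_in_ideal_add[of a b] monomial_in_ideal_add[of b a] assms
  by (auto simp: monomial_binoid_def Let_def cls_def add.commute)

lemma B_cases:
  assumes "x \<in> carrier B"
  obtains "x = None" | m where "m \<in> monoms n" "x = cls m"
  using assms by (auto simp: B_simps)

sublocale B: binoid B
proof (intro binoid.intro comm_monoidI binoid_axioms.intro)
  show "\<one>\<^bsub>B\<^esub> \<in> carrier B" "absorb B \<in> carrier B" by (auto simp: B_simps)
  fix x y z assume x: "x \<in> carrier B"
  show "\<one>\<^bsub>B\<^esub> \<otimes>\<^bsub>B\<^esub> x = x" by (rule B_cases[OF x]) (simp_all add: B_simps B_mult)
  show "absorb B \<otimes>\<^bsub>B\<^esub> x = absorb B" by (simp add: B_simps)
  assume y: "y \<in> carrier B"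
  show "x \<otimes>\<^bsub>B\<^esub> y \<in> carrier B" by (rule B_cases[OF x]; rule B_cases[OF y]) (simp_all add: B_simps B_mult)
  show "x \<otimes>\<^bsub>B\<^esub> y = y \<otimes>\<^bsub>B\<^esub> x" by (rule B_cases[OF x]; rule B_cases[OF y]) (simp_all add: B_simps B_mult add.commute)
  assume z: "z \<in> carrier B"
  show "x \<otimes>\<^bsub>B\<^esub> y \<otimes>\<^bsub>B\<^esub> z = x \<otimes>\<^bsub>B\<^esub> (y \<otimes>\<^bsub>B\<^esub> z)"
    by (rule B_cases[OF x]; rule B_cases[OF y]; rule B_cases[OF z]) (simp_all add: B_simps B_mult add.assoc)
qed

lemma cls_closed [simp]: "m \<in> monoms n \<Longrightarrow> cls m \<in> carrier B"
  by (simp add: B_simps)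

lemma cls_notin:
  assumes P: "binoid_prime P B" and m: "m \<in> monoms n"
    and vars: "\<And>i. i \<in> Poly_Mapping.keys m \<Longrightarrow> cls (Poly_Mapping.single i 1) \<notin> P"
  shows "cls m \<notin> P"
proof -
  have one: "cls 0 \<notin> P" using B.prime_one[OF P] by (simp add: B_simps)
  have add: "cls (a + b) \<notin> P" if "a \<in> monoms n" "b \<in> monoms n" "cls a \<notin> P" "cls b \<notin> P" for a b
    using B.prime_mult[OF P, of "cls a" "cls b"] that by (simp add: B_mult)
  have pow: "cls (Poly_Mapping.single i a) \<notin> P" if "i \<in> {1..n}" "cls (Poly_Mapping.single i 1) \<notin> P" for i a
  proof (induction a)
    case (Suc a)
    then show ?case using add[of "Poly_Mapping.single i 1" "Poly_Mapping.single i a"] that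
      by (simp add: monoms_def single_add[symmetric] split: if_splits)
  qed (simp add: one)
  show ?thesis using m vars
  proof (induction m rule: poly_mapping_single_induct)
    case (2 i a m)
    show ?case
    proof (cases "a = 0")
      case False
      have k: "Poly_Mapping.keys (Poly_Mapping.single i a + m) = insert i (Poly_Mapping.keys m)"
        using False by (simp add: keys_add_monom)
      have "i \<in> {1..n}" "m \<in> monoms n" using "2.prems"(1) by (auto simp: monoms_def k)
      then show ?thesis using 2 pow[of i a] add[of "Poly_Mapping.single i a" m] k by (auto simp: monoms_def)
    qed (use 2 in simp)
  qed (simp add: one)
qed

definition W :: "nat \<Rightarrow> monom option set set" where
  "W j = B.D (cls (Poly_Mapping.single j 1))"

lemma in_W: "P \<in> W j \<longleftrightarrow> binoid_prime P B \<and> cls (Poly_Mapping.single j 1) \<notin> P"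
  by (simp add: W_def B.D_def)

lemma single_monoms [simp]: "j \<in> {1..n} \<Longrightarrow> Poly_Mapping.single j a \<in> monoms n"
  by (simp add: monoms_def)

lemma cls_notin_W:
  assumes F: "\<And>i. i \<in> F \<Longrightarrow> P \<in> W i" and P: "binoid_prime P B" and m: "Poly_Mapping.keys m \<subseteq> F" "F \<subseteq> {1..n}"
  shows "cls m \<notin> P"
proof (rule cls_notin[OF P])
  show "m \<in> monoms n" using m by (auto simp: monoms_def)
  show "cls (Poly_Mapping.single i 1) \<notin> P" if "i \<in> Poly_Mapping.keys m" for i
    using F[of i] m(1) that by (auto simp: in_W)
qed

text \<open>A power of the product over a nonface is a monomial in the ideal, so its class is the
  absorbing element, which belongs to every prime.\<close>

lemma face_of_W:
  assumes F: "F \<subseteq> {1..n}" and P: "binoid_prime P B" "\<And>i. i \<in> F \<Longrightarrow> P \<in> W i"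
  shows "F \<in> \<Delta>"
proof (rule ccontr)
  assume "F \<notin> \<Delta>"
  then obtain k where k: "(\<Prod>i\<in>F. pvar i) ^ k \<in> I" using nonface F(1) by blast
  have "finite F" using F(1) finite_subset by blast
  then have "\<exists>m. Poly_Mapping.keys m \<subseteq> F \<and> (\<Prod>i\<in>F. pvar i :: 'k mpoly) ^ k = monomial m"
  proof (induction rule: finite_induct)
    case empty
    then show ?case by (intro exI[of _ 0]) (simp add: monomial_def)
  next
    case (insert i F)
    then obtain m where m: "Poly_Mapping.keys m \<subseteq> F" "(\<Prod>i\<in>F. pvar i :: 'k mpoly) ^ k = monomial m" by blast
    show ?case
      by (rule exI[of _ "Poly_Mapping.single i k + m"])
        (use m insert.hyps in \<open>auto simp: power_mult_distrib pvar_power monomial_def mult_single keys_add_monom split: if_splits\<close>)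
  qed
  then obtain m where m: "Poly_Mapping.keys m \<subseteq> F" "(\<Prod>i\<in>F. pvar i :: 'k mpoly) ^ k = monomial m" by blast
  then have "cls m = absorb B" using k by (simp add: cls_def B_simps)
  moreover have "absorb B \<in> P" using P(1) by (simp add: binoid_prime_def)
  ultimately show False using cls_notin_W[OF P(2,1) m(1) F] by simp
qed

text \<open>The absorbing element \<open>None\<close> satisfies the condition vacuously. The
  complement consists of the classes of monomials supported on \<open>F\<close>.\<close>

definition binoid_face_prime :: "nat set \<Rightarrow> monom option set" where
  "binoid_face_prime F = {x \<in> carrier B. \<forall>m. x = Some m \<longrightarrow> \<not> Poly_Mapping.keys m \<subseteq> F}"

lemma cls_face:
  assumes "F \<in> \<Delta>" "Poly_Mapping.keys m \<subseteq> F"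
  shows "cls m = Some m"
proof -
  have "rst F (monomial m) = (monomial m :: 'k mpoly)" using assms(2) by (simp add: monomial_def)
  moreover have "monomial m \<noteq> (0 :: 'k mpoly)"
    unfolding monomial_def by (metis lookup_single_eq lookup_zero zero_neq_one)
  ultimately have "rst F (monomial m :: 'k mpoly) \<noteq> 0" by simp
  then show ?thesis using face_zero[OF assms(1)] by (auto simp: cls_def)
qed

lemma keys_monoms: "F \<in> \<Delta> \<Longrightarrow> Poly_Mapping.keys m \<subseteq> F \<Longrightarrow> m \<in> monoms n"
  using face_sub[of F] by (auto simp: monoms_def)

lemma notin_face_prime:
  assumes "F \<in> \<Delta>"
  shows "x \<in> carrier B - binoid_face_prime F \<longleftrightarrow> (\<exists>m. Poly_Mapping.keys m \<subseteq> F \<and> x = cls m)"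
proof
  assume x: "x \<in> carrier B - binoid_face_prime F"
  then obtain m where m: "x = Some m" "Poly_Mapping.keys m \<subseteq> F" by (auto simp: binoid_face_prime_def)
  then show "\<exists>m. Poly_Mapping.keys m \<subseteq> F \<and> x = cls m" using cls_face[OF assms] by metis
next
  assume "\<exists>m. Poly_Mapping.keys m \<subseteq> F \<and> x = cls m"
  then obtain m where m: "Poly_Mapping.keys m \<subseteq> F" "x = cls m" by blast
  then show "x \<in> carrier B - binoid_face_prime F"
    using cls_closed[OF keys_monoms[OF assms m(1)]] cls_face[OF assms m(1)] by (auto simp: binoid_face_prime_def)
qed

lemma cls_in_face_prime:
  assumes F: "F \<in> \<Delta>" and m: "m \<in> monoms n"
  shows "cls m \<in> binoid_face_prime F \<longleftrightarrow> \<not> Poly_Mapping.keys m \<subseteq> F"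
proof -
  have "cls m = cls a \<longleftrightarrow> m = a" if "Poly_Mapping.keys a \<subseteq> F" for a
    using cls_face[OF F that] by (auto simp: cls_def)
  then show ?thesis using notin_face_prime[OF F, of "cls m"] cls_closed[OF m] by blast
qed

lemma binoid_face_prime:
  assumes F: "F \<in> \<Delta>"
  shows "binoid_prime (binoid_face_prime F) B"
  unfolding binoid_prime_def
proof (intro conjI ballI)
  show "binoid_face_prime F \<subseteq> carrier B" "absorb B \<in> binoid_face_prime F"
    by (auto simp: binoid_face_prime_def B_simps)
  show "submonoid (carrier B - binoid_face_prime F) B"
  proof
    show "\<one>\<^bsub>B\<^esub> \<in> carrier B - binoid_face_prime F" unfolding notin_face_prime[OF F] by (rule exI[of _ 0]) (simp add: B_simps)
    show "x \<otimes>\<^bsub>B\<^esub> y \<in> carrier B - binoid_face_prime F"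
      if "x \<in> carrier B - binoid_face_prime F" "y \<in> carrier B - binoid_face_prime F" for x y
    proof -
      obtain a b where ab: "Poly_Mapping.keys a \<subseteq> F" "x = cls a" "Poly_Mapping.keys b \<subseteq> F" "y = cls b"
        using \<open>x \<in> _\<close> \<open>y \<in> _\<close> unfolding notin_face_prime[OF F] by blast
      then have "x \<otimes>\<^bsub>B\<^esub> y = cls (a + b)" using B_mult keys_monoms[OF F] by simp
      then show ?thesis using ab unfolding notin_face_prime[OF F]
        by (intro exI[of _ "a + b"]) (auto simp: keys_add_monom)
    qed
  qed auto
  fix x y assume x: "x \<in> binoid_face_prime F" and y: "y \<in> carrier B"
  have "x \<in> carrier B" using x by (simp add: binoid_face_prime_def)
  then show "x \<otimes>\<^bsub>B\<^esub> y \<in> binoid_face_prime F"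
  proof (rule B_cases)
    assume "x = None"
    then show ?thesis using x by (simp add: B_simps)
  next
    fix a assume a: "a \<in> monoms n" "x = cls a"
    from y show ?thesis
    proof (rule B_cases)
      assume "y = None"
      then show ?thesis by (simp add: B_simps binoid_face_prime_def)
    next
      fix b assume b: "b \<in> monoms n" "y = cls b"
      then show ?thesis using a x by (simp add: B_mult cls_in_face_prime[OF F] keys_add_monom)
    qed
  qed
qed

lemma face_prime_in_W:
  assumes "F \<in> \<Delta>" "j \<in> F"
  shows "binoid_face_prime F \<in> W j"
  using binoid_face_prime[OF assms(1)] cls_in_face_prime[OF assms(1), of "Poly_Mapping.single j 1"] assms face_sub[OF assms(1)]
  by (auto simp: in_W monoms_def)

text \<open>Local triviality at this point is therefore triviality on \<open>W j\<close>.\<close>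

lemma face_prime_minimal_nbhd:
  assumes F: "F \<in> \<Delta>" and U: "openin (binoid_Spec B) U" "binoid_face_prime F \<in> U"
    and P: "binoid_prime P B" "\<And>i. i \<in> F \<Longrightarrow> P \<in> W i"
  shows "P \<in> U"
proof -
  obtain f where f: "f \<in> carrier B" "binoid_face_prime F \<in> B.D f" "B.D f \<subseteq> U" using B.Spec_basis[OF U] by blast
  then have "f \<in> carrier B - binoid_face_prime F" by (simp add: B.D_def)
  then obtain m where m: "Poly_Mapping.keys m \<subseteq> F" "f = cls m" unfolding notin_face_prime[OF F] by blast
  then have "f \<notin> P" using cls_notin_W[OF P(2,1) m(1) face_sub[OF F]] by simp
  then show ?thesis using f P by (auto simp: B.D_def)
qed

text \<open>Distinct monomials supported on a face have distinct classes, so exponents can be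
  cancelled there and equal fractions have equal exponent differences.\<close>

lemma frac_eq_face_prime:
  assumes F: "F \<in> \<Delta>" and keys: "Poly_Mapping.keys a \<subseteq> F" "Poly_Mapping.keys b \<subseteq> F" "Poly_Mapping.keys s \<subseteq> F" "Poly_Mapping.keys t \<subseteq> F"
    and eq: "B.frac (binoid_face_prime F) (cls a) (cls s) = B.frac (binoid_face_prime F) (cls b) (cls t)"
  shows "a + t = b + s"
proof -
  note mon = keys_monoms[OF F]
  have in_compl: "cls m \<in> carrier B - binoid_face_prime F" if "Poly_Mapping.keys m \<subseteq> F" for m
    unfolding notin_face_prime[OF F] using that by blast
  obtain w where "w \<in> carrier B - binoid_face_prime F" and w: "w \<otimes>\<^bsub>B\<^esub> (cls a \<otimes>\<^bsub>B\<^esub> cls t) = w \<otimes>\<^bsub>B\<^esub> (cls b \<otimes>\<^bsub>B\<^esub> cls s)"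
    using eq B.frac_eq_iff[OF binoid_face_prime[OF F], of "cls a" "cls b" "cls s" "cls t"] keys in_compl mon by auto
  then obtain m where m: "Poly_Mapping.keys m \<subseteq> F" "w = cls m" unfolding notin_face_prime[OF F] by blast
  have "cls (m + (a + t)) = cls (m + (b + s))" using w m keys mon by (simp add: B_mult)
  then show ?thesis using keys m by (simp add: cls_face[OF F] keys_add_monom)
qed

section \<open>The punctured spectrum of the binoid\<close>

definition binoid_punctured :: "monom option set topology" where
  "binoid_punctured = puncture (binoid_Spec B) (carrier B - Units B)"

lemma binoid_Pic_loc_eq: "binoid_Pic_loc B = binoid_Pic binoid_punctured B.\<O>"
  by (simp add: binoid_Pic_loc_def binoid_punctured_def)

lemma binoid_prime_proper: "binoid_prime P B \<Longrightarrow> cls 0 = Some 0"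
  using B.prime_one[of P] unfolding binoid_prime_def by (auto simp: B_simps cls_def)

text \<open>The hypothesis says that 1 is not in the ideal. A sum of exponent vectors is zero only
  if both summands are.\<close>

lemma Units_B:
  assumes "cls 0 = Some 0"
  shows "Units B = {cls 0}"
proof
  show "{cls 0} \<subseteq> Units B" using B.Units_one_closed by (simp add: B_simps)
  show "Units B \<subseteq> {cls 0}"
  proof
    fix x assume "x \<in> Units B"
    then obtain y where y: "x \<in> carrier B" "y \<in> carrier B" "x \<otimes>\<^bsub>B\<^esub> y = \<one>\<^bsub>B\<^esub>" unfolding Units_def by auto
    then have xy: "x \<in> carrier B" "y \<in> carrier B" "x \<otimes>\<^bsub>B\<^esub> y = cls 0" by (simp_all only: B_simps)
    have "x \<noteq> None" "y \<noteq> None" using xy(3) assms B_simps(4)[of y] B_simps(5)[of x] by (metis option.distinct(1))+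
    then obtain a b where a: "a \<in> monoms n" "x = cls a" and b: "b \<in> monoms n" "y = cls b"
      using B_cases[OF xy(1)] B_cases[OF xy(2)] by metis
    have "cls (a + b) = Some 0" using xy(3) a b assms by (simp add: B_mult)
    then have "a + b = 0" by (simp add: cls_def split: if_splits)
    then have "Poly_Mapping.keys (a + b) = {}" by simp
    then have "a = 0" by (simp add: keys_add_monom)
    then show "x \<in> {cls 0}" using a by simp
  qed
qed

lemma binoid_punctured_set: "topspace (binoid_Spec B) - {carrier B - Units B} = \<Union>(W ` {1..n})"
proof (rule Set.set_eqI)
  fix P
  show "P \<in> topspace (binoid_Spec B) - {carrier B - Units B} \<longleftrightarrow> P \<in> \<Union>(W ` {1..n})"
  proof (cases "binoid_prime P B")
    case True
    note U = Units_B[OF binoid_prime_proper[OF True]]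
    have sub: "P \<subseteq> carrier B - {cls 0}" using True B.prime_one[OF True] unfolding binoid_prime_def by (auto simp: B_simps)
    have "P = carrier B - {cls 0} \<longleftrightarrow> (\<forall>i\<in>{1..n}. cls (Poly_Mapping.single i 1) \<in> P)"
    proof
      assume P: "P = carrier B - {cls 0}"
      show "\<forall>i\<in>{1..n}. cls (Poly_Mapping.single i 1) \<in> P"
      proof
        fix i assume i: "i \<in> {1..n}"
        have "Poly_Mapping.single i (1::nat) \<noteq> 0" by (metis lookup_single_eq lookup_zero zero_neq_one)
        then have "cls (Poly_Mapping.single i 1) \<noteq> cls 0"
          using binoid_prime_proper[OF True] by (auto simp: cls_def split: if_splits)
        then show "cls (Poly_Mapping.single i 1) \<in> P" using P i by simp
      qed
    next
      assume all: "\<forall>i\<in>{1..n}. cls (Poly_Mapping.single i 1) \<in> P"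
      have "x \<in> P" if x: "x \<in> carrier B" "x \<noteq> cls 0" for x
        using x(1)
      proof (rule B_cases)
        assume "x = None"
        then show ?thesis using True by (simp add: binoid_prime_def B_simps)
      next
        fix m assume m: "m \<in> monoms n" "x = cls m"
        then obtain i where i: "i \<in> Poly_Mapping.keys m" using x(2) by fastforce
        obtain m' where m': "m = Poly_Mapping.single i 1 + m'" using single_eq_pvar_mult[OF i] by metis
        have "i \<in> {1..n}" "m' \<in> monoms n" using m(1) i m' by (auto simp: monoms_def keys_add_monom)
        then show ?thesis
          using B.prime_mult[OF True, of "cls (Poly_Mapping.single i 1)" "cls m'"] all m m' by (simp add: B_mult)
      qed
      then show "P = carrier B - {cls 0}" using sub by blast
    qed
    then show ?thesis using True by (auto simp: B.topspace_Spec U in_W)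
  qed (auto simp: B.topspace_Spec in_W)
qed

lemma openin_binoid_punctured: "openin binoid_punctured U \<longleftrightarrow> openin (binoid_Spec B) U \<and> U \<subseteq> \<Union>(W ` {1..n})"
proof -
  have "openin (binoid_Spec B) (\<Union>(W ` {1..n}))" unfolding W_def
    by (intro openin_Union) (auto intro!: B.open_D)
  then show ?thesis unfolding binoid_punctured_def puncture_def binoid_punctured_set by (rule openin_open_subtopology)
qed

lemma topspace_binoid_punctured: "topspace binoid_punctured = \<Union>(W ` {1..n})"
  unfolding binoid_punctured_def puncture_def binoid_punctured_set by (auto simp: B.topspace_Spec in_W)

lemma open_W: "j \<in> {1..n} \<Longrightarrow> openin binoid_punctured (W j)"
  unfolding openin_binoid_punctured W_def by (auto intro!: B.open_D)

lemma binoid_Spec_open: "openin binoid_punctured U \<Longrightarrow> openin (binoid_Spec B) U"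
  by (simp add: openin_binoid_punctured)

sublocale BS: binoid_space binoid_punctured "B.\<O>"
  by (rule B.binoid_space) (rule binoid_Spec_open)

text \<open>\<open>U\<close> is contained in every neighbourhood of the prime of the face, so the
  fraction that represents the section near this prime represents it on all of \<open>U\<close>. Its
  denominator avoids that prime and is thus a monomial supported on \<open>F\<close>.\<close>

lemma binoid_section_at_face:
  assumes F: "F \<in> \<Delta>" and U: "U = {P. binoid_prime P B \<and> (\<forall>i\<in>F. P \<in> W i)}"
    and s: "s \<in> carrier (sec B.\<O> U)"
  shows "\<exists>a\<in>carrier B. \<exists>m. Poly_Mapping.keys m \<subseteq> F \<and> (\<forall>P\<in>U. s P = B.frac P a (cls m))"
proof -
  have "binoid_face_prime F \<in> U" using binoid_face_prime[OF F] face_prime_in_W[OF F] U by blast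
  then obtain V where V: "openin (binoid_Spec B) V" "binoid_face_prime F \<in> V" "B.regular V s"
    using s unfolding B.sections_eq by blast
  have UV: "P \<in> V" if "P \<in> U" for P using that face_prime_minimal_nbhd[OF F V(1,2)] U by blast
  obtain a f where af: "a \<in> carrier B" "f \<in> carrier B" "\<forall>Q\<in>V. f \<notin> Q \<and> s Q = B.frac Q a f"
    using V(3) unfolding B.regular_def by blast
  have "f \<in> carrier B - binoid_face_prime F" using af V(2) by blast
  then obtain m where "Poly_Mapping.keys m \<subseteq> F" "f = cls m" unfolding notin_face_prime[OF F] by blast
  then show ?thesis using af UV by blast
qed

text \<open>The denominator is a monomial on the edge in any case. Invertibility at the prime of the
  edge keeps the numerator out of that prime, so it is such a monomial, too.\<close>

lemma binoid_edge_transition: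
  assumes jk: "{j, k} \<in> \<Delta>"
    and a: "a \<in> carrier (sec B.\<O> (W j \<inter> W k))" and b: "b \<in> carrier (sec B.\<O> (W j \<inter> W k))"
    and ab: "a \<otimes>\<^bsub>sec B.\<O> (W j \<inter> W k)\<^esub> b = \<one>\<^bsub>sec B.\<O> (W j \<inter> W k)\<^esub>"
  shows "\<exists>u v. Poly_Mapping.keys u \<subseteq> {j, k} \<and> Poly_Mapping.keys v \<subseteq> {j, k} \<and>
    (\<forall>P\<in>W j \<inter> W k. a P = B.frac P (cls u) (cls v))"
proof -
  let ?F = "{j, k}" and ?P = "binoid_face_prime {j, k}"
  have U: "W j \<inter> W k = {P. binoid_prime P B \<and> (\<forall>i\<in>?F. P \<in> W i)}" by (auto simp: in_W)
  note compl = notin_face_prime[OF jk]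
  obtain x m where x: "x \<in> carrier B" "Poly_Mapping.keys m \<subseteq> ?F" "\<forall>P\<in>W j \<inter> W k. a P = B.frac P x (cls m)"
    using binoid_section_at_face[OF jk U a] by blast
  obtain y m' where y: "y \<in> carrier B" "Poly_Mapping.keys m' \<subseteq> ?F" "\<forall>P\<in>W j \<inter> W k. b P = B.frac P y (cls m')"
    using binoid_section_at_face[OF jk U b] by blast
  have P: "?P \<in> W j \<inter> W k" using face_prime_in_W[OF jk] by simp
  have pr: "binoid_prime ?P B" by (rule binoid_face_prime[OF jk])
  have mm: "cls m \<in> carrier B - ?P" "cls m' \<in> carrier B - ?P" using x(2) y(2) compl by blast+
  have mc: "cls m \<in> carrier B" "cls m' \<in> carrier B" using mm by auto
  have one: "\<one>\<^bsub>B\<^esub> \<in> carrier B - ?P" using B.prime_one[OF pr] by simp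
  have mm': "cls m \<otimes>\<^bsub>B\<^esub> cls m' \<in> carrier B - ?P" using mm B.prime_mult[OF pr] by auto
  have "a ?P \<otimes>\<^bsub>B.stalk ?P\<^esub> b ?P = \<one>\<^bsub>B.stalk ?P\<^esub>" using fun_cong[OF ab, of ?P] P by (simp add: B.sec_simps)
  then have "B.frac ?P (x \<otimes>\<^bsub>B\<^esub> y) (cls m \<otimes>\<^bsub>B\<^esub> cls m') = B.frac ?P \<one>\<^bsub>B\<^esub> \<one>\<^bsub>B\<^esub>"
    using x(3) y(3) P B.frac_mult[OF pr x(1) y(1) mm] B.stalk_one by simp
  then obtain w where w: "w \<in> carrier B - ?P"
    "w \<otimes>\<^bsub>B\<^esub> (x \<otimes>\<^bsub>B\<^esub> y \<otimes>\<^bsub>B\<^esub> \<one>\<^bsub>B\<^esub>) = w \<otimes>\<^bsub>B\<^esub> (\<one>\<^bsub>B\<^esub> \<otimes>\<^bsub>B\<^esub> (cls m \<otimes>\<^bsub>B\<^esub> cls m'))"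
    using B.frac_eq_iff[OF pr B.m_closed[OF x(1) y(1)] B.one_closed mm' one] by blast
  have "w \<otimes>\<^bsub>B\<^esub> (\<one>\<^bsub>B\<^esub> \<otimes>\<^bsub>B\<^esub> (cls m \<otimes>\<^bsub>B\<^esub> cls m')) \<notin> ?P" using w(1) mm' B.prime_mult[OF pr, of w] mc by auto
  then have "w \<otimes>\<^bsub>B\<^esub> (x \<otimes>\<^bsub>B\<^esub> y) \<notin> ?P" using w(2) x(1) y(1) by simp
  then have "x \<notin> ?P" using w(1) x(1) y(1) B.prime_mult[OF pr] by auto
  then obtain u where "Poly_Mapping.keys u \<subseteq> ?F" "x = cls u" using x(1) compl[of x] by blast
  then show ?thesis using x(2,3) by blast
qed

lemma binoid_vertex_generator:
  assumes F: "invertible_binoid_set_sheaf binoid_punctured B.\<O> F" and j: "j \<in> {1..n}" "{j} \<in> \<Delta>"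
  shows "\<exists>e. BS.free_generator F (W j) e"
proof -
  have mF: "binoid_set_sheaf binoid_punctured B.\<O> F" using F by (simp add: invertible_binoid_set_sheaf_def)
  interpret G: act_sheaf binoid_punctured B.\<O> F "\<lambda>U. act (sec F U)" using BS.act_sheaf_binoid_set[OF mF] .
  have "binoid_face_prime {j} \<in> topspace binoid_punctured"
    using face_prime_in_W[OF j(2)] j(1) by (auto simp: topspace_binoid_punctured)
  then obtain U e where U: "binoid_face_prime {j} \<in> U" "G.gen U e"
    using BS.invertible_local_generator[OF F] unfolding BS.free_generator_def by blast
  have "openin (binoid_Spec B) U" using G.genD(1)[OF U(2)] by (rule binoid_Spec_open)
  then have "W j \<subseteq> U" using face_prime_minimal_nbhd[OF j(2) _ U(1)] by (auto simp: in_W)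
  then show ?thesis using G.gen_res[OF U(2) open_W[OF j(1)]] unfolding BS.free_generator_def by blast
qed

text \<open>Transition functions over a binoid carry no scalars, so the splitting is applied with
  \<open>\<kappa>\<close> constantly 1, and its exponents provide the correcting units.\<close>

theorem binoid_generator_of_splitting:
  assumes split: "\<And>\<kappa> u v. monomial_cocycle_axioms \<Delta> \<kappa> u v \<Longrightarrow> cocycle_splits \<Delta> (\<kappa> :: nat \<Rightarrow> nat \<Rightarrow> 'k) u v"
    and F: "invertible_binoid_set_sheaf binoid_punctured B.\<O> F"
  shows "\<exists>e. BS.free_generator F (topspace binoid_punctured) e"
proof -
  have mF: "binoid_set_sheaf binoid_punctured B.\<O> F" using F by (simp add: invertible_binoid_set_sheaf_def)
  interpret G: act_sheaf binoid_punctured B.\<O> F "\<lambda>U. act (sec F U)" using BS.act_sheaf_binoid_set[OF mF] .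
  define J where "J = {j \<in> {1..n}. {j} \<in> \<Delta>}"
  have J: "j \<in> {1..n}" "{j} \<in> \<Delta>" if "j \<in> J" for j using that by (auto simp: J_def)
  have JF: "j \<in> J" if K: "K \<in> \<Delta>" "j \<in> K" for K j
    using face_sub[OF K(1)] face_mono[OF K(1), of "{j}"] K(2) by (auto simp: J_def)
  have cover: "topspace binoid_punctured = \<Union>(W ` J)"
  proof -
    have "{j} \<in> \<Delta>" if "P \<in> W j" "j \<in> {1..n}" for P j
      using that by (intro face_of_W[of _ P]) (auto simp: in_W)
    then show ?thesis by (auto simp: topspace_binoid_punctured J_def)
  qed
  obtain e where e: "\<And>j. j \<in> J \<Longrightarrow> G.gen (W j) (e j)"
    using binoid_vertex_generator[OF F] J unfolding BS.free_generator_def by metis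
  have oW: "openin binoid_punctured (W j)" if "j \<in> J" for j using open_W J that by blast
  have "\<exists>\<rho>. G.transitions J W e \<rho>" by (rule G.exists_transitions) (rule e)
  then obtain \<rho> where tr: "G.transitions J W e \<rho>" by blast
  note \<rho> = G.transitionsD(1)[OF tr]
  define Q where "Q j k u v \<longleftrightarrow> ({j, k} \<in> \<Delta> \<longrightarrow> Poly_Mapping.keys u \<subseteq> {j, k} \<and> Poly_Mapping.keys v \<subseteq> {j, k} \<and>
      (\<forall>P\<in>W j \<inter> W k. \<rho> j k P = B.frac P (cls u) (cls v)))" for j k u v
  have "\<exists>u v. Q j k u v" for j k
  proof (cases "{j, k} \<in> \<Delta>")
    case True
    then have jk: "j \<in> J" "k \<in> J" using JF by auto
    then obtain b where "b \<in> carrier (sec B.\<O> (W j \<inter> W k))" "\<rho> j k \<otimes>\<^bsub>sec B.\<O> (W j \<inter> W k)\<^esub> b = \<one>\<^bsub>sec B.\<O> (W j \<inter> W k)\<^esub>"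
      using G.transitionsD(2)[OF tr] by blast
    then show ?thesis using binoid_edge_transition[OF True \<rho>[OF jk]] unfolding Q_def by blast
  qed (simp add: Q_def)
  then obtain u0 where "\<And>j k. \<exists>v. Q j k (u0 j k) v" by metis
  then obtain v0 where Q: "\<And>j k. Q j k (u0 j k) (v0 j k)" by metis
  define u where "u j k = u0 k j" for j k
  define v where "v j k = v0 k j" for j k
  have uv: "Poly_Mapping.keys (u k j) \<subseteq> {j, k} \<and> Poly_Mapping.keys (v k j) \<subseteq> {j, k} \<and>
      (\<forall>P\<in>W j \<inter> W k. \<rho> j k P = B.frac P (cls (u k j)) (cls (v k j)))"
    if "{j, k} \<in> \<Delta>" for j k
    using Q[of j k] that unfolding Q_def u_def v_def by blast
  have "monomial_cocycle_axioms \<Delta> (\<lambda>_ _. 1 :: 'k) u v"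
  proof
    fix j k assume "{j, k} \<in> \<Delta>"
    then have "{k, j} \<in> \<Delta>" by (simp add: insert_commute)
    from uv[OF this] show "(1 :: 'k) \<noteq> 0" "Poly_Mapping.keys (u j k) \<subseteq> {j, k}" "Poly_Mapping.keys (v j k) \<subseteq> {j, k}"
      by auto
  next
    fix i j k assume K: "{i, j, k} \<in> \<Delta>"
    let ?P = "binoid_face_prime {i, j, k}" and ?W = "W k \<inter> W j \<inter> W i"
    have ijk: "i \<in> J" "j \<in> J" "k \<in> J" using JF[OF K] by auto
    have edges: "{j, i} \<in> \<Delta>" "{k, j} \<in> \<Delta>" "{k, i} \<in> \<Delta>" using face_mono[OF K] by auto
    have P: "?P \<in> W i" "?P \<in> W j" "?P \<in> W k" using face_prime_in_W[OF K] by auto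
    have pr: "binoid_prime ?P B" by (rule binoid_face_prime[OF K])
    have "restrict (\<rho> j i) ?W \<otimes>\<^bsub>sec B.\<O> ?W\<^esub> restrict (\<rho> k j) ?W = restrict (\<rho> k i) ?W"
      using G.transitions_cocycle[OF e tr ijk(3,2,1)] by simp
    from fun_cong[OF this, of ?P]
    have eq: "\<rho> j i ?P \<otimes>\<^bsub>B.stalk ?P\<^esub> \<rho> k j ?P = \<rho> k i ?P" using P by (simp add: B.sec_simps)
    have keys: "Poly_Mapping.keys (u i j) \<subseteq> {i, j, k}" "Poly_Mapping.keys (v i j) \<subseteq> {i, j, k}"
      "Poly_Mapping.keys (u j k) \<subseteq> {i, j, k}" "Poly_Mapping.keys (v j k) \<subseteq> {i, j, k}"
      "Poly_Mapping.keys (u i k) \<subseteq> {i, j, k}" "Poly_Mapping.keys (v i k) \<subseteq> {i, j, k}"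
      using uv[OF edges(1)] uv[OF edges(2)] uv[OF edges(3)] by blast+
    note mon = keys_monoms[OF K]
    have nn: "cls (v i j) \<in> carrier B - ?P" "cls (v j k) \<in> carrier B - ?P"
      unfolding notin_face_prime[OF K] using keys by blast+
    have "B.frac ?P (cls (u i j + u j k)) (cls (v i j + v j k)) = B.frac ?P (cls (u i k)) (cls (v i k))"
      using eq uv[OF edges(1)] uv[OF edges(2)] uv[OF edges(3)] P
        B.frac_mult[OF pr cls_closed[OF mon[OF keys(1)]] cls_closed[OF mon[OF keys(3)]] nn] mon keys
      by (simp add: B_mult)
    then have "u i j + u j k + v i k = u i k + (v i j + v j k)"
      using keys by (intro frac_eq_face_prime[OF K]) (simp_all add: keys_add_monom)
    then show "u i j + u j k + v i k = v i j + v j k + u i k" by (simp add: ac_simps)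
  qed simp
  from split[OF this] obtain s N where exps: "\<And>j k. {j, k} \<in> \<Delta> \<Longrightarrow>
      Poly_Mapping.single k (s k) + v k j + Poly_Mapping.single j (N j)
        = u k j + Poly_Mapping.single j (s j) + Poly_Mapping.single k (N k)"
    unfolding cocycle_splits_def by blast
  let ?e = "\<lambda>k m. Poly_Mapping.single k m :: monom"
  define g where "g k = (\<lambda>P\<in>W k. B.frac P (cls (?e k (N k))) (cls (?e k (s k))))" for k
  define g' where "g' k = (\<lambda>P\<in>W k. B.frac P (cls (?e k (s k))) (cls (?e k (N k))))" for k
  have prW: "binoid_prime P B" if "P \<in> W k" for P k using that by (simp add: in_W)
  have nn: "cls (?e k m) \<in> carrier B - P" if "P \<in> W k" "k \<in> J" for P k m
    using cls_notin_W[of "{k}" P "?e k m"] that prW[OF that(1)] J(1)[OF that(2)] by (auto split: if_splits)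
  have cl: "cls (?e k m) \<in> carrier B" if "k \<in> J" for k m using J(1)[OF that] by simp
  have gO: "g k \<in> carrier (sec B.\<O> (W k))" "g' k \<in> carrier (sec B.\<O> (W k))" if k: "k \<in> J" for k
    unfolding g_def g'_def using binoid_Spec_open[OF oW[OF k]] cl[OF k] nn[OF _ k] by (auto intro!: B.basic_section)
  have gg': "g k \<otimes>\<^bsub>sec B.\<O> (W k)\<^esub> g' k = \<one>\<^bsub>sec B.\<O> (W k)\<^esub>" if k: "k \<in> J" for k
  proof (rule extensionalityI[of _ "W k"])
    fix P assume P: "P \<in> W k"
    note pr = prW[OF P] and n = nn[OF P k]
    have "B.frac P (cls (?e k (N k)) \<otimes>\<^bsub>B\<^esub> cls (?e k (s k))) (cls (?e k (s k)) \<otimes>\<^bsub>B\<^esub> cls (?e k (N k))) = B.frac P \<one>\<^bsub>B\<^esub> \<one>\<^bsub>B\<^esub>"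
    proof (rule B.frac_eqI[OF pr])
      show "cls (?e k (s k)) \<otimes>\<^bsub>B\<^esub> cls (?e k (N k)) \<in> carrier B - P"
        using n[of "s k"] n[of "N k"] B.prime_mult[OF pr] by auto
      show "\<one>\<^bsub>B\<^esub> \<in> carrier B - P" using B.prime_one[OF pr] by simp
    qed (use cl[OF k] B.m_comm in auto)
    then show "(g k \<otimes>\<^bsub>sec B.\<O> (W k)\<^esub> g' k) P = \<one>\<^bsub>sec B.\<O> (W k)\<^esub> P"
      using P B.frac_mult[OF pr cl[OF k] cl[OF k] n n] by (simp add: B.sec_simps g_def g'_def B.stalk_one)
  qed (auto simp: B.sec_simps)
  have "\<exists>t. G.gen (\<Union>(W ` J)) t"
  proof (rule G.gen_glue_units[OF e tr gO(1)])
    show "\<exists>b\<in>carrier (sec B.\<O> (W k)). g k \<otimes>\<^bsub>sec B.\<O> (W k)\<^esub> b = \<one>\<^bsub>sec B.\<O> (W k)\<^esub>" if "k \<in> J" for k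
      using gO(2)[OF that] gg'[OF that] by blast
    fix j k assume j: "j \<in> J" and k: "k \<in> J"
    let ?W = "W j \<inter> W k"
    have "restrict (g k) ?W \<otimes>\<^bsub>sec B.\<O> ?W\<^esub> \<rho> j k = restrict (g j) ?W"
    proof (rule extensionalityI[of _ ?W])
      fix P assume "P \<in> ?W"
      then have P: "P \<in> W j" "P \<in> W k" by auto
      note pr = prW[OF P(1)]
      have E: "{j, k} \<in> \<Delta>" using P J[OF j] J[OF k] pr by (intro face_of_W[of _ P]) auto
      have \<rho>P: "\<rho> j k P = B.frac P (cls (u k j)) (cls (v k j))" using uv[OF E] P by blast
      have keys: "Poly_Mapping.keys (u k j) \<subseteq> {j, k}" "Poly_Mapping.keys (v k j) \<subseteq> {j, k}" using uv[OF E] by blast+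
      note mon = keys_monoms[OF E keys(1)] keys_monoms[OF E keys(2)]
      have nv: "cls (v k j) \<in> carrier B - P"
        using cls_notin_W[of "{j, k}" P "v k j"] P pr keys face_sub[OF E] mon by auto
      have m2: "?e k (N k) + u k j + ?e j (s j) = ?e j (N j) + (?e k (s k) + v k j)"
        using exps[OF E] by (simp add: ac_simps)
      have "B.frac P (cls (?e k (N k)) \<otimes>\<^bsub>B\<^esub> cls (u k j)) (cls (?e k (s k)) \<otimes>\<^bsub>B\<^esub> cls (v k j))
          = B.frac P (cls (?e j (N j))) (cls (?e j (s j)))"
      proof (rule B.frac_eqI[OF pr])
        show "cls (?e k (s k)) \<otimes>\<^bsub>B\<^esub> cls (v k j) \<in> carrier B - P"
          using nn[OF P(2) k, of "s k"] nv B.prime_mult[OF pr] by auto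
        show "cls (?e j (s j)) \<in> carrier B - P" by (rule nn[OF P(1) j])
        show "cls (?e k (N k)) \<otimes>\<^bsub>B\<^esub> cls (u k j) \<otimes>\<^bsub>B\<^esub> cls (?e j (s j))
            = cls (?e j (N j)) \<otimes>\<^bsub>B\<^esub> (cls (?e k (s k)) \<otimes>\<^bsub>B\<^esub> cls (v k j))"
          using J(1)[OF j] J(1)[OF k] mon m2 by (simp add: B_mult del: atLeastAtMost_iff)
      qed (use cl[OF j] cl[OF k] mon in auto)
      then show "(restrict (g k) ?W \<otimes>\<^bsub>sec B.\<O> ?W\<^esub> \<rho> j k) P = restrict (g j) ?W P"
        using P \<rho>P B.frac_mult[OF pr cl[OF k] cls_closed[OF mon(1)] nn[OF P(2) k] nv] by (simp add: B.sec_simps g_def)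
    qed (auto simp: B.sec_simps)
    then show "res B.\<O> (W k) ?W (g k) \<otimes>\<^bsub>sec B.\<O> ?W\<^esub> \<rho> j k = res B.\<O> (W j) ?W (g j)" by simp
  qed
  then show ?thesis by (simp add: cover BS.free_generator_def)
qed

theorem binoid_Pic_trivial_of_splitting:
  assumes split: "\<And>\<kappa> u v. monomial_cocycle_axioms \<Delta> \<kappa> u v \<Longrightarrow> cocycle_splits \<Delta> (\<kappa> :: nat \<Rightarrow> nat \<Rightarrow> 'k) u v"
  shows "carrier (binoid_Pic_loc B) = {\<one>\<^bsub>binoid_Pic_loc B\<^esub>}"
  unfolding binoid_Pic_loc_eq
  by (rule BS.binoid_Pic_trivialI[OF B.invertible_structure], erule binoid_Spec_open)
    (rule binoid_generator_of_splitting[OF split])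

end


section \<open>First cohomology of a simplicial complex\<close>

lemma sorted_list_of_two:
  fixes a b :: "'a::linorder"
  assumes "a < b"
  shows "sorted_list_of_set {a, b} = [a, b]"
  using assms by (intro sorted_list_of_set_unique[THEN iffD1]) auto

lemma sorted_list_of_three:
  fixes a b c :: "'a::linorder"
  assumes "a < b" "b < c"
  shows "sorted_list_of_set {a, b, c} = [a, b, c]"
proof -
  have "a \<noteq> b" "a \<noteq> c" "b \<noteq> c" using assms by auto
  then show ?thesis using assms by (intro sorted_list_of_set_unique[THEN iffD1]) (auto simp: card_insert_if)
qed

lemma cochains_closed:
  "c \<in> carrier (cochains \<Delta> G k) \<Longrightarrow> \<sigma> \<in> simplices \<Delta> k \<Longrightarrow> c \<sigma> \<in> carrier G"
  unfolding cochains_def carrier_product_group by (rule PiE_mem)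

text \<open>Cochains are given on ordered simplices only. From the identity for one order of three
  vertices the other five follow by inverting it and by moving a factor to the other side; triples
  with repetitions follow from \<open>diag\<close> and \<open>skew\<close>.\<close>

lemma skew_cocycle:
  fixes \<kappa> :: "'v::linorder \<Rightarrow> 'v \<Rightarrow> 'g"
  assumes "comm_group G"
    and closed: "\<And>x y. x \<in> K \<Longrightarrow> y \<in> K \<Longrightarrow> \<kappa> x y \<in> carrier G"
    and diag: "\<And>x. x \<in> K \<Longrightarrow> \<kappa> x x = \<one>\<^bsub>G\<^esub>"
    and skew: "\<And>x y. x \<in> K \<Longrightarrow> y \<in> K \<Longrightarrow> \<kappa> y x = inv\<^bsub>G\<^esub> \<kappa> x y"
    and ordered: "\<And>x y z. x \<in> K \<Longrightarrow> y \<in> K \<Longrightarrow> z \<in> K \<Longrightarrow> x < y \<Longrightarrow> y < z \<Longrightarrow> \<kappa> z y \<otimes>\<^bsub>G\<^esub> \<kappa> y x = \<kappa> z x"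
    and ijk: "i \<in> K" "j \<in> K" "k \<in> K"
  shows "\<kappa> i j \<otimes>\<^bsub>G\<^esub> \<kappa> j k = \<kappa> i k"
proof -
  interpret comm_group G by fact
  have rev: "\<kappa> z y \<otimes>\<^bsub>G\<^esub> \<kappa> y x = \<kappa> z x" if "\<kappa> x y \<otimes>\<^bsub>G\<^esub> \<kappa> y z = \<kappa> x z" "x \<in> K" "y \<in> K" "z \<in> K" for x y z
    using that skew[of x z] skew[of x y] skew[of y z] closed by (metis inv_mult_group)
  have swap: "\<kappa> y x \<otimes>\<^bsub>G\<^esub> \<kappa> x z = \<kappa> y z" if "\<kappa> x y \<otimes>\<^bsub>G\<^esub> \<kappa> y z = \<kappa> x z" "x \<in> K" "y \<in> K" "z \<in> K" for x y z
    using that skew[of x y] closed by (metis inv_closed inv_solve_left)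
  have all: "\<kappa> a b \<otimes>\<^bsub>G\<^esub> \<kappa> b c = \<kappa> a c" if xyz: "x \<in> K" "y \<in> K" "z \<in> K" "x < y" "y < z"
    and abc: "(a, b, c) \<in> {(x, y, z), (x, z, y), (y, x, z), (y, z, x), (z, x, y), (z, y, x)}" for x y z a b c
  proof -
    have 1: "\<kappa> z y \<otimes>\<^bsub>G\<^esub> \<kappa> y x = \<kappa> z x" using ordered xyz by blast
    have 2: "\<kappa> x y \<otimes>\<^bsub>G\<^esub> \<kappa> y z = \<kappa> x z" using rev[OF 1] xyz by blast
    have 3: "\<kappa> y z \<otimes>\<^bsub>G\<^esub> \<kappa> z x = \<kappa> y x" using swap[OF 1] xyz by blast
    have 4: "\<kappa> x z \<otimes>\<^bsub>G\<^esub> \<kappa> z y = \<kappa> x y" using rev[OF 3] xyz by blast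
    have 5: "\<kappa> y x \<otimes>\<^bsub>G\<^esub> \<kappa> x z = \<kappa> y z" using swap[OF 2] xyz by blast
    have 6: "\<kappa> z x \<otimes>\<^bsub>G\<^esub> \<kappa> x y = \<kappa> z y" using rev[OF 5] xyz by blast
    show ?thesis using abc 1 2 3 4 5 6 by auto
  qed
  show ?thesis
  proof (cases "i = j \<or> j = k \<or> i = k")
    case True
    then show ?thesis
    proof (elim disjE)
      assume "i = k"
      then show ?thesis using skew[of i j] diag closed ijk by simp
    qed (use diag closed ijk in simp_all)
  next
    case False
    then consider "i < j" "j < k" | "i < k" "k < j" | "j < i" "i < k" | "j < k" "k < i" | "k < i" "i < j" | "k < j" "j < i"
      by (metis linorder_neqE)
    then show ?thesis
    proof cases
      case 1 show ?thesis by (rule all[of i j k]) (use ijk 1 in auto)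
    next
      case 2 show ?thesis by (rule all[of i k j]) (use ijk 2 in auto)
    next
      case 3 show ?thesis by (rule all[of j i k]) (use ijk 3 in auto)
    next
      case 4 show ?thesis by (rule all[of j k i]) (use ijk 4 in auto)
    next
      case 5 show ?thesis by (rule all[of k i j]) (use ijk 5 in auto)
    next
      case 6 show ?thesis by (rule all[of k j i]) (use ijk 6 in auto)
    qed
  qed
qed

context comm_group
begin

lemma coboundary_edge:
  fixes \<Delta> :: "'v::linorder set set"
  assumes c: "c \<in> carrier (cochains \<Delta> G 0)" and vert: "{x} \<in> \<Delta>" "{y} \<in> \<Delta>" and xy: "{x, y} \<in> \<Delta>" "x < y"
  shows "coboundary \<Delta> G 0 c {x, y} = c {y} \<otimes> inv c {x}"
proof -
  have cl: "c {x} \<in> carrier G" "c {y} \<in> carrier G" using cochains_closed[OF c] vert by (simp_all add: simplices_def)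
  have \<sigma>: "{x, y} \<in> simplices \<Delta> (0 + 1)" using xy by (simp add: simplices_def)
  define f where "f = (\<lambda>j. c ({x, y} - {sorted_list_of_set {x, y} ! j}) [^] ((- 1 :: int) ^ j))"
  have "{x, y} - {x} = {y}" "{x, y} - {y} = {x}" using xy by auto
  then have f: "f 0 = c {y}" "f (Suc 0) = inv c {x}"
    using cl by (simp_all add: f_def sorted_list_of_two[OF xy(2)] int_pow_neg)
  have "f \<in> {..Suc 0} \<rightarrow> carrier G" using f cl by (auto simp: le_Suc_eq)
  moreover have "coboundary \<Delta> G 0 c {x, y} = finprod G f {..0 + 1}"
    by (simp only: coboundary_def restrict_apply f_def if_P[OF \<sigma>])
  ultimately show ?thesis using f cl by (simp add: m_comm)
qed

lemma coboundary_triangle: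
  fixes \<Delta> :: "'v::linorder set set"
  assumes c: "c \<in> carrier (cochains \<Delta> G 1)" and edges: "{x, y} \<in> \<Delta>" "{x, z} \<in> \<Delta>" "{y, z} \<in> \<Delta>"
    and xyz: "{x, y, z} \<in> \<Delta>" "x < y" "y < z"
  shows "coboundary \<Delta> G 1 c {x, y, z} = c {x, y} \<otimes> c {y, z} \<otimes> inv c {x, z}"
proof -
  have cl: "c {x, y} \<in> carrier G" "c {x, z} \<in> carrier G" "c {y, z} \<in> carrier G"
    using cochains_closed[OF c] edges xyz by (simp_all add: simplices_def)
  have \<sigma>: "{x, y, z} \<in> simplices \<Delta> (1 + 1)" using xyz less_trans[OF xyz(2,3)] by (auto simp: simplices_def card_insert_if)
  define f where "f = (\<lambda>j. c ({x, y, z} - {sorted_list_of_set {x, y, z} ! j}) [^] ((- 1 :: int) ^ j))"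
  have "{x, y, z} - {x} = {y, z}" "{x, y, z} - {y} = {x, z}" "{x, y, z} - {z} = {x, y}" using xyz by auto
  then have f: "f 0 = c {y, z}" "f (Suc 0) = inv c {x, z}" "f (Suc (Suc 0)) = c {x, y}"
    using cl by (simp_all add: f_def sorted_list_of_three[OF xyz(2,3)] int_pow_neg)
  have "f \<in> {..Suc (Suc 0)} \<rightarrow> carrier G" "f \<in> {..Suc 0} \<rightarrow> carrier G" using f cl by (auto simp: le_Suc_eq)
  moreover have "coboundary \<Delta> G 1 c {x, y, z} = finprod G f {..1 + 1}"
    by (simp only: coboundary_def restrict_apply f_def if_P[OF \<sigma>])
  ultimately show ?thesis using f cl by (simp add: m_ac)
qed

text \<open>An ordered 1-cocycle extends skew-symmetrically to all pairs of vertices. A splitting of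
  the extension is a 0-cochain with the given coboundary, so every cocycle is a coboundary and there
  is one coset.\<close>

lemma cohomology_1_trivialI:
  fixes \<Delta> :: "'v::linorder set set"
  assumes mono: "\<And>F H. F \<in> \<Delta> \<Longrightarrow> H \<subseteq> F \<Longrightarrow> H \<in> \<Delta>"
    and split: "\<And>\<kappa>. (\<And>j k. {j, k} \<in> \<Delta> \<Longrightarrow> \<kappa> j k \<in> carrier G) \<Longrightarrow>
      (\<And>i j k. {i, j, k} \<in> \<Delta> \<Longrightarrow> \<kappa> i j \<otimes> \<kappa> j k = \<kappa> i k) \<Longrightarrow>
      \<exists>\<mu>. (\<forall>j. {j} \<in> \<Delta> \<longrightarrow> \<mu> j \<in> carrier G) \<and> (\<forall>j k. {j, k} \<in> \<Delta> \<longrightarrow> \<mu> k = \<kappa> k j \<otimes> \<mu> j)"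
  shows "carrier (simplicial_cohomology 1 \<Delta> G) = {\<one>\<^bsub>simplicial_cohomology 1 \<Delta> G\<^esub>}"
proof -
  let ?C = "cochains \<Delta> G" and ?d = "coboundary \<Delta> G 0" and ?Z = "kernel (cochains \<Delta> G 1) (cochains \<Delta> G 2) (coboundary \<Delta> G 1)"
  define H where "H = ?d ` carrier (?C 0)"
  have vertices: "{x} \<in> \<Delta>" "{y} \<in> \<Delta>" if "{x, y} \<in> \<Delta>" for x y using mono[OF that] by auto
  have edgeE: "\<exists>x y. \<sigma> = {x, y} \<and> x < y \<and> {x, y} \<in> \<Delta>" if "\<sigma> \<in> simplices \<Delta> 1" for \<sigma>
  proof -
    have "card \<sigma> = 2" "\<sigma> \<in> \<Delta>" using that by (auto simp: simplices_def)
    then obtain x y where "\<sigma> = {x, y}" "x \<noteq> y" by (auto simp: card_2_iff)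
    then show ?thesis using \<open>\<sigma> \<in> \<Delta>\<close> by (metis insert_commute linorder_neqE)
  qed
  have closed0: "c {x} \<in> carrier G" if "c \<in> carrier (?C 0)" "{x} \<in> \<Delta>" for c x
    using cochains_closed[OF that(1)] that(2) by (simp add: simplices_def)
  have ZH: "\<exists>c'\<in>carrier (?C 0). ?d c' = c" if c: "c \<in> carrier (?C 1)" "coboundary \<Delta> G 1 c = \<one>\<^bsub>?C 2\<^esub>" for c
  proof -
    \<comment> \<open>The orientation matches the coboundary: for \<open>j < k\<close> the relation
      \<open>\<mu> k = \<kappa> k j \<otimes> \<mu> j\<close> reads
      \<open>c {j, k} = \<mu> k \<otimes> inv \<mu> j\<close>.\<close>
    define \<kappa> where "\<kappa> j k = (if j = k then \<one> else if k < j then c {k, j} else inv c {j, k})" for j k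
    have c_closed: "c {x, y} \<in> carrier G" if "{x, y} \<in> \<Delta>" "x < y" for x y
      using that by (intro cochains_closed[OF c(1)]) (auto simp: simplices_def)
    have \<kappa>_closed: "\<kappa> j k \<in> carrier G" if "{j, k} \<in> \<Delta>" for j k
      using that c_closed[of k j] c_closed[of j k] unfolding \<kappa>_def by (auto simp: insert_commute)
    have cocycle: "\<kappa> i j \<otimes> \<kappa> j k = \<kappa> i k" if K: "{i, j, k} \<in> \<Delta>" for i j k
    proof (rule skew_cocycle[where K = "{i, j, k}"])
      show "comm_group G" by (rule comm_group_axioms)
      have pair: "{x, y} \<in> \<Delta>" if "x \<in> {i, j, k}" "y \<in> {i, j, k}" for x y using mono[OF K, of "{x, y}"] that by auto
      show "\<kappa> x y \<in> carrier G" if "x \<in> {i, j, k}" "y \<in> {i, j, k}" for x y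
        using \<kappa>_closed pair that by blast
      show "\<kappa> y x = inv \<kappa> x y" if "x \<in> {i, j, k}" "y \<in> {i, j, k}" for x y
        using c_closed[of x y] c_closed[of y x] pair[OF that] pair[OF that(2,1)]
        by (cases x y rule: linorder_cases) (auto simp: \<kappa>_def dest: less_asym)
      show "\<kappa> z y \<otimes> \<kappa> y x = \<kappa> z x" if xyz: "x \<in> {i, j, k}" "y \<in> {i, j, k}" "z \<in> {i, j, k}" and lt: "x < y" "y < z" for x y z
      proof -
        have tri: "{x, y, z} \<in> \<Delta>" using mono[OF K, of "{x, y, z}"] xyz by auto
        note E = pair[OF xyz(1,2)] pair[OF xyz(1,3)] pair[OF xyz(2,3)]
        have xz: "x < z" using lt by simp
        note cl = c_closed[OF E(1) lt(1)] c_closed[OF E(2) xz] c_closed[OF E(3) lt(2)]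
        have "{x, y, z} \<in> simplices \<Delta> 2" using tri lt xz by (auto simp: simplices_def card_insert_if)
        then have "coboundary \<Delta> G 1 c {x, y, z} = \<one>" using c(2) by (simp add: cochains_def)
        then have "c {x, y} \<otimes> c {y, z} \<otimes> inv c {x, z} = \<one>" using coboundary_triangle[OF c(1) E tri lt] by simp
        then have "c {x, y} \<otimes> c {y, z} = c {x, z}" using cl by (metis inv_closed inv_equality inv_inv m_closed)
        moreover have "\<kappa> z y = c {y, z}" "\<kappa> y x = c {x, y}" "\<kappa> z x = c {x, z}"
          using lt xz by (auto simp: \<kappa>_def dest: less_asym)
        ultimately show ?thesis using cl by (simp add: m_comm)
      qed
    qed (auto simp: \<kappa>_def)
    have "\<exists>\<mu>. (\<forall>j. {j} \<in> \<Delta> \<longrightarrow> \<mu> j \<in> carrier G) \<and> (\<forall>j k. {j, k} \<in> \<Delta> \<longrightarrow> \<mu> k = \<kappa> k j \<otimes> \<mu> j)"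
      by (rule split) (fact \<kappa>_closed, fact cocycle)
    then obtain \<mu> where "\<forall>j. {j} \<in> \<Delta> \<longrightarrow> \<mu> j \<in> carrier G"
      "\<forall>j k. {j, k} \<in> \<Delta> \<longrightarrow> \<mu> k = \<kappa> k j \<otimes> \<mu> j" by (elim exE conjE)
    then have \<mu>: "{j} \<in> \<Delta> \<Longrightarrow> \<mu> j \<in> carrier G" "{j, k} \<in> \<Delta> \<Longrightarrow> \<mu> k = \<kappa> k j \<otimes> \<mu> j" for j k by simp_all
    define c' where "c' = (\<lambda>\<sigma>\<in>simplices \<Delta> 0. \<mu> (the_elem \<sigma>))"
    have c'_v: "c' {x} = \<mu> x" if "{x} \<in> \<Delta>" for x using that by (simp add: c'_def simplices_def)
    have c': "c' \<in> carrier (?C 0)"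
      unfolding cochains_def carrier_product_group
    proof
      fix \<sigma> assume s: "\<sigma> \<in> simplices \<Delta> 0"
      then obtain x where "\<sigma> = {x}" by (auto simp: simplices_def card_1_singleton_iff)
      then show "c' \<sigma> \<in> carrier G" using s c'_v \<mu>(1) by (simp add: simplices_def)
    qed (simp add: c'_def)
    have "?d c' = c"
    proof (rule extensionalityI[of _ "simplices \<Delta> 1"])
      show "?d c' \<in> extensional (simplices \<Delta> 1)" by (simp add: coboundary_def)
      show "c \<in> extensional (simplices \<Delta> 1)" using c(1) by (auto simp: cochains_def PiE_def)
      fix \<sigma> assume "\<sigma> \<in> simplices \<Delta> 1"
      then obtain x y where xy: "\<sigma> = {x, y}" "x < y" "{x, y} \<in> \<Delta>" using edgeE by blast
      note v = vertices[OF xy(3)]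
      have "?d c' \<sigma> = \<mu> y \<otimes> inv \<mu> x" using coboundary_edge[OF c' v xy(3,2)] c'_v v xy(1) by simp
      also have "\<dots> = c {x, y}" using \<mu>(2)[OF xy(3)] xy \<mu>(1) v c_closed[OF xy(3,2)] less_imp_neq[OF xy(2)] by (simp add: \<kappa>_def m_assoc)
      finally show "?d c' \<sigma> = c \<sigma>" using xy by simp
    qed
    then show ?thesis using c' by blast
  qed
  \<comment> \<open>Multiplication by a coboundary permutes the coboundaries, because
    \<open>?d\<close> is multiplicative on 0-cochains.\<close>
  have coset: "H #>\<^bsub>?C 1\<lparr>carrier := ?Z\<rparr>\<^esub> a = H" if a: "a \<in> ?Z" for a
  proof -
    obtain c where c: "c \<in> carrier (?C 0)" "?d c = a" using ZH a by (auto simp: kernel_def)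
    have mult: "?d c1 \<otimes>\<^bsub>?C 1\<^esub> ?d c2 = ?d (c1 \<otimes>\<^bsub>?C 0\<^esub> c2)" if c12: "c1 \<in> carrier (?C 0)" "c2 \<in> carrier (?C 0)" for c1 c2
    proof (rule extensionalityI[of _ "simplices \<Delta> 1"])
      have c3: "c1 \<otimes>\<^bsub>?C 0\<^esub> c2 \<in> carrier (?C 0)" using c12 by (auto simp: cochains_def)
      fix \<sigma> assume s: "\<sigma> \<in> simplices \<Delta> 1"
      then obtain x y where xy: "\<sigma> = {x, y}" "x < y" "{x, y} \<in> \<Delta>" using edgeE by blast
      note v = vertices[OF xy(3)]
      have m: "(c1 \<otimes>\<^bsub>?C 0\<^esub> c2) {w} = c1 {w} \<otimes> c2 {w}" if "{w} \<in> \<Delta>" for w using that by (simp add: cochains_def simplices_def)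
      show "(?d c1 \<otimes>\<^bsub>?C 1\<^esub> ?d c2) \<sigma> = ?d (c1 \<otimes>\<^bsub>?C 0\<^esub> c2) \<sigma>"
        using coboundary_edge[OF c12(1) v xy(3,2)] coboundary_edge[OF c12(2) v xy(3,2)] coboundary_edge[OF c3 v xy(3,2)]
          closed0[OF c12(1)] closed0[OF c12(2)] v m s xy(1)
        by (simp add: cochains_def inv_mult m_ac)
    qed (simp_all add: cochains_def coboundary_def)
    interpret C0: group "?C 0" unfolding cochains_def by (rule product_group) (rule is_group)
    have "(\<lambda>h. h \<otimes>\<^bsub>?C 1\<^esub> a) ` H = H"
    proof
      show "(\<lambda>h. h \<otimes>\<^bsub>?C 1\<^esub> a) ` H \<subseteq> H"
      proof (rule image_subsetI)
        fix h assume "h \<in> H"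
        then obtain c1 where "c1 \<in> carrier (?C 0)" "h = ?d c1" unfolding H_def by blast
        then show "h \<otimes>\<^bsub>?C 1\<^esub> a \<in> H"
          using mult[OF _ c(1), of c1] C0.m_closed[OF _ c(1), of c1] c(2) unfolding H_def by auto
      qed
      show "H \<subseteq> (\<lambda>h. h \<otimes>\<^bsub>?C 1\<^esub> a) ` H"
      proof
        fix h assume "h \<in> H"
        then obtain c2 where c2: "c2 \<in> carrier (?C 0)" "h = ?d c2" unfolding H_def by blast
        define c1 where "c1 = c2 \<otimes>\<^bsub>?C 0\<^esub> inv\<^bsub>?C 0\<^esub> c"
        have c1: "c1 \<in> carrier (?C 0)" using c2 c C0.m_closed C0.inv_closed unfolding c1_def by blast
        have "c1 \<otimes>\<^bsub>?C 0\<^esub> c = c2"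
          unfolding c1_def using C0.m_assoc[OF c2(1) C0.inv_closed[OF c(1)] c(1)] C0.l_inv[OF c(1)] C0.r_one[OF c2(1)] by (simp only:)
        then have "h = ?d c1 \<otimes>\<^bsub>?C 1\<^esub> a" using mult[OF c1 c(1)] c(2) c2(2) by (simp only:)
        then show "h \<in> (\<lambda>h. h \<otimes>\<^bsub>?C 1\<^esub> a) ` H" using c1 unfolding H_def by blast
      qed
    qed
    then show ?thesis by (auto simp: r_coset_def)
  qed
  \<comment> \<open>The set of cosets is a singleton only if there is a cocycle; the trivial one is
    exhibited.\<close>
  have "\<one>\<^bsub>?C 1\<^esub> \<in> ?Z"
  proof -
    have c: "\<one>\<^bsub>?C 1\<^esub> \<in> carrier (?C 1)" by (auto simp: cochains_def)
    have "coboundary \<Delta> G 1 (\<one>\<^bsub>?C 1\<^esub>) = \<one>\<^bsub>?C 2\<^esub>"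
    proof (rule extensionalityI[of _ "simplices \<Delta> 2"])
      fix \<sigma> assume s: "\<sigma> \<in> simplices \<Delta> 2"
      then have "card \<sigma> = 3" and D: "\<sigma> \<in> \<Delta>" by (auto simp: simplices_def)
      then obtain p q r where pqr: "\<sigma> = {p, q, r}" "p \<noteq> q" "p \<noteq> r" "q \<noteq> r" by (auto simp: card_3_iff)
      have "\<exists>x y z. \<sigma> = {x, y, z} \<and> x < y \<and> y < z"
      proof -
        consider "p < q" "q < r" | "p < r" "r < q" | "q < p" "p < r" | "q < r" "r < p" | "r < p" "p < q" | "r < q" "q < p"
          using pqr by (metis linorder_neqE)
        then show ?thesis
          by cases (use pqr in \<open>metis insert_commute\<close>)+
      qed
      then obtain x y z where xyz: "\<sigma> = {x, y, z}" "x < y" "y < z" by blast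
      have E: "{x, y} \<in> \<Delta>" "{x, z} \<in> \<Delta>" "{y, z} \<in> \<Delta>" using mono[OF D] xyz by auto
      have "\<one>\<^bsub>?C 1\<^esub> {a, b} = \<one>" if "{a, b} \<in> \<Delta>" "a < b" for a b using that by (auto simp: cochains_def simplices_def)
      then show "coboundary \<Delta> G 1 (\<one>\<^bsub>?C 1\<^esub>) \<sigma> = \<one>\<^bsub>?C 2\<^esub> \<sigma>"
        using coboundary_triangle[OF c E] D xyz E s by (simp add: cochains_def)
    qed (simp_all add: coboundary_def cochains_def numeral_2_eq_2)
    then show ?thesis using c by (simp add: kernel_def)
  qed
  then have "rcosets\<^bsub>?C 1\<lparr>carrier := ?Z\<rparr>\<^esub> H = {H}"
    using coset by (auto simp: RCOSETS_def)
  then show ?thesis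
    by (simp add: simplicial_cohomology_def FactGroup_def coboundaries_def H_def numeral_2_eq_2)
qed

end


section \<open>Monomial ideals and their radicals\<close>

lemma mpoly_ideal_iff:
  fixes I :: "'k::field mpoly set"
  shows "ideal I (mpoly_ring n) \<longleftrightarrow> I \<subseteq> {p. rst {1..n} p = p} \<and> 0 \<in> I \<and> (\<forall>p\<in>I. \<forall>q\<in>I. p + q \<in> I) \<and>
     (\<forall>p\<in>I. \<forall>q. rst {1..n} q = q \<longrightarrow> q * p \<in> I)" (is "_ \<longleftrightarrow> ?I")
proof
  assume "ideal I (mpoly_ring n)"
  then interpret I: ideal I "mpoly_ring n" .
  show ?I using I.a_subset additive_subgroup.zero_closed[OF I.is_additive_subgroup]
      additive_subgroup.a_closed[OF I.is_additive_subgroup] I.I_l_closed by auto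
next
  interpret R: cring "mpoly_ring n :: 'k mpoly ring" by (rule mpoly_ring_cring)
  assume I: ?I
  have neg: "- p \<in> I" if "p \<in> I" for p
  proof -
    have "(- 1) * p \<in> I" using I that by (metis rst_simps(2,7))
    then show ?thesis by simp
  qed
  have minus: "\<ominus>\<^bsub>mpoly_ring n\<^esub> p = - p" if "p \<in> I" for p
    using R.minus_equality[of "- p" p] I that by auto
  show "ideal I (mpoly_ring n)"
  proof (rule idealI)
    show "ring (mpoly_ring n)" by (rule cring.axioms(1)[OF mpoly_ring_cring])
    show "subgroup I (add_monoid (mpoly_ring n))"
      by (rule R.add.subgroupI) (use I neg minus in \<open>auto simp: a_inv_def[symmetric]\<close>)
  qed (use I in \<open>auto simp: mult.commute\<close>)
qed

lemma ideal_radical_mpoly: "p \<in> ideal_radical (mpoly_ring n) I \<longleftrightarrow> rst {1..n} p = p \<and> (\<exists>k. p ^ k \<in> I)"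
  by (simp add: ideal_radical_def)

lemma ideal_ideal_radical:
  fixes I :: "'k::field mpoly set"
  assumes I: "ideal I (mpoly_ring n)"
  shows "ideal (ideal_radical (mpoly_ring n) I) (mpoly_ring n)"
proof -
  have I0: "0 \<in> I" and add: "\<And>p q. p \<in> I \<Longrightarrow> q \<in> I \<Longrightarrow> p + q \<in> I"
    and mult: "\<And>p q. p \<in> I \<Longrightarrow> rst {1..n} q = q \<Longrightarrow> q * p \<in> I"
    using I unfolding mpoly_ideal_iff by blast+
  have nat: "rst {1..n} (of_nat k) = (of_nat k :: 'k mpoly)" for k by (induction k) auto
  have "\<exists>m. (p + q) ^ m \<in> I" if p: "rst {1..n} p = p" "p ^ k \<in> I" and q: "rst {1..n} q = q" "q ^ l \<in> I" for p q k l
  proof -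
    \<comment> \<open>In each term of the binomial expansion with exponent \<open>k + l\<close>,
      either \<open>p\<close> occurs to the power \<open>k\<close> at least or \<open>q\<close> to
      the power \<open>l\<close> at least.\<close>
    have summand: "of_nat c * p ^ i * q ^ (k + l - i) \<in> I" for i c
    proof (cases "k \<le> i")
      case True
      have "of_nat c * p ^ (i - k) * q ^ (k + l - i) * p ^ k \<in> I" using p q nat by (intro mult) auto
      moreover have "p ^ i = p ^ (i - k) * p ^ k" using True by (simp add: power_add[symmetric])
      ultimately show ?thesis by (simp add: ac_simps)
    next
      case False
      have "of_nat c * p ^ i * q ^ (k - i) * q ^ l \<in> I" using p q nat by (intro mult) auto
      moreover have "q ^ (k + l - i) = q ^ (k - i) * q ^ l" using False by (simp add: power_add[symmetric])
      ultimately show ?thesis by (simp add: ac_simps)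
    qed
    have "(\<Sum>i\<in>S. of_nat (k + l choose i) * p ^ i * q ^ (k + l - i)) \<in> I" if "finite S" for S
      using that by (induction rule: finite_induct) (simp_all only: sum.empty sum.insert I0 add summand not_False_eq_True)
    from this[OF finite_atMost] have "(p + q) ^ (k + l) \<in> I" unfolding binomial_ring .
    then show ?thesis by blast
  qed
  then have "p + q \<in> ideal_radical (mpoly_ring n) I"
    if "p \<in> ideal_radical (mpoly_ring n) I" "q \<in> ideal_radical (mpoly_ring n) I" for p q
    using that unfolding ideal_radical_mpoly by (metis rst_simps(4))
  moreover have "q * p \<in> ideal_radical (mpoly_ring n) I" if p: "p \<in> ideal_radical (mpoly_ring n) I" and q: "rst {1..n} q = q" for p q
  proof -
    obtain k where k: "rst {1..n} p = p" "p ^ k \<in> I" using p unfolding ideal_radical_mpoly by blast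
    then have "(q * p) ^ k \<in> I" using mult[OF k(2), of "q ^ k"] q by (simp add: power_mult_distrib)
    then show ?thesis using k(1) q unfolding ideal_radical_mpoly by (simp only: rst_simps(5)) blast
  qed
  moreover have "0 \<in> ideal_radical (mpoly_ring n) I"
    unfolding ideal_radical_mpoly using I0 by (intro conjI exI[of _ 1]) simp_all
  moreover have "ideal_radical (mpoly_ring n) I \<subseteq> {p. rst {1..n} p = p}"
    by (simp add: subset_iff ideal_radical_mpoly)
  ultimately show ?thesis unfolding mpoly_ideal_iff by (intro conjI ballI allI impI)
qed

lemma prod_pvar_rst:
  assumes "finite F"
  shows "rst V (\<Prod>i\<in>F. pvar i :: 'k::field mpoly) = (if F \<subseteq> V then \<Prod>i\<in>F. pvar i else 0)"
  using assms by (induction rule: finite_induct) auto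

lemma monomial_dvd_power:
  assumes "Poly_Mapping.keys m \<subseteq> F" "finite F"
  shows "\<exists>k q. rst F q = q \<and> (\<Prod>i\<in>F. pvar i :: 'k::field mpoly) ^ k = q * monomial m"
  using assms(1)
proof (induction m rule: poly_mapping_single_induct)
  case 1
  then show ?case by (intro exI[of _ 0] exI[of _ 1]) (simp add: monomial_def)
next
  case (2 i a m)
  have sub: "Poly_Mapping.keys m \<subseteq> F" "a \<noteq> 0 \<Longrightarrow> i \<in> F" using 2(2) by (auto simp: keys_add_monom split: if_splits)
  obtain k q where kq: "rst F q = q" "(\<Prod>i\<in>F. pvar i :: 'k mpoly) ^ k = q * monomial m" using 2(1) sub by blast
  show ?case
  proof (cases "a = 0")
    case True
    then show ?thesis using kq by auto
  next
    case False
    let ?r = "\<Prod>i\<in>F - {i}. pvar i :: 'k mpoly"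
    have "(\<Prod>i\<in>F. pvar i :: 'k mpoly) = pvar i * ?r" using assms(2) sub(2)[OF False] by (rule prod.remove)
    then have "(\<Prod>i\<in>F. pvar i :: 'k mpoly) ^ (a + k) = (?r ^ a * q) * monomial (Poly_Mapping.single i a + m)"
      using kq(2) by (simp add: power_add power_mult_distrib pvar_power monomial_def mult_single ac_simps)
    moreover have "rst F (?r ^ a * q) = ?r ^ a * q" using kq(1) assms(2) by (auto simp: prod_pvar_rst)
    ultimately show ?thesis by blast
  qed
qed

lemma prod_pvar_dvd_monomial:
  "\<exists>q. Poly_Mapping.keys q \<subseteq> Poly_Mapping.keys m \<and> monomial m = (\<Prod>i\<in>Poly_Mapping.keys m. pvar i) * (monomial q :: 'k::field mpoly)"
proof -
  define S where "S = Poly_Mapping.keys m"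
  \<comment> \<open>The last conjunct is the invariant that makes the induction work: variables not
    yet split off still divide the cofactor.\<close>
  have "\<exists>q. Poly_Mapping.keys q \<subseteq> Poly_Mapping.keys m \<and> monomial m = (\<Prod>i\<in>F. pvar i) * (monomial q :: 'k mpoly)
      \<and> (\<forall>i\<in>S - F. i \<in> Poly_Mapping.keys q)" if "finite F" "F \<subseteq> S" for F
    using that
  proof (induction rule: finite_induct)
    case empty
    then show ?case by (intro exI[of _ m]) (simp add: S_def)
  next
    case (insert i F)
    then obtain q where q: "Poly_Mapping.keys q \<subseteq> Poly_Mapping.keys m"
      "monomial m = (\<Prod>i\<in>F. pvar i) * (monomial q :: 'k mpoly)" "\<forall>i\<in>S - F. i \<in> Poly_Mapping.keys q" by auto
    have "i \<in> Poly_Mapping.keys q" using q(3) insert by auto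
    then obtain q' where q': "q = Poly_Mapping.single i 1 + q'" "\<And>a. Poly_Mapping.single q a = (pvar i :: 'k mpoly) * Poly_Mapping.single q' a"
      using single_eq_pvar_mult[where 'k = 'k] by metis
    show ?case
      using q q' insert.hyps by (intro exI[of _ q']) (auto simp: keys_add_monom monomial_def ac_simps split: if_splits)
  qed
  from this[of S] show ?thesis unfolding S_def by auto
qed

context
  fixes n :: nat and I :: "'k::field mpoly set" and \<Delta> :: "nat set set"
  assumes I: "monomial_ideal n I"
    and \<Delta>: "\<Delta> = stanley_reisner_complex n (ideal_radical (mpoly_ring n) I)"
begin

lemma ideal_of_monomial_ideal: "ideal I (mpoly_ring n)"
proof -
  interpret R: cring "mpoly_ring n :: 'k mpoly ring" by (rule mpoly_ring_cring)
  obtain A where A: "A \<subseteq> monoms n" "I = Idl\<^bsub>mpoly_ring n\<^esub> (monomial ` A)" using I unfolding monomial_ideal_def by blast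
  have "monomial ` A \<subseteq> carrier (mpoly_ring n :: 'k mpoly ring)" using A(1) by (auto simp: monomial_def monoms_def)
  then show ?thesis unfolding A(2) by (rule R.genideal_ideal)
qed

lemma face_iff: "F \<in> \<Delta> \<longleftrightarrow> F \<subseteq> {1..n} \<and> (\<forall>k. (\<Prod>i\<in>F. pvar i) ^ k \<notin> I)"
proof -
  have "rst {1..n} (\<Prod>i\<in>F. pvar i :: 'k mpoly) = (\<Prod>i\<in>F. pvar i)" if "F \<subseteq> {1..n}"
    using that finite_subset[OF that] by (simp add: prod_pvar_rst)
  then show ?thesis unfolding \<Delta> stanley_reisner_complex_def by (auto simp: ideal_radical_mpoly)
qed

lemma face_subset:
  assumes F: "F \<in> \<Delta>" and G: "G \<subseteq> F"
  shows "G \<in> \<Delta>"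
proof -
  have sub: "F \<subseteq> {1..n}" using F by (simp add: face_iff)
  then have fin: "finite F" using finite_subset by blast
  have "(\<Prod>i\<in>F. pvar i) = (\<Prod>i\<in>F - G. pvar i :: 'k mpoly) * (\<Prod>i\<in>G. pvar i)"
    using prod.subset_diff[OF G fin] .
  moreover have "rst {1..n} (\<Prod>i\<in>F - G. pvar i :: 'k mpoly) = (\<Prod>i\<in>F - G. pvar i)"
    using fin sub by (auto simp: prod_pvar_rst)
  moreover have "rst {1..n} q = q \<Longrightarrow> p \<in> I \<Longrightarrow> q * p \<in> I" for p q
    using ideal_of_monomial_ideal unfolding mpoly_ideal_iff by blast
  ultimately have "(\<Prod>i\<in>F. pvar i) ^ k \<in> I" if "(\<Prod>i\<in>G. pvar i) ^ k \<in> I" for k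
    using that by (simp add: power_mult_distrib)
  then show ?thesis using F sub G unfolding face_iff by blast
qed

text \<open>A generator supported on \<open>F\<close> would divide a power of the product over
  \<open>F\<close> and put this power into the ideal, so \<open>F\<close> would not be a face. Hence
  all generators lie in the kernel of \<open>rst F\<close>, which is an ideal.\<close>

lemma face_kills_ideal:
  assumes F: "F \<in> \<Delta>" and p: "p \<in> I"
  shows "rst F p = 0"
proof -
  interpret R: cring "mpoly_ring n :: 'k mpoly ring" by (rule mpoly_ring_cring)
  obtain A where A: "A \<subseteq> monoms n" "I = Idl\<^bsub>mpoly_ring n\<^esub> (monomial ` A)" using I unfolding monomial_ideal_def by blast
  have sub: "F \<subseteq> {1..n}" using F by (simp add: face_iff)
  then have fin: "finite F" using finite_subset by blast
  have AI: "monomial ` A \<subseteq> I" unfolding A(2) using A(1) by (intro R.genideal_self) (auto simp: monomial_def monoms_def)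
  have "rst F (monomial a :: 'k mpoly) = 0" if a: "a \<in> A" for a
  proof (cases "Poly_Mapping.keys a \<subseteq> F")
    case True
    then obtain k q where kq: "rst F q = q" "(\<Prod>i\<in>F. pvar i :: 'k mpoly) ^ k = q * monomial a"
      using monomial_dvd_power[OF _ fin] by blast
    have "rst {1..n} q = q" using kq(1) sub by (metis rst_rst Int_absorb1)
    then have "(\<Prod>i\<in>F. pvar i) ^ k \<in> I"
      unfolding kq(2) using ideal_of_monomial_ideal AI a unfolding mpoly_ideal_iff by blast
    then show ?thesis using F by (simp add: face_iff)
  qed (simp add: monomial_def)
  moreover have "I \<subseteq> {p. rst {1..n} p = p}" using ideal_of_monomial_ideal unfolding mpoly_ideal_iff by blast
  ultimately have "monomial ` A \<subseteq> {p :: 'k mpoly. rst {1..n} p = p \<and> rst F p = 0}" using AI by blast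
  moreover have "ideal {p. rst {1..n} p = p \<and> rst F p = (0 :: 'k mpoly)} (mpoly_ring n)"
    unfolding mpoly_ideal_iff by (intro conjI subsetI CollectI ballI allI impI) simp_all
  ultimately have "I \<subseteq> {p. rst {1..n} p = p \<and> rst F p = 0}" unfolding A(2) by (intro R.genideal_minimal) auto
  then show ?thesis using p by blast
qed

lemma monomial_quotient_of_ideal: "monomial_quotient n I \<Delta>"
proof (rule monomial_quotient.intro)
  show "F \<in> \<Delta> \<Longrightarrow> F \<subseteq> {1..n}" for F by (simp add: face_iff)
  show "F \<subseteq> {1..n} \<Longrightarrow> F \<notin> \<Delta> \<Longrightarrow> \<exists>k. (\<Prod>i\<in>F. pvar i) ^ k \<in> I" for F by (simp add: face_iff)
qed (use ideal_of_monomial_ideal face_subset face_kills_ideal in auto)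

lemma reduced_monomial_quotient_of_radical:
  "reduced_monomial_quotient n (ideal_radical (mpoly_ring n) I) \<Delta>"
proof -
  let ?J = "ideal_radical (mpoly_ring n) I"
  have J: "ideal ?J (mpoly_ring n)" by (rule ideal_ideal_radical[OF ideal_of_monomial_ideal])
  have add: "\<And>p q. p \<in> ?J \<Longrightarrow> q \<in> ?J \<Longrightarrow> p + q \<in> ?J" and J0: "0 \<in> ?J"
    and mult: "\<And>p q. p \<in> ?J \<Longrightarrow> rst {1..n} q = q \<Longrightarrow> q * p \<in> ?J"
    using J unfolding mpoly_ideal_iff by blast+
  have nonface: "(\<Prod>i\<in>F. pvar i) \<in> ?J" if "F \<subseteq> {1..n}" "F \<notin> \<Delta>" for F
    using that unfolding \<Delta> stanley_reisner_complex_def by auto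
  show ?thesis
  proof (intro reduced_monomial_quotient.intro monomial_quotient.intro reduced_monomial_quotient_axioms.intro)
    show "ideal ?J (mpoly_ring n)" by (rule J)
    show "F \<in> \<Delta> \<Longrightarrow> F \<subseteq> {1..n}" for F by (simp add: face_iff)
    show "F \<in> \<Delta> \<Longrightarrow> G \<subseteq> F \<Longrightarrow> G \<in> \<Delta>" for F G by (rule face_subset)
    show "rst F p = 0" if F: "F \<in> \<Delta>" and p: "p \<in> ?J" for F p
    proof -
      obtain k where "p ^ k \<in> I" using p by (auto simp: ideal_radical_mpoly)
      then have "rst F p ^ k = 0" using face_kills_ideal[OF F] by fastforce
      then show ?thesis by simp
    qed
    show "\<exists>k. (\<Prod>i\<in>F. pvar i) ^ k \<in> ?J" if "F \<subseteq> {1..n}" "F \<notin> \<Delta>" for F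
      using nonface[OF that] by (intro exI[of _ 1]) simp
    show "p \<in> ?J" if p: "rst {1..n} p = p" "\<And>F. F \<in> \<Delta> \<Longrightarrow> rst F p = 0" for p :: "'k mpoly"
    proof -
      \<comment> \<open>Restriction to the support of a term keeps that term, so the support is not
        a face. The product of its variables then lies in the radical and divides the
        monomial.\<close>
      have summand: "Poly_Mapping.single m (Poly_Mapping.lookup p m) \<in> ?J" if m: "m \<in> Poly_Mapping.keys p" for m
      proof -
        let ?F = "Poly_Mapping.keys m"
        have "Poly_Mapping.lookup p m \<noteq> 0" using m by (simp add: in_keys_iff)
        then have F: "?F \<subseteq> {1..n}" "?F \<notin> \<Delta>"
          using p lookup_rst[of "{1..n}" p m] lookup_rst[of ?F p m] by (auto split: if_splits)
        obtain q where q: "Poly_Mapping.keys q \<subseteq> ?F" "monomial m = (\<Prod>i\<in>?F. pvar i) * (monomial q :: 'k mpoly)"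
          using prod_pvar_dvd_monomial by blast
        have "Poly_Mapping.single m (Poly_Mapping.lookup p m) = const (Poly_Mapping.lookup p m) * (monomial m :: 'k mpoly)"
          by (simp add: monomial_def mult_single)
        also have "\<dots> = (const (Poly_Mapping.lookup p m) * monomial q) * (\<Prod>i\<in>?F. pvar i)"
          unfolding q(2) by (simp only: ac_simps)
        also have "\<dots> \<in> ?J" by (rule mult[OF nonface[OF F]]) (use q F in \<open>auto simp: monomial_def mult_single\<close>)
        finally show ?thesis .
      qed
      have sum_closed: "(\<Sum>m\<in>S. Poly_Mapping.single m (Poly_Mapping.lookup p m)) \<in> ?J" if "finite S" "S \<subseteq> Poly_Mapping.keys p" for S
        using that by (induction rule: finite_induct) (auto simp: J0 intro!: add summand)
      have "p = (\<Sum>m\<in>Poly_Mapping.keys p. Poly_Mapping.single m (Poly_Mapping.lookup p m))"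
        by (rule poly_mapping_eqI) (simp add: lookup_sum lookup_single when_def in_keys_iff)
      then show ?thesis using sum_closed[OF finite_keys subset_refl] by simp
    qed
  qed
qed

end

theorem corollary4p46:
  fixes n :: nat and I :: "'k::field mpoly set"
  assumes "monomial_ideal n I"
    and "carrier (Pic_loc n (ideal_radical (mpoly_ring n) I)) \<noteq>
           {\<one>\<^bsub>Pic_loc n (ideal_radical (mpoly_ring n) I)\<^esub>}
       \<or> carrier (binoid_Pic_loc (monomial_binoid n I)) \<noteq>
           {\<one>\<^bsub>binoid_Pic_loc (monomial_binoid n I)\<^esub>}
       \<or> carrier (simplicial_cohomology 1 (stanley_reisner_complex n (ideal_radical (mpoly_ring n) I))
             (units_of (ring_of_type_algebra :: 'k ring))) \<noteq>
           {\<one>\<^bsub>simplicial_cohomology 1 (stanley_reisner_complex n (ideal_radical (mpoly_ring n) I))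
             (units_of (ring_of_type_algebra :: 'k ring))\<^esub>}"
  shows "carrier (Pic_loc n I) \<noteq> {\<one>\<^bsub>Pic_loc n I\<^esub>}"
proof
  assume trivial: "carrier (Pic_loc n I) = {\<one>\<^bsub>Pic_loc n I\<^esub>}"
  define \<Delta> where "\<Delta> = stanley_reisner_complex n (ideal_radical (mpoly_ring n) I)"
  interpret Q: monomial_quotient n I \<Delta> using monomial_quotient_of_ideal[OF assms(1) \<Delta>_def] .
  interpret J: reduced_monomial_quotient n "ideal_radical (mpoly_ring n) I" \<Delta>
    using reduced_monomial_quotient_of_radical[OF assms(1) \<Delta>_def] .
  \<comment> \<open>The conditions on a cocycle of terms refer to \<open>\<Delta>\<close> alone, and
    both quotients have the same complex. So splittings obtained over the quotient by the ideal also
    serve for the reduced one.\<close>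
  have split: "cocycle_splits \<Delta> \<kappa> u v" if "monomial_cocycle_axioms \<Delta> \<kappa> u v" for \<kappa> :: "nat \<Rightarrow> nat \<Rightarrow> 'k" and u v
  proof -
    interpret C: monomial_cocycle n I \<Delta> \<kappa> u v
      using monomial_cocycle.intro[OF Q.monomial_quotient_axioms that] .
    show ?thesis by (rule C.splits_of_trivial_Pic[OF trivial])
  qed
  have "carrier (simplicial_cohomology 1 \<Delta> (units_of (ring_of_type_algebra :: 'k ring))) =
      {\<one>\<^bsub>simplicial_cohomology 1 \<Delta> (units_of (ring_of_type_algebra :: 'k ring))\<^esub>}"
  proof -
    let ?K = "ring_of_type_algebra :: 'k ring"
    have "field ?K" by (rule field_from_type_algebra)
    then interpret K: field ?K .
    have K: "carrier (units_of ?K) = {x. x \<noteq> 0}" "\<And>x y. x \<otimes>\<^bsub>units_of ?K\<^esub> y = x * y"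
      using K.field_Units by (auto simp: units_of_def ring_of_type_algebra_def)
    interpret U: comm_group "units_of ?K" by (rule K.units_comm_group)
    show ?thesis
    proof (rule U.cohomology_1_trivialI)
      show "F \<in> \<Delta> \<Longrightarrow> H \<subseteq> F \<Longrightarrow> H \<in> \<Delta>" for F H by (rule Q.face_mono)
      fix \<kappa> :: "nat \<Rightarrow> nat \<Rightarrow> 'k"
      assume "\<And>j k. {j, k} \<in> \<Delta> \<Longrightarrow> \<kappa> j k \<in> carrier (units_of ?K)"
        "\<And>i j k. {i, j, k} \<in> \<Delta> \<Longrightarrow> \<kappa> i j \<otimes>\<^bsub>units_of ?K\<^esub> \<kappa> j k = \<kappa> i k"
      then have "monomial_cocycle_axioms \<Delta> \<kappa> (\<lambda>_ _. 0) (\<lambda>_ _. 0)" by unfold_locales (simp_all add: K)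
      from split[OF this] show "\<exists>\<mu>. (\<forall>j. {j} \<in> \<Delta> \<longrightarrow> \<mu> j \<in> carrier (units_of ?K)) \<and>
          (\<forall>j k. {j, k} \<in> \<Delta> \<longrightarrow> \<mu> k = \<kappa> k j \<otimes>\<^bsub>units_of ?K\<^esub> \<mu> j)"
        unfolding cocycle_splits_def K by blast
    qed
  qed
  then show False
    using assms(2) J.Pic_trivial_of_splitting[OF split] Q.binoid_Pic_trivial_of_splitting[OF split]
    unfolding \<Delta>_def by blast
qed

end
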